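(* Let $K$ be a locally integrable function on $(S\times S)\setminus\{(x,x):x\in S\}$ such that $$\nu_1:=\sup_{y\in S}\,\sup_{r>0}\int_{r<d(x,y)\le 2r}\big[|K(x,y)|+|K(y,x)|\big]\,d\rho(x)<\infty$$ and $$\nu_2:=\sup_{R\in\mathcal R}\ \sup_{y,y'\in R}\int_{S\setminus R^\ast}\big[|K(x,y)-K(x,y')|+|K(y,x)-K(y',x)|\big]\,d\rho(x)<\infty .$$ Let $T^\ast$ be the maximal singular integral operator associated with $K$, that is, for $f\in L^\infty_c$ and $x\in S$, $$T^\ast f(x)=\sup_{R\in\mathcal R(x)}\left|\int_{S\setminus R^\ast}K(x,y)f(y)\,d\rho(y)\right| .$$ Then the following statements are equivalent: (i) $T^\ast$ is bounded from $L^\infty_c$ to $\mathrm{BMO}$; (ii) $T^\ast$ is bounded on $L^p$ for all $p\in(1,\infty)$; (iii) $T^\ast$ is bounded on $L^p$ for some $p\in(1,\infty)$; (iv) $T^\ast$ is bounded from $L^1$ to $L^{1,\infty}$.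
   Context: Fix an integer $n\ge 1$ and write $\mathbb R^+=(0,\infty)$. $S=\mathbb R^n\ltimes\mathbb R^+$ is the group with product $(x,a)\cdot(x',a')=(x+ax',aa')$ and unit $e=(0,1)$. It carries the left-invariant Riemannian distance $$d\big((x,a),(x',a')\big)=\cosh^{-1}\Big(\frac{a^2+a'^2+|x-x'|^2}{2aa'}\Big)$$ and the right Haar measure $d\rho(x,a)=a^{-1}\,dx\,da$. Functions are complex-valued; $L^p$, $L^1_{\rm loc}$ and weak $L^p$, denoted $L^{p,\infty}$, with $\|f\|_{L^{p,\infty}}=\sup_{\alpha>0}\alpha[\rho(\{|f|>\alpha\})]^{1/p}$, are taken with respect to $\rho$. $L^\infty_c$ is the set of functions in $L^\infty$ with compact support. Calderón–Zygmund sets: a Calderón–Zygmund set is a set $R=Q\times[ae^{-r},ae^r)\subset S$, where $Q$ is a dyadic cube in $\mathbb R^n$ with side length $L$, $a\in\mathbb R^+$, $r>0$, and $e^2ar\le L<e^8ar$ if $r<1$, while $ae^{2r}\le L<ae^{8r}$ if $r\ge1$. Put $r_R=r$. $\mathcal R$ is the family of all Calderón–Zygmund sets, $\mathcal R(x)=\{R\in\mathcal R: x\in R\}$, and $R^\ast=\{x\in S: d(x,R)<r_R\}$. $\mathrm{BMO}$ is the space of $f\in L^1_{\rm loc}$ with $\|f\|_{\mathrm{BMO}}=\sup_{R\in\mathcal R}\frac1{\rho(R)}\int_R|f-f_R|\,d\rho<\infty$, where $f_R=\frac1{\rho(R)}\int_R f\,d\rho$. $T^\ast$ is defined on $L^\infty_c$;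 "bounded from $A$ to $B$" means that there is a constant $C$ with $\|T^\ast f\|_B\le C\|f\|_A$ for all $f\in L^\infty_c$ (with $A=L^\infty_c$ normed by $\|\cdot\|_{L^\infty}$; in (ii)–(iv) this is boundedness on the dense subspace $L^\infty_c$). *)

theory Defs
  imports "HOL-Analysis.Analysis" "HOL-Probability.Essential_Supremum"
begin

text \<open>The group \<open>S\<close> is the upper half-space inside \<open>\<real>\<^sup>n \<times> \<real>\<close>; points are pairs \<open>(x, a)\<close>
  with \<open>a > 0\<close>.  Its topology is the Euclidean one.\<close>

definition axS :: "((real ^ 'n) \<times> real) set" where
  "axS = {p. 0 < snd p}"

definition axd :: "(real ^ 'n) \<times> real \<Rightarrow> (real ^ 'n) \<times> real \<Rightarrow> real" where
  "axd = (\<lambda>(x, a) (x', a'). arcosh ((a\<^sup>2 + a'\<^sup>2 + (norm (x - x'))\<^sup>2) / (2 * a * a')))"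

text \<open>The right Haar measure, defined on the Lebesgue (not merely Borel) subsets of \<open>S\<close>.\<close>

definition rho :: "((real ^ 'n) \<times> real) measure" where
  "rho = density (lebesgue_on axS) (\<lambda>(x, a). ennreal (1 / a))"

definition dyadic_cube :: "(real ^ 'n) set \<Rightarrow> real \<Rightarrow> bool" where
  "dyadic_cube Q L \<longleftrightarrow> (\<exists>(j::int) (k::'n \<Rightarrow> int). L = 2 powi j \<and>
     Q = {x. \<forall>i. of_int (k i) * L \<le> x $ i \<and> x $ i < (of_int (k i) + 1) * L})"

definition cz_with :: "((real ^ 'n) \<times> real) set \<Rightarrow> real \<Rightarrow> bool" where
  "cz_with R r \<longleftrightarrow> (\<exists>Q L a. dyadic_cube Q L \<and> 0 < a \<and> 0 < r \<and>
     (if r < 1 then exp 2 * a * r \<le> L \<and> L < exp 8 * a * r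
      else a * exp (2 * r) \<le> L \<and> L < a * exp (8 * r)) \<and>
     R = Q \<times> {a * exp (- r)..<a * exp r})"

definition CZ :: "((real ^ 'n) \<times> real) set set" where
  "CZ = {R. \<exists>r. cz_with R r}"

definition cz_rad :: "((real ^ 'n) \<times> real) set \<Rightarrow> real" where
  "cz_rad R = (THE r. cz_with R r)"

lemma dyadic_cube_nonempty: "dyadic_cube Q L \<Longrightarrow> Q \<noteq> {}"
proof -
  assume "dyadic_cube Q L"
  then obtain j :: int and k :: "'a \<Rightarrow> int" where
    L: "L = 2 powi j" and Q: "Q = {x. \<forall>i. of_int (k i) * L \<le> x $ i \<and> x $ i < (of_int (k i) + 1) * L}"
    unfolding dyadic_cube_def by blast
  have "0 < L" by (simp add: L)
  then have "(\<chi> i. of_int (k i) * L) \<in> Q" by (simp add: Q)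
  then show ?thesis by blast
qed

text \<open>The radius depends only on the set, so the definite description is meaningful.\<close>

lemma cz_rad_eq: "cz_rad R = r" if "cz_with R r"
proof -
  have "r' = r" if "cz_with R r'" for r'
  proof -
    obtain Q L a where Q: "dyadic_cube Q L" "0 < a" "0 < r" "R = Q \<times> {a * exp (- r)..<a * exp r}"
      using \<open>cz_with R r\<close> unfolding cz_with_def by blast
    obtain Q' L' a' where Q': "dyadic_cube Q' L'" "0 < a'" "0 < r'"
      "R = Q' \<times> {a' * exp (- r')..<a' * exp r'}"
      using \<open>cz_with R r'\<close> unfolding cz_with_def by blast
    have "a * exp (- r) < a * exp r" "a' * exp (- r') < a' * exp r'"
      using Q Q' by simp_all
    moreover have "{a * exp (- r)..<a * exp r} = {a' * exp (- r')..<a' * exp r'}"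
      using arg_cong[OF Q(4), of "image snd"] Q'(4)
        dyadic_cube_nonempty[OF Q(1)] dyadic_cube_nonempty[OF Q'(1)]
      by simp
    ultimately have e: "a * exp (- r) = a' * exp (- r')" "a * exp r = a' * exp r'"
      by (simp_all add: atLeastLessThan_eq_iff)
    then have "ln (a * exp (- r)) = ln (a' * exp (- r'))" "ln (a * exp r) = ln (a' * exp r')"
      by simp_all
    then show "r' = r"
      using Q(2) Q'(2) by (simp add: ln_mult)
  qed
  then show ?thesis
    unfolding cz_rad_def using that by (rule the_equality[rotated])
qed

definition cz_star :: "((real ^ 'n) \<times> real) set \<Rightarrow> ((real ^ 'n) \<times> real) set" where
  "cz_star R = {x \<in> axS. (INF z\<in>R. axd x z) < cz_rad R}"

text \<open>Maximal functions take values in \<open>[0, \<infinity>]\<close>, so norms are defined on extended nonnegative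
  functions; \<open>epow\<close> is only used for exponents \<open>p > 0\<close>.\<close>

definition epow :: "ennreal \<Rightarrow> real \<Rightarrow> ennreal" where
  "epow t p = (if t = \<infinity> then \<infinity> else ennreal (enn2real t powr p))"

definition Lp_norm :: "real \<Rightarrow> ((real ^ 'n) \<times> real \<Rightarrow> ennreal) \<Rightarrow> ennreal" where
  "Lp_norm p g = epow (\<integral>\<^sup>+x. epow (g x) p \<partial>rho) (1 / p)"

definition weak_Lp_norm :: "real \<Rightarrow> ((real ^ 'n) \<times> real \<Rightarrow> ennreal) \<Rightarrow> ennreal" where
  "weak_Lp_norm p g =
     (SUP \<alpha>\<in>{0<..}. ennreal \<alpha> * epow (emeasure rho {x \<in> axS. ennreal \<alpha> < g x}) (1 / p))"

definition Linf_norm :: "((real ^ 'n) \<times> real \<Rightarrow> ennreal) \<Rightarrow> ennreal" where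
  "Linf_norm g = esssup rho g"

abbreviation emod :: "((real ^ 'n) \<times> real \<Rightarrow> complex) \<Rightarrow> (real ^ 'n) \<times> real \<Rightarrow> ennreal" where
  "emod f \<equiv> (\<lambda>x. ennreal (cmod (f x)))"

definition Linf_c :: "((real ^ 'n) \<times> real \<Rightarrow> complex) set" where
  "Linf_c = {f. f \<in> borel_measurable rho \<and> Linf_norm (emod f) < \<infinity> \<and>
     (\<exists>C. compact C \<and> C \<subseteq> axS \<and> (AE x in rho. x \<notin> C \<longrightarrow> f x = 0))}"

definition L1_loc :: "((real ^ 'n) \<times> real \<Rightarrow> complex) set" where
  "L1_loc = {f. \<forall>C. compact C \<and> C \<subseteq> axS \<longrightarrow> set_integrable rho C f}"

definition cz_avg :: "((real ^ 'n) \<times> real \<Rightarrow> complex) \<Rightarrow> ((real ^ 'n) \<times> real) set \<Rightarrow> complex" where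
  "cz_avg f R = (1 / measure rho R) *\<^sub>R (LINT x:R|rho. f x)"

definition BMO_norm :: "((real ^ 'n) \<times> real \<Rightarrow> complex) \<Rightarrow> ennreal" where
  "BMO_norm f =
     (SUP R\<in>CZ. (\<integral>\<^sup>+x\<in>R. ennreal (cmod (f x - cz_avg f R)) \<partial>rho) / emeasure rho R)"

definition BMO :: "((real ^ 'n) \<times> real \<Rightarrow> complex) set" where
  "BMO = {f \<in> L1_loc. BMO_norm f < \<infinity>}"

text \<open>Local integrability off the diagonal, with respect to the product measure.  Sections of
  functions measurable for the product \<open>\<sigma>\<close>-algebra are measurable, so that the
  integrals of \<open>K\<close> in one variable below make sense for every value of the other.\<close>

definition loc_integrable_kernel ::
    "((real ^ 'n) \<times> real \<Rightarrow> (real ^ 'n) \<times> real \<Rightarrow> complex) \<Rightarrow> bool" where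
  "loc_integrable_kernel K \<longleftrightarrow>
     (\<forall>C. compact C \<and> C \<subseteq> axS \<times> axS - {(x, x) |x. x \<in> axS} \<longrightarrow>
        set_integrable (rho \<Otimes>\<^sub>M rho) C (\<lambda>(x, y). K x y))"

definition nu1 :: "((real ^ 'n) \<times> real \<Rightarrow> (real ^ 'n) \<times> real \<Rightarrow> complex) \<Rightarrow> ennreal" where
  "nu1 K = (SUP y\<in>axS. SUP r\<in>{0<..}.
     \<integral>\<^sup>+x\<in>{x \<in> axS. r < axd x y \<and> axd x y \<le> 2 * r}.
       ennreal (cmod (K x y) + cmod (K y x)) \<partial>rho)"

definition nu2 :: "((real ^ 'n) \<times> real \<Rightarrow> (real ^ 'n) \<times> real \<Rightarrow> complex) \<Rightarrow> ennreal" where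
  "nu2 K = (SUP R\<in>CZ. SUP y\<in>R. SUP y'\<in>R.
     \<integral>\<^sup>+x\<in>axS - cz_star R.
       ennreal (cmod (K x y - K x y') + cmod (K y x - K y' x)) \<partial>rho)"

definition Tstar :: "((real ^ 'n) \<times> real \<Rightarrow> (real ^ 'n) \<times> real \<Rightarrow> complex) \<Rightarrow>
    ((real ^ 'n) \<times> real \<Rightarrow> complex) \<Rightarrow> (real ^ 'n) \<times> real \<Rightarrow> ennreal" where
  "Tstar K f x =
     (SUP R\<in>{R \<in> CZ. x \<in> R}. ennreal (cmod (LINT y:axS - cz_star R|rho. K x y * f y)))"

text \<open>Boundedness, tested on \<open>L\<^sup>\<infinity>\<^sub>c\<close>, of operators with values in the extended nonnegative
  functions.  Membership in BMO requires the image to be finite almost everywhere and locally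
  integrable.\<close>

definition bounded_Linf_c_BMO ::
    "(((real ^ 'n) \<times> real \<Rightarrow> complex) \<Rightarrow> (real ^ 'n) \<times> real \<Rightarrow> ennreal) \<Rightarrow> bool" where
  "bounded_Linf_c_BMO T \<longleftrightarrow> (\<exists>C\<ge>0. \<forall>f\<in>Linf_c.
     (AE x in rho. T f x < \<infinity>) \<and>
     (\<lambda>x. complex_of_real (enn2real (T f x))) \<in> BMO \<and>
     BMO_norm (\<lambda>x. complex_of_real (enn2real (T f x))) \<le> ennreal C * Linf_norm (emod f))"

definition bounded_Lp ::
    "real \<Rightarrow> (((real ^ 'n) \<times> real \<Rightarrow> complex) \<Rightarrow> (real ^ 'n) \<times> real \<Rightarrow> ennreal) \<Rightarrow> bool" where
  "bounded_Lp p T \<longleftrightarrow> (\<exists>C\<ge>0. \<forall>f\<in>Linf_c.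
     T f \<in> borel_measurable rho \<and> Lp_norm p (T f) \<le> ennreal C * Lp_norm p (emod f))"

definition bounded_L1_weak_L1 ::
    "(((real ^ 'n) \<times> real \<Rightarrow> complex) \<Rightarrow> (real ^ 'n) \<times> real \<Rightarrow> ennreal) \<Rightarrow> bool" where
  "bounded_L1_weak_L1 T \<longleftrightarrow> (\<exists>C\<ge>0. \<forall>f\<in>Linf_c.
     T f \<in> borel_measurable rho \<and> weak_Lp_norm 1 (T f) \<le> ennreal C * Lp_norm 1 (emod f))"

end

(* The proof isolates a local oscillation property of the maximal operator on bounded functions:
   on an admissible set R where T*g <= t on more than a small proportion, T*g exceeds t by a
   multiple of the sup norm of g only on a small proportion. Boundedness from L^infinity to BMO
   gives it by Chebyshev's inequality. A weak type (q,q) estimate gives it after splitting g along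
   R*: for the part away from R*, the conditions nu1 and nu2 bound the oscillation of T*g on R.
   Conversely, a Calderon-Zygmund decomposition f = g + b at height c a, with T*b <= a outside a
   set controlled by the tail of |f|, reduces f to the bounded function g. The kernel satisfies
   only integral bounds, so the pieces of b that cross the boundary of a truncation are located in
   an annulus and estimated through nu1. Applied on the pieces of a decomposition of {T*f > a}, the
   oscillation property yields the good-lambda inequality
   |{T*f > 4a}| <= d |{T*f > a}| + (C/a) int_{|f| > ca} |f|
   for every d > 0. Iterating it gives weak type (1,1) and integrating it gives all L^p; the case
   p = 2 and the splitting along R* lead back to BMO. *)

theory Submission
  imports Defs
begin

section \<open>Geometry of the distance and of the admissible sets\<close>

text \<open>The volume of balls grows exponentially, so \<open>rho\<close> is not doubling with
  respect to \<open>axd\<close> and balls cannot carry a covering argument. Admissible sets can: the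
  cube is so wide compared with the radius that passing to the star only triples the cube and
  doubles the logarithmic height. They also refine one another, each child having at least
  \<open>2 ^ -n\<close> of the measure of its parent, which is what a stopping-time argument uses.
  Since the diameter of an admissible set is at most a multiple of its radius, a point outside the
  star sees the whole set at comparable distances; this is what puts the crossing pieces into annuli
  of bounded ratio. Neither measurability nor finiteness of the maximal function is given at the
  outset. The former comes from a countable family of admissible sets with rational logarithmic
  endpoints. The latter is needed to absorb terms: off an exceptional set the decomposition also
  bounds the integral of |K(x,y) f(y)| over every dyadic shell around x, and two shells cover the
  support of f when x is far away, so level sets have finite measure.\<close>

lemma cosh_axd:
  fixes p q :: "(real ^ 'n) \<times> real"
  assumes "p \<in> axS" "q \<in> axS"
  shows "cosh (axd p q) = ((snd p)\<^sup>2 + (snd q)\<^sup>2 + (norm (fst p - fst q))\<^sup>2) / (2 * snd p * snd q)"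
proof -
  have "0 < snd p" "0 < snd q"
    using assms by (auto simp: axS_def)
  moreover have "2 * snd p * snd q \<le> (snd p)\<^sup>2 + (snd q)\<^sup>2 + (norm (fst p - fst q))\<^sup>2"
    using sum_squares_bound[of "snd p" "snd q"] by (smt (verit) zero_le_power2)
  ultimately show ?thesis
    unfolding axd_def by (auto simp: split_beta)
qed

lemma cosh_axd_minus_one:
  fixes p q :: "(real ^ 'n) \<times> real"
  assumes "p \<in> axS" "q \<in> axS"
  shows "cosh (axd p q) - 1 = ((snd p - snd q)\<^sup>2 + (norm (fst p - fst q))\<^sup>2) / (2 * snd p * snd q)"
proof -
  have "0 < snd p" "0 < snd q"
    using assms by (auto simp: axS_def)
  then show ?thesis
    unfolding cosh_axd[OF assms] by (simp add: field_simps power2_eq_square)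
qed

lemma axd_nonneg:
  fixes p q :: "(real ^ 'n) \<times> real"
  assumes "p \<in> axS" "q \<in> axS"
  shows "0 \<le> axd p q"
proof -
  have "0 < snd p" "0 < snd q"
    using assms by (auto simp: axS_def)
  moreover have "2 * snd p * snd q \<le> (snd p)\<^sup>2 + (snd q)\<^sup>2 + (norm (fst p - fst q))\<^sup>2"
    using sum_squares_bound[of "snd p" "snd q"] by (smt (verit) zero_le_power2)
  ultimately show ?thesis
    unfolding axd_def by (auto simp: split_beta)
qed

lemma axd_commute: "axd p q = axd q p"
  unfolding axd_def by (auto simp: split_beta norm_minus_commute ac_simps)

lemma axd_self: "p \<in> axS \<Longrightarrow> axd p p = 0"
  unfolding axd_def axS_def by (auto simp: split_beta power2_eq_square)

text \<open>With the intermediate point normalised to \<open>(0, 1)\<close>, the triangle inequality is the addition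
  formula for \<open>cosh\<close> combined with the Cauchy-Schwarz inequality for the vectors \<open>V\<close> and \<open>V'\<close>,
  whose norms are multiples of the two values of \<open>sinh\<close>.\<close>

lemma axd_triangle:
  fixes p q e :: "(real ^ 'n) \<times> real"
  assumes "p \<in> axS" "q \<in> axS" "e \<in> axS"
  shows "axd p q \<le> axd p e + axd e q"
proof -
  define a a' b where "a = snd p" and "a' = snd q" and "b = snd e"
  define X X' where "X = fst p - fst e" and "X' = fst q - fst e"
  define s s' where "s = a\<^sup>2 + X \<bullet> X" and "s' = a'\<^sup>2 + X' \<bullet> X'"
  define V V' where "V = (s - b\<^sup>2, (2 * b) *\<^sub>R X)" and "V' = (s' - b\<^sup>2, (2 * b) *\<^sub>R X')"
  have pos: "0 < a" "0 < a'" "0 < b"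
    using assms by (auto simp: axS_def a_def a'_def b_def)
  have A: "cosh (axd p e) = (s + b\<^sup>2) / (2 * a * b)"
    unfolding cosh_axd[OF assms(1,3)] s_def X_def a_def b_def
    by (simp add: power2_norm_eq_inner algebra_simps)
  have B: "cosh (axd e q) = (s' + b\<^sup>2) / (2 * a' * b)"
    unfolding cosh_axd[OF assms(3,2)] s'_def X'_def a'_def b_def
    by (simp add: power2_norm_eq_inner algebra_simps norm_minus_commute inner_commute)
  have C: "cosh (axd p q) = (s + s' - 2 * (X \<bullet> X')) / (2 * a * a')"
  proof -
    have e: "fst p - fst q = X - X'" by (simp add: X_def X'_def)
    show ?thesis
      unfolding cosh_axd[OF assms(1,2)] s_def s'_def a_def a'_def e
      by (simp add: power2_norm_eq_inner algebra_simps inner_commute)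
  qed
  have VV: "V \<bullet> V = (s + b\<^sup>2)\<^sup>2 - 4 * a\<^sup>2 * b\<^sup>2" "V' \<bullet> V' = (s' + b\<^sup>2)\<^sup>2 - 4 * a'\<^sup>2 * b\<^sup>2"
    by (simp_all add: V_def V'_def s_def s'_def power2_eq_square algebra_simps)
  have sA: "sinh (axd p e) = norm V / (2 * a * b)"
  proof -
    have "(sinh (axd p e))\<^sup>2 = (norm V / (2 * a * b))\<^sup>2"
      using pos unfolding sinh_square_eq A power2_norm_eq_inner power_divide VV
      by (simp add: field_simps power2_eq_square)
    then show ?thesis
      using pos axd_nonneg[OF assms(1,3)] by (subst (asm) power2_eq_iff_nonneg) auto
  qed
  have sB: "sinh (axd e q) = norm V' / (2 * a' * b)"
  proof -
    have "(sinh (axd e q))\<^sup>2 = (norm V' / (2 * a' * b))\<^sup>2"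
      using pos unfolding sinh_square_eq B power2_norm_eq_inner power_divide VV
      by (simp add: field_simps power2_eq_square)
    then show ?thesis
      using pos axd_nonneg[OF assms(3,2)] by (subst (asm) power2_eq_iff_nonneg) auto
  qed
  have vv: "V \<bullet> V' = (s + b\<^sup>2) * (s' + b\<^sup>2) - 2 * b\<^sup>2 * (s + s' - 2 * (X \<bullet> X'))"
    by (simp add: V_def V'_def power2_eq_square algebra_simps)
  have "cosh (axd p q) = cosh (axd p e) * cosh (axd e q) - (V \<bullet> V') / (4 * a * a' * b\<^sup>2)"
    using pos unfolding A B C vv by (simp add: field_simps power2_eq_square)
  also have "\<dots> \<le> cosh (axd p e) * cosh (axd e q) + (norm V * norm V') / (4 * a * a' * b\<^sup>2)"
  proof -
    have "- (V \<bullet> V') \<le> norm V * norm V'"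
      using norm_cauchy_schwarz[of V "- V'"] by simp
    then have "- (V \<bullet> V') / (4 * a * a' * b\<^sup>2) \<le> (norm V * norm V') / (4 * a * a' * b\<^sup>2)"
      using pos by (intro divide_right_mono) auto
    then show ?thesis by simp
  qed
  also have "\<dots> = cosh (axd p e + axd e q)"
    unfolding cosh_add sA sB by (simp add: power2_eq_square)
  finally show ?thesis
    using axd_nonneg[OF assms(1,2)] axd_nonneg[OF assms(1,3)] axd_nonneg[OF assms(3,2)]
    by (simp add: cosh_real_nonneg_le_iff)
qed

text \<open>Dropping the horizontal term from the formula for \<open>cosh\<close> leaves the
  \<open>cosh\<close> of the vertical distance \<open>ln (snd p / snd q)\<close>; since
  \<open>cosh\<close> increases on nonnegative arguments, that distance cannot exceed
  \<open>axd p q\<close>.\<close>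

lemma snd_le_exp_axd:
  fixes p q :: "(real ^ 'n) \<times> real"
  assumes "p \<in> axS" "q \<in> axS"
  shows "snd p \<le> snd q * exp (axd p q)"
proof (rule ccontr)
  assume "\<not> ?thesis"
  then have lt: "snd q * exp (axd p q) < snd p" by simp
  have pos: "0 < snd p" "0 < snd q"
    using assms by (auto simp: axS_def)
  have "axd p q < ln (snd p / snd q)"
    using lt pos by (subst exp_less_cancel_iff[symmetric]) (simp add: field_simps)
  then have "cosh (axd p q) < cosh (ln (snd p / snd q))"
    using axd_nonneg[OF assms] by (subst cosh_real_nonneg_less_iff) auto
  also have "\<dots> = ((snd p)\<^sup>2 + (snd q)\<^sup>2) / (2 * snd p * snd q)"
    using pos by (simp add: cosh_ln_real field_simps power2_eq_square)
  also have "\<dots> \<le> cosh (axd p q)"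
    unfolding cosh_axd[OF assms] using pos by (intro divide_right_mono) auto
  finally show False by simp
qed

lemma norm_fst_diff_sq:
  fixes p q :: "(real ^ 'n) \<times> real"
  assumes "p \<in> axS" "q \<in> axS"
  shows "(norm (fst p - fst q))\<^sup>2 \<le> 2 * snd p * snd q * (cosh (axd p q) - 1)"
proof -
  have "0 < snd p" "0 < snd q"
    using assms by (auto simp: axS_def)
  then show ?thesis
    unfolding cosh_axd_minus_one[OF assms] by simp
qed

lemma cosh_minus_one_eq: "cosh (x::real) - 1 = 2 * (sinh (x / 2))\<^sup>2"
  using cosh_double_cosh[of "x / 2"] by (simp add: cosh_square_eq)

lemma cosh_minus_one_ge: "x\<^sup>2 / 2 \<le> cosh x - 1" for x :: real
proof -
  have "\<bar>x\<bar> / 2 \<le> sinh (\<bar>x\<bar> / 2)" using real_le_x_sinh[of "\<bar>x\<bar> / 2"] by (simp add: sinh_field_def exp_minus)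
  then have "(\<bar>x\<bar> / 2)\<^sup>2 \<le> (sinh (\<bar>x\<bar> / 2))\<^sup>2" by (intro power_mono) auto
  then have "x\<^sup>2 / 2 \<le> 2 * (sinh (\<bar>x\<bar> / 2))\<^sup>2" by (simp add: power_divide)
  then show ?thesis using cosh_minus_one_eq[of "\<bar>x\<bar>"] by simp
qed

text \<open>The quadratic behaviour of \<open>cosh - 1\<close> with an explicit constant. The factor
  \<open>exp r\<close> is harmless in \<open>cz_star_subset_box\<close>: combined with the heights
  it gives \<open>exp (4 * r)\<close>, for \<open>r < 1\<close> at most the square of the
  admissibility constant \<open>exp 2\<close>.\<close>

lemma cosh_minus_one_le: "cosh r - 1 \<le> r\<^sup>2 * exp r / 2" if "0 \<le> r" for r :: real
proof -
  have "1 - r \<le> exp (- r)" using exp_ge_add_one_self[of "- r"] by simp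
  then have "sinh (r / 2) \<le> r * exp (r / 2) / 2"
  proof -
    have "1 - r \<le> exp (- r)" by fact
    then have "exp (r / 2) * (1 - r) \<le> exp (r / 2) * exp (- r)" by (intro mult_left_mono) auto
    also have "\<dots> = exp (- (r / 2))" by (simp flip: exp_add)
    finally show ?thesis by (simp add: sinh_def algebra_simps)
  qed
  then have "(sinh (r / 2))\<^sup>2 \<le> (r * exp (r / 2) / 2)\<^sup>2"
    using that by (intro power_mono) auto
  also have "\<dots> = r\<^sup>2 * exp r / 4"
    by (simp add: power2_eq_square field_simps flip: exp_add)
  finally show ?thesis unfolding cosh_minus_one_eq by simp
qed

lemma exp_le_cosh: "exp x \<le> 2 * cosh x" for x :: real
  by (simp add: cosh_def)

lemma norm_sq_le_vec:
  fixes x :: "real ^ 'n"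
  assumes "\<And>i. \<bar>x $ i\<bar> \<le> L"
  shows "(norm x)\<^sup>2 \<le> real CARD('n) * L\<^sup>2"
proof -
  have "(norm x)\<^sup>2 = (\<Sum>i\<in>UNIV. (x $ i)\<^sup>2)"
    by (simp add: norm_vec_def L2_set_def sum_nonneg)
  also have "\<dots> \<le> (\<Sum>i\<in>(UNIV::'n set). L\<^sup>2)"
    by (intro sum_mono) (metis assms abs_le_square_iff abs_ge_zero abs_of_nonneg order_trans)
  finally show ?thesis by simp
qed

section \<open>Diameter, star and existence of admissible sets\<close>

lemma cz_withE:
  fixes R :: "((real ^ 'n) \<times> real) set"
  assumes "cz_with R r"
  obtains j :: int and k :: "'n::finite \<Rightarrow> int" and L a where "L = 2 powi j" "0 < L" "0 < a" "0 < r"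
    "r < 1 \<Longrightarrow> exp 2 * a * r \<le> L" "r < 1 \<Longrightarrow> L < exp 8 * a * r"
    "1 \<le> r \<Longrightarrow> a * exp (2 * r) \<le> L" "1 \<le> r \<Longrightarrow> L < a * exp (8 * r)"
    "R = {x::real^'n. \<forall>i. of_int (k i) * L \<le> x $ i \<and> x $ i < (of_int (k i) + 1) * L} \<times>
      {a * exp (- r)..<a * exp r}"
  using assms unfolding cz_with_def dyadic_cube_def
  by (elim exE conjE) (simp split: if_splits; metis)

lemma cz_subset_axS: "cz_with R r \<Longrightarrow> R \<subseteq> axS"
  by (erule cz_withE) (auto simp: axS_def intro: less_le_trans[rotated])

text \<open>For \<open>r < 1\<close> both extents of \<open>R\<close> are of order
  \<open>a * r\<close>, so \<open>cosh (axd p q) - 1\<close> is of order \<open>r\<^sup>2\<close>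
  and the distance of order \<open>r\<close>. For \<open>1 \<le> r\<close> the distance is
  logarithmic in the side, which is below \<open>a * exp (8 * r)\<close>, hence again linear in
  \<open>r\<close>; the additive constant is absorbed because \<open>1 \<le> r\<close>.\<close>

lemma cz_diam:
  "\<exists>C\<ge>1. \<forall>(R :: ((real^'n) \<times> real) set) r p q. cz_with R r \<longrightarrow> p \<in> R \<longrightarrow> q \<in> R \<longrightarrow> axd p q \<le> C * r"
proof -
  define n where "n = real CARD('n)"
  have n: "1 \<le> n" unfolding n_def by (simp add: Suc_leI)
  \<comment> \<open>The entries are the constants of the cases \<open>r < 1\<close> and
    \<open>1 \<le> r\<close>; 18 is 16, from the square of the side, plus 2, from the lower bound of
    the heights.\<close>
  define C where "C = max (sqrt ((16 + n * exp 16) * exp 2)) (ln (2 * n + 4) + 18)"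
  have "axd p q \<le> C * r" if cz: "cz_with R r" and pq: "p \<in> R" "q \<in> R"
    for R :: "((real^'n) \<times> real) set" and r p q
  proof -
    from cz obtain j :: int and k :: "'n::finite \<Rightarrow> int" and L a where *: "L = 2 powi j" "0 < L" "0 < a" "0 < r"
      and c: "r < 1 \<Longrightarrow> exp 2 * a * r \<le> L" "r < 1 \<Longrightarrow> L < exp 8 * a * r"
      "1 \<le> r \<Longrightarrow> a * exp (2 * r) \<le> L" "1 \<le> r \<Longrightarrow> L < a * exp (8 * r)"
      and R: "R = {x::real^'n. \<forall>i. of_int (k i) * L \<le> x $ i \<and> x $ i < (of_int (k i) + 1) * L} \<times>
      {a * exp (- r)..<a * exp r}"
      by (rule cz_withE) blast
    have S: "p \<in> axS" "q \<in> axS" using cz_subset_axS[OF cz] pq by auto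
    have h: "a * exp (- r) \<le> snd p" "snd p \<le> a * exp r" "a * exp (- r) \<le> snd q" "snd q \<le> a * exp r"
      using pq R by auto
    have nm: "(norm (fst p - fst q))\<^sup>2 \<le> n * L\<^sup>2"
      unfolding n_def
    proof (rule norm_sq_le_vec)
      fix i
      have "of_int (k i) * L \<le> fst p $ i" "fst p $ i < (of_int (k i) + 1) * L"
        "of_int (k i) * L \<le> fst q $ i" "fst q $ i < (of_int (k i) + 1) * L"
        using pq R by auto
      then show "\<bar>(fst p - fst q) $ i\<bar> \<le> L" by (simp add: algebra_simps)
    qed
    have den: "2 * a\<^sup>2 * exp (- 2 * r) \<le> 2 * snd p * snd q"
    proof -
      have "(a * exp (- r)) * (a * exp (- r)) \<le> snd p * snd q"
        using h * S by (intro mult_mono) (auto simp: axS_def)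
      moreover have "(a * exp (- r)) * (a * exp (- r)) = a\<^sup>2 * exp (- 2 * r)"
        by (simp add: power2_eq_square mult_ac flip: exp_add)
      ultimately show ?thesis by simp
    qed
    have dpos: "0 < 2 * a\<^sup>2 * exp (- 2 * r)" using * by simp
    have dif: "(snd p - snd q)\<^sup>2 \<le> (a * exp r - a * exp (- r))\<^sup>2"
      using h by (intro abs_le_square_iff[THEN iffD1]) auto
    have main: "cosh (axd p q) - 1 \<le> ((a * exp r - a * exp (- r))\<^sup>2 + n * L\<^sup>2) / (2 * a\<^sup>2 * exp (- 2 * r))"
      unfolding cosh_axd_minus_one[OF S]
      using den dpos dif nm n by (intro frac_le add_mono) auto
    show ?thesis
    proof (cases "r < 1")
      case True
      have "exp r - exp (- r) \<le> 4 * r"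
      proof -
        have "1 - r \<le> exp (- r)" using exp_ge_add_one_self[of "- r"] by simp
        moreover from this have "exp r * (1 - r) \<le> exp r * exp (- r)" by (intro mult_left_mono) auto
        then have "exp r * (1 - r) \<le> 1" by (simp flip: exp_add)
        moreover have "r * exp r \<le> r * 3"
          using True * exp_le order_trans[of "exp r" "exp 1" 3] by (intro mult_left_mono) auto
        ultimately show ?thesis by (simp add: algebra_simps)
      qed
      then have "(a * (exp r - exp (- r)))\<^sup>2 \<le> (a * (4 * r))\<^sup>2"
        using * by (intro power_mono mult_left_mono) auto
      moreover have "n * L\<^sup>2 \<le> n * (exp 8 * a * r)\<^sup>2"
        using c(2)[OF True] * n by (intro mult_left_mono power_mono) auto
      ultimately have "(a * exp r - a * exp (- r))\<^sup>2 + n * L\<^sup>2 \<le> a\<^sup>2 * r\<^sup>2 * (16 + n * exp 16)"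
        by (simp add: power_mult_distrib algebra_simps flip: exp_double)
      moreover have "2 * a\<^sup>2 * exp (- 2) \<le> 2 * a\<^sup>2 * exp (- 2 * r)"
        using True by (intro mult_left_mono) auto
      ultimately have "((a * exp r - a * exp (- r))\<^sup>2 + n * L\<^sup>2) / (2 * a\<^sup>2 * exp (- 2 * r)) \<le>
          (a\<^sup>2 * r\<^sup>2 * (16 + n * exp 16)) / (2 * a\<^sup>2 * exp (- 2))"
        using * n by (intro frac_le) auto
      also have "\<dots> = r\<^sup>2 * ((16 + n * exp 16) * exp 2) / 2"
        using * by (simp add: field_simps exp_minus)
      finally have "cosh (axd p q) - 1 \<le> r\<^sup>2 * ((16 + n * exp 16) * exp 2) / 2"
        using main by (rule order_trans[rotated])
      then have "(axd p q)\<^sup>2 \<le> r\<^sup>2 * ((16 + n * exp 16) * exp 2)"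
        using cosh_minus_one_ge[of "axd p q"] by linarith
      then have "axd p q \<le> sqrt (r\<^sup>2 * ((16 + n * exp 16) * exp 2))"
        by (rule real_le_rsqrt)
      also have "\<dots> = sqrt ((16 + n * exp 16) * exp 2) * r"
        using * by (simp add: real_sqrt_mult)
      also have "\<dots> \<le> C * r"
        using * unfolding C_def by (intro mult_right_mono) auto
      finally show ?thesis .
    next
      case False
      then have r1: "1 \<le> r" by simp
      have "(a * exp r - a * exp (- r))\<^sup>2 \<le> (a * exp r)\<^sup>2"
        using * by (intro power_mono) (auto simp: mult_left_mono)
      also have "\<dots> = a\<^sup>2 * exp (2 * r)"
        by (simp add: power_mult_distrib exp_double)
      also have "\<dots> \<le> a\<^sup>2 * exp (16 * r)" using * by (intro mult_left_mono) auto
      finally have "(a * exp r - a * exp (- r))\<^sup>2 \<le> a\<^sup>2 * exp (16 * r)" .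
      moreover have "n * L\<^sup>2 \<le> n * (a\<^sup>2 * exp (16 * r))"
      proof -
        have "n * L\<^sup>2 \<le> n * (a * exp (8 * r))\<^sup>2"
          using c(4)[OF r1] * n by (intro mult_left_mono power_mono) auto
        also have "(a * exp (8 * r))\<^sup>2 = a\<^sup>2 * exp (16 * r)"
          by (simp add: power_mult_distrib flip: exp_double)
        finally show ?thesis .
      qed
      ultimately have "(a * exp r - a * exp (- r))\<^sup>2 + n * L\<^sup>2 \<le> a\<^sup>2 * exp (16 * r) * (n + 1)"
        by (simp add: algebra_simps)
      then have "((a * exp r - a * exp (- r))\<^sup>2 + n * L\<^sup>2) / (2 * a\<^sup>2 * exp (- 2 * r)) \<le>
          (a\<^sup>2 * exp (16 * r) * (n + 1)) / (2 * a\<^sup>2 * exp (- 2 * r))"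
        using dpos by (intro divide_right_mono) auto
      also have "\<dots> = (n + 1) * exp (18 * r) / 2"
      proof -
        have "exp (18 * r) = exp (16 * r) * exp (2 * r)" by (simp flip: exp_add)
        then show ?thesis using * by (simp add: field_simps exp_minus)
      qed
      finally have "cosh (axd p q) \<le> 1 + (n + 1) * exp (18 * r) / 2" using main by linarith
      also have "\<dots> \<le> (n + 2) * exp (18 * r)"
      proof -
        have "1 \<le> exp (18 * r)" using r1 by simp
        moreover have "0 \<le> n * exp (18 * r)" using n by simp
        ultimately show ?thesis by (simp only: distrib_right add_divide_distrib)
      qed
      finally have "exp (axd p q) \<le> (2 * n + 4) * exp (18 * r)"
        using exp_le_cosh[of "axd p q"] by (simp add: algebra_simps)
      then have "axd p q \<le> ln ((2 * n + 4) * exp (18 * r))"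
        using n by (subst ln_ge_iff) auto
      also have "\<dots> = ln (2 * n + 4) + 18 * r" using n by (simp add: ln_mult)
      also have "\<dots> \<le> (ln (2 * n + 4) + 18) * r"
        using r1 n mult_left_mono[of 1 r "ln (2 * n + 4)"] by (simp add: algebra_simps)
      also have "\<dots> \<le> C * r"
        using * unfolding C_def by (intro mult_right_mono) auto
      finally show ?thesis .
    qed
  qed
  moreover have "1 \<le> C"
  proof -
    have "0 \<le> ln (2 * n + 4)" using n by simp
    then show ?thesis unfolding C_def by simp
  qed
  ultimately show ?thesis by blast
qed

lemma mem_cz_star_iff:
  assumes "cz_with R r" and "x \<in> axS"
  shows "x \<in> cz_star R \<longleftrightarrow> (\<exists>z\<in>R. axd x z < r)"
proof -
  have "R \<noteq> {}"
    using assms(1) dyadic_cube_nonempty unfolding cz_with_def by fastforce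
  moreover have "bdd_below (axd x ` R)"
    using assms cz_subset_axS axd_nonneg by (intro bdd_belowI[of _ 0]) blast
  ultimately show ?thesis
    using assms by (simp add: cz_star_def cz_rad_eq cINF_less_iff)
qed

lemma cz_star_subset_axS: "cz_star R \<subseteq> axS"
  by (auto simp: cz_star_def)

lemma cz_subset_cz_star:
  assumes "cz_with R r" shows "R \<subseteq> cz_star R"
proof
  fix x assume "x \<in> R"
  then have "x \<in> axS" using cz_subset_axS[OF assms] by blast
  moreover have "0 < r" using assms by (auto elim: cz_withE)
  ultimately show "x \<in> cz_star R"
    using mem_cz_star_iff[OF assms] \<open>x \<in> R\<close> axd_self by fastforce
qed

text \<open>Moving by less than \<open>r\<close> changes a height by a factor at most
  \<open>exp r\<close>, which gives the doubled logarithmic interval. The squared horizontal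
  displacement is at most twice the product of the heights times \<open>cosh r - 1\<close>, and the
  lower bounds \<open>exp 2 * a * r\<close> and \<open>a * exp (2 * r)\<close> on the side make this
  at most the square of \<open>L\<close>.\<close>

lemma cz_star_subset_box:
  fixes k :: "'n::finite \<Rightarrow> int"
  assumes cz: "cz_with R r" and *: "0 < L" "0 < a" "0 < r"
    and c: "r < 1 \<Longrightarrow> exp 2 * a * r \<le> L" "1 \<le> r \<Longrightarrow> a * exp (2 * r) \<le> L"
    and R: "R = {x::real^'n. \<forall>i. of_int (k i) * L \<le> x $ i \<and> x $ i < (of_int (k i) + 1) * L} \<times>
      {a * exp (- r)..<a * exp r}"
  shows "cz_star R \<subseteq> cbox (\<chi> i. (of_int (k i) - 1) * L) (\<chi> i. (of_int (k i) + 2) * L) \<times>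
      {a * exp (- 2 * r)..<a * exp (2 * r)}"
proof
  fix x assume x: "x \<in> cz_star R"
  then have xS: "x \<in> axS" using cz_star_subset_axS by blast
  obtain z where z: "z \<in> R" "axd x z < r"
    using x mem_cz_star_iff[OF cz xS] by blast
  then have zS: "z \<in> axS" using cz_subset_axS[OF cz] by blast
  have pos: "0 < snd x" "0 < snd z" using xS zS by (auto simp: axS_def)
  have hz: "a * exp (- r) \<le> snd z" "snd z < a * exp r" using z R by auto
  have "snd x \<le> snd z * exp r"
    using snd_le_exp_axd[OF xS zS] z pos by (smt (verit) exp_less_mono mult_left_mono)
  also have "\<dots> < a * exp r * exp r" using hz by simp
  also have "\<dots> = a * exp (2 * r)" by (simp add: mult.assoc flip: exp_add)
  finally have u: "snd x < a * exp (2 * r)" .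
  have "a * exp (- r) \<le> snd x * exp r"
    using snd_le_exp_axd[OF zS xS] z pos hz axd_commute[of z x] by (smt (verit) exp_less_mono mult_left_mono)
  then have "a * exp (- r) * exp (- r) \<le> snd x * exp r * exp (- r)" by (intro mult_right_mono) auto
  then have l: "a * exp (- 2 * r) \<le> snd x"
    by (simp add: mult.assoc flip: exp_add)
  have pr: "snd x * snd z \<le> a\<^sup>2 * exp (3 * r)"
  proof -
    have "snd x * snd z \<le> (a * exp (2 * r)) * (a * exp r)"
      using u hz pos * by (intro mult_mono) auto
    also have "\<dots> = a\<^sup>2 * (exp (2 * r) * exp r)" by (simp add: power2_eq_square)
    finally show ?thesis by (simp flip: exp_add)
  qed
  have ch: "cosh (axd x z) - 1 \<le> cosh r - 1"
    using z * axd_nonneg[OF xS zS] by (simp add: cosh_real_nonneg_le_iff)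
  have "(norm (fst x - fst z))\<^sup>2 \<le> 2 * (snd x * snd z) * (cosh (axd x z) - 1)"
    using norm_fst_diff_sq[OF xS zS] by simp
  also have "\<dots> \<le> 2 * (a\<^sup>2 * exp (3 * r)) * (cosh r - 1)"
    using pr ch pos cosh_real_ge_1[of "axd x z"] by (intro mult_mono[OF mult_left_mono[OF pr]]) auto
  also have "\<dots> \<le> L\<^sup>2"
  proof (cases "r < 1")
    case True
    have "2 * (a\<^sup>2 * exp (3 * r)) * (cosh r - 1) \<le> 2 * (a\<^sup>2 * exp (3 * r)) * (r\<^sup>2 * exp r / 2)"
      using cosh_minus_one_le[of r] * by (intro mult_left_mono) auto
    also have "\<dots> = a\<^sup>2 * r\<^sup>2 * (exp (3 * r) * exp r)" by simp
    also have "\<dots> = a\<^sup>2 * r\<^sup>2 * exp (4 * r)" by (simp flip: exp_add)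
    also have "\<dots> \<le> a\<^sup>2 * r\<^sup>2 * exp 4" using True by (intro mult_left_mono) auto
    also have "\<dots> = (exp 2 * a * r)\<^sup>2"
      by (simp add: power_mult_distrib flip: exp_double)
    also have "\<dots> \<le> L\<^sup>2" using c True * by (intro power_mono) auto
    finally show ?thesis .
  next
    case False
    have "exp (- r) \<le> 1" using * by simp
    then have "exp (- r) \<le> 2" by linarith
    then have "2 * cosh r \<le> exp r + 2" by (simp add: cosh_def)
    then have "2 * (a\<^sup>2 * exp (3 * r)) * (cosh r - 1) \<le> 2 * (a\<^sup>2 * exp (3 * r)) * (exp r / 2)"
      using * by (intro mult_left_mono) auto
    also have "\<dots> = a\<^sup>2 * (exp (3 * r) * exp r)" by simp
    also have "\<dots> = (a * exp (2 * r))\<^sup>2"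
      by (simp add: power_mult_distrib flip: exp_add exp_double)
    also have "\<dots> \<le> L\<^sup>2" using c False * by (intro power_mono) auto
    finally show ?thesis .
  qed
  finally have nL: "norm (fst x - fst z) \<le> L"
    using * by (simp add: power2_le_iff_abs_le)
  have "fst x \<in> cbox (\<chi> i. (of_int (k i) - 1) * L) (\<chi> i. (of_int (k i) + 2) * L)"
    unfolding mem_box_cart
  proof
    fix i
    have "\<bar>fst x $ i - fst z $ i\<bar> \<le> L"
      using component_le_norm_cart[of "fst x - fst z" i] nL by simp
    moreover have "of_int (k i) * L \<le> fst z $ i" "fst z $ i < (of_int (k i) + 1) * L"
      using z R by auto
    ultimately show "(\<chi> i. (of_int (k i) - 1) * L) $ i \<le> fst x $ i \<and> fst x $ i \<le> (\<chi> i. (of_int (k i) + 2) * L) $ i"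
      unfolding abs_le_iff by (simp add: algebra_simps)
  qed
  then show "x \<in> cbox (\<chi> i. (of_int (k i) - 1) * L) (\<chi> i. (of_int (k i) + 2) * L) \<times>
      {a * exp (- 2 * r)..<a * exp (2 * r)}"
    using u l by (simp add: mem_Times_iff)
qed

lemma ex_powi2_between:
  fixes x :: real assumes "0 < x"
  shows "\<exists>j::int. x \<le> 2 powi j \<and> 2 powi j < 2 * x"
proof -
  define j where "j = \<lceil>log 2 x\<rceil>"
  have e: "(2::real) powi j = 2 powr real_of_int j" by (simp add: powr_real_of_int')
  have "log 2 x \<le> j" "j < log 2 x + 1" unfolding j_def by linarith+
  then have "2 powr log 2 x \<le> 2 powr j" "2 powr j < 2 powr (log 2 x + 1)" by auto
  then show ?thesis using assms e by (intro exI[of _ j]) (auto simp: powr_add)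
qed

text \<open>The bounds that admissibility puts on the side differ by the factor \<open>exp 6\<close>
  or \<open>exp (6 * r)\<close>, hence by more than 2, so a power of two fits between them.
  Prescribing both the radius and a point allows two points to be compared at the same
  scale.\<close>

lemma ex_cz_with:
  fixes x :: "(real ^ 'n) \<times> real"
  assumes "x \<in> axS" "0 < r"
  shows "\<exists>R. cz_with R r \<and> x \<in> R"
proof -
  define a where "a = snd x"
  have a: "0 < a" using assms by (auto simp: axS_def a_def)
  define l where "l = (if r < 1 then exp 2 * a * r else a * exp (2 * r))"
  define u where "u = (if r < 1 then exp 8 * a * r else a * exp (8 * r))"
  have l: "0 < l" using a assms by (auto simp: l_def)
  have e2: "exp 8 = exp 2 * exp (6::real)" by (simp flip: exp_add)
  have e6: "2 \<le> exp (6::real)" using exp_ge_add_one_self[of "6::real"] by simp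
  have "2 * l \<le> u"
  proof (cases "r < 1")
    case True
    then show ?thesis using a assms e6 unfolding l_def u_def e2
      by (simp add: mult_right_mono)
  next
    case False
    have "exp (8 * r) = exp (2 * r) * exp (6 * r)" by (simp flip: exp_add)
    moreover have "2 \<le> exp (6 * r)" using False exp_ge_add_one_self[of "6 * r"] by linarith
    ultimately show ?thesis using a False unfolding l_def u_def
      by (simp add: mult_left_mono)
  qed
  then obtain j :: int where j: "l \<le> 2 powi j" "2 powi j < u"
    using ex_powi2_between[OF l] by fastforce
  define L :: real where "L = 2 powi j"
  have L: "0 < L" by (simp add: L_def)
  define k where "k = (\<lambda>i. \<lfloor>fst x $ i / L\<rfloor>)"
  define Q where "Q = {y::real^'n. \<forall>i. of_int (k i) * L \<le> y $ i \<and> y $ i < (of_int (k i) + 1) * L}"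
  have "of_int \<lfloor>y / L\<rfloor> * L \<le> y \<and> y < (of_int \<lfloor>y / L\<rfloor> + 1) * L" for y
    using L by (simp add: floor_le_iff pos_le_divide_eq[symmetric] pos_divide_less_eq[symmetric])
  then have "fst x \<in> Q" unfolding Q_def k_def by auto
  moreover have "snd x \<in> {a * exp (- r)..<a * exp r}"
    using a assms by (auto simp: a_def)
  moreover have "dyadic_cube Q L"
    unfolding dyadic_cube_def Q_def L_def by blast
  ultimately show ?thesis
    using j a assms unfolding l_def u_def L_def[symmetric]
    by (intro exI[of _ "Q \<times> {a * exp (- r)..<a * exp r}"])
      (auto simp: cz_with_def mem_Times_iff split: if_splits)
qed

section \<open>The right Haar measure\<close>

lemma open_axS: "open (axS :: ((real ^ 'n) \<times> real) set)"
  unfolding axS_def by (intro open_Collect_less continuous_intros)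

lemma space_rho [simp]: "space (rho :: ((real ^ 'n) \<times> real) measure) = axS"
  by (simp add: rho_def)

lemma sets_rho: "sets (rho :: ((real ^ 'n) \<times> real) measure) = sets (lebesgue_on axS)"
  by (simp add: rho_def)

lemma axS_lebesgue: "axS \<in> sets (lebesgue :: ((real ^ 'n) \<times> real) measure)"
  by (intro sets_completionI_sets) (simp add: borel_open open_axS)

lemma sets_rho_iff: "A \<in> sets (rho :: ((real ^ 'n) \<times> real) measure) \<longleftrightarrow> A \<in> sets lebesgue \<and> A \<subseteq> axS"
proof -
  have "axS \<inter> space (lebesgue :: ((real ^ 'n) \<times> real) measure) \<in> sets lebesgue"
    using axS_lebesgue by simp
  from sets_restrict_space_iff[OF this, of A]
  show ?thesis unfolding sets_rho by (rule trans) (rule conj_commute)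
qed

lemma borel_sets_rho:
  fixes A :: "((real ^ 'n) \<times> real) set"
  assumes "A \<in> sets borel" "A \<subseteq> axS"
  shows "A \<in> sets rho"
proof -
  have "A \<in> sets lebesgue" by (rule sets_completionI_sets) (simp add: assms)
  with assms(2) show ?thesis by (simp only: sets_rho_iff)
qed

lemma borel_measurable_rho:
  fixes f :: "(real ^ 'n) \<times> real \<Rightarrow> 'b :: topological_space"
  assumes "f \<in> borel_measurable borel"
  shows "f \<in> borel_measurable rho"
proof -
  have "f \<in> borel_measurable lebesgue" using assms by (intro measurable_completion) simp
  then have "f \<in> borel_measurable (lebesgue_on axS)" by (rule measurable_restrict_space1)
  moreover have "measurable (rho :: ((real ^ 'n) \<times> real) measure) borel = measurable (lebesgue_on axS) (borel :: 'b measure)"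
    by (rule measurable_cong_sets) (simp_all only: sets_rho)
  ultimately show ?thesis by (simp only:)
qed

lemma nn_integral_rho:
  fixes f :: "(real ^ 'n) \<times> real \<Rightarrow> ennreal"
  assumes "f \<in> borel_measurable rho"
  shows "(\<integral>\<^sup>+x. f x \<partial>rho) = (\<integral>\<^sup>+x. ennreal (1 / snd x) * f x * indicator axS x \<partial>lborel)"
proof -
  have m: "(\<lambda>x::(real ^ 'n) \<times> real. ennreal (1 / snd x)) \<in> borel_measurable (lebesgue_on axS)"
  proof -
    have "(\<lambda>x::(real ^ 'n) \<times> real. ennreal (1 / snd x)) \<in> borel_measurable borel"
      unfolding borel_prod[symmetric] by measurable
    from borel_measurable_rho[OF this] show ?thesis by (simp add: rho_def)
  qed
  have "f \<in> borel_measurable (lebesgue_on axS)"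
    using assms by (simp add: rho_def)
  then have "(\<integral>\<^sup>+x. f x \<partial>rho) = (\<integral>\<^sup>+x. ennreal (1 / snd x) * f x \<partial>lebesgue_on axS)"
    unfolding rho_def split_beta' using m by (simp add: nn_integral_density)
  also have "\<dots> = (\<integral>\<^sup>+x. ennreal (1 / snd x) * f x * indicator axS x \<partial>lebesgue)"
    using axS_lebesgue by (subst nn_integral_restrict_space) simp_all
  finally show ?thesis by (simp add: nn_integral_completion)
qed

lemma emeasure_rho:
  fixes A :: "((real ^ 'n) \<times> real) set"
  assumes "A \<in> sets rho"
  shows "emeasure rho A = (\<integral>\<^sup>+x. ennreal (1 / snd x) * indicator A x \<partial>lborel)"
proof -
  have "A \<subseteq> axS" using assms by (simp add: sets_rho_iff)
  have "emeasure rho A = (\<integral>\<^sup>+x. indicator A x \<partial>rho)" using assms by simp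
  also have "\<dots> = (\<integral>\<^sup>+x. ennreal (1 / snd x) * indicator A x * indicator axS x \<partial>lborel)"
    using assms by (intro nn_integral_rho) auto
  finally show ?thesis
    using \<open>A \<subseteq> axS\<close> by (auto simp: indicator_def intro!: nn_integral_cong)
qed

lemma emeasure_rho_Times:
  fixes B :: "(real ^ 'n) set"
  assumes B: "B \<in> sets borel" and st: "0 < s" "s \<le> t"
  shows "emeasure rho (B \<times> {s..<t}) = emeasure lborel B * ennreal (ln (t / s))"
proof -
  have Bs: "B \<times> {s..<t} \<in> sets borel"
    using B by (auto simp flip: borel_prod)
  have inner: "(\<integral>\<^sup>+y. ennreal (1 / y) * indicator {s..<t} y \<partial>lborel) = ennreal (ln (t / s))"
  proof -
    have "(\<integral>\<^sup>+y. ennreal (1 / y) * indicator {s..<t} y \<partial>lborel) = (\<integral>\<^sup>+y. ennreal (1 / y) * indicator {s..t} y \<partial>lborel)"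
      using AE_lborel_singleton[of t] by (intro nn_integral_cong_AE) (auto simp: indicator_def elim!: eventually_mono)
    also have "\<dots> = ennreal (ln t - ln s)"
      using st by (intro nn_integral_FTC_Icc) (auto intro!: derivative_eq_intros simp: has_real_derivative_iff_has_vector_derivative[symmetric])
    finally show ?thesis using st by (simp add: ln_div)
  qed
  have "emeasure rho (B \<times> {s..<t}) = (\<integral>\<^sup>+x. ennreal (1 / snd x) * indicator (B \<times> {s..<t}) x \<partial>lborel)"
    using st by (intro emeasure_rho borel_sets_rho[OF Bs]) (auto simp: axS_def)
  also have "\<dots> = (\<integral>\<^sup>+x. ennreal (1 / snd x) * indicator (B \<times> {s..<t}) x \<partial>(lborel \<Otimes>\<^sub>M lborel))"
    by (simp add: lborel_prod)
  also have "\<dots> = (\<integral>\<^sup>+x. \<integral>\<^sup>+y. ennreal (1 / y) * indicator (B \<times> {s..<t}) (x, y) \<partial>lborel \<partial>lborel)"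
    using B by (subst lborel.nn_integral_fst[symmetric]) auto
  also have "\<dots> = (\<integral>\<^sup>+x. indicator B x * ennreal (ln (t / s)) \<partial>lborel)"
    by (intro nn_integral_cong) (auto simp: indicator_times inner[symmetric] nn_integral_cmult[symmetric] mult_ac
        intro!: nn_integral_cong)
  also have "\<dots> = emeasure lborel B * ennreal (ln (t / s))"
    using B by (simp add: nn_integral_multc)
  finally show ?thesis .
qed

lemma emeasure_rho_bounded:
  fixes B :: "(real ^ 'n) set"
  assumes "bounded B" "0 < s"
  shows "emeasure rho (B \<times> {s..t}) < \<infinity>"
proof -
  obtain u v where uv: "B \<subseteq> cbox u v" using bounded_subset_cbox_symmetric[OF assms(1)] by metis
  have "emeasure rho (B \<times> {s..t}) \<le> emeasure rho (cbox u v \<times> {s..<max s t + 1})"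
    using uv assms by (intro emeasure_mono borel_sets_rho) (auto simp: axS_def simp flip: borel_prod)
  also have "\<dots> = emeasure lborel (cbox u v) * ennreal (ln ((max s t + 1) / s))"
    using assms by (intro emeasure_rho_Times) auto
  also have "\<dots> < \<infinity>"
    by (simp add: ennreal_mult_less_top emeasure_lborel_cbox_eq)
  finally show ?thesis .
qed

lemma compact_axS_bounds:
  fixes C :: "((real ^ 'n) \<times> real) set"
  assumes "compact C" "C \<subseteq> axS"
  obtains M s t where "0 < s" "s \<le> t" "C \<subseteq> cball 0 M \<times> {s..t}"
proof (cases "C = {}")
  case True then show ?thesis using that[of 1 1] by auto
next
  case False
  have "compact (snd ` C)" "snd ` C \<noteq> {}" "compact (fst ` C)"
    using assms False by (auto intro!: compact_continuous_image continuous_intros)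
  then obtain s t where s: "s \<in> snd ` C" "\<And>x. x \<in> snd ` C \<Longrightarrow> s \<le> x" and t: "t \<in> snd ` C" "\<And>x. x \<in> snd ` C \<Longrightarrow> x \<le> t"
    by (metis compact_attains_inf compact_attains_sup)
  obtain M where "\<forall>x\<in>fst ` C. norm x \<le> M"
    using \<open>compact (fst ` C)\<close> compact_imp_bounded bounded_iff by metis
  then have M: "norm (fst x) \<le> M" if "x \<in> C" for x using that by simp
  show ?thesis
  proof (rule that)
    show "0 < s" using s(1) assms(2) by (auto simp: axS_def)
    show "s \<le> t" using s(2)[OF t(1)] .
    show "C \<subseteq> cball 0 M \<times> {s..t}"
    proof
      fix x assume x: "x \<in> C"
      show "x \<in> cball 0 M \<times> {s..t}"
        using M[OF x] s(2)[OF imageI[OF x]] t(2)[OF imageI[OF x]] by (simp add: mem_Times_iff)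
    qed
  qed
qed

lemma emeasure_rho_compact:
  fixes C :: "((real ^ 'n) \<times> real) set"
  assumes "compact C" "C \<subseteq> axS"
  shows "emeasure rho C < \<infinity>"
proof -
  obtain M s t where "0 < s" "s \<le> t" "C \<subseteq> cball 0 M \<times> {s..t}"
    using compact_axS_bounds[OF assms] .
  moreover from this assms have "emeasure rho C \<le> emeasure rho (cball (0 :: real ^ 'n) M \<times> {s..t})"
    by (intro emeasure_mono borel_sets_rho) (auto simp: axS_def simp flip: borel_prod)
  ultimately show ?thesis
    using emeasure_rho_bounded[of "cball (0 :: real ^ 'n) M" s t] by (auto intro: le_less_trans)
qed

lemma sigma_finite_rho: "sigma_finite_measure (rho :: ((real ^ 'n) \<times> real) measure)"
proof
  define A where "A m = cball (0 :: real ^ 'n) (real m) \<times> {1 / real (Suc m)..real m}" for m :: nat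
  have "x \<in> (\<Union>m. A m)" if x: "x \<in> axS" for x
  proof -
    obtain m :: nat where m: "max (norm (fst x)) (max (snd x) (1 / snd x)) \<le> real m"
      using real_arch_simple by blast
    have "0 < snd x" using x by (auto simp: axS_def)
    then have "1 / real (Suc m) \<le> snd x"
      using m by (simp add: field_simps)
    then show ?thesis using m by (intro UN_I[of m]) (auto simp: A_def mem_Times_iff)
  qed
  moreover have "A m \<subseteq> axS" for m
    by (auto simp: A_def axS_def intro: less_le_trans[rotated])
  moreover have "A m \<in> sets borel" for m
    unfolding A_def by (auto simp flip: borel_prod)
  moreover have "emeasure rho (A m) \<noteq> \<infinity>" for m
    using emeasure_rho_bounded[of "cball (0 :: real ^ 'n) (real m)" "1 / real (Suc m)" "real m"] unfolding A_def by auto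
  ultimately show "\<exists>A::((real ^ 'n) \<times> real) set set. countable A \<and> A \<subseteq> sets rho \<and> \<Union> A = space rho \<and> (\<forall>a\<in>A. emeasure rho a \<noteq> \<infinity>)"
    by (intro exI[of _ "range A"]) (auto simp: borel_sets_rho)
qed

text \<open>Above the height \<open>s\<close> the density of \<open>rho\<close> is at most
  \<open>1 / s\<close>, so Lebesgue outer regularity with tolerance \<open>\<delta> * s\<close>
  suffices, once the open set is cut down to the same region.\<close>

lemma rho_outer_open:
  fixes E :: "((real ^ 'n) \<times> real) set"
  assumes "E \<in> sets rho" "E \<subseteq> {p. s < snd p}" "0 < s" "0 < \<delta>"
  obtains U where "open U" "E \<subseteq> U" "U \<subseteq> axS" "emeasure rho (U - E) < ennreal \<delta>"
proof -
  have "E \<in> sets lebesgue" using assms by (simp add: sets_rho_iff)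
  moreover have "0 < \<delta> * s" using assms by simp
  ultimately obtain T where T: "open T" "E \<subseteq> T" "T - E \<in> lmeasurable" "emeasure lebesgue (T - E) < ennreal (\<delta> * s)"
    by (rule sets_lebesgue_outer_open)
  define U where "U = T \<inter> {p. s < snd p}"
  have "open U" unfolding U_def using T by (intro open_Int open_Collect_less continuous_intros) auto
  moreover have "E \<subseteq> U" using T assms by (auto simp: U_def)
  moreover have US: "U \<subseteq> axS" using assms by (auto simp: U_def axS_def)
  moreover have "emeasure rho (U - E) < ennreal \<delta>"
  proof -
    have m: "U - E \<in> sets rho" by (rule sets.Diff[OF borel_sets_rho[OF borel_open[OF \<open>open U\<close>] US] assms(1)])
    have mT: "T - E \<in> sets lebesgue" using T by auto
    have "emeasure rho (U - E) = (\<integral>\<^sup>+x. ennreal (1 / snd x) * indicator (U - E) x \<partial>lebesgue)"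
      using emeasure_rho[OF m] by (simp add: nn_integral_completion)
    also have "\<dots> \<le> (\<integral>\<^sup>+x. ennreal (1 / s) * indicator (T - E) x \<partial>lebesgue)"
      using assms by (intro nn_integral_mono) (auto simp: U_def indicator_def intro!: ennreal_leI frac_le)
    also have "\<dots> = ennreal (1 / s) * emeasure lebesgue (T - E)"
      using mT by (simp add: nn_integral_cmult)
    also have "\<dots> < ennreal (1 / s) * ennreal (\<delta> * s)"
      using T assms by (intro ennreal_mult_strict_left_mono) auto
    also have "\<dots> = ennreal \<delta>" using assms by (simp add: ennreal_mult'[symmetric])
    finally show ?thesis .
  qed
  ultimately show ?thesis by (rule that)
qed

section \<open>Topology and measurability of balls and stars\<close>

lemma open_axd_ball:
  fixes z :: "(real ^ 'n) \<times> real"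
  assumes "z \<in> axS"
  shows "open {x \<in> axS. axd x z < r}"
proof (cases "0 < r")
  case False
  then have "\<not> axd x z < r" if "x \<in> axS" for x
    using axd_nonneg[OF that assms] by linarith
  then have "{x \<in> axS. axd x z < r} = {}" by blast
  then show ?thesis by (metis open_empty)
next
  case True
  \<comment> \<open>With the positive denominator cleared, the ball is described by a strict
    inequality between continuous functions, in which \<open>arcosh\<close> no longer
    occurs.\<close>
  have "axd x z < r \<longleftrightarrow> (snd x)\<^sup>2 + (snd z)\<^sup>2 + (norm (fst x - fst z))\<^sup>2 < cosh r * (2 * snd x * snd z)"
    if x: "x \<in> axS" for x
  proof -
    have "axd x z < r \<longleftrightarrow> cosh (axd x z) < cosh r"
      using axd_nonneg[OF x assms] True by (simp add: cosh_real_nonneg_less_iff)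
    moreover have "0 < 2 * snd x * snd z" using x assms by (simp add: axS_def)
    ultimately show ?thesis unfolding cosh_axd[OF x assms] by (simp add: pos_divide_less_eq)
  qed
  then have "{x \<in> axS. axd x z < r} =
     axS \<inter> {x. (snd x)\<^sup>2 + (snd z)\<^sup>2 + (norm (fst x - fst z))\<^sup>2 < cosh r * (2 * snd x * snd z)}"
    by auto
  also have "open \<dots>"
    by (intro open_Int open_axS open_Collect_less continuous_intros)
  finally show ?thesis .
qed

lemma axd_measurable [measurable]:
  fixes z :: "(real ^ 'n) \<times> real"
  assumes "z \<in> axS"
  shows "(\<lambda>x. axd x z) \<in> borel_measurable rho" "(\<lambda>x. axd z x) \<in> borel_measurable rho"
proof -
  show 1: "(\<lambda>x. axd x z) \<in> borel_measurable rho"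
  proof (rule borel_measurableI_less)
    fix y
    have "{x \<in> space rho. axd x z < y} = {x \<in> axS. axd x z < y}" by simp
    then show "{x \<in> space rho. axd x z < y} \<in> sets rho"
      using open_axd_ball[OF assms, of y] by (simp add: borel_sets_rho)
  qed
  then show "(\<lambda>x. axd z x) \<in> borel_measurable rho" by (simp add: axd_commute[of z])
qed

lemma open_cz_star:
  assumes "cz_with R r" shows "open (cz_star R)"
proof -
  have "cz_star R = (\<Union>z\<in>R. {x \<in> axS. axd x z < r})"
    using mem_cz_star_iff[OF assms] cz_star_subset_axS[of R] by auto
  also have "open \<dots>"
    using cz_subset_axS[OF assms] by (intro open_UN ballI open_axd_ball) auto
  finally show ?thesis .
qed

lemma cz_star_sets: "R \<in> CZ \<Longrightarrow> cz_star R \<in> sets rho"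
  using open_cz_star cz_star_subset_axS by (auto simp: CZ_def intro!: borel_sets_rho)

section \<open>Measures of admissible sets and of their stars\<close>

lemma dyadic_sets: "{x::real^'n. \<forall>i. f i \<le> x $ i \<and> x $ i < g i} \<in> sets borel"
proof -
  have "{x::real^'n. \<forall>i. f i \<le> x $ i \<and> x $ i < g i} = (\<Inter>i. {x. f i \<le> x $ i} \<inter> {x. x $ i < g i})"
    by auto
  also have "\<dots> \<in> sets borel"
    by (intro sets.countable_INT'' sets.Int borel_closed borel_open closed_Collect_le open_Collect_less continuous_intros) auto
  finally show ?thesis .
qed

lemma emeasure_cbox_cart:
  fixes u v :: "real ^ 'n"
  assumes "\<And>i. u $ i \<le> v $ i"
  shows "emeasure lborel (cbox u v) = ennreal (\<Prod>i\<in>UNIV. v $ i - u $ i)"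
    and "emeasure lborel (box u v) = ennreal (\<Prod>i\<in>UNIV. v $ i - u $ i)"
proof -
  have ne: "cbox u v \<noteq> {}" using assms by (simp add: interval_ne_empty_cart)
  have "emeasure lborel (cbox u v) = ennreal (measure lborel (cbox u v))"
    by (intro emeasure_eq_ennreal_measure) (simp add: emeasure_lborel_cbox_eq)
  then show 1: "emeasure lborel (cbox u v) = ennreal (\<Prod>i\<in>UNIV. v $ i - u $ i)"
    using content_cbox_cart[OF ne] by simp
  show "emeasure lborel (box u v) = ennreal (\<Prod>i\<in>UNIV. v $ i - u $ i)"
    using 1 by (simp add: emeasure_lborel_box_eq emeasure_lborel_cbox_eq)
qed

lemma emeasure_dyadic:
  fixes k :: "'n::finite \<Rightarrow> int"
  assumes "0 < L"
  shows "emeasure lborel {x::real^'n. \<forall>i. of_int (k i) * L \<le> x $ i \<and> x $ i < (of_int (k i) + 1) * L} = ennreal (L ^ CARD('n))"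
    (is "emeasure lborel ?Q = _")
proof -
  let ?u = "(\<chi> i. of_int (k i) * L) :: real^'n" and ?v = "(\<chi> i. (of_int (k i) + 1) * L) :: real^'n"
  have le: "?u $ i \<le> ?v $ i" for i using assms by (simp add: algebra_simps)
  have pr: "(\<Prod>i\<in>UNIV. ?v $ i - ?u $ i) = L ^ CARD('n)" by (simp add: algebra_simps)
  have "?Q \<subseteq> cbox ?u ?v" "box ?u ?v \<subseteq> ?Q"
    by (auto simp: mem_box_cart less_imp_le)
  then have "emeasure lborel ?Q \<le> emeasure lborel (cbox ?u ?v)" "emeasure lborel (box ?u ?v) \<le> emeasure lborel ?Q"
    using dyadic_sets by (auto intro!: emeasure_mono)
  then show ?thesis using emeasure_cbox_cart[of ?u ?v, OF le] unfolding pr by simp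
qed

lemma cz_borel: "cz_with R r \<Longrightarrow> R \<in> sets borel"
  by (erule cz_withE) (auto simp: dyadic_sets simp flip: borel_prod)

lemma cz_sets: "R \<in> CZ \<Longrightarrow> R \<in> sets rho"
  by (auto simp: CZ_def intro!: borel_sets_rho cz_borel dest: cz_subset_axS)

lemma emeasure_cell:
  fixes k :: "'n::finite \<Rightarrow> int"
  assumes "0 < L" "0 < a" "0 < r"
  shows "emeasure rho ({x::real^'n. \<forall>i. of_int (k i) * L \<le> x $ i \<and> x $ i < (of_int (k i) + 1) * L} \<times>
      {a * exp (- r)..<a * exp r}) = ennreal (2 * r * L ^ CARD('n))"
proof -
  have "ln (a * exp r / (a * exp (- r))) = ln (exp (r + r))"
    using assms by (simp only: exp_add exp_minus) (simp add: field_simps)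
  then have "ln (a * exp r / (a * exp (- r))) = 2 * r"
    by (simp only: ln_exp)
  then show ?thesis
    using assms emeasure_dyadic[OF assms(1), of k]
    by (subst emeasure_rho_Times) (auto simp: dyadic_sets simp flip: ennreal_mult' ennreal_mult'')
qed

lemma cz_emeasure_pos: "R \<in> CZ \<Longrightarrow> 0 < emeasure rho R"
  and cz_emeasure_finite: "R \<in> CZ \<Longrightarrow> emeasure rho R < \<infinity>"
  for R :: "((real ^ 'n) \<times> real) set"
  by (auto simp: CZ_def emeasure_cell elim!: cz_withE)

text \<open>\<open>3 ^ CARD('n)\<close> comes from the tripled cube and 2 from the logarithmic
  interval of length \<open>4 * r\<close> instead of \<open>2 * r\<close>. This takes the place of a
  doubling property.\<close>

lemma cz_star_emeasure:
  fixes R :: "((real ^ 'n) \<times> real) set"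
  assumes "R \<in> CZ"
  shows "emeasure rho (cz_star R) \<le> ennreal (2 * 3 ^ CARD('n)) * emeasure rho R"
proof -
  obtain r where cz: "cz_with R r" using assms by (auto simp: CZ_def)
  then obtain j :: int and k :: "'n::finite \<Rightarrow> int" and L a where *: "L = 2 powi j" "0 < L" "0 < a" "0 < r"
      and c: "r < 1 \<Longrightarrow> exp 2 * a * r \<le> L" "r < 1 \<Longrightarrow> L < exp 8 * a * r"
      "1 \<le> r \<Longrightarrow> a * exp (2 * r) \<le> L" "1 \<le> r \<Longrightarrow> L < a * exp (8 * r)"
      and R: "R = {x::real^'n. \<forall>i. of_int (k i) * L \<le> x $ i \<and> x $ i < (of_int (k i) + 1) * L} \<times>
      {a * exp (- r)..<a * exp r}"
    by (rule cz_withE) blast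
  let ?u = "(\<chi> i. (of_int (k i) - 1) * L) :: real^'n" and ?v = "(\<chi> i. (of_int (k i) + 2) * L) :: real^'n"
  have le: "?u $ i \<le> ?v $ i" for i using * by (simp add: algebra_simps)
  have pr: "(\<Prod>i\<in>UNIV. ?v $ i - ?u $ i) = (3 * L) ^ CARD('n)" by (simp add: algebra_simps)
  have sub: "cz_star R \<subseteq> cbox ?u ?v \<times> {a * exp (- 2 * r)..<a * exp (2 * r)}"
    by (rule cz_star_subset_box[OF cz *(2-4) c(1,3) R])
  have "emeasure rho (cz_star R) \<le> emeasure rho (cbox ?u ?v \<times> {a * exp (- 2 * r)..<a * exp (2 * r)})"
    using * sub by (intro emeasure_mono borel_sets_rho) (auto simp: axS_def less_le_trans[rotated] simp flip: borel_prod)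
  also have "\<dots> = emeasure lborel (cbox ?u ?v) * ennreal (ln (a * exp (2 * r) / (a * exp (- 2 * r))))"
    using * by (intro emeasure_rho_Times) auto
  also have "ln (a * exp (2 * r) / (a * exp (- 2 * r))) = ln (exp (2 * r + 2 * r))"
    using * by (simp only: exp_add exp_minus) (simp add: field_simps exp_minus)
  also have "\<dots> = 4 * r" by (simp only: ln_exp)
  also have "emeasure lborel (cbox ?u ?v) = ennreal ((3 * L) ^ CARD('n))"
    using emeasure_cbox_cart(1)[of ?u ?v, OF le] unfolding pr .
  also have "ennreal ((3 * L) ^ CARD('n)) * ennreal (4 * r) = ennreal (2 * 3 ^ CARD('n)) * ennreal (2 * r * L ^ CARD('n))"
    using * by (simp add: ennreal_mult'[symmetric] power_mult_distrib mult_ac)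
  also have "ennreal (2 * r * L ^ CARD('n)) = emeasure rho R"
    unfolding R using emeasure_cell[of L a r k] * by simp
  finally show ?thesis .
qed

section \<open>Dyadic filtrations by admissible sets\<close>

lemma tendsto_null_le:
  fixes f g :: "nat \<Rightarrow> real"
  assumes "g \<longlonglongrightarrow> 0" "\<And>m. \<bar>f m\<bar> \<le> g m"
  shows "f \<longlonglongrightarrow> 0"
  using assms by (intro Lim_null_comparison[of f g] always_eventually) auto

section \<open>Subdivision of admissible sets\<close>

definition cz_adm :: "real \<Rightarrow> real \<Rightarrow> real \<Rightarrow> bool" where
  "cz_adm a r L \<longleftrightarrow> (if r < 1 then exp 2 * a * r \<le> L \<and> L < exp 8 * a * r
      else a * exp (2 * r) \<le> L \<and> L < a * exp (8 * r))"

text \<open>The gap between \<open>exp 2\<close> and \<open>exp 8\<close> in the definition of the admissible sets is what makes one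
  of the two subdivisions admissible again.\<close>

lemma cz_adm_split:
  assumes "cz_adm a r L" "0 < a" "0 < r"
  shows "(cz_adm (a * exp (- r / 2)) (r / 2) L \<and> cz_adm (a * exp (r / 2)) (r / 2) L) \<or> cz_adm a r (L / 2)"
proof -
  have le1: "a * exp (- r / 2) \<le> a * exp (r / 2)" using assms by simp
  have e2: "2 \<le> exp (1::real)" using exp_ge_add_one_self[of "1::real"] by simp
  have e4: "4 \<le> exp x" if "3 \<le> x" for x :: real
    using exp_ge_add_one_self[of x] that by linarith
  \<comment> \<open>The formula for admissibility changes at radius 1: for \<open>2 \<le> r\<close>
    the halves stay in the upper range, for \<open>1 \<le> r < 2\<close> they drop into the lower
    one, and for \<open>r < 1\<close> everything is in the lower one.\<close>
  consider "2 \<le> r" | "1 \<le> r" "r < 2" | "r < 1" by linarith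
  then show ?thesis
  proof cases
    case 1
    show ?thesis
    \<comment> \<open>This is the upper bound required of the lower half, whose centre is
      \<open>a * exp (- r / 2)\<close>. It implies the one for the upper half, and the lower bounds
      hold anyway. If it fails, \<open>L\<close> is so large that its half still meets the lower
      bound for the undivided strip.\<close>
    proof (cases "L < a * exp (7 / 2 * r)")
      case True
      have "a * exp (- r / 2) * exp (8 * (r / 2)) = a * exp (7 / 2 * r)"
           "a * exp (r / 2) * exp (2 * (r / 2)) = a * exp (3 / 2 * r)"
           "a * exp (- r / 2) * exp (2 * (r / 2)) = a * exp (r / 2)"
           "a * exp (r / 2) * exp (8 * (r / 2)) = a * exp (9 / 2 * r)"
        by (simp_all add: mult.assoc flip: exp_add)
      moreover have "a * exp (3 / 2 * r) \<le> a * exp (2 * r)" "a * exp (r / 2) \<le> a * exp (2 * r)"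
          "a * exp (7 / 2 * r) \<le> a * exp (9 / 2 * r)"
        using assms by auto
      moreover have "\<not> r < 1" "\<not> r / 2 < 1" using 1 by auto
      moreover from this(1) have "a * exp (2 * r) \<le> L" using assms(1) by (simp add: cz_adm_def)
      ultimately show ?thesis using True unfolding cz_adm_def by argo
    next
      case False
      have "2 \<le> exp r" using 1 exp_ge_add_one_self[of r] by linarith
      then have "2 * exp (2 * r) \<le> exp r * exp (2 * r)"
        by (intro mult_right_mono) auto
      also have "\<dots> \<le> exp (7 / 2 * r)" using 1 by (simp flip: exp_add)
      finally have "a * (2 * exp (2 * r)) \<le> a * exp (7 / 2 * r)" using assms by (intro mult_left_mono) auto
      then have "a * exp (2 * r) \<le> L / 2" using False by simp
      moreover have "L / 2 < a * exp (8 * r)"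
        using 1 assms calculation unfolding cz_adm_def by (smt (verit) exp_gt_zero mult_pos_pos field_sum_of_halves)
      ultimately show ?thesis using 1 by (simp add: cz_adm_def)
    qed
  next
    case 2
    have "r / 2 \<le> exp (r / 2 - 1)" using exp_ge_add_one_self[of "r / 2 - 1"] by simp
    then have "exp 2 * (a * exp (r / 2)) * (r / 2) \<le> exp 2 * (a * exp (r / 2)) * exp (r / 2 - 1)"
      using assms by (intro mult_left_mono) auto
    also have "\<dots> = a * (exp 2 * exp (r / 2) * exp (r / 2 - 1))" by simp
    also have "exp 2 * exp (r / 2) * exp (r / 2 - 1) = exp (1 + r)" by (simp flip: exp_add)
    also have "a * exp (1 + r) \<le> a * exp (2 * r)" using 2 assms by simp
    also have "\<dots> \<le> L" using 2 assms(1) by (simp add: cz_adm_def)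
    finally have lo: "exp 2 * (a * exp (r / 2)) * (r / 2) \<le> L" .
    have lo': "exp 2 * (a * exp (- r / 2)) * (r / 2) \<le> L"
      using assms le1 by (intro order_trans[OF _ lo] mult_right_mono mult_left_mono) auto
    show ?thesis
    proof (cases "L < exp 8 * (a * exp (- r / 2)) * (r / 2)")
      case True
      have "exp 8 * (a * exp (- r / 2)) * (r / 2) \<le> exp 8 * (a * exp (r / 2)) * (r / 2)"
        using assms le1 by (intro mult_right_mono mult_left_mono) auto
      with True have "L < exp 8 * (a * exp (r / 2)) * (r / 2)" by (rule less_le_trans)
      moreover have "r / 2 < 1" using 2 by simp
      ultimately show ?thesis using True lo lo' unfolding cz_adm_def by (simp only: if_True simp_thms)
    next
      case False
      have "exp 8 * (a * exp (- r / 2)) * (1 / 2) \<le> exp 8 * (a * exp (- r / 2)) * (r / 2)"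
        using assms 2 by (intro mult_left_mono) auto
      then have "exp 8 * (a * exp (- r / 2)) * (1 / 2) \<le> L" using False by linarith
      moreover have "exp 8 * (a * exp (- r / 2)) = a * exp (8 - r / 2)"
      proof -
        have "exp (8 - r / 2) = exp 8 * exp (- r / 2)" by (simp flip: exp_add)
        then show ?thesis by simp
      qed
      moreover have "4 * (a * exp (2 * r)) \<le> a * exp (8 - r / 2)"
      proof -
        have "4 * exp (2 * r) \<le> exp (8 - r / 2 - 2 * r) * exp (2 * r)"
          using 2 by (intro mult_right_mono e4) auto
        then show ?thesis using assms mult_left_mono[of "4 * exp (2 * r)" "exp (8 - r / 2)" a] by (simp flip: exp_add)
      qed
      ultimately have "a * exp (2 * r) \<le> L / 2" by linarith
      moreover have "L / 2 < a * exp (8 * r)"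
        using 2 assms calculation unfolding cz_adm_def by (smt (verit) exp_gt_zero mult_pos_pos field_sum_of_halves)
      ultimately show ?thesis using 2 by (simp add: cz_adm_def)
    qed
  next
    case 3
    have "exp (r / 2) \<le> 2"
    proof -
      have "(exp (r / 2))\<^sup>2 = exp r" by (simp flip: exp_double)
      also have "\<dots> \<le> exp 1" using 3 by simp
      also have "\<dots> \<le> 2\<^sup>2" using exp_le by simp
      finally show ?thesis by (rule power2_le_imp_le) simp
    qed
    then have "exp 2 * (a * exp (r / 2)) * (r / 2) \<le> exp 2 * (a * 2) * (r / 2)"
      using assms by (intro mult_right_mono mult_left_mono) auto
    also have "\<dots> \<le> L" using 3 assms(1) by (simp add: cz_adm_def)
    finally have lo: "exp 2 * (a * exp (r / 2)) * (r / 2) \<le> L" .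
    have lo': "exp 2 * (a * exp (- r / 2)) * (r / 2) \<le> L"
      using assms le1 by (intro order_trans[OF _ lo] mult_right_mono mult_left_mono) auto
    show ?thesis
    proof (cases "L < exp 8 * (a * exp (- r / 2)) * (r / 2)")
      case True
      have "exp 8 * (a * exp (- r / 2)) * (r / 2) \<le> exp 8 * (a * exp (r / 2)) * (r / 2)"
        using assms le1 by (intro mult_right_mono mult_left_mono) auto
      with True have "L < exp 8 * (a * exp (r / 2)) * (r / 2)" by (rule less_le_trans)
      moreover have "r / 2 < 1" using 3 by simp
      ultimately show ?thesis using True lo lo' unfolding cz_adm_def by (simp only: if_True simp_thms)
    next
      case False
      have "4 * exp 2 \<le> exp (6 - r / 2) * exp 2"
        using 3 by (intro mult_right_mono e4) auto
      also have "\<dots> = exp 8 * exp (- r / 2)" by (simp flip: exp_add)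
      finally have "(4 * exp 2) * (a * r / 2) \<le> (exp 8 * exp (- r / 2)) * (a * r / 2)"
        using assms by (intro mult_right_mono) auto
      then have "exp 2 * a * r \<le> L / 2" using False by (simp add: mult_ac)
      moreover have "L / 2 < exp 8 * a * r"
        using 3 assms calculation unfolding cz_adm_def by (smt (verit) exp_gt_zero mult_pos_pos field_sum_of_halves)
      ultimately show ?thesis using 3 by (simp add: cz_adm_def)
    qed
  qed
qed

text \<open>A state \<open>(l, r, j)\<close> encodes the strip \<open>[exp l, exp (l + 2 r))\<close> tiled by dyadic cubes of
  side \<open>2 powi j\<close>; whether a cell is halved vertically or cut into \<open>2 ^ n\<close> cells does not depend on
  the cube, so all cells over one strip are subdivided in the same way.\<close>

type_synonym strip = "real \<times> real \<times> int"

definition in_strip :: "strip \<Rightarrow> real \<Rightarrow> bool" where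
  "in_strip s u \<longleftrightarrow> (case s of (l, r, j) \<Rightarrow> l \<le> u \<and> u < l + 2 * r)"

definition adm_strip :: "strip \<Rightarrow> bool" where
  "adm_strip s \<longleftrightarrow> (case s of (l, r, j) \<Rightarrow> 0 < r \<and> cz_adm (exp (l + r)) r (2 powi j))"

definition split_strip :: "real \<Rightarrow> strip \<Rightarrow> strip" where
  "split_strip u s = (case s of (l, r, j) \<Rightarrow>
     if cz_adm (exp (l + r / 2)) (r / 2) (2 powi j) \<and> cz_adm (exp (l + r + r / 2)) (r / 2) (2 powi j)
     then (if u < l + r then (l, r / 2, j) else (l + r, r / 2, j)) else (l, r, j - 1))"

lemma split_strip_in: "in_strip s u \<Longrightarrow> in_strip (split_strip u s) u"
  by (auto simp: in_strip_def split_strip_def split: prod.splits)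

lemma split_strip_mono: "adm_strip s \<Longrightarrow> in_strip (split_strip u s) u' \<Longrightarrow> in_strip s u'"
  by (auto simp: in_strip_def split_strip_def adm_strip_def split: prod.splits if_splits)

lemma split_strip_cong: "in_strip (split_strip u s) u' \<Longrightarrow> in_strip s u \<Longrightarrow> in_strip s u' \<Longrightarrow> split_strip u' s = split_strip u s"
  by (auto simp: in_strip_def split_strip_def split: prod.splits if_splits)

lemma split_strip_adm:
  assumes "adm_strip s" shows "adm_strip (split_strip u s)"
proof -
  obtain l r j where s: "s = (l, r, j)" by (cases s) auto
  have r: "0 < r" and a: "cz_adm (exp (l + r)) r (2 powi j)" using assms by (auto simp: adm_strip_def s)
  have "exp (l + r) * exp (- r / 2) = exp (l + r / 2)" "exp (l + r) * exp (r / 2) = exp (l + r + r / 2)"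
    by (simp_all flip: exp_add)
  moreover have h: "2 powi (j - 1) = 2 powi j / (2::real)"
    by (simp add: power_int_diff)
  ultimately show ?thesis
    using cz_adm_split[OF a _ r] r by (auto simp: adm_strip_def split_strip_def s h)
qed

text \<open>The initial strips have half-width \<open>V * 2 ^ k\<close>, so every initial cell has measure at least \<open>V\<close>; a
  function with a finite integral then has small averages over all of them once \<open>V\<close> is large.\<close>

definition strip_bound :: "real \<Rightarrow> nat \<Rightarrow> real" where
  "strip_bound V k = 2 * V * (2 ^ k - 1)"

text \<open>For \<open>1 \<le> r\<close>, \<open>exp (l + 3 * r)\<close> is the least side
  admissible for the centre \<open>exp (l + r)\<close> and the radius \<open>r\<close>. The maximum
  with 1 makes every initial cube of side at least 1, so that the measure of an initial cell is
  bounded below through its half-width alone.\<close>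

definition init_side :: "real \<Rightarrow> real \<Rightarrow> int" where
  "init_side l r = \<lceil>log 2 (max (exp (l + 3 * r)) 1)\<rceil>"

text \<open>Every strip is closed below and open above, also those of negative logarithmic height;
  this is why the strict inequality of the first case becomes \<open>\<le>\<close> for
  \<open>- u\<close>.\<close>

definition init_strip :: "real \<Rightarrow> real \<Rightarrow> strip" where
  "init_strip V u =
    (if 0 \<le> u then let k = (LEAST k. u < strip_bound V (Suc k))
       in (strip_bound V k, V * 2 ^ k, init_side (strip_bound V k) (V * 2 ^ k))
     else let k = (LEAST k. - u \<le> strip_bound V (Suc k))
       in (- strip_bound V (Suc k), V * 2 ^ k, init_side (- strip_bound V (Suc k)) (V * 2 ^ k)))"

section \<open>The initial partition into strips\<close>

lemma strip_bound_Suc: "strip_bound V (Suc k) = strip_bound V k + 2 * (V * 2 ^ k)"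
  by (simp add: strip_bound_def algebra_simps)

lemma strip_bound_mono: "0 \<le> V \<Longrightarrow> i \<le> k \<Longrightarrow> strip_bound V i \<le> strip_bound V k"
  unfolding strip_bound_def by (intro mult_left_mono) (auto simp: power_increasing)

lemma strip_bound_nonneg: "0 \<le> V \<Longrightarrow> 0 \<le> strip_bound V k"
  unfolding strip_bound_def by simp

lemma strip_bound_unbounded: "1 \<le> V \<Longrightarrow> \<exists>k. u < strip_bound V (Suc k)"
proof -
  assume V: "1 \<le> V"
  obtain k where k: "u < 2 ^ k" using real_arch_pow[of 2 u] by auto
  have one: "1 \<le> (2::real) ^ k" by simp
  then have "(2::real) ^ k \<le> 1 * (2 ^ Suc k - 1)" by simp
  also have "\<dots> \<le> 2 * V * (2 ^ Suc k - 1)" using V one by (intro mult_right_mono) (simp, simp only: power_Suc)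
  finally show ?thesis using k unfolding strip_bound_def by (intro exI[of _ k]) linarith
qed

lemma Least_eq_of_between:
  fixes P :: "nat \<Rightarrow> bool"
  assumes "P k" "\<And>i. i < k \<Longrightarrow> \<not> P i"
  shows "(LEAST k. P k) = k"
  using assms by (intro Least_equality) (auto simp: not_le[symmetric])

lemma init_strip_nonneg:
  assumes "1 \<le> V" "strip_bound V k \<le> u" "u < strip_bound V (Suc k)"
  shows "init_strip V u = (strip_bound V k, V * 2 ^ k, init_side (strip_bound V k) (V * 2 ^ k))"
proof -
  have "(LEAST k. u < strip_bound V (Suc k)) = k"
  proof (rule Least_eq_of_between)
    fix i assume "i < k"
    then have "strip_bound V (Suc i) \<le> strip_bound V k" using assms by (intro strip_bound_mono) auto
    then show "\<not> u < strip_bound V (Suc i)" using assms by linarith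
  qed (fact assms)
  moreover have "0 \<le> u" using strip_bound_nonneg[of V k] assms by linarith
  ultimately show ?thesis by (simp add: init_strip_def Let_def)
qed

lemma init_strip_neg:
  assumes "1 \<le> V" "strip_bound V k < - u" "- u \<le> strip_bound V (Suc k)"
  shows "init_strip V u = (- strip_bound V (Suc k), V * 2 ^ k, init_side (- strip_bound V (Suc k)) (V * 2 ^ k))"
proof -
  have "(LEAST k. - u \<le> strip_bound V (Suc k)) = k"
  proof (rule Least_eq_of_between)
    fix i assume "i < k"
    then have "strip_bound V (Suc i) \<le> strip_bound V k" using assms by (intro strip_bound_mono) auto
    then show "\<not> - u \<le> strip_bound V (Suc i)" using assms by linarith
  qed (fact assms)
  moreover have "\<not> 0 \<le> u" using strip_bound_nonneg[of V k] assms by linarith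
  ultimately show ?thesis by (simp add: init_strip_def Let_def)
qed

lemma init_strip_cases:
  assumes "1 \<le> V"
  obtains k where "strip_bound V k \<le> u" "u < strip_bound V (Suc k)"
  | k where "strip_bound V k < - u" "- u \<le> strip_bound V (Suc k)"
proof (cases "0 \<le> u")
  case True
  define k where "k = (LEAST k. u < strip_bound V (Suc k))"
  have 1: "u < strip_bound V (Suc k)"
    unfolding k_def using strip_bound_unbounded[OF assms, of u] by (rule LeastI_ex)
  have "strip_bound V k \<le> u"
  proof (cases k)
    case 0 then show ?thesis using True by (simp add: strip_bound_def)
  next
    case (Suc i)
    then show ?thesis using not_less_Least[of i "\<lambda>k. u < strip_bound V (Suc k)"] unfolding k_def[symmetric] by simp
  qed
  with 1 show ?thesis using that by blast
next
  case False
  define k where "k = (LEAST k. - u \<le> strip_bound V (Suc k))"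
  have "\<exists>k. - u \<le> strip_bound V (Suc k)" using strip_bound_unbounded[OF assms, of "- u"] less_imp_le by blast
  then have 1: "- u \<le> strip_bound V (Suc k)"
    unfolding k_def by (rule LeastI_ex)
  have "strip_bound V k < - u"
  proof (cases k)
    case 0 then show ?thesis using False by (simp add: strip_bound_def)
  next
    case (Suc i)
    then show ?thesis using not_less_Least[of i "\<lambda>k. - u \<le> strip_bound V (Suc k)"] unfolding k_def[symmetric] by simp
  qed
  with 1 show ?thesis using that by blast
qed

lemma init_strip_in: "1 \<le> V \<Longrightarrow> in_strip (init_strip V u) u"
  by (rule init_strip_cases[of V u]) (auto simp: in_strip_def init_strip_nonneg init_strip_neg strip_bound_Suc)

lemma init_strip_cong:
  assumes V: "1 \<le> V" and "in_strip (init_strip V u) u'"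
  shows "init_strip V u' = init_strip V u"
proof (rule init_strip_cases[OF V, of u])
  fix k assume *: "strip_bound V k \<le> u" "u < strip_bound V (Suc k)"
  then have "strip_bound V k \<le> u'" "u' < strip_bound V (Suc k)"
    using assms by (auto simp: init_strip_nonneg in_strip_def strip_bound_Suc)
  then show ?thesis using * V by (simp add: init_strip_nonneg)
next
  fix k assume *: "strip_bound V k < - u" "- u \<le> strip_bound V (Suc k)"
  then have "strip_bound V k < - u'" "- u' \<le> strip_bound V (Suc k)"
    using assms by (auto simp: init_strip_neg in_strip_def strip_bound_Suc)
  then show ?thesis using * V by (simp add: init_strip_neg)
qed

text \<open>The second hypothesis leaves room for a side of at least 1 below the upper bound
  \<open>exp (l + 9 * r)\<close>, even for strips at very small heights. It is met because
  \<open>r\<close> is comparable with \<open>- l\<close> there: \<open>l + 9 * r\<close> equals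
  \<open>5 * (V * 2 ^ k) + 2 * V\<close>.\<close>

lemma init_side_adm:
  assumes "1 \<le> r" "1 \<le> l + 9 * r"
  shows "cz_adm (exp (l + r)) r (2 powi init_side l r)" "1 \<le> (2::real) powi init_side l r"
proof -
  define x where "x = max (exp (l + 3 * r)) 1"
  have x: "1 \<le> x" "exp (l + 3 * r) \<le> x" by (auto simp: x_def)
  have e: "(2::real) powi init_side l r = 2 powr real_of_int (init_side l r)"
    by (simp add: powr_real_of_int')
  have "log 2 x \<le> init_side l r" "init_side l r < log 2 x + 1" unfolding init_side_def x_def by linarith+
  then have "2 powr log 2 x \<le> 2 powr init_side l r" "2 powr init_side l r < 2 powr (log 2 x + 1)"
    by (auto simp: powr_less_cancel_iff)
  then have *: "x \<le> 2 powi init_side l r" "2 powi init_side l r < 2 * x"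
    using x e by (auto simp: powr_add)
  have "2 * x \<le> exp (l + 9 * r)"
  proof -
    have "2 \<le> exp (6 * r)"
      using exp_ge_add_one_self[of "6 * r"] assms by linarith
    then have "2 * exp (l + 3 * r) \<le> exp (6 * r) * exp (l + 3 * r)"
      by (intro mult_right_mono) auto
    also have "\<dots> = exp (l + 9 * r)" by (simp add: add_ac flip: exp_add)
    finally have "2 * exp (l + 3 * r) \<le> exp (l + 9 * r)" .
    moreover have "2 \<le> exp (l + 9 * r)" using exp_ge_add_one_self[of "l + 9 * r"] assms by linarith
    ultimately show ?thesis unfolding x_def by (simp add: max_def)
  qed
  moreover have "exp (l + r) * exp (2 * r) = exp (l + 3 * r)" "exp (l + r) * exp (8 * r) = exp (l + 9 * r)"
    by (simp_all flip: exp_add)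
  ultimately show "cz_adm (exp (l + r)) r (2 powi init_side l r)"
    using * x assms unfolding cz_adm_def by auto
  show "1 \<le> (2::real) powi init_side l r" using * x by linarith
qed

lemma init_strip_adm:
  assumes V: "1 \<le> V"
  shows "adm_strip (init_strip V u)" "init_strip V u = (l, r, j) \<Longrightarrow> V \<le> r \<and> 1 \<le> (2::real) powi j"
proof -
  have p: "V \<le> V * 2 ^ k" for k :: nat using V by (simp add: mult_le_cancel_left1)
  have 2: "1 \<le> - strip_bound V (Suc k) + 9 * (V * 2 ^ k)" for k
  proof -
    have "- strip_bound V (Suc k) + 9 * (V * 2 ^ k) = 5 * (V * 2 ^ k) + 2 * V"
      by (simp add: strip_bound_def algebra_simps)
    then show ?thesis using p[of k] V by linarith
  qed
  have 1: "1 \<le> strip_bound V k + 9 * (V * 2 ^ k)" for k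
    using p[of k] V strip_bound_nonneg[of V k] by linarith
  have r: "1 \<le> V * 2 ^ k" for k using p[of k] V by linarith
  show "adm_strip (init_strip V u)"
  proof (rule init_strip_cases[OF V, of u])
    fix k assume "strip_bound V k \<le> u" "u < strip_bound V (Suc k)"
    from init_strip_nonneg[OF V this] show ?thesis
      using init_side_adm(1)[OF r[of k] 1[of k]] r[of k] by (simp add: adm_strip_def)
  next
    fix k assume "strip_bound V k < - u" "- u \<le> strip_bound V (Suc k)"
    from init_strip_neg[OF V this] show ?thesis
      using init_side_adm(1)[OF r[of k] 2[of k]] r[of k] unfolding adm_strip_def by simp
  qed
  show "init_strip V u = (l, r, j) \<Longrightarrow> V \<le> r \<and> 1 \<le> (2::real) powi j"
    by (rule init_strip_cases[OF V, of u])
      (use r V p 1 2 init_side_adm in \<open>auto simp: init_strip_nonneg init_strip_neg\<close>)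
qed

section \<open>Nested strips and cells\<close>

primrec strip_at :: "real \<Rightarrow> nat \<Rightarrow> real \<Rightarrow> strip" where
  "strip_at V 0 u = init_strip V u"
| "strip_at V (Suc m) u = split_strip u (strip_at V m u)"

lemma strip_at_adm: "1 \<le> V \<Longrightarrow> adm_strip (strip_at V m u)"
  by (induction m) (auto simp: init_strip_adm split_strip_adm)

lemma strip_at_in: "1 \<le> V \<Longrightarrow> in_strip (strip_at V m u) u"
  by (induction m) (auto simp: init_strip_in split_strip_in)

lemma strip_at_cong:
  assumes V: "1 \<le> V" shows "in_strip (strip_at V m u) u' \<Longrightarrow> strip_at V m u' = strip_at V m u"
proof (induction m)
  case 0 then show ?case using init_strip_cong[OF V] by simp
next
  case (Suc m)
  then have i: "in_strip (strip_at V m u) u'"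
    using split_strip_mono[OF strip_at_adm[OF V]] by simp
  then have e: "strip_at V m u' = strip_at V m u" by (rule Suc.IH)
  show ?case using split_strip_cong[of u "strip_at V m u" u'] Suc.prems i strip_at_in[OF V, of m u] by (simp add: e)
qed

text \<open>A subdivision halves either the half-width or the side, hence their product in both
  cases. The last equation records this invariant, from which \<open>cell_small\<close> deduces that
  the cells shrink.\<close>

lemma strip_at_bounds:
  assumes V: "1 \<le> V" and "strip_at V 0 u = (l0, r0, j0)" "strip_at V m u = (l, r, j)"
  shows "l0 \<le> l" "l + 2 * r \<le> l0 + 2 * r0" "0 < r" "r * 2 powi j * 2 ^ m = r0 * 2 powi j0"
proof -
  have "l0 \<le> l \<and> l + 2 * r \<le> l0 + 2 * r0 \<and> r * 2 powi j * 2 ^ m = r0 * 2 powi j0"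
    using assms(3)
  proof (induction m arbitrary: l r j)
    case 0 then show ?case using assms(2) by simp
  next
    case (Suc m)
    obtain l' r' j' where s: "strip_at V m u = (l', r', j')" by (metis prod_cases3)
    have "0 < r'" using strip_at_adm[OF V, of m u] by (simp add: s adm_strip_def)
    have h: "2 powi (j' - 1) = 2 powi j' / (2::real)" by (simp add: power_int_diff)
    show ?case using Suc.IH[OF s] Suc.prems s \<open>0 < r'\<close>
      by (auto simp: split_strip_def h split: if_splits)
  qed
  then show "l0 \<le> l" "l + 2 * r \<le> l0 + 2 * r0" "r * 2 powi j * 2 ^ m = r0 * 2 powi j0" by auto
  show "0 < r" using strip_at_adm[OF V, of m u] assms(3) by (simp add: adm_strip_def)
qed

text \<open>Stated through equal floors rather than as a product of intervals, membership is visibly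
  an equivalence with \<open>p\<close>, which makes \<open>cell_cong\<close> and the nesting formal;
  \<open>cell_eq\<close> recovers the product form.\<close>

definition cell :: "real \<Rightarrow> nat \<Rightarrow> (real ^ 'n) \<times> real \<Rightarrow> ((real ^ 'n) \<times> real) set" where
  "cell V m p = (case strip_at V m (ln (snd p)) of (l, r, j) \<Rightarrow>
     {q. 0 < snd q \<and> (\<forall>i. \<lfloor>fst q $ i / 2 powi j\<rfloor> = \<lfloor>fst p $ i / 2 powi j\<rfloor>) \<and>
        in_strip (l, r, j) (ln (snd q))})"

lemma floor_div_eq_iff: "0 < L \<Longrightarrow> \<lfloor>y / L\<rfloor> = k \<longleftrightarrow> of_int k * L \<le> y \<and> y < (of_int k + 1) * L" for L y :: real
  by (simp add: floor_eq_iff pos_le_divide_eq pos_divide_less_eq)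

lemma cell_eq:
  assumes "strip_at V m (ln (snd p)) = (l, r, j)"
  shows "cell V m p = {x. \<forall>i. of_int \<lfloor>fst p $ i / 2 powi j\<rfloor> * 2 powi j \<le> x $ i \<and>
       x $ i < (of_int \<lfloor>fst p $ i / 2 powi j\<rfloor> + 1) * 2 powi j} \<times> {exp (l + r) * exp (- r)..<exp (l + r) * exp r}"
proof -
  have e: "exp (l + r) * exp (- r) = exp l" "exp (l + r) * exp r = exp (l + 2 * r)"
    by (simp_all flip: exp_add)
  have iff: "(0 < b \<and> l \<le> ln b \<and> ln b < l + 2 * r) \<longleftrightarrow> exp l \<le> b \<and> b < exp (l + 2 * r)" for b
  proof (cases "0 < b")
    case True
    then show ?thesis using ln_ge_iff[OF True] by (simp add: not_le[symmetric])
  next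
    case False
    then show ?thesis using exp_gt_zero[of l] by linarith
  qed
  have "cell V m p = {q. (\<forall>i. \<lfloor>fst q $ i / 2 powi j\<rfloor> = \<lfloor>fst p $ i / 2 powi j\<rfloor>) \<and>
      (0 < snd q \<and> l \<le> ln (snd q) \<and> ln (snd q) < l + 2 * r)}"
    unfolding cell_def assms by (auto simp: in_strip_def)
  then show ?thesis
    unfolding iff e by (auto simp: floor_div_eq_iff)
qed

context
  fixes V :: real
  assumes V: "1 \<le> V"
begin

lemma cell_CZ: "cell V m p \<in> CZ"
proof -
  obtain l r j where s: "strip_at V m (ln (snd p)) = (l, r, j)" by (metis prod_cases3)
  have "0 < r" "cz_adm (exp (l + r)) r (2 powi j)"
    using strip_at_adm[OF V, of m "ln (snd p)"] by (auto simp: s adm_strip_def)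
  then have "cz_with (cell V m p) r"
    unfolding cz_with_def cell_eq[OF s] dyadic_cube_def cz_adm_def
    by (intro exI[of _ "{x. \<forall>i. of_int \<lfloor>fst p $ i / 2 powi j\<rfloor> * 2 powi j \<le> x $ i \<and>
       x $ i < (of_int \<lfloor>fst p $ i / 2 powi j\<rfloor> + 1) * 2 powi j}"] exI[of _ "2 powi j"] exI[of _ "exp (l + r)"]) auto
  then show ?thesis by (auto simp: CZ_def)
qed

lemma cell_subset_axS: "cell V m p \<subseteq> axS"
  by (auto simp: cell_def axS_def split: prod.splits)

lemma cell_self: "p \<in> axS \<Longrightarrow> p \<in> cell V m p"
  using strip_at_in[OF V, of m "ln (snd p)"] by (auto simp: cell_def axS_def split: prod.splits)

lemma cell_cong: "q \<in> cell V m p \<Longrightarrow> cell V m q = cell V m p"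
  using strip_at_cong[OF V, of m "ln (snd p)" "ln (snd q)"] by (auto simp: cell_def split: prod.splits)

lemma emeasure_cell_at:
  fixes p :: "(real ^ 'n) \<times> real"
  assumes "strip_at V m (ln (snd p)) = (l, r, j)"
  shows "emeasure rho (cell V m p) = ennreal (2 * r * (2 powi j) ^ CARD('n))"
  using strip_at_adm[OF V, of m "ln (snd p)"] unfolding cell_eq[OF assms]
  by (subst emeasure_cell) (auto simp: assms adm_strip_def)

text \<open>A vertical halving divides the measure by 2 and a horizontal one by
  \<open>2 ^ CARD('n)\<close>; the latter factor covers both because the dimension is at least
  1.\<close>

lemma cell_ratio:
  fixes p :: "(real ^ 'n) \<times> real"
  shows "emeasure rho (cell V m p) \<le> ennreal (2 ^ CARD('n)) * emeasure rho (cell V (Suc m) p)"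
proof -
  obtain l r j where s: "strip_at V m (ln (snd p)) = (l, r, j)" by (metis prod_cases3)
  obtain l' r' j' where s': "strip_at V (Suc m) (ln (snd p)) = (l', r', j')" by (metis prod_cases3)
  have r: "0 < r" using strip_at_adm[OF V, of m "ln (snd p)"] by (auto simp: s adm_strip_def)
  have n: "(2::real) \<le> 2 ^ CARD('n)" using power_increasing[of 1 "CARD('n)" "2::real"] by (simp add: Suc_leI)
  have h: "2 powi (j - 1) = 2 powi j / (2::real)" by (simp add: power_int_diff)
  have "2 * r * (2 powi j) ^ CARD('n) \<le> 2 ^ CARD('n) * (2 * r' * (2 powi j') ^ CARD('n))"
  proof (cases "j' = j")
    case True
    then have "2 * r' = r" using s s' by (auto simp: split_strip_def split: if_splits)
    then show ?thesis using True r mult_right_mono[OF n, of "r * (2 powi j) ^ CARD('n)"] by (simp only: mult.assoc) simp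
  next
    case False
    then have "r' = r" "j' = j - 1" using s s' by (auto simp: split_strip_def split: if_splits)
    then show ?thesis using r by (simp add: h power_divide)
  qed
  then show ?thesis
    unfolding emeasure_cell_at[OF s] emeasure_cell_at[OF s'] using r
    by (subst ennreal_mult'[symmetric]) (auto intro!: ennreal_leI)
qed

lemma cell_Suc: "cell V (Suc m) p \<subseteq> cell V m p"
proof
  fix q assume q: "q \<in> cell V (Suc m) p"
  obtain l r j where s: "strip_at V m (ln (snd p)) = (l, r, j)" by (metis prod_cases3)
  obtain l' r' j' where s': "strip_at V (Suc m) (ln (snd p)) = (l', r', j')" by (metis prod_cases3)
  have "in_strip (l, r, j) (ln (snd q))"
    using split_strip_mono[OF strip_at_adm[OF V], of "ln (snd p)" m "ln (snd p)" "ln (snd q)"] q s s'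
    by (simp add: cell_def)
  moreover have "\<lfloor>fst q $ i / 2 powi j\<rfloor> = \<lfloor>fst p $ i / 2 powi j\<rfloor>" for i
  proof (cases "j' = j")
    case True then show ?thesis using q s' by (simp add: cell_def)
  next
    case False
    then have j': "j' = j - 1" using s s' by (auto simp: split_strip_def split: if_splits)
    \<comment> \<open>Dyadic nesting: the index of the parent interval is the integer half of the
      index of the child.\<close>
    have f: "\<lfloor>y / 2 powi j\<rfloor> = \<lfloor>y / 2 powi j'\<rfloor> div 2" for y :: real
    proof -
      have "y / 2 powi j = (y / 2 powi j') / real_of_int 2" by (simp add: j' power_int_diff)
      then show ?thesis using floor_divide_real_eq_div[of 2 "y / 2 powi j'"] by (simp only:)
    qed
    show ?thesis unfolding f using q s' by (simp add: cell_def)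
  qed
  ultimately show "q \<in> cell V m p" using q s s' by (simp add: cell_def)
qed

lemma cell_antimono: "m \<le> k \<Longrightarrow> cell V k p \<subseteq> cell V m p"
  by (induction rule: dec_induct) (use cell_Suc in blast)+

lemma cell_init_large:
  fixes p :: "(real ^ 'n) \<times> real"
  shows "ennreal V \<le> emeasure rho (cell V 0 p)"
proof -
  obtain l r j where s: "strip_at V 0 (ln (snd p)) = (l, r, j)" by (metis prod_cases3)
  then have "V \<le> r" "1 \<le> (2::real) powi j" using init_strip_adm(2)[OF V] by auto
  then have "V * 1 \<le> (2 * r) * (2 powi j) ^ CARD('n)"
    using V by (intro mult_mono one_le_power) auto
  then show ?thesis unfolding emeasure_cell_at[OF s] by (simp add: ennreal_leI)
qed

text \<open>The product of half-width and side tends to 0 by \<open>strip_at_bounds\<close>. The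
  lower admissibility bound makes the side at least a fixed multiple of the half-width, so the
  half-width tends to 0; the upper bound then forces the side to 0 as well. If every cell left
  \<open>U\<close>, points \<open>q m\<close> outside \<open>U\<close> would converge to
  \<open>p\<close>.\<close>

lemma cell_small:
  fixes p :: "(real ^ 'n) \<times> real"
  assumes U: "open U" "p \<in> U" and p: "p \<in> axS"
  shows "\<exists>m. cell V m p \<subseteq> U"
proof (rule ccontr)
  assume "\<nexists>m. cell V m p \<subseteq> U"
  then have "\<forall>m. \<exists>q. q \<in> cell V m p \<and> q \<notin> U" by blast
  from choice[OF this] obtain q where q: "\<And>m. q m \<in> cell V m p" "\<And>m. q m \<notin> U" by auto
  define u where "u = ln (snd p)"
  obtain l0 r0 j0 where s0: "strip_at V 0 u = (l0, r0, j0)" by (metis prod_cases3)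
  define lf rf jf where "lf m = fst (strip_at V m u)" and "rf m = fst (snd (strip_at V m u))"
    and "jf m = snd (snd (strip_at V m u))" for m
  have s: "strip_at V m u = (lf m, rf m, jf m)" for m by (simp add: lf_def rf_def jf_def)
  define c where "c = r0 * 2 powi j0"
  note b = strip_at_bounds[OF V s0 s]
  have adm: "cz_adm (exp (lf m + rf m)) (rf m) (2 powi jf m)" for m
    using strip_at_adm[OF V, of m u] by (simp add: s adm_strip_def)
  \<comment> \<open>The heights in the initial strip are at least \<open>exp l0\<close>, so one
    constant serves all generations.\<close>
  have lower: "exp l0 * rf m \<le> 2 powi jf m" for m
  proof (cases "rf m < 1")
    case True
    have "exp l0 * rf m \<le> exp (2 + (lf m + rf m)) * rf m"
      using b[of m] by (intro mult_right_mono) auto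
    also have "\<dots> \<le> 2 powi jf m" using adm[of m] True by (simp add: cz_adm_def exp_add)
    finally show ?thesis .
  next
    case False
    have "rf m \<le> exp (2 * rf m)" using exp_ge_add_one_self[of "2 * rf m"] b(3)[of m] by linarith
    then have "exp l0 * rf m \<le> exp (lf m + rf m) * exp (2 * rf m)"
      using b[of m] by (intro mult_mono) auto
    also have "\<dots> \<le> 2 powi jf m" using adm[of m] False by (simp add: cz_adm_def)
    finally show ?thesis .
  qed
  have sq: "(rf m)\<^sup>2 \<le> c / exp l0 * (1 / 2) ^ m" for m
  proof -
    have "rf m * (exp l0 * rf m) \<le> rf m * 2 powi jf m"
      using b(3)[of m] lower[of m] by (intro mult_left_mono) auto
    also have "\<dots> = c / 2 ^ m"
      using b(4)[of m] unfolding c_def by (subst eq_divide_eq) simp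
    also have "\<dots> = c * (1 / 2) ^ m"
      by (simp only: power_divide power_one) simp
    finally have "exp l0 * (rf m)\<^sup>2 \<le> c * (1 / 2) ^ m"
      by (simp only: power2_eq_square mult_ac)
    then have "(rf m)\<^sup>2 \<le> c * (1 / 2) ^ m / exp l0"
      by (subst pos_le_divide_eq) (simp_all only: mult.commute exp_gt_zero)
    then show ?thesis by (simp only: times_divide_eq_left)
  qed
  have "(\<lambda>m. c / exp l0 * (1 / 2) ^ m) \<longlonglongrightarrow> 0"
    using tendsto_mult[OF tendsto_const LIMSEQ_realpow_zero, of "1 / 2" "c / exp l0"] by simp
  then have "(\<lambda>m. (rf m)\<^sup>2) \<longlonglongrightarrow> 0"
    by (rule tendsto_null_le) (use sq in simp)
  then have "(\<lambda>m. sqrt ((rf m)\<^sup>2)) \<longlonglongrightarrow> sqrt 0" by (rule tendsto_real_sqrt)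
  then have rf: "rf \<longlonglongrightarrow> 0" using b(3) by (simp add: less_imp_le)
  have jf: "(\<lambda>m. 2 powi jf m :: real) \<longlonglongrightarrow> 0"
  proof (rule tendsto_sandwich[OF _ _ tendsto_const])
    have "eventually (\<lambda>m. rf m < 1) sequentially" using rf by (rule order_tendstoD) simp
    then show "eventually (\<lambda>m. 2 powi jf m \<le> exp 8 * exp (l0 + 2 * r0) * rf m) sequentially"
    proof eventually_elim
      case (elim m)
      have "2 powi jf m \<le> exp 8 * exp (lf m + rf m) * rf m" using adm[of m] elim by (simp add: cz_adm_def)
      also have "\<dots> \<le> exp 8 * exp (l0 + 2 * r0) * rf m"
        using b[of m] by (intro mult_right_mono mult_left_mono) auto
      finally show ?case .
    qed
    have "(\<lambda>m. exp 8 * exp (l0 + 2 * r0) * rf m) \<longlonglongrightarrow> exp 8 * exp (l0 + 2 * r0) * 0"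
      by (rule tendsto_mult[OF tendsto_const rf])
    then show "(\<lambda>m. exp 8 * exp (l0 + 2 * r0) * rf m) \<longlonglongrightarrow> 0" by simp
  qed simp
  have "(\<lambda>m. fst (q m)) \<longlonglongrightarrow> fst p"
  proof (rule vec_tendstoI)
    fix i
    have "\<bar>fst (q m) $ i - fst p $ i\<bar> \<le> 2 powi jf m" for m
    proof -
      have e: "\<lfloor>fst (q m) $ i / 2 powi jf m\<rfloor> = \<lfloor>fst p $ i / 2 powi jf m\<rfloor>"
        using q(1)[of m] s[of m] by (simp add: cell_def u_def)
      have "\<bar>fst (q m) $ i / 2 powi jf m - fst p $ i / 2 powi jf m\<bar> < 1"
        using e by linarith
      then show ?thesis by (simp add: diff_divide_distrib[symmetric] field_simps)
    qed
    then have "(\<lambda>m. fst (q m) $ i - fst p $ i) \<longlonglongrightarrow> 0"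
      by (rule tendsto_null_le[OF jf])
    then show "(\<lambda>m. fst (q m) $ i) \<longlonglongrightarrow> fst p $ i" by (simp add: LIM_zero_iff)
  qed
  moreover have "(\<lambda>m. snd (q m)) \<longlonglongrightarrow> snd p"
  proof -
    have "\<bar>ln (snd (q m)) - u\<bar> \<le> 2 * rf m" for m
    proof -
      have "in_strip (strip_at V m u) (ln (snd (q m)))"
        using q(1)[of m] unfolding cell_def u_def by (simp split: prod.splits)
      moreover have "in_strip (strip_at V m u) u" by (rule strip_at_in[OF V])
      ultimately show ?thesis unfolding s in_strip_def prod.case by linarith
    qed
    moreover have "(\<lambda>m. 2 * rf m) \<longlonglongrightarrow> 0" using tendsto_mult[OF tendsto_const[of 2] rf] by simp
    ultimately have "(\<lambda>m. ln (snd (q m)) - u) \<longlonglongrightarrow> 0"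
      by (rule tendsto_null_le[of "\<lambda>m. 2 * rf m", rotated])
    from tendsto_exp[OF LIM_zero_cancel[OF this]]
    have "(\<lambda>m. exp (ln (snd (q m)))) \<longlonglongrightarrow> exp u" .
    moreover have "(\<lambda>m. exp (ln (snd (q m)))) = (\<lambda>m. snd (q m))"
    proof
      fix m
      have "q m \<in> axS" using q(1)[of m] cell_CZ[of m p] cz_subset_axS unfolding CZ_def by blast
      then show "exp (ln (snd (q m))) = snd (q m)" by (simp add: axS_def)
    qed
    moreover have "exp u = snd p" unfolding u_def using p by (simp add: axS_def)
    ultimately show ?thesis by (simp only:)
  qed
  ultimately have "q \<longlonglongrightarrow> p"
    using tendsto_Pair[of "\<lambda>m. fst (q m)" "fst p" sequentially "\<lambda>m. snd (q m)" "snd p"] by simp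
  then have "eventually (\<lambda>m. q m \<in> U) sequentially" using U by (intro topological_tendstoD)
  then show False using q(2) by (auto simp: eventually_sequentially)
qed

text \<open>Each cell has interior points and so contains a member of a countable dense set, which
  determines it by \<open>cell_cong\<close>.\<close>

lemma countable_cells: "countable (cell V m ` axS :: ((real ^ 'n) \<times> real) set set)"
proof -
  obtain D :: "((real ^ 'n) \<times> real) set" where D: "countable D" "\<And>X. open X \<Longrightarrow> X \<noteq> {} \<Longrightarrow> \<exists>d\<in>D. d \<in> X"
    using countable_dense_exists by blast
  have "cell V m p \<in> cell V m ` D" for p :: "(real ^ 'n) \<times> real"
  proof -
    obtain l r j where s: "strip_at V m (ln (snd p)) = (l, r, j)" by (metis prod_cases3)
    have r: "0 < r" using strip_at_adm[OF V, of m "ln (snd p)"] by (auto simp: s adm_strip_def)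
    let ?L = "2 powi j :: real"
    let ?u = "(\<chi> i. of_int \<lfloor>fst p $ i / ?L\<rfloor> * ?L) :: real^'n" and ?v = "(\<chi> i. (of_int \<lfloor>fst p $ i / ?L\<rfloor> + 1) * ?L) :: real^'n"
    define X where "X = box ?u ?v \<times> {exp (l + r) * exp (- r)<..<exp (l + r) * exp r}"
    have "open X" unfolding X_def by (intro open_Times open_box open_greaterThanLessThan)
    moreover have "X \<noteq> {}"
    proof -
      have "box ?u ?v \<noteq> {}" unfolding interval_ne_empty_cart by (simp add: distrib_right)
      moreover have "{exp (l + r) * exp (- r)<..<exp (l + r) * exp r} \<noteq> {}" using r by simp
      ultimately obtain x y where "x \<in> box ?u ?v" "y \<in> {exp (l + r) * exp (- r)<..<exp (l + r) * exp r}"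
        by (meson ex_in_conv)
      then have "(x, y) \<in> X" unfolding X_def by (rule SigmaI)
      then show ?thesis by (metis empty_iff)
    qed
    moreover have "X \<subseteq> cell V m p"
    proof
      fix x assume "x \<in> X"
      then have "fst x \<in> box ?u ?v" "snd x \<in> {exp (l + r) * exp (- r)<..<exp (l + r) * exp r}"
        unfolding X_def by (simp_all only: mem_Times_iff)
      then show "x \<in> cell V m p"
        unfolding cell_eq[OF s] mem_Times_iff mem_box_cart by (simp add: less_imp_le)
    qed
    ultimately obtain d where d: "d \<in> D" "d \<in> cell V m p" using D(2)[of X] by (meson subsetD)
    have "cell V m p = cell V m d" by (rule cell_cong[OF d(2), symmetric])
    then show ?thesis using d(1) by (rule image_eqI)
  qed
  then have "cell V m ` axS \<subseteq> cell V m ` D" by (rule image_subsetI)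
  from countable_subset[OF this countable_image[OF D(1)]] show ?thesis .
qed

text \<open>Each point of the union is given the first generation at which its cell satisfies
  \<open>P\<close>. If two such cells meet, nesting makes the later one a subset of the earlier, and
  minimality makes them equal. The enumeration is padded with empty sets, so that finite and
  infinite families are treated alike.\<close>

lemma stopping_cells:
  fixes P :: "((real ^ 'n) \<times> real) set \<Rightarrow> bool"
  obtains A :: "nat \<Rightarrow> ((real ^ 'n) \<times> real) set" where "disjoint_family A"
    "\<forall>i. A i \<noteq> {} \<longrightarrow> (\<exists>p m. p \<in> axS \<and> A i = cell V m p \<and> P (cell V m p) \<and> (\<forall>k<m. \<not> P (cell V k p)))"
    "(\<Union>i. A i) = {p \<in> axS. \<exists>m. P (cell V m p)}"
proof -
  define S where "S = {p \<in> axS. \<exists>m. P (cell V m p)}"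
  have S_ax: "p \<in> axS" if "p \<in> S" for p
    using that unfolding S_def by (rule CollectE) (erule conjunct1)
  define \<tau> where "\<tau> p = (LEAST m. P (cell V m p))" for p
  have \<tau>: "P (cell V (\<tau> p) p)" "\<And>k. k < \<tau> p \<Longrightarrow> \<not> P (cell V k p)" if "p \<in> S" for p
    using that unfolding S_def \<tau>_def by (auto intro: LeastI dest: not_less_Least)
  define F where "F = (\<lambda>p. cell V (\<tau> p) p) ` S"
  have "F \<subseteq> (\<Union>m. cell V m ` axS)" by (auto simp: F_def S_def)
  then have cF: "countable F"
    by (rule countable_subset) (intro countable_UN countableI_type countable_cells)
  have eq: "cell V (\<tau> p) p = cell V (\<tau> p') p'"
    if "p \<in> S" "p' \<in> S" "\<tau> p \<le> \<tau> p'" "q \<in> cell V (\<tau> p) p" "q \<in> cell V (\<tau> p') p'" for p p' q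
  proof -
    have "q \<in> cell V (\<tau> p) p'" using that cell_antimono by blast
    then have e: "cell V (\<tau> p) p' = cell V (\<tau> p) p" using cell_cong that by metis
    then have "P (cell V (\<tau> p) p')" using \<tau>(1)[OF that(1)] by simp
    then have "\<not> \<tau> p < \<tau> p'" using \<tau>(2)[OF that(2)] by blast
    then show ?thesis using that(3) e by simp
  qed
  have dF: "R = R'" if RF: "R \<in> F" "R' \<in> F" and qR: "q \<in> R" "q \<in> R'" for R R' q
  proof -
    obtain p p' where pp: "p \<in> S" "p' \<in> S" "R = cell V (\<tau> p) p" "R' = cell V (\<tau> p') p'"
      using RF unfolding F_def by blast
    show ?thesis
    proof (cases "\<tau> p \<le> \<tau> p'")
      case True
      then show ?thesis using eq[OF pp(1,2) True] qR unfolding pp by blast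
    next
      case False
      then have "\<tau> p' \<le> \<tau> p" by simp
      then show ?thesis using eq[OF pp(2,1)] qR unfolding pp by blast
    qed
  qed
  define A where "A i = (if i \<in> to_nat_on F ` F then from_nat_into F i else {})" for i
  have AR: "A (to_nat_on F R) = R" if "R \<in> F" for R
    unfolding A_def using that cF by simp
  have inA: "\<exists>R\<in>F. i = to_nat_on F R \<and> A i = R" if ne: "A i \<noteq> {}" for i
  proof -
    have "i \<in> to_nat_on F ` F" using ne unfolding A_def by (rule contrapos_np) (rule if_not_P)
    then obtain R where R: "i = to_nat_on F R" "R \<in> F" by (rule imageE)
    then show ?thesis using AR[OF R(2)] by (intro bexI[of _ R]) simp_all
  qed
  show ?thesis
  proof (rule that)
    show "disjoint_family A"
      unfolding disjoint_family_on_def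
    proof (intro ballI impI)
      fix i k :: nat assume "i \<noteq> k"
      show "A i \<inter> A k = {}"
      proof (rule ccontr)
        assume "A i \<inter> A k \<noteq> {}"
        then obtain q where q: "q \<in> A i" "q \<in> A k" by blast
        obtain R where R: "R \<in> F" "i = to_nat_on F R" "A i = R" using inA[of i] q by blast
        obtain R' where R': "R' \<in> F" "k = to_nat_on F R'" "A k = R'" using inA[of k] q by blast
        have "R = R'" using dF[OF R(1) R'(1)] q R R' by blast
        then show False using R R' \<open>i \<noteq> k\<close> by simp
      qed
    qed
    show "\<forall>i. A i \<noteq> {} \<longrightarrow> (\<exists>p m. p \<in> axS \<and> A i = cell V m p \<and> P (cell V m p) \<and> (\<forall>k<m. \<not> P (cell V k p)))"
    proof (intro allI impI)
      fix i assume ne: "A i \<noteq> {}"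
      obtain p where "p \<in> S" "A i = cell V (\<tau> p) p" using inA[OF ne] unfolding F_def by blast
      then show "\<exists>p m. p \<in> axS \<and> A i = cell V m p \<and> P (cell V m p) \<and> (\<forall>k<m. \<not> P (cell V k p))" using \<tau>[of p] by (intro exI[of _ p] exI[of _ "\<tau> p"]) (auto simp: S_def)
    qed
    have "(\<Union>i. A i) = \<Union>F"
    proof (intro subset_antisym subsetI)
      fix q assume "q \<in> (\<Union>i. A i)"
      then obtain i where i: "q \<in> A i" by (rule UN_E)
      then have "A i \<noteq> {}" by (metis empty_iff)
      from inA[OF this] i show "q \<in> \<Union>F" by (metis UnionI)
    next
      fix q assume "q \<in> \<Union>F"
      then obtain R where "R \<in> F" "q \<in> R" by (rule UnionE)
      then show "q \<in> (\<Union>i. A i)" using AR[of R] by (intro UN_I[of "to_nat_on F R"]) simp_all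
    qed
    also have "\<Union>F = S"
    proof
      show "\<Union>F \<subseteq> S"
      proof
        fix q assume "q \<in> \<Union>F"
        then obtain p where p: "p \<in> S" "q \<in> cell V (\<tau> p) p" unfolding F_def by blast
        have "q \<in> axS" using p(2) cell_subset_axS by (rule subsetD[rotated])
        moreover have "P (cell V (\<tau> p) q)" using \<tau>(1)[OF p(1)] cell_cong[OF p(2)] by simp
        ultimately show "q \<in> S" unfolding S_def by blast
      qed
      show "S \<subseteq> \<Union>F"
      proof
        fix q assume q: "q \<in> S"
        then have "q \<in> cell V (\<tau> q) q" by (rule cell_self[OF S_ax])
        moreover have "cell V (\<tau> q) q \<in> F"
          unfolding F_def by (rule image_eqI[where x = q]) (rule refl, rule q)
        ultimately show "q \<in> \<Union>F" by (rule UnionI[rotated])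
      qed
    qed
    finally show "(\<Union>i. A i) = {p \<in> axS. \<exists>m. P (cell V m p)}" unfolding S_def .
  qed
qed

end

section \<open>The stopping-time decomposition\<close>

lemma nn_integral_UN_disjoint:
  fixes A :: "nat \<Rightarrow> 'a set"
  assumes "h \<in> borel_measurable M" "disjoint_family A" "\<And>i. A i \<in> sets M"
  shows "(\<integral>\<^sup>+x\<in>(\<Union>i. A i). h x \<partial>M) = (\<Sum>i. \<integral>\<^sup>+x\<in>A i. h x \<partial>M)"
proof -
  have "emeasure (density M h) (\<Union>i. A i) = (\<Sum>i. emeasure (density M h) (A i))"
    using assms by (intro suminf_emeasure[symmetric]) auto
  then show ?thesis
    using assms by (simp add: emeasure_density)
qed

text \<open>Replaces the Lebesgue differentiation theorem: an open set \<open>U\<close> slightly larger than \<open>E\<close> is exhausted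
  by cells meeting \<open>E\<close>, over each of which the average of \<open>h\<close> is at most \<open>\<alpha>\<close>.\<close>

lemma cell_average_bound_null:
  fixes h :: "(real ^ 'n) \<times> real \<Rightarrow> ennreal"
  assumes V: "1 \<le> V" and h: "h \<in> borel_measurable rho" and "0 < \<alpha>" "0 < \<epsilon>" "0 < s"
    and E: "E \<in> sets rho" "E \<subseteq> {p. s < snd p}" "emeasure rho E < \<infinity>"
    and le: "\<And>p m. p \<in> E \<Longrightarrow> (\<integral>\<^sup>+x\<in>cell V m p. h x \<partial>rho) \<le> ennreal \<alpha> * emeasure rho (cell V m p)"
    and ge: "\<And>p. p \<in> E \<Longrightarrow> ennreal (\<alpha> + \<epsilon>) \<le> h p"
  shows "emeasure rho E = 0"
proof (rule ccontr)
  define e where "e = measure rho E"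
  have Ee: "emeasure rho E = ennreal e"
    using E(3) unfolding e_def by (intro emeasure_eq_ennreal_measure) (simp add: less_top)
  assume "emeasure rho E \<noteq> 0"
  then have e: "0 < e" unfolding Ee by (metis ennreal_neg not_le)
  \<comment> \<open>Chosen so that \<open>\<alpha> * \<delta>\<close> is half of
    \<open>\<epsilon> * e\<close>: estimating the integral over the cells from both sides leaves
    \<open>\<epsilon> * e \<le> \<alpha> * \<delta>\<close>, a contradiction.\<close>
  define \<delta> where "\<delta> = \<epsilon> * e / (2 * \<alpha>)"
  have \<delta>: "0 < \<delta>" using assms(3,4) e unfolding \<delta>_def by simp
  obtain U where U: "open U" "E \<subseteq> U" "U \<subseteq> axS" "emeasure rho (U - E) < ennreal \<delta>"
    using rho_outer_open[OF E(1,2) \<open>0 < s\<close> \<delta>] .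
  have Um: "U \<in> sets rho" by (rule borel_sets_rho[OF borel_open[OF U(1)] U(3)])
  obtain A :: "nat \<Rightarrow> ((real ^ 'n) \<times> real) set" where A: "disjoint_family A"
    "\<forall>i. A i \<noteq> {} \<longrightarrow> (\<exists>p m. p \<in> axS \<and> A i = cell V m p \<and> (cell V m p \<subseteq> U \<and> cell V m p \<inter> E \<noteq> {}) \<and>
        (\<forall>k<m. \<not> (cell V k p \<subseteq> U \<and> cell V k p \<inter> E \<noteq> {})))"
    "(\<Union>i. A i) = {p \<in> axS. \<exists>m. cell V m p \<subseteq> U \<and> cell V m p \<inter> E \<noteq> {}}"
    using stopping_cells[OF V, of "\<lambda>B. B \<subseteq> U \<and> B \<inter> E \<noteq> {}"] .
  have Ai: "A i \<in> sets rho \<and> A i \<subseteq> U \<and> (\<integral>\<^sup>+x\<in>A i. h x \<partial>rho) \<le> ennreal \<alpha> * emeasure rho (A i)" for i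
  proof (cases "A i = {}")
    case True then show ?thesis by simp
  next
    case False
    then obtain p m where pm: "A i = cell V m p" "cell V m p \<subseteq> U" "cell V m p \<inter> E \<noteq> {}"
      using A(2) by metis
    then obtain q where q: "q \<in> cell V m p" "q \<in> E" by (metis disjoint_iff)
    have e: "A i = cell V m q" using pm(1) cell_cong[OF V q(1)] by simp
    have "A i \<in> sets rho" unfolding e by (rule cz_sets[OF cell_CZ[OF V]])
    moreover have "A i \<subseteq> U" using pm by simp
    moreover have "(\<integral>\<^sup>+x\<in>A i. h x \<partial>rho) \<le> ennreal \<alpha> * emeasure rho (A i)"
      unfolding e by (rule le[OF q(2)])
    ultimately show ?thesis by simp
  qed
  have EA: "E \<subseteq> (\<Union>i. A i)"
  proof
    fix p assume p: "p \<in> E"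
    then have pS: "p \<in> axS" "p \<in> U" using U(2,3) by auto
    obtain m where m: "cell V m p \<subseteq> U" using cell_small[OF V U(1) pS(2,1)] by metis
    have "p \<in> cell V m p" by (rule cell_self[OF V pS(1)])
    then have "cell V m p \<inter> E \<noteq> {}" using p by (metis disjoint_iff)
    then show "p \<in> (\<Union>i. A i)" unfolding A(3) using pS m by auto
  qed
  have AU: "(\<Union>i. A i) \<subseteq> U" using Ai by (intro UN_least) simp
  have "ennreal (\<alpha> + \<epsilon>) * ennreal e = (\<integral>\<^sup>+x. ennreal (\<alpha> + \<epsilon>) * indicator E x \<partial>rho)"
    using E(1) by (simp add: nn_integral_cmult Ee)
  also have "\<dots> \<le> (\<integral>\<^sup>+x\<in>(\<Union>i. A i). h x \<partial>rho)"
  proof (rule nn_integral_mono)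
    fix x
    show "ennreal (\<alpha> + \<epsilon>) * indicator E x \<le> h x * indicator (\<Union>i. A i) x"
      using ge[of x] subsetD[OF EA, of x] by (cases "x \<in> E") (simp_all add: indicator_def)
  qed
  also have "\<dots> = (\<Sum>i. \<integral>\<^sup>+x\<in>A i. h x \<partial>rho)"
    using Ai by (intro nn_integral_UN_disjoint h A(1)) simp
  also have "\<dots> \<le> (\<Sum>i. ennreal \<alpha> * emeasure rho (A i))"
    using Ai by (intro suminf_le) auto
  also have "\<dots> = ennreal \<alpha> * emeasure rho (\<Union>i. A i)"
    using Ai A(1) by (subst ennreal_suminf_cmult) (subst suminf_emeasure, auto)
  also have "\<dots> \<le> ennreal \<alpha> * emeasure rho U"
    using AU Um by (intro mult_left_mono emeasure_mono) auto
  also have "emeasure rho U = emeasure rho E + emeasure rho (U - E)"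
    using U E Um by (subst plus_emeasure) (auto simp: Un_absorb1)
  also have "ennreal \<alpha> * \<dots> \<le> ennreal \<alpha> * (ennreal e + ennreal \<delta>)"
    using U(4) unfolding Ee by (intro mult_left_mono add_left_mono) auto
  also have "\<dots> = ennreal (\<alpha> * (e + \<delta>))"
    using assms(3,4) e \<delta> by (simp add: ennreal_mult' ennreal_plus)
  finally have "(\<alpha> + \<epsilon>) * e \<le> \<alpha> * (e + \<delta>)"
    using assms(3,4) e \<delta> by (simp add: ennreal_mult'[symmetric] del: ennreal_plus)
  then have "\<epsilon> * e \<le> \<alpha> * \<delta>" by (simp add: algebra_simps)
  also have "\<dots> = \<epsilon> * e / 2" using assms(3) unfolding \<delta>_def by simp
  finally have "\<epsilon> * e \<le> 0" by simp
  moreover have "0 < \<epsilon> * e" using assms(4) e by (rule mult_pos_pos)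
  ultimately show False by linarith
qed

text \<open>The pieces are the maximal cells over which the average of \<open>h\<close> exceeds
  \<open>\<alpha>\<close>; the parent of a piece was not selected, which costs the factor
  \<open>2 ^ CARD('n)\<close>. The last conclusion sharpens the usual estimate of the union: values
  of \<open>h\<close> up to \<open>\<alpha> / 2\<close> account for at most half of the integral
  over a piece, so only the part of \<open>h\<close> above \<open>\<alpha> / 2\<close> is
  charged.\<close>

lemma cz_decomposition:
  fixes h :: "(real ^ 'n) \<times> real \<Rightarrow> ennreal"
  assumes h: "h \<in> borel_measurable rho" and fin: "(\<integral>\<^sup>+x. h x \<partial>rho) < \<infinity>" and \<alpha>: "0 < \<alpha>"
  obtains A :: "nat \<Rightarrow> ((real ^ 'n) \<times> real) set" where "disjoint_family A"
    "\<forall>i. A i \<noteq> {} \<longrightarrow> A i \<in> CZ"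
    "\<forall>i. A i \<in> sets rho"
    "\<forall>i. ennreal \<alpha> * emeasure rho (A i) \<le> (\<integral>\<^sup>+x\<in>A i. h x \<partial>rho)"
    "\<forall>i. (\<integral>\<^sup>+x\<in>A i. h x \<partial>rho) \<le> ennreal (2 ^ CARD('n) * \<alpha>) * emeasure rho (A i)"
    "AE x in rho. x \<notin> (\<Union>i. A i) \<longrightarrow> h x \<le> ennreal \<alpha>"
    "ennreal (\<alpha> / 2) * emeasure rho (\<Union>i. A i) \<le> (\<integral>\<^sup>+x. (if ennreal (\<alpha> / 2) < h x then h x else 0) \<partial>rho)"
proof -
  \<comment> \<open>With initial cells of measure at least \<open>V\<close>, no average over an
    initial cell exceeds \<open>\<alpha>\<close>; every selected cell therefore has a
    parent.\<close>
  define V where "V = max 1 (enn2real (\<integral>\<^sup>+x. h x \<partial>rho) / \<alpha>)"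
  have V: "1 \<le> V" by (simp add: V_def)
  define P where "P B \<longleftrightarrow> ennreal \<alpha> * emeasure rho B < (\<integral>\<^sup>+x\<in>B. h x \<partial>rho)" for B
  have int_mono: "(\<integral>\<^sup>+x\<in>B. h x \<partial>rho) \<le> (\<integral>\<^sup>+x\<in>B'. h x \<partial>rho)" if "B \<subseteq> B'" for B B'
    using that by (intro nn_integral_mono) (auto simp: indicator_def)
  have P0: "\<not> P (cell V 0 p)" for p
  proof -
    have "(\<integral>\<^sup>+x\<in>cell V 0 p. h x \<partial>rho) \<le> (\<integral>\<^sup>+x. h x \<partial>rho)"
      by (intro nn_integral_mono) (auto simp: indicator_def)
    also have "\<dots> = ennreal (enn2real (\<integral>\<^sup>+x. h x \<partial>rho))" using fin by simp
    also have "\<dots> \<le> ennreal (\<alpha> * V)"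
    proof (rule ennreal_leI)
      have "enn2real (\<integral>\<^sup>+x. h x \<partial>rho) = \<alpha> * (enn2real (\<integral>\<^sup>+x. h x \<partial>rho) / \<alpha>)" using \<alpha> by simp
      also have "\<dots> \<le> \<alpha> * V" unfolding V_def using \<alpha> by (intro mult_left_mono) auto
      finally show "enn2real (\<integral>\<^sup>+x. h x \<partial>rho) \<le> \<alpha> * V" .
    qed
    also have "\<dots> = ennreal \<alpha> * ennreal V" using \<alpha> V by (simp add: ennreal_mult')
    also have "\<dots> \<le> ennreal \<alpha> * emeasure rho (cell V 0 p)"
      by (intro mult_left_mono cell_init_large[OF V]) simp
    finally show ?thesis unfolding P_def by simp
  qed
  obtain A :: "nat \<Rightarrow> ((real ^ 'n) \<times> real) set" where A: "disjoint_family A"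
    "\<forall>i. A i \<noteq> {} \<longrightarrow> (\<exists>p m. p \<in> axS \<and> A i = cell V m p \<and> P (cell V m p) \<and> (\<forall>k<m. \<not> P (cell V k p)))"
    "(\<Union>i. A i) = {p \<in> axS. \<exists>m. P (cell V m p)}"
    using stopping_cells[OF V, of P] .
  have CZ: "A i \<in> CZ" if ne: "A i \<noteq> {}" for i
    using A(2) ne cell_CZ[OF V] by metis
  have sets: "A i \<in> sets rho" for i
    using CZ[of i] cz_sets by (cases "A i = {}") auto
  have lower: "ennreal \<alpha> * emeasure rho (A i) \<le> (\<integral>\<^sup>+x\<in>A i. h x \<partial>rho)" for i
  proof (cases "A i = {}")
    case False
    then have "P (A i)" using A(2) by metis
    then show ?thesis unfolding P_def by (rule less_imp_le)
  qed simp
  have upper: "(\<integral>\<^sup>+x\<in>A i. h x \<partial>rho) \<le> ennreal (2 ^ CARD('n) * \<alpha>) * emeasure rho (A i)" for i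
  proof (cases "A i = {}")
    case False
    then obtain p m where pm: "A i = cell V m p" "P (cell V m p)" "\<forall>k<m. \<not> P (cell V k p)"
      using A(2) by metis
    have "m \<noteq> 0" using pm(2) P0 by metis
    then obtain k where k: "m = Suc k" by (metis not0_implies_Suc)
    have "(\<integral>\<^sup>+x\<in>A i. h x \<partial>rho) \<le> (\<integral>\<^sup>+x\<in>cell V k p. h x \<partial>rho)"
      unfolding pm(1) k by (rule int_mono[OF cell_Suc[OF V]])
    also have "\<dots> \<le> ennreal \<alpha> * emeasure rho (cell V k p)"
      using pm(3) unfolding P_def k by (metis lessI not_le)
    also have "\<dots> \<le> ennreal \<alpha> * (ennreal (2 ^ CARD('n)) * emeasure rho (cell V (Suc k) p))"
      by (intro mult_left_mono cell_ratio[OF V]) simp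
    also have "\<dots> = ennreal (2 ^ CARD('n) * \<alpha>) * emeasure rho (A i)"
      using \<alpha> unfolding pm(1) k by (simp add: ennreal_mult' mult_ac)
    finally show ?thesis .
  qed simp
  have UA: "(\<Union>i. A i) \<in> sets rho" by (rule sets.countable_UN) (simp add: image_subset_iff sets)
  have ae: "AE x in rho. x \<notin> (\<Union>i. A i) \<longrightarrow> h x \<le> ennreal \<alpha>"
  proof -
    \<comment> \<open>Parts of the exceptional set that have finite measure, stay away from height 0
      and exceed \<open>\<alpha>\<close> by a definite amount, as
      \<open>cell_average_bound_null\<close> requires. The heights start at
      \<open>2 / real (Suc k)\<close> to lie strictly above the threshold
      \<open>1 / real (Suc k)\<close>.\<close>
    define E where "E k = {x \<in> space rho. x \<notin> (\<Union>i. A i) \<and> ennreal (\<alpha> + 1 / real (Suc k)) \<le> h x} \<inter>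
        (cball 0 (real k) \<times> {2 / real (Suc k)..real k})" for k :: nat
    have sub: "cball (0 :: real ^ 'n) (real k) \<times> {2 / real (Suc k)..real k} \<subseteq> axS" for k
    proof
      fix x assume "x \<in> cball (0 :: real ^ 'n) (real k) \<times> {2 / real (Suc k)..real k}"
      then have "2 / real (Suc k) \<le> snd x" by (simp add: mem_Times_iff)
      moreover have "0 < 2 / real (Suc k)" by simp
      ultimately show "x \<in> axS" unfolding axS_def by (simp only: mem_Collect_eq)
    qed
    have Eset: "E k \<in> sets rho" for k
    proof -
      have "cball (0 :: real ^ 'n) (real k) \<times> {2 / real (Suc k)..real k} \<in> sets rho"
        using sub by (intro borel_sets_rho borel_closed closed_Times) auto
      moreover have "{x \<in> space rho. x \<notin> (\<Union>i. A i) \<and> ennreal (\<alpha> + 1 / real (Suc k)) \<le> h x} \<in> sets rho"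
        using h UA by measurable
      ultimately show ?thesis unfolding E_def by (rule sets.Int[rotated])
    qed
    have "emeasure rho (E k) = 0" for k
    proof (rule cell_average_bound_null[OF V h \<alpha>])
      show "0 < 1 / real (Suc k)" "0 < 1 / real (Suc k)" by simp_all
      show "E k \<in> sets rho" by (rule Eset)
      have "1 / real (Suc k) < 2 / real (Suc k)" by (simp add: divide_strict_right_mono)
      then show "E k \<subseteq> {p. 1 / real (Suc k) < snd p}"
        unfolding E_def by auto
      have "emeasure rho (E k) \<le> emeasure rho (cball (0 :: real ^ 'n) (real k) \<times> {2 / real (Suc k)..real k})"
        using sub unfolding E_def by (intro emeasure_mono borel_sets_rho borel_closed closed_Times) auto
      also have "\<dots> < \<infinity>" by (rule emeasure_rho_bounded) auto
      finally show "emeasure rho (E k) < \<infinity>" .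
      fix p assume p: "p \<in> E k"
      then show "ennreal (\<alpha> + 1 / real (Suc k)) \<le> h p" unfolding E_def by simp
      fix m
      have "p \<in> axS" "p \<notin> (\<Union>i. A i)" using p unfolding E_def by simp_all
      then have "\<not> P (cell V m p)" unfolding A(3) by simp
      then show "(\<integral>\<^sup>+x\<in>cell V m p. h x \<partial>rho) \<le> ennreal \<alpha> * emeasure rho (cell V m p)"
        unfolding P_def by simp
    qed
    then have "E k \<in> null_sets rho" for k using Eset by (intro null_setsI)
    then have null: "(\<Union>k. E k) \<in> null_sets rho" by (rule null_sets_UN)
    have memb: "x \<in> (\<Union>k. E k)" if x: "x \<in> axS" "x \<notin> (\<Union>i. A i)" "\<not> h x \<le> ennreal \<alpha>" for x
    proof -
      have pos: "0 < snd x" using x(1) unfolding axS_def by simp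
      obtain \<epsilon> where \<epsilon>: "0 < \<epsilon>" "ennreal (\<alpha> + \<epsilon>) \<le> h x"
      proof (cases "h x")
        case (real r)
        then have "\<alpha> < r" using x(3) ennreal_leI[of r \<alpha>] by (metis not_le)
        then show ?thesis using that[of "r - \<alpha>"] real by simp
      next
        case top
        then show ?thesis using that[of 1] by simp
      qed
      obtain k :: nat where k: "max (max (1 / \<epsilon>) (2 / snd x)) (max (norm (fst x)) (snd x)) \<le> real k"
        using real_arch_simple by blast
      then have k4: "1 / \<epsilon> \<le> real k" "2 / snd x \<le> real k" "norm (fst x) \<le> real k" "snd x \<le> real k" by simp_all
      have "1 / real (Suc k) \<le> \<epsilon>" using k4(1) \<epsilon>(1) by (simp add: field_simps)
      then have "ennreal (\<alpha> + 1 / real (Suc k)) \<le> ennreal (\<alpha> + \<epsilon>)" by (intro ennreal_leI) simp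
      then have 1: "ennreal (\<alpha> + 1 / real (Suc k)) \<le> h x" using \<epsilon>(2) by (rule order_trans)
      have "2 / real (Suc k) \<le> snd x" using k4(2) pos by (simp add: field_simps)
      then have "x \<in> E k" unfolding E_def using 1 x(1,2) k4 by (simp add: mem_Times_iff)
      then show ?thesis by (rule UN_I[rotated]) simp
    qed
    show ?thesis
    proof (rule AE_I'[OF null], rule subsetI)
      fix x assume "x \<in> {x \<in> space rho. \<not> (x \<notin> (\<Union>i. A i) \<longrightarrow> h x \<le> ennreal \<alpha>)}"
      then have "x \<in> axS" "x \<notin> (\<Union>i. A i)" "\<not> h x \<le> ennreal \<alpha>" by simp_all
      then show "x \<in> (\<Union>k. E k)" by (rule memb)
    qed
  qed
  have weak: "ennreal (\<alpha> / 2) * emeasure rho (\<Union>i. A i) \<le> (\<integral>\<^sup>+x. (if ennreal (\<alpha> / 2) < h x then h x else 0) \<partial>rho)"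
  proof -
    define g where "g x = (if ennreal (\<alpha> / 2) < h x then h x else 0)" for x
    have g: "g \<in> borel_measurable rho" unfolding g_def using h by measurable
    \<comment> \<open>Twice the left side is at most the integral of \<open>h\<close> over the
      piece, and the values of \<open>h\<close> up to \<open>\<alpha> / 2\<close> use up one of the
      two copies; cancelling it requires the piece to have finite measure.\<close>
    have one: "ennreal (\<alpha> / 2) * emeasure rho (A i) \<le> (\<integral>\<^sup>+x\<in>A i. g x \<partial>rho)" for i
    proof (cases "A i = {}")
      case False
      have fn: "emeasure rho (A i) \<noteq> top" using cz_emeasure_finite[OF CZ[OF False]] by simp
      have "ennreal (\<alpha> / 2) * emeasure rho (A i) + ennreal (\<alpha> / 2) * emeasure rho (A i) = ennreal \<alpha> * emeasure rho (A i)"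
        using \<alpha> by (simp add: distrib_right[symmetric] ennreal_plus[symmetric] del: ennreal_plus)
      also have "\<dots> \<le> (\<integral>\<^sup>+x\<in>A i. h x \<partial>rho)" by (rule lower)
      also have "\<dots> \<le> (\<integral>\<^sup>+x. g x * indicator (A i) x + ennreal (\<alpha> / 2) * indicator (A i) x \<partial>rho)"
        by (intro nn_integral_mono) (auto simp: g_def indicator_def)
      also have "\<dots> = ennreal (\<alpha> / 2) * emeasure rho (A i) + (\<integral>\<^sup>+x\<in>A i. g x \<partial>rho)"
        using g sets[of i] by (simp add: nn_integral_add nn_integral_cmult add.commute)
      finally show ?thesis
        using fn by (simp add: ennreal_add_left_cancel_le ennreal_mult_eq_top_iff)
    qed simp
    have "ennreal (\<alpha> / 2) * emeasure rho (\<Union>i. A i) = (\<Sum>i. ennreal (\<alpha> / 2) * emeasure rho (A i))"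
      using sets A(1) by (subst ennreal_suminf_cmult) (subst suminf_emeasure, auto)
    also have "\<dots> \<le> (\<Sum>i. \<integral>\<^sup>+x\<in>A i. g x \<partial>rho)" using one by (intro suminf_le) auto
    also have "\<dots> = (\<integral>\<^sup>+x\<in>(\<Union>i. A i). g x \<partial>rho)"
      using nn_integral_UN_disjoint[OF g A(1) sets] by simp
    also have "\<dots> \<le> (\<integral>\<^sup>+x. g x \<partial>rho)" by (intro nn_integral_mono) (auto simp: indicator_def)
    finally show ?thesis unfolding g_def .
  qed
  show ?thesis
    by (rule that[OF A(1) _ _ _ _ ae weak]) (simp_all add: CZ sets lower upper)
qed

section \<open>Truncated integrals and the size condition\<close>

text \<open>The unit of the group, used as base point: compact support in \<open>axS\<close> is
  handled as bounded distance from it.\<close>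

definition axe :: "(real ^ 'n) \<times> real" where
  "axe = (0, 1)"

lemma axe_in: "axe \<in> axS"
  by (simp add: axe_def axS_def)

lemma axd_axe_bound:
  fixes p :: "(real ^ 'n) \<times> real"
  assumes "0 < s" "s \<le> snd p" "snd p \<le> t" "norm (fst p) \<le> M"
  shows "axd p axe \<le> ln ((t\<^sup>2 + 1 + M\<^sup>2) / s)"
proof -
  have p: "p \<in> axS" "0 < snd p" using assms by (auto simp: axS_def)
  have "exp (axd p axe) \<le> 2 * cosh (axd p axe)" by (rule exp_le_cosh)
  also have "\<dots> = ((snd p)\<^sup>2 + 1 + (norm (fst p))\<^sup>2) / snd p"
    unfolding cosh_axd[OF p(1) axe_in] using p(2) by (simp add: axe_def field_simps)
  also have "\<dots> \<le> (t\<^sup>2 + 1 + M\<^sup>2) / s"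
    using assms p(2) by (intro frac_le add_mono power_mono) auto
  finally have e: "exp (axd p axe) \<le> (t\<^sup>2 + 1 + M\<^sup>2) / s" .
  then have "0 < (t\<^sup>2 + 1 + M\<^sup>2) / s" using exp_gt_zero less_le_trans by metis
  with e show ?thesis by (simp add: ln_ge_iff)
qed

text \<open>A bound on the distance from the unit confines the height to
  \<open>[exp (- D), exp D]\<close> and then the horizontal part to a ball. With
  \<open>axd_axe_bound\<close> as a converse, supports can be enlarged by the triangle inequality
  and remain inside compact sets.\<close>

lemma axd_ball_compact:
  "\<exists>C. compact C \<and> C \<subseteq> axS \<and> {p \<in> axS. axd p (axe :: (real ^ 'n) \<times> real) \<le> D} \<subseteq> C"
proof (intro exI conjI)
  define M where "M = sqrt (2 * exp D * cosh D)"
  let ?C = "cball (0 :: real ^ 'n) M \<times> {exp (- D)..exp D}"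
  show "compact ?C" by (intro compact_Times) auto
  show "?C \<subseteq> axS"
  proof
    fix x assume "x \<in> ?C"
    then have "exp (- D) \<le> snd x" by (simp add: mem_Times_iff)
    then have "0 < snd x" by (rule less_le_trans[rotated]) simp
    then show "x \<in> axS" by (simp add: axS_def)
  qed
  show "{p \<in> axS. axd p axe \<le> D} \<subseteq> ?C"
  proof
    fix p :: "(real ^ 'n) \<times> real" assume "p \<in> {p \<in> axS. axd p axe \<le> D}"
    then have p: "p \<in> axS" "axd p axe \<le> D" by simp_all
    have pos: "0 < snd p" using p(1) by (simp add: axS_def)
    have "snd p \<le> exp (axd p axe)" using snd_le_exp_axd[OF p(1) axe_in] by (simp add: axe_def)
    also have "\<dots> \<le> exp D" using p(2) by simp
    finally have u: "snd p \<le> exp D" .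
    have "1 \<le> snd p * exp (axd axe p)" using snd_le_exp_axd[OF axe_in p(1)] by (simp add: axe_def)
    also have "\<dots> \<le> snd p * exp D" using p(2) pos by (simp add: axd_commute)
    finally have "exp (- D) \<le> snd p" by (simp add: exp_minus field_simps)
    moreover have "norm (fst p) \<le> M"
    proof -
      have ch: "cosh (axd p axe) \<le> cosh D"
        using p axd_nonneg[OF p(1) axe_in] by (subst cosh_real_nonneg_le_iff) auto
      have "(norm (fst p))\<^sup>2 \<le> 2 * snd p * (cosh (axd p axe) - 1)"
        using norm_fst_diff_sq[OF p(1) axe_in] by (simp add: axe_def)
      also have "\<dots> \<le> 2 * exp D * cosh D"
        using u ch pos cosh_real_ge_1[of "axd p axe"] by (intro mult_mono) auto
      finally show ?thesis unfolding M_def by (rule real_le_rsqrt)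
    qed
    ultimately show "p \<in> ?C" using u by (simp add: mem_Times_iff)
  qed
qed

section \<open>Bounded functions with compact support\<close>

lemma Linf_c_norm_le:
  assumes "f \<in> Linf_c"
  shows "AE x in rho. cmod (f x) \<le> enn2real (Linf_norm (emod f))"
proof -
  have fin: "esssup rho (emod f) = ennreal (enn2real (Linf_norm (emod f)))"
    using assms by (simp add: Linf_c_def Linf_norm_def)
  have "AE x in rho. emod f x \<le> esssup rho (emod f)" by (rule esssup_AE)
  then show ?thesis
  proof eventually_elim
    case (elim x)
    then have "emod f x \<le> ennreal (enn2real (Linf_norm (emod f)))" by (simp only: fin)
    then show ?case by (subst (asm) ennreal_le_iff) (rule enn2real_nonneg)
  qed
qed

lemma Linf_c_support:
  assumes "f \<in> Linf_c"
  obtains D where "AE x in rho. f x \<noteq> 0 \<longrightarrow> axd x axe \<le> D"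
proof -
  obtain C where C: "compact C" "C \<subseteq> axS" "AE x in rho. x \<notin> C \<longrightarrow> f x = 0"
    using assms unfolding Linf_c_def by blast
  obtain M s t where b: "0 < s" "s \<le> t" "C \<subseteq> cball 0 M \<times> {s..t}"
    using compact_axS_bounds[OF C(1,2)] .
  have "axd x axe \<le> ln ((t\<^sup>2 + 1 + M\<^sup>2) / s)" if x: "x \<in> C" for x
  proof -
    have "x \<in> cball 0 M \<times> {s..t}" using b(3) x by (rule subsetD)
    then show ?thesis using b(1) by (intro axd_axe_bound) (simp_all add: mem_Times_iff)
  qed
  then have "AE x in rho. f x \<noteq> 0 \<longrightarrow> axd x axe \<le> ln ((t\<^sup>2 + 1 + M\<^sup>2) / s)"
    using C(3) by (auto elim!: eventually_mono)
  then show ?thesis by (rule that)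
qed

lemma Linf_cI:
  fixes f :: "(real ^ 'n) \<times> real \<Rightarrow> complex"
  assumes f: "f \<in> borel_measurable rho" and M: "AE x in rho. cmod (f x) \<le> M"
    and D: "AE x in rho. f x \<noteq> 0 \<longrightarrow> axd x axe \<le> D"
  shows "f \<in> Linf_c"
proof -
  obtain C :: "((real ^ 'n) \<times> real) set" where C: "compact C" "C \<subseteq> axS" "{p \<in> axS. axd p axe \<le> D} \<subseteq> C"
    using axd_ball_compact by blast
  have "esssup rho (emod f) \<le> ennreal M"
    using f M by (intro esssup_I) (auto elim!: eventually_mono intro: ennreal_leI)
  then have "Linf_norm (emod f) < \<infinity>"
    unfolding Linf_norm_def by (rule le_less_trans) simp
  moreover have "AE x in rho. x \<notin> C \<longrightarrow> f x = 0"
    using D AE_space by eventually_elim (use C(3) in auto)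
  ultimately show ?thesis using f C(1,2) unfolding Linf_c_def by simp (intro exI[of _ C], simp)
qed

lemma Linf_norm_le:
  assumes "f \<in> borel_measurable rho" "AE x in rho. cmod (f x) \<le> M"
  shows "Linf_norm (emod f) \<le> ennreal M"
  unfolding Linf_norm_def
  using assms by (intro esssup_I) (auto elim!: eventually_mono intro: ennreal_leI)

lemma Linf_c_measurable: "f \<in> Linf_c \<Longrightarrow> f \<in> borel_measurable rho"
  by (simp add: Linf_c_def)

lemma Linf_c_diff:
  assumes "f \<in> Linf_c" "g \<in> Linf_c" shows "(\<lambda>x. f x - g x) \<in> Linf_c"
proof -
  obtain D where D: "AE x in rho. f x \<noteq> 0 \<longrightarrow> axd x axe \<le> D" using assms(1) by (rule Linf_c_support)
  obtain D' where D': "AE x in rho. g x \<noteq> 0 \<longrightarrow> axd x axe \<le> D'" using assms(2) by (rule Linf_c_support)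
  show ?thesis
  proof (rule Linf_cI)
    show "(\<lambda>x. f x - g x) \<in> borel_measurable rho"
      using assms by (intro borel_measurable_diff Linf_c_measurable)
    show "AE x in rho. cmod (f x - g x) \<le> enn2real (Linf_norm (emod f)) + enn2real (Linf_norm (emod g))"
      using Linf_c_norm_le[OF assms(1)] Linf_c_norm_le[OF assms(2)]
      by eventually_elim (metis add_mono norm_triangle_ineq4 order_trans)
    show "AE x in rho. f x - g x \<noteq> 0 \<longrightarrow> axd x axe \<le> max D D'"
      using D D' by eventually_elim auto
  qed
qed

lemma Linf_c_restrict:
  assumes "f \<in> Linf_c" "A \<in> sets rho" shows "(\<lambda>x. if x \<in> A then f x else 0) \<in> Linf_c"
proof -
  obtain D where D: "AE x in rho. f x \<noteq> 0 \<longrightarrow> axd x axe \<le> D" using assms(1) by (rule Linf_c_support)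
  show ?thesis
  proof (rule Linf_cI)
    show "(\<lambda>x. if x \<in> A then f x else 0) \<in> borel_measurable rho"
      using Linf_c_measurable[OF assms(1)] assms(2) by measurable
    show "AE x in rho. cmod (if x \<in> A then f x else 0) \<le> enn2real (Linf_norm (emod f))"
      using Linf_c_norm_le[OF assms(1)] by eventually_elim auto
    show "AE x in rho. (if x \<in> A then f x else 0) \<noteq> 0 \<longrightarrow> axd x axe \<le> D"
      using D by eventually_elim auto
  qed
qed

lemma Linf_c_powr_finite:
  assumes f: "f \<in> Linf_c" and p: "0 < p"
  shows "(\<integral>\<^sup>+x. ennreal (cmod (f x) powr p) \<partial>rho) < \<infinity>"
proof -
  define M where "M = enn2real (Linf_norm (emod f))"
  obtain C where C: "compact C" "C \<subseteq> axS" "AE x in rho. x \<notin> C \<longrightarrow> f x = 0"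
    using f unfolding Linf_c_def by blast
  have Cm: "C \<in> sets rho" using C by (intro borel_sets_rho borel_compact)
  have "(\<integral>\<^sup>+x. ennreal (cmod (f x) powr p) \<partial>rho) \<le> (\<integral>\<^sup>+x. ennreal (M powr p) * indicator C x \<partial>rho)"
  proof (rule nn_integral_mono_AE)
    show "AE x in rho. ennreal (cmod (f x) powr p) \<le> ennreal (M powr p) * indicator C x"
      using Linf_c_norm_le[OF f] C(3)
    proof eventually_elim
      case (elim x)
      then show ?case using p by (cases "x \<in> C") (auto simp: M_def intro!: ennreal_leI powr_mono2)
    qed
  qed
  also have "\<dots> = ennreal (M powr p) * emeasure rho C" using Cm by (simp add: nn_integral_cmult)
  also have "\<dots> < \<infinity>" using emeasure_rho_compact[OF C(1,2)] by (simp add: ennreal_mult_less_top)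
  finally show ?thesis .
qed

lemma cz_star_far:
  assumes "cz_with R r" "x \<in> R" "y \<in> axS - cz_star R"
  shows "r \<le> axd x y"
  using assms mem_cz_star_iff[OF assms(1), of y] by (auto simp: axd_commute[of x y] not_less)

text \<open>Measurability is asked on the whole product, diagonal included, so that every section of
  \<open>K\<close> is measurable and Tonelli's theorem applies; the kernel of the theorem is brought
  into this form by a modification on the diagonal.\<close>

locale cz_kernel =
  fixes K :: "(real ^ 'n) \<times> real \<Rightarrow> (real ^ 'n) \<times> real \<Rightarrow> complex"
  assumes K_measurable: "(\<lambda>z. K (fst z) (snd z)) \<in> borel_measurable (rho \<Otimes>\<^sub>M rho)"
    and nu1_finite: "nu1 K < \<infinity>" and nu2_finite: "nu2 K < \<infinity>"
begin

lemma K_section [measurable]: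
  assumes "x \<in> axS"
  shows "(\<lambda>y. K x y) \<in> borel_measurable rho" "(\<lambda>y. K y x) \<in> borel_measurable rho"
proof -
  have "(\<lambda>y. (x, y)) \<in> measurable rho (rho \<Otimes>\<^sub>M rho)" "(\<lambda>y. (y, x)) \<in> measurable rho (rho \<Otimes>\<^sub>M rho)"
    using assms by (auto intro!: measurable_Pair1' measurable_Pair2')
  from measurable_compose[OF this(1) K_measurable] measurable_compose[OF this(2) K_measurable]
  show "(\<lambda>y. K x y) \<in> borel_measurable rho" "(\<lambda>y. K y x) \<in> borel_measurable rho" by simp_all
qed

section \<open>The size condition on shells and annuli\<close>

definition N1 where "N1 = enn2real (nu1 K)"
definition N2 where "N2 = enn2real (nu2 K)"

lemma N1_nonneg: "0 \<le> N1" and N2_nonneg: "0 \<le> N2"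
  by (simp_all add: N1_def N2_def)

lemma shell_bound:
  assumes "x \<in> axS" "0 < s"
  shows "(\<integral>\<^sup>+y\<in>{y \<in> axS. s < axd x y \<and> axd x y \<le> 2 * s}. ennreal (cmod (K x y)) \<partial>rho) \<le> ennreal N1"
proof -
  have "(\<integral>\<^sup>+y\<in>{y \<in> axS. s < axd x y \<and> axd x y \<le> 2 * s}. ennreal (cmod (K x y)) \<partial>rho) \<le>
    (\<integral>\<^sup>+y\<in>{y \<in> axS. s < axd y x \<and> axd y x \<le> 2 * s}. ennreal (cmod (K y x) + cmod (K x y)) \<partial>rho)"
    by (intro nn_integral_mono) (auto simp: indicator_def axd_commute[of x] intro!: ennreal_leI)
  also have "\<dots> \<le> nu1 K"
    unfolding nu1_def using assms by (intro SUP_upper2[of x] SUP_upper2[of s]) auto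
  also have "\<dots> = ennreal N1" using nu1_finite by (simp add: N1_def)
  finally show ?thesis .
qed

lemma shells_bound:
  assumes x: "x \<in> axS" and s: "0 < s"
  shows "(\<integral>\<^sup>+y\<in>{y \<in> axS. s < axd x y \<and> axd x y \<le> 2 ^ k * s}. ennreal (cmod (K x y)) \<partial>rho) \<le> ennreal (real k * N1)"
proof (induction k)
  case 0
  have "{y \<in> axS. s < axd x y \<and> axd x y \<le> 2 ^ 0 * s} = {}" by auto
  then show ?case by (simp only:) simp
next
  case (Suc k)
  define A where "A = {y \<in> space rho. s < axd x y \<and> axd x y \<le> 2 ^ k * s}"
  define B where "B = {y \<in> space rho. 2 ^ k * s < axd x y \<and> axd x y \<le> 2 * (2 ^ k * s)}"
  have AB: "A \<in> sets rho" "B \<in> sets rho"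
    unfolding A_def B_def using axd_measurable(2)[OF x] by measurable
  have km: "(\<lambda>y. ennreal (cmod (K x y))) \<in> borel_measurable rho" using K_section(1)[OF x] by measurable
  have "(\<integral>\<^sup>+y\<in>{y \<in> axS. s < axd x y \<and> axd x y \<le> 2 ^ Suc k * s}. ennreal (cmod (K x y)) \<partial>rho) \<le>
     (\<integral>\<^sup>+y. ennreal (cmod (K x y)) * indicator A y + ennreal (cmod (K x y)) * indicator B y \<partial>rho)"
    by (intro nn_integral_mono) (auto simp: A_def B_def indicator_def)
  also have "\<dots> = (\<integral>\<^sup>+y\<in>A. ennreal (cmod (K x y)) \<partial>rho) + (\<integral>\<^sup>+y\<in>B. ennreal (cmod (K x y)) \<partial>rho)"
    using AB km by (intro nn_integral_add) auto
  also have "\<dots> \<le> ennreal (real k * N1) + ennreal N1"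
    using Suc.IH shell_bound[OF x, of "2 ^ k * s"] s unfolding A_def B_def
    by (intro add_mono) (auto simp: mult.assoc)
  also have "\<dots> = ennreal (real (Suc k) * N1)"
    using N1_nonneg by (simp add: ennreal_plus[symmetric] algebra_simps del: ennreal_plus)
  finally show ?case .
qed

text \<open>The shells of \<open>nu1\<close> are open at the inner radius, so they are started at
  \<open>s / 2\<close> in order to contain the points at distance exactly \<open>s\<close>; this
  costs one shell more than the ratio \<open>2 ^ k\<close> suggests.\<close>

lemma annulus_bound:
  assumes x: "x \<in> axS" and s: "0 < s" and t: "t \<le> 2 ^ k * s"
    and A: "\<And>y. y \<in> A \<Longrightarrow> y \<in> axS \<and> s \<le> axd x y \<and> axd x y \<le> t"
    and f: "AE y in rho. cmod (f y) \<le> M" and M: "0 \<le> M"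
  shows "(\<integral>\<^sup>+y\<in>A. ennreal (cmod (K x y) * cmod (f y)) \<partial>rho) \<le> ennreal (real (k + 1) * N1 * M)"
proof -
  define B where "B = {y \<in> space rho. s / 2 < axd x y \<and> axd x y \<le> 2 ^ (k + 1) * (s / 2)}"
  have B: "B \<in> sets rho"
    unfolding B_def using axd_measurable(2)[OF x] by measurable
  have AB: "y \<in> B" if "y \<in> A" for y
    using A[OF that] s t unfolding B_def by simp
  have km: "(\<lambda>y. ennreal (cmod (K x y)) * indicator B y) \<in> borel_measurable rho"
    using K_section(1)[OF x] B by measurable
  have "(\<integral>\<^sup>+y\<in>A. ennreal (cmod (K x y) * cmod (f y)) \<partial>rho) \<le> (\<integral>\<^sup>+y. ennreal M * (ennreal (cmod (K x y)) * indicator B y) \<partial>rho)"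
  proof (rule nn_integral_mono_AE)
    show "AE y in rho. ennreal (cmod (K x y) * cmod (f y)) * indicator A y \<le> ennreal M * (ennreal (cmod (K x y)) * indicator B y)"
      using f
    proof eventually_elim
      case (elim y)
      then have "ennreal (cmod (K x y) * cmod (f y)) \<le> ennreal (M * cmod (K x y))"
        by (intro ennreal_leI) (simp add: mult.commute mult_right_mono)
      then show ?case using AB[of y] M by (cases "y \<in> A") (simp_all add: ennreal_mult')
    qed
  qed
  also have "\<dots> = ennreal M * (\<integral>\<^sup>+y\<in>B. ennreal (cmod (K x y)) \<partial>rho)"
    using km by (rule nn_integral_cmult)
  also have "\<dots> \<le> ennreal M * ennreal (real (k + 1) * N1)"
    using shells_bound[OF x, of "s / 2" "k + 1"] s unfolding B_def by (intro mult_left_mono) simp_all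
  also have "\<dots> = ennreal (real (k + 1) * N1 * M)"
    using M by (simp add: ennreal_mult'[symmetric] mult_ac)
  finally show ?thesis .
qed

text \<open>Seen from \<open>x\<close>, the support of \<open>f\<close> lies within a bounded
  distance, so away from the diagonal the integrand lives in an annulus and converges absolutely by
  the size condition.\<close>

lemma integrable_off_diagonal:
  assumes f: "f \<in> Linf_c" and x: "x \<in> axS" and s: "0 < s"
    and B: "B \<in> sets rho" "\<And>y. y \<in> B \<Longrightarrow> s \<le> axd x y"
  shows "set_integrable rho B (\<lambda>y. K x y * f y)"
proof -
  obtain D where D: "AE y in rho. f y \<noteq> 0 \<longrightarrow> axd y axe \<le> D" using f by (rule Linf_c_support)
  define t where "t = axd x axe + D"
  obtain k :: nat where "t / s < 2 ^ k" using real_arch_pow[of 2 "t / s"] by auto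
  then have k: "t \<le> 2 ^ k * s" using s by (simp add: pos_divide_less_eq)
  define A where "A = {y \<in> axS. s \<le> axd x y \<and> axd x y \<le> t}"
  note fM = Linf_c_norm_le[OF f]
  have "(\<integral>\<^sup>+y. ennreal (norm (indicator B y *\<^sub>R (K x y * f y))) \<partial>rho) \<le>
      (\<integral>\<^sup>+y\<in>A. ennreal (cmod (K x y) * cmod (f y)) \<partial>rho)"
  proof (rule nn_integral_mono_AE)
    show "AE y in rho. ennreal (norm (indicator B y *\<^sub>R (K x y * f y))) \<le> ennreal (cmod (K x y) * cmod (f y)) * indicator A y"
      using D AE_space
    proof eventually_elim
      case (elim y)
      then have y: "y \<in> axS" by simp
      show ?case
      proof (cases "y \<in> B \<and> f y \<noteq> 0")
        case True
        then have "axd y axe \<le> D" using elim by simp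
        then have "axd x y \<le> t" unfolding t_def
          using axd_triangle[OF x y axe_in] by (simp add: axd_commute[of axe y])
        then have "y \<in> A" using y B(2)[of y] True unfolding A_def by simp
        then show ?thesis using True by (simp add: norm_mult)
      next
        case False
          then have "norm (indicator B y *\<^sub>R (K x y * f y)) = 0" by (cases "y \<in> B") simp_all
        then show ?thesis by (simp only: ennreal_0 zero_le)
      qed
    qed
  qed
  also have "\<dots> \<le> ennreal (real (k + 1) * N1 * enn2real (Linf_norm (emod f)))"
    by (rule annulus_bound[OF x s k _ fM]) (simp_all add: A_def)
  also have "\<dots> < \<infinity>" by simp
  finally have fin: "(\<integral>\<^sup>+y. ennreal (norm (indicator B y *\<^sub>R (K x y * f y))) \<partial>rho) < \<infinity>" .
  have "(\<lambda>y. indicator B y *\<^sub>R (K x y * f y)) \<in> borel_measurable rho"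
    using K_section(1)[OF x] Linf_c_measurable[OF f] B(1) by measurable
  then show ?thesis unfolding set_integrable_def using fin by (rule integrableI_bounded)
qed

section \<open>Truncations and the maximal operator\<close>

definition TI where "TI f R x = (LINT y:axS - cz_star R|rho. K x y * f y)"

lemma Tstar_eq: "Tstar K f x = (SUP R\<in>{R \<in> CZ. x \<in> R}. ennreal (cmod (TI f R x)))"
  by (simp add: Tstar_def TI_def)

lemma TI_le_Tstar: "R \<in> CZ \<Longrightarrow> x \<in> R \<Longrightarrow> ennreal (cmod (TI f R x)) \<le> Tstar K f x"
  unfolding Tstar_eq by (rule SUP_upper) simp

lemma Tstar_leI: "(\<And>R. R \<in> CZ \<Longrightarrow> x \<in> R \<Longrightarrow> ennreal (cmod (TI f R x)) \<le> c) \<Longrightarrow> Tstar K f x \<le> c"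
  unfolding Tstar_eq by (rule SUP_least) simp

lemma TI_integrable:
  assumes "f \<in> Linf_c" "R \<in> CZ" "x \<in> R"
  shows "set_integrable rho (axS - cz_star R) (\<lambda>y. K x y * f y)"
proof -
  obtain r where r: "cz_with R r" using assms(2) by (auto simp: CZ_def)
  have x: "x \<in> axS" using cz_subset_axS[OF r] assms(3) by (rule subsetD)
  have r0: "0 < r" using r by (rule cz_withE)
  have "axS - cz_star R \<in> sets rho"
    using sets.compl_sets[OF cz_star_sets[OF assms(2)]] by simp
  then show ?thesis
    using cz_star_far[OF r assms(3)] by (rule integrable_off_diagonal[OF assms(1) x r0])
qed

lemma TI_diff:
  assumes "f \<in> Linf_c" "g \<in> Linf_c" "R \<in> CZ" "x \<in> R"
  shows "TI (\<lambda>y. f y - g y) R x = TI f R x - TI g R x"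
  using TI_integrable[OF assms(1,3,4)] TI_integrable[OF assms(2-4)]
  unfolding TI_def by (simp add: right_diff_distrib set_integral_diff)

lemma Tstar_triangle:
  assumes "f \<in> Linf_c" "g \<in> Linf_c"
  shows "Tstar K f x \<le> Tstar K g x + Tstar K (\<lambda>y. f y - g y) x"
proof (rule Tstar_leI)
  fix R assume R: "R \<in> CZ" "x \<in> R"
  have "TI f R x = TI g R x + TI (\<lambda>y. f y - g y) R x"
    using TI_diff[OF assms R] by simp
  then have "cmod (TI f R x) \<le> cmod (TI g R x) + cmod (TI (\<lambda>y. f y - g y) R x)"
    by (simp add: norm_triangle_ineq)
  then have "ennreal (cmod (TI f R x)) \<le> ennreal (cmod (TI g R x)) + ennreal (cmod (TI (\<lambda>y. f y - g y) R x))"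
    by (simp add: ennreal_plus[symmetric] ennreal_leI del: ennreal_plus)
  also have "\<dots> \<le> Tstar K g x + Tstar K (\<lambda>y. f y - g y) x"
    by (intro add_mono TI_le_Tstar R)
  finally show "ennreal (cmod (TI f R x)) \<le> Tstar K g x + Tstar K (\<lambda>y. f y - g y) x" .
qed

lemma Tstar_triangle':
  assumes "f \<in> Linf_c" "g \<in> Linf_c"
  shows "Tstar K g x \<le> Tstar K f x + Tstar K (\<lambda>y. f y - g y) x"
proof (rule Tstar_leI)
  fix R assume R: "R \<in> CZ" "x \<in> R"
  have "TI g R x = TI f R x - TI (\<lambda>y. f y - g y) R x"
    using TI_diff[OF assms R] by simp
  then have "cmod (TI g R x) \<le> cmod (TI f R x) + cmod (TI (\<lambda>y. f y - g y) R x)"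
    by (simp add: norm_triangle_ineq4)
  then have "ennreal (cmod (TI g R x)) \<le> ennreal (cmod (TI f R x)) + ennreal (cmod (TI (\<lambda>y. f y - g y) R x))"
    by (simp add: ennreal_plus[symmetric] ennreal_leI del: ennreal_plus)
  also have "\<dots> \<le> Tstar K f x + Tstar K (\<lambda>y. f y - g y) x"
    by (intro add_mono TI_le_Tstar R)
  finally show "ennreal (cmod (TI g R x)) \<le> Tstar K f x + Tstar K (\<lambda>y. f y - g y) x" .
qed

lemma hormander_bound:
  assumes "R \<in> CZ" "x \<in> R" "x' \<in> R"
  shows "(\<integral>\<^sup>+y\<in>axS - cz_star R. ennreal (cmod (K x y - K x' y)) \<partial>rho) \<le> ennreal N2"
    and "(\<integral>\<^sup>+y\<in>axS - cz_star R. ennreal (cmod (K y x - K y x')) \<partial>rho) \<le> ennreal N2"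
proof -
  have "(\<integral>\<^sup>+y\<in>axS - cz_star R. ennreal (cmod (K y x - K y x') + cmod (K x y - K x' y)) \<partial>rho) \<le> nu2 K"
    unfolding nu2_def using assms by (intro SUP_upper2[of R] SUP_upper2[of x] SUP_upper2[of x']) auto
  also have "\<dots> = ennreal N2" using nu2_finite by (simp add: N2_def)
  finally have *: "(\<integral>\<^sup>+y\<in>axS - cz_star R. ennreal (cmod (K y x - K y x') + cmod (K x y - K x' y)) \<partial>rho) \<le> ennreal N2" .
  show "(\<integral>\<^sup>+y\<in>axS - cz_star R. ennreal (cmod (K x y - K x' y)) \<partial>rho) \<le> ennreal N2"
    by (rule order_trans[OF nn_integral_mono *]) (auto simp: indicator_def intro!: ennreal_leI)
  show "(\<integral>\<^sup>+y\<in>axS - cz_star R. ennreal (cmod (K y x - K y x')) \<partial>rho) \<le> ennreal N2"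
    by (rule order_trans[OF nn_integral_mono *]) (auto simp: indicator_def intro!: ennreal_leI)
qed

text \<open>The truncation at an admissible set containing \<open>x\<close> is compared with the truncation at a set of
  the same radius containing \<open>x'\<close>. Where \<open>f\<close> does not vanish, the two truncation regions differ only
  inside an annulus of bounded ratio.\<close>

lemma Tstar_oscillation:
  "\<exists>C\<ge>0. \<forall>f M R x x'. f \<in> Linf_c \<longrightarrow> 0 \<le> M \<longrightarrow> (AE y in rho. cmod (f y) \<le> M) \<longrightarrow> R \<in> CZ \<longrightarrow>
     (AE y in rho. y \<in> cz_star R \<longrightarrow> f y = 0) \<longrightarrow> x \<in> R \<longrightarrow> x' \<in> R \<longrightarrow>
     Tstar K f x \<le> Tstar K f x' + ennreal (C * M)"
proof -
  obtain diam_const where diam_const: "1 \<le> diam_const"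
    "\<And>(R :: ((real ^ 'n) \<times> real) set) r p q. cz_with R r \<Longrightarrow> p \<in> R \<Longrightarrow> q \<in> R \<Longrightarrow> axd p q \<le> diam_const * r"
    using cz_diam by blast
  \<comment> \<open>The ratio of the outer radius \<open>(1 + 2 * diam_const) * m\<close> to the
    inner radius \<open>m / (1 + diam_const)\<close> of the annulus that will contain
    \<open>W\<close>.\<close>
  obtain k :: nat where "(1 + 2 * diam_const) * (1 + diam_const) < 2 ^ k"
    using real_arch_pow[of 2 "(1 + 2 * diam_const) * (1 + diam_const)"] by auto
  then have k: "(1 + 2 * diam_const) * m \<le> 2 ^ k * (m / (1 + diam_const))" if "0 \<le> m" for m
    using mult_right_mono[OF less_imp_le that, of "(1 + 2 * diam_const) * (1 + diam_const)" "2 ^ k"] diam_const(1)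
    by (simp add: field_simps)
  define C where "C = N2 + real (k + 1) * N1"
  have C: "0 \<le> C" using N1_nonneg N2_nonneg unfolding C_def by simp
  have "Tstar K f x \<le> Tstar K f x' + ennreal (C * M)"
    if f: "f \<in> Linf_c" and M: "0 \<le> M" and fM: "AE y in rho. cmod (f y) \<le> M" and R: "R \<in> CZ"
      and f0: "AE y in rho. y \<in> cz_star R \<longrightarrow> f y = 0" and xx: "x \<in> R" "x' \<in> R" for f M R x x'
  proof (rule Tstar_leI)
    fix R' assume R': "R' \<in> CZ" "x \<in> R'"
    obtain r where r: "cz_with R r" using R by (auto simp: CZ_def)
    obtain r' where r': "cz_with R' r'" using R' by (auto simp: CZ_def)
    have r0: "0 < r" using r by (rule cz_withE)
    have r'0: "0 < r'" using r' by (rule cz_withE)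
    have xS: "x \<in> axS" "x' \<in> axS" using cz_subset_axS[OF r] xx by auto
    obtain R'' where R'': "cz_with R'' r'" "x' \<in> R''" using ex_cz_with[OF xS(2) r'0] by blast
    then have R''CZ: "R'' \<in> CZ" by (auto simp: CZ_def)
    \<comment> \<open>The scale has to be the larger of the two radii: if \<open>r'\<close> is much
      smaller than \<open>r\<close>, the points of \<open>W\<close> are kept away from
      \<open>x'\<close> by \<open>cz_star R\<close>, on which \<open>f\<close> vanishes.\<close>
    define m where "m = max r r'"
    have m: "0 < m" "r \<le> m" "r' \<le> m" using r0 unfolding m_def by auto
    have dxx: "axd x x' \<le> diam_const * r" by (rule diam_const(2)[OF r xx])
    define W where "W = ((axS - cz_star R') - (axS - cz_star R'') \<union> ((axS - cz_star R'') - (axS - cz_star R'))) - cz_star R"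
    have W: "y \<in> axS \<and> m / (1 + diam_const) \<le> axd x' y \<and> axd x' y \<le> (1 + 2 * diam_const) * m" if y: "y \<in> W" for y
    proof -
      have yS: "y \<in> axS" and yR: "y \<in> axS - cz_star R" using y unfolding W_def by auto
      have l1: "r \<le> axd x' y" by (rule cz_star_far[OF r xx(2) yR])
      have near: "axd p y \<le> (1 + diam_const) * r'" if Q: "cz_with Q r'" "p \<in> Q" "y \<in> cz_star Q" for Q p
      proof -
        obtain z where z: "z \<in> Q" "axd y z < r'" using Q(3) mem_cz_star_iff[OF Q(1) yS] by blast
        have S: "z \<in> axS" "p \<in> axS" using cz_subset_axS[OF Q(1)] z(1) Q(2) by auto
        have "axd p y \<le> axd p z + axd z y" by (rule axd_triangle[OF S(2) yS S(1)])
        moreover have "axd p z \<le> diam_const * r'" by (rule diam_const(2)[OF Q(1,2) z(1)])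
        ultimately show ?thesis using z(2) by (simp add: axd_commute[of z y] algebra_simps)
      qed
      have t1: "axd x' y \<le> axd x x' + axd x y" using axd_triangle[OF xS(2) yS xS(1)] by (simp add: axd_commute[of x' x])
      have t2: "axd x y \<le> axd x x' + axd x' y" by (rule axd_triangle[OF xS(1) yS xS(2)])
      have a1: "diam_const * r \<le> diam_const * m" "diam_const * r' \<le> diam_const * m" using m diam_const(1) by (auto intro: mult_left_mono)
      consider "y \<in> cz_star R'" "y \<in> axS - cz_star R''" | "y \<in> cz_star R''" "y \<in> axS - cz_star R'"
        using y unfolding W_def by blast
      then show ?thesis
      proof cases
        case 1
        have "axd x y \<le> (1 + diam_const) * r'" by (rule near[OF r' R'(2) 1(1)])
        then have "axd x' y \<le> diam_const * m + (1 + diam_const) * m" using t1 dxx a1 m(3) by (simp add: algebra_simps)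
        moreover have "r' \<le> axd x' y" by (rule cz_star_far[OF R'' 1(2)])
        then have "m \<le> axd x' y" using l1 unfolding m_def by simp
        moreover have "m / (1 + diam_const) \<le> m" using m(1) diam_const(1) by (simp add: field_simps)
        ultimately show ?thesis using yS by (simp add: algebra_simps)
      next
        case 2
        have "axd x' y \<le> (1 + diam_const) * r'" by (rule near[OF R'' 2(1)])
        also have "\<dots> \<le> (1 + 2 * diam_const) * m" using m diam_const(1) r'0 by (intro mult_mono) auto
        finally have u: "axd x' y \<le> (1 + 2 * diam_const) * m" .
        have "r' \<le> axd x y" by (rule cz_star_far[OF r' R'(2) 2(2)])
        then have "r' \<le> diam_const * r + axd x' y" using t2 dxx by simp
        also have "\<dots> \<le> diam_const * axd x' y + axd x' y" using l1 diam_const(1) by (simp add: mult_left_mono)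
        finally have "r' \<le> (1 + diam_const) * axd x' y" by (simp add: algebra_simps)
        moreover have "r \<le> (1 + diam_const) * axd x' y"
          using l1 r0 diam_const(1) mult_mono[of 1 "1 + diam_const" r "axd x' y"] by simp
        ultimately have "m \<le> (1 + diam_const) * axd x' y" unfolding m_def by simp
        then have "m / (1 + diam_const) \<le> axd x' y" using diam_const(1) by (simp add: pos_divide_le_eq mult.commute)
        then show ?thesis using yS u by simp
      qed
    qed
    let ?F = "\<lambda>y. indicator (axS - cz_star R') y *\<^sub>R (K x y * f y)"
    let ?G = "\<lambda>y. indicator (axS - cz_star R'') y *\<^sub>R (K x' y * f y)"
    have int: "integrable rho ?F" "integrable rho ?G"
      using TI_integrable[OF f R'] TI_integrable[OF f R''CZ R''(2)] unfolding set_integrable_def by auto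
    have wm: "(\<lambda>y. ennreal (cmod (K x y - K x' y)) * indicator (axS - cz_star R) y) \<in> borel_measurable rho"
      "(\<lambda>y. ennreal (cmod (K x' y) * cmod (f y)) * indicator W y) \<in> borel_measurable rho"
    proof -
      have "axS - cz_star R \<in> sets rho" "axS - cz_star R' \<in> sets rho" "axS - cz_star R'' \<in> sets rho" "cz_star R \<in> sets rho"
        using sets.compl_sets[OF cz_star_sets[OF R]] sets.compl_sets[OF cz_star_sets[OF R'(1)]]
          sets.compl_sets[OF cz_star_sets[OF R''CZ]] cz_star_sets[OF R] by simp_all
      then show "(\<lambda>y. ennreal (cmod (K x y - K x' y)) * indicator (axS - cz_star R) y) \<in> borel_measurable rho"
        "(\<lambda>y. ennreal (cmod (K x' y) * cmod (f y)) * indicator W y) \<in> borel_measurable rho"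
        using K_section(1)[OF xS(1)] K_section(1)[OF xS(2)] Linf_c_measurable[OF f] unfolding W_def by measurable
    qed
    have "ennreal (cmod (TI f R' x - TI f R'' x')) = ennreal (norm (\<integral>y. ?F y - ?G y \<partial>rho))"
      unfolding TI_def set_lebesgue_integral_def using int by simp
    also have "\<dots> \<le> (\<integral>\<^sup>+y. ennreal (norm (?F y - ?G y)) \<partial>rho)"
      using int by (intro integral_norm_bound_ennreal) auto
    also have "\<dots> \<le> (\<integral>\<^sup>+y. ennreal M * (ennreal (cmod (K x y - K x' y)) * indicator (axS - cz_star R) y) +
        ennreal (cmod (K x' y) * cmod (f y)) * indicator W y \<partial>rho)"
    proof (rule nn_integral_mono_AE)
      show "AE y in rho. ennreal (norm (?F y - ?G y)) \<le> ennreal M * (ennreal (cmod (K x y - K x' y)) * indicator (axS - cz_star R) y) +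
        ennreal (cmod (K x' y) * cmod (f y)) * indicator W y"
        using fM f0 AE_space
      proof eventually_elim
        case (elim y)
        then have yS: "y \<in> axS" by simp
        show ?case
        proof (cases "y \<in> cz_star R")
          case True
          then have "f y = 0" using elim by simp
          then show ?thesis by simp
        next
          case False
          have "K x y * f y - K x' y * f y = (K x y - K x' y) * f y" by (simp add: left_diff_distrib)
          then have "cmod (K x y * f y - K x' y * f y) = cmod (f y) * cmod (K x y - K x' y)"
            by (simp only: norm_mult mult.commute)
          also have "\<dots> \<le> M * cmod (K x y - K x' y)"
            using elim(1) by (intro mult_right_mono) simp_all
          finally have 1: "cmod (K x y * f y - K x' y * f y) \<le> M * cmod (K x y - K x' y)" .
          \<comment> \<open>Where only the truncation at \<open>x\<close> contributes,
            \<open>K x y\<close> is replaced by \<open>K x' y\<close> at the cost of the regularity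
            term, so that the annulus estimate is needed around \<open>x'\<close> only.\<close>
          have 2: "cmod (K x y * f y) \<le> M * cmod (K x y - K x' y) + cmod (K x' y) * cmod (f y)"
            using 1 norm_triangle_ineq2[of "K x y * f y" "K x' y * f y"] by (simp add: norm_mult)
          have "norm (?F y - ?G y) \<le> M * cmod (K x y - K x' y) + cmod (K x' y) * cmod (f y) * indicator W y"
          proof (cases "y \<in> cz_star R'")
            case T1: True
            show ?thesis
            proof (cases "y \<in> cz_star R''")
              case True
              then show ?thesis using T1 M by (simp add: indicator_def)
            next
              case F2: False
              then have "y \<in> W" using T1 yS False unfolding W_def by simp
              then show ?thesis using T1 F2 yS M by (simp add: indicator_def norm_mult)
            qed
          next
            case F1: False
            show ?thesis
            proof (cases "y \<in> cz_star R''")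
              case T2: True
              then have "y \<in> W" using F1 yS False unfolding W_def by simp
              then show ?thesis using F1 T2 yS 2 by (simp add: indicator_def)
            next
              case F2: False
              then show ?thesis using F1 yS 1 by (simp add: indicator_def add_increasing2)
            qed
          qed
          then have "ennreal (norm (?F y - ?G y)) \<le> ennreal (M * cmod (K x y - K x' y) + cmod (K x' y) * cmod (f y) * indicator W y)"
            by (rule ennreal_leI)
          also have "\<dots> = ennreal M * ennreal (cmod (K x y - K x' y)) + ennreal (cmod (K x' y) * cmod (f y)) * indicator W y"
            using M by (simp add: ennreal_mult'[symmetric] ennreal_indicator[symmetric])
          finally show ?thesis using False yS by simp
        qed
      qed
    qed
    also have "\<dots> = ennreal M * (\<integral>\<^sup>+y\<in>axS - cz_star R. ennreal (cmod (K x y - K x' y)) \<partial>rho) +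
        (\<integral>\<^sup>+y\<in>W. ennreal (cmod (K x' y) * cmod (f y)) \<partial>rho)"
      using wm by (subst nn_integral_add) (auto simp: nn_integral_cmult)
    also have "\<dots> \<le> ennreal M * ennreal N2 + ennreal (real (k + 1) * N1 * M)"
    proof (intro add_mono mult_left_mono)
      show "(\<integral>\<^sup>+y\<in>axS - cz_star R. ennreal (cmod (K x y - K x' y)) \<partial>rho) \<le> ennreal N2"
        by (rule hormander_bound(1)[OF R xx])
      have mp: "0 < m / (1 + diam_const)" using m(1) diam_const(1) by simp
      have mk: "(1 + 2 * diam_const) * m \<le> 2 ^ k * (m / (1 + diam_const))" using m(1) by (intro k) simp
      show "(\<integral>\<^sup>+y\<in>W. ennreal (cmod (K x' y) * cmod (f y)) \<partial>rho) \<le> ennreal (real (k + 1) * N1 * M)"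
        by (rule annulus_bound[OF xS(2) mp mk W fM M])
    qed simp
    also have "\<dots> = ennreal (C * M)"
      using M N1_nonneg N2_nonneg unfolding C_def
      by (simp add: ennreal_mult'[symmetric] ennreal_plus[symmetric] algebra_simps del: ennreal_plus)
    finally have d: "cmod (TI f R' x - TI f R'' x') \<le> C * M"
      using C M by (simp add: ennreal_le_iff)
    have "cmod (TI f R' x) \<le> cmod (TI f R'' x') + C * M"
      using d norm_triangle_ineq2[of "TI f R' x" "TI f R'' x'"] by linarith
    then have "ennreal (cmod (TI f R' x)) \<le> ennreal (cmod (TI f R'' x')) + ennreal (C * M)"
      using C M by (simp add: ennreal_plus[symmetric] ennreal_leI del: ennreal_plus)
    also have "\<dots> \<le> Tstar K f x' + ennreal (C * M)"
      by (intro add_right_mono TI_le_Tstar R''CZ R''(2))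
    finally show "ennreal (cmod (TI f R' x)) \<le> Tstar K f x' + ennreal (C * M)" .
  qed
  then show ?thesis using C by (intro exI[of _ C]) simp
qed

end

section \<open>Measurability of the maximal operator\<close>

lemma axd_vertical:
  fixes x :: "real ^ 'n"
  assumes "0 < a" "a \<le> b"
  shows "axd (x, a) (x, b) = ln (b / a)"
proof -
  have S: "(x, a) \<in> axS" "(x, b) \<in> axS" using assms by (auto simp: axS_def)
  have "cosh (axd (x, a) (x, b)) = cosh (ln (b / a))"
    unfolding cosh_axd[OF S] using assms by (simp add: cosh_ln_real field_simps power2_eq_square)
  moreover have "0 \<le> ln (b / a)" using assms by simp
  ultimately show ?thesis
    using axd_nonneg[OF S] by (metis arcosh_cosh_real)
qed

text \<open>The two ends replace centre and radius as parameters: boxes with rational ends form a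
  countable family, and each end can be moved independently of the other.\<close>

definition log_box :: "int \<Rightarrow> ('n::finite \<Rightarrow> int) \<Rightarrow> real \<Rightarrow> real \<Rightarrow> ((real ^ 'n) \<times> real) set" where
  "log_box j k \<sigma> \<tau> = {x::real^'n. \<forall>i. of_int (k i) * 2 powi j \<le> x $ i \<and> x $ i < (of_int (k i) + 1) * 2 powi j} \<times>
     {exp \<sigma>..<exp \<tau>}"

definition adm_log_box :: "int \<Rightarrow> real \<Rightarrow> real \<Rightarrow> bool" where
  "adm_log_box j \<sigma> \<tau> \<longleftrightarrow> \<sigma> < \<tau> \<and> cz_adm (exp ((\<sigma> + \<tau>) / 2)) ((\<tau> - \<sigma>) / 2) (2 powi j)"

lemma cz_with_log_box:
  fixes k :: "'n::finite \<Rightarrow> int"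
  assumes "adm_log_box j \<sigma> \<tau>" shows "cz_with (log_box j k \<sigma> \<tau>) ((\<tau> - \<sigma>) / 2)"
proof -
  define a r where "a = exp ((\<sigma> + \<tau>) / 2)" and "r = (\<tau> - \<sigma>) / 2"
  have "a * exp (- r) = exp \<sigma>" "a * exp r = exp \<tau>"
    unfolding a_def r_def by (simp_all add: field_simps flip: exp_add)
  then have "log_box j k \<sigma> \<tau> = {x::real^'n. \<forall>i. of_int (k i) * 2 powi j \<le> x $ i \<and> x $ i < (of_int (k i) + 1) * 2 powi j} \<times>
     {a * exp (- r)..<a * exp r}"
    by (simp add: log_box_def)
  moreover have "0 < r" "0 < a" "cz_adm a r (2 powi j)" using assms by (auto simp: adm_log_box_def a_def r_def)
  ultimately show ?thesis
    unfolding cz_with_def dyadic_cube_def r_def[symmetric] cz_adm_def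
    by (intro exI[of _ "{x::real^'n. \<forall>i. of_int (k i) * 2 powi j \<le> x $ i \<and> x $ i < (of_int (k i) + 1) * 2 powi j}"]
      exI[of _ "2 powi j"] exI[of _ a]) auto
qed

lemma cz_with_log_boxE:
  fixes R :: "((real ^ 'n) \<times> real) set"
  assumes "cz_with R r"
  obtains j k \<sigma> \<tau> where "R = log_box j k \<sigma> \<tau>" "adm_log_box j \<sigma> \<tau>" "r = (\<tau> - \<sigma>) / 2"
proof -
  obtain j :: int and k :: "'n \<Rightarrow> int" and L a where *: "L = 2 powi j" "0 < L" "0 < a" "0 < r"
    and c: "r < 1 \<Longrightarrow> exp 2 * a * r \<le> L" "r < 1 \<Longrightarrow> L < exp 8 * a * r"
      "1 \<le> r \<Longrightarrow> a * exp (2 * r) \<le> L" "1 \<le> r \<Longrightarrow> L < a * exp (8 * r)"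
    and R: "R = {x::real^'n. \<forall>i. of_int (k i) * L \<le> x $ i \<and> x $ i < (of_int (k i) + 1) * L} \<times>
      {a * exp (- r)..<a * exp r}"
    using assms by (rule cz_withE) blast
  have e: "exp (ln a - r) = a * exp (- r)" "exp (ln a + r) = a * exp r"
    using *(3) by (simp_all add: exp_diff exp_add exp_minus divide_inverse)
  have "R = log_box j k (ln a - r) (ln a + r)"
    unfolding R log_box_def e *(1) ..
  moreover have "adm_log_box j (ln a - r) (ln a + r)"
  proof -
    have "cz_adm a r L" using c by (auto simp: cz_adm_def)
    then show ?thesis using * by (simp add: adm_log_box_def)
  qed
  ultimately show ?thesis by (rule that) simp
qed

text \<open>The lower bounds for the side increase with centre and radius, so they survive when
  neither grows; the upper bounds are strict and survive small changes. The strict decrease of the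
  radius matters at \<open>r = 1\<close>, where the perturbed boxes fall into the other branch of
  the definition, the formulas of both branches agreeing at that radius.\<close>

lemma adm_log_box_perturb:
  assumes adm: "adm_log_box j \<sigma> \<tau>" and lim: "s \<longlonglongrightarrow> \<sigma>" "t \<longlonglongrightarrow> \<tau>"
    and le: "\<And>m. s m + t m \<le> \<sigma> + \<tau>" "\<And>m::nat. t m - s m < \<tau> - \<sigma>"
  shows "eventually (\<lambda>m. adm_log_box j (s m) (t m)) sequentially"
proof -
  define a r am rm where "a = exp ((\<sigma> + \<tau>) / 2)" and "r = (\<tau> - \<sigma>) / 2"
    and "am m = exp ((s m + t m) / 2)" and "rm m = (t m - s m) / 2" for m
  define L :: real where "L = 2 powi j"
  have r: "0 < r" and ad: "cz_adm a r L" using adm by (auto simp: adm_log_box_def a_def r_def L_def)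
  have la: "am \<longlonglongrightarrow> a" unfolding am_def a_def
    by (rule tendsto_exp, rule tendsto_divide[OF tendsto_add[OF lim] tendsto_const]) simp
  have lr: "rm \<longlonglongrightarrow> r" unfolding rm_def r_def
    by (rule tendsto_divide[OF tendsto_diff[OF lim(2,1)] tendsto_const]) simp
  have am: "am m \<le> a" "0 < am m" for m using le(1)[of m] by (auto simp: am_def a_def)
  have rm: "rm m < r" for m using le(2)[of m] by (simp add: rm_def r_def)
  have ev0: "eventually (\<lambda>m. 0 < rm m) sequentially" using order_tendstoD(1)[OF lr r] .
  have lo1: "exp 2 * am m * rm m \<le> exp 2 * a * r" if "0 < rm m" for m
    using am[of m] rm[of m] that by (intro mult_mono) auto
  have lim1: "(\<lambda>m. exp 8 * am m * rm m) \<longlonglongrightarrow> exp 8 * a * r"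
    by (rule tendsto_mult[OF tendsto_mult[OF tendsto_const la] lr])
  have lim2: "(\<lambda>m. am m * exp (8 * rm m)) \<longlonglongrightarrow> a * exp (8 * r)"
    by (rule tendsto_mult[OF la tendsto_exp[OF tendsto_mult[OF tendsto_const lr]]])
  have "eventually (\<lambda>m. 0 < rm m \<and> cz_adm (am m) (rm m) L) sequentially"
  proof (cases "1 < r")
    case True
    then have ad': "a * exp (2 * r) \<le> L" "L < a * exp (8 * r)" using ad by (auto simp: cz_adm_def)
    have "eventually (\<lambda>m. 1 < rm m) sequentially" using order_tendstoD(1)[OF lr True] .
    moreover have "eventually (\<lambda>m. L < am m * exp (8 * rm m)) sequentially" using order_tendstoD(1)[OF lim2 ad'(2)] .
    ultimately show ?thesis
    proof eventually_elim
      case (elim m)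
      have "am m * exp (2 * rm m) \<le> a * exp (2 * r)" using am[of m] rm[of m] by (intro mult_mono) auto
      then show ?case using elim ad'(1) by (simp add: cz_adm_def)
    qed
  next
    case False
    have ad': "exp 2 * a * r \<le> L" "L < exp 8 * a * r"
      using ad False by (cases "r = 1"; simp add: cz_adm_def mult.commute)+
    have "eventually (\<lambda>m. L < exp 8 * am m * rm m) sequentially" using order_tendstoD(1)[OF lim1 ad'(2)] .
    with ev0 show ?thesis
    proof eventually_elim
      case (elim m)
      have "rm m < 1" using rm[of m] False by simp
      moreover have "exp 2 * am m * rm m \<le> L" using order_trans[OF lo1 ad'(1)] elim by blast
      ultimately show ?case using elim by (simp add: cz_adm_def)
    qed
  qed
  then show ?thesis
    by (rule eventually_mono) (simp add: adm_log_box_def am_def rm_def L_def)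
qed

context cz_kernel
begin

text \<open>Slightly smaller admissible boxes with rational logarithmic endpoints have stars contained in the
  star of \<open>R\<close> and converging to it, so a countable supremum suffices.\<close>

lemma TI_rational_approx:
  assumes f: "f \<in> Linf_c" and R: "R \<in> CZ" and x: "x \<in> R" and e: "0 < \<epsilon>"
  shows "\<exists>j k (q::rat) (q'::rat). adm_log_box j (of_rat q) (of_rat q') \<and> x \<in> log_box j k (of_rat q) (of_rat q') \<and>
     cmod (TI f R x) \<le> cmod (TI f (log_box j k (of_rat q) (of_rat q')) x) + \<epsilon>"
proof -
  obtain r where r: "cz_with R r" using R by (auto simp: CZ_def)
  obtain j k \<sigma> \<tau> where Rc: "R = log_box j k \<sigma> \<tau>" and adm: "adm_log_box j \<sigma> \<tau>" and r\<sigma>: "r = (\<tau> - \<sigma>) / 2"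
    using r by (rule cz_with_log_boxE)
  have r0: "0 < r" using r by (rule cz_withE)
  have xS: "x \<in> axS" using cz_subset_axS[OF r] x by (rule subsetD)
  define \<delta> where "\<delta> m = inverse (real (Suc m))" for m
  have \<delta>: "0 < \<delta> m" for m by (simp add: \<delta>_def)
  have l\<delta>: "\<delta> \<longlonglongrightarrow> 0" unfolding \<delta>_def by (rule LIMSEQ_inverse_real_of_nat)
  \<comment> \<open>The lower end moves out by less than \<open>\<delta> m\<close>, so that the
    closed lower end of \<open>R\<close> is not lost. The upper end moves in by more than three
    times as much; the radius thus shrinks by more than \<open>\<delta> m\<close>, which pays for
    the part of the new box that sticks out below \<open>R\<close>.\<close>
  have "\<forall>m. \<exists>q::rat. \<sigma> - \<delta> m < of_rat q \<and> of_rat q < \<sigma>" using of_rat_dense \<delta> by simp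
  from choice[OF this] obtain q :: "nat \<Rightarrow> rat" where q: "\<sigma> - \<delta> m < of_rat (q m)" "of_rat (q m) < \<sigma>" for m by blast
  have "\<forall>m. \<exists>q::rat. \<tau> - 6 * \<delta> m < of_rat q \<and> of_rat q < \<tau> - 3 * \<delta> m" using of_rat_dense \<delta> by simp
  from choice[OF this] obtain q' :: "nat \<Rightarrow> rat" where q': "\<tau> - 6 * \<delta> m < of_rat (q' m)" "of_rat (q' m) < \<tau> - 3 * \<delta> m" for m by blast
  define s t where "s m = real_of_rat (q m)" and "t m = real_of_rat (q' m)" for m
  have ls: "s \<longlonglongrightarrow> \<sigma>"
  proof -
    have "(\<lambda>m. s m - \<sigma>) \<longlonglongrightarrow> 0"
    proof (rule tendsto_null_le[OF l\<delta>])
      fix m show "\<bar>s m - \<sigma>\<bar> \<le> \<delta> m" using q[of m] by (simp add: s_def)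
    qed
    then show ?thesis by (rule LIM_zero_cancel)
  qed
  have lt: "t \<longlonglongrightarrow> \<tau>"
  proof -
    have "(\<lambda>m. 6 * \<delta> m) \<longlonglongrightarrow> 0" using tendsto_mult[OF tendsto_const[of 6] l\<delta>] by simp
    then have "(\<lambda>m. t m - \<tau>) \<longlonglongrightarrow> 0"
    proof (rule tendsto_null_le)
      fix m show "\<bar>t m - \<tau>\<bar> \<le> 6 * \<delta> m" using q'[of m] \<delta>[of m] by (simp add: t_def)
    qed
    then show ?thesis by (rule LIM_zero_cancel)
  qed
  define rm where "rm m = (t m - s m) / 2" for m
  have sl: "s m < \<sigma>" "\<sigma> - s m < \<delta> m" "t m < \<tau> - 3 * \<delta> m" for m using q[of m] q'[of m] by (simp_all add: s_def t_def)
  have rr: "rm m + (\<sigma> - s m) \<le> r" for m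
    using sl[of m] unfolding rm_def r\<sigma> by (simp add: field_simps)
  have lr: "rm \<longlonglongrightarrow> r" unfolding rm_def r\<sigma>
    by (rule tendsto_divide[OF tendsto_diff[OF lt ls] tendsto_const]) simp
  define Rm where "Rm m = log_box j k (s m) (t m)" for m
  have ev1: "eventually (\<lambda>m. adm_log_box j (s m) (t m)) sequentially"
  proof (rule adm_log_box_perturb[OF adm ls lt])
    fix m show "s m + t m \<le> \<sigma> + \<tau>" using sl[of m] \<delta>[of m] by simp
    show "t m - s m < \<tau> - \<sigma>" using sl[of m] \<delta>[of m] by simp
  qed
  have top: "eventually (\<lambda>m. b < exp (t m)) sequentially" if "b < exp \<tau>" for b
    using order_tendstoD(1)[OF tendsto_exp[OF lt] that] .
  have bot: "exp (s m) \<le> b" if "exp \<sigma> \<le> b" for b m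
  proof -
    have "exp (s m) \<le> exp \<sigma>" using sl(1)[of m] by simp
    then show ?thesis using that by linarith
  qed
  have inRm: "eventually (\<lambda>m. z \<in> Rm m) sequentially" if z: "z \<in> R" for z
  proof -
    have zz: "exp \<sigma> \<le> snd z" "snd z < exp \<tau>" using z unfolding Rc log_box_def by auto
    show ?thesis
      using top[OF zz(2)]
    proof eventually_elim
      case (elim m)
      then show ?case using z bot[OF zz(1), of m] unfolding Rc Rm_def log_box_def by (simp add: mem_Times_iff)
    qed
  qed
  have ev3: "eventually (\<lambda>m. r / 2 < rm m) sequentially"
    by (rule order_tendstoD(1)[OF lr]) (use r0 in simp)
  have "eventually (\<lambda>m. adm_log_box j (s m) (t m) \<and> x \<in> Rm m \<and> r / 2 < rm m) sequentially"
    using ev1 inRm[OF x] ev3 by eventually_elim simp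
  then obtain N where N: "\<And>m. N \<le> m \<Longrightarrow> adm_log_box j (s m) (t m) \<and> x \<in> Rm m \<and> r / 2 < rm m"
    unfolding eventually_sequentially by blast
  have cz: "cz_with (Rm m) (rm m)" if "N \<le> m" for m
    using cz_with_log_box[of j "s m" "t m" k] N[OF that] unfolding Rm_def rm_def by simp
  have sub: "cz_star (Rm m) \<subseteq> cz_star R" if m: "N \<le> m" for m
  proof
    fix y assume y: "y \<in> cz_star (Rm m)"
    then have yS: "y \<in> axS" using cz_star_subset_axS by blast
    obtain z where z: "z \<in> Rm m" "axd y z < rm m" using y mem_cz_star_iff[OF cz[OF m] yS] by blast
    have zz: "exp (s m) \<le> snd z" "snd z < exp (t m)" using z(1) unfolding Rm_def log_box_def by auto
    have tm: "exp (t m) \<le> exp \<tau>" using sl(3)[of m] \<delta>[of m] by simp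
    have "\<exists>z'\<in>R. axd y z' < r"
    proof (cases "exp \<sigma> \<le> snd z")
      case True
      moreover have "snd z < exp \<tau>" using zz(2) tm by linarith
      ultimately have "z \<in> R" using z(1) unfolding Rm_def Rc log_box_def by (simp add: mem_Times_iff)
      moreover have "axd y z < r" using z(2) rr[of m] sl(1)[of m] by simp
      ultimately show ?thesis by blast
    next
      case False
      \<comment> \<open>The vertical projection onto the lower face of \<open>R\<close>, at distance
        at most \<open>\<sigma> - s m\<close> from \<open>z\<close>; \<open>rr\<close> allows for
        this loss.\<close>
      define z' where "z' = (fst z, exp \<sigma>)"
      have z0: "0 < snd z" using zz(1) by (rule less_le_trans[rotated]) simp
      have "\<sigma> < \<tau>" using adm by (simp add: adm_log_box_def)
      then have z'R: "z' \<in> R" using z(1) unfolding Rm_def Rc log_box_def z'_def by (simp add: mem_Times_iff)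
      have zS: "z \<in> axS" "z' \<in> axS" using z0 by (auto simp: axS_def z'_def)
      have "axd z z' = ln (exp \<sigma> / snd z)"
        using axd_vertical[OF z0, of "exp \<sigma>" "fst z"] False by (simp add: z'_def)
      also have "\<dots> = \<sigma> - ln (snd z)" using z0 by (simp add: ln_div)
      also have "\<dots> \<le> \<sigma> - s m" using zz(1) z0 by (simp add: ln_ge_iff)
      finally have "axd y z' \<le> axd y z + (\<sigma> - s m)" using axd_triangle[OF yS zS(2,1)] by simp
      then have "axd y z' < r" using z(2) rr[of m] by simp
      then show ?thesis using z'R by blast
    qed
    then show "y \<in> cz_star R" using mem_cz_star_iff[OF r yS] by blast
  qed
  have cover: "eventually (\<lambda>m. y \<in> cz_star (Rm m)) sequentially" if y: "y \<in> cz_star R" for y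
  proof -
    have yS: "y \<in> axS" using y cz_star_subset_axS by blast
    obtain z where z: "z \<in> R" "axd y z < r" using y mem_cz_star_iff[OF r yS] by blast
    show ?thesis
      using inRm[OF z(1)] order_tendstoD(1)[OF lr z(2)] eventually_ge_at_top[of N]
    proof eventually_elim
      case (elim m)
      then show ?case using mem_cz_star_iff[OF cz yS, of m] by blast
    qed
  qed
  \<comment> \<open>All stars in play contain the ball of radius \<open>r / 2\<close> around
    \<open>x\<close>, so one integrable majorant supported off this ball serves for dominated
    convergence.\<close>
  define B where "B = {y \<in> space rho. r / 2 \<le> axd x y}"
  have B: "B \<in> sets rho" unfolding B_def using axd_measurable(2)[OF xS] by measurable
  define F where "F m y = indicator (axS - cz_star (Rm (m + N))) y *\<^sub>R (K x y * f y)" for m y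
  define G where "G y = indicator (axS - cz_star R) y *\<^sub>R (K x y * f y)" for y
  have RmCZ: "Rm (m + N) \<in> CZ" "x \<in> Rm (m + N)" for m
    using cz[of "m + N"] N[of "m + N"] by (auto simp: CZ_def)
  have Fint: "integrable rho (F m)" for m
    using TI_integrable[OF f RmCZ] unfolding F_def set_integrable_def .
  have Gint: "integrable rho G"
    using TI_integrable[OF f R x] unfolding G_def set_integrable_def .
  have "(\<lambda>m. integral\<^sup>L rho (F m)) \<longlonglongrightarrow> integral\<^sup>L rho G"
  proof (rule integral_dominated_convergence)
    show "G \<in> borel_measurable rho" using Gint by (rule borel_measurable_integrable)
    show "F m \<in> borel_measurable rho" for m using Fint by (rule borel_measurable_integrable)
    have "set_integrable rho B (\<lambda>y. K x y * f y)"
      by (rule integrable_off_diagonal[OF f xS _ B, of "r / 2"]) (use r0 in \<open>auto simp: B_def\<close>)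
    then show "integrable rho (\<lambda>y. norm (indicator B y *\<^sub>R (K x y * f y)))"
      unfolding set_integrable_def by (rule integrable_norm)
    show "AE y in rho. (\<lambda>m. F m y) \<longlonglongrightarrow> G y"
    proof (rule AE_I2)
      fix y :: "(real ^ 'n) \<times> real" assume "y \<in> space rho"
      then have yS: "y \<in> axS" by simp
      have "eventually (\<lambda>m. F m y = G y) sequentially"
      proof (cases "y \<in> cz_star R")
        case True
        have "eventually (\<lambda>m. y \<in> cz_star (Rm (m + N))) sequentially"
          using cover[OF True] by (subst eventually_sequentially_seg)
        then show ?thesis by (rule eventually_mono) (simp add: F_def G_def True)
      next
        case False
        then have "y \<notin> cz_star (Rm (m + N))" for m using sub[of "m + N"] by auto
          then have "F m y = G y" for m unfolding F_def G_def using False by (simp only: Diff_iff indicator_def simp_thms)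
          then show ?thesis by simp
      qed
      then show "(\<lambda>m. F m y) \<longlonglongrightarrow> G y" by (rule tendsto_eventually)
    qed
    show "AE y in rho. norm (F m y) \<le> norm (indicator B y *\<^sub>R (K x y * f y))" for m
    proof (rule AE_I2)
      fix y :: "(real ^ 'n) \<times> real" assume "y \<in> space rho"
      then have yS: "y \<in> axS" by simp
      show "norm (F m y) \<le> norm (indicator B y *\<^sub>R (K x y * f y))"
      proof (cases "y \<in> cz_star (Rm (m + N))")
        case True
        then show ?thesis by (simp add: F_def)
      next
        case False
        then have "rm (m + N) \<le> axd x y"
          using cz_star_far[OF cz[of "m + N"], of x y] yS RmCZ(2)[of m] by simp
        then have "y \<in> B" using N[of "m + N"] yS unfolding B_def by simp
        then show ?thesis by (simp add: F_def indicator_def)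
      qed
    qed
  qed
  then have "(\<lambda>m. cmod (TI f (Rm (m + N)) x)) \<longlonglongrightarrow> cmod (TI f R x)"
    unfolding F_def G_def TI_def set_lebesgue_integral_def by (rule tendsto_norm)
  then have "eventually (\<lambda>m. cmod (TI f R x) - \<epsilon> < cmod (TI f (Rm (m + N)) x)) sequentially"
    by (rule order_tendstoD(1)) (use e in simp)
  then obtain m where m: "cmod (TI f R x) - \<epsilon> < cmod (TI f (Rm (m + N)) x)"
    using eventually_happens'[OF sequentially_bot] by blast
  show ?thesis
    using m N[of "m + N"]
    by (intro exI[of _ j] exI[of _ k] exI[of _ "q (m + N)"] exI[of _ "q' (m + N)"])
      (simp add: Rm_def s_def t_def)
qed

lemma TI_measurable:
  assumes f: "f \<in> Linf_c" and R: "R \<in> CZ"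
  shows "(\<lambda>x. TI f R x) \<in> borel_measurable rho"
proof -
  interpret sigma_finite_measure "rho :: ((real ^ 'n) \<times> real) measure" by (rule sigma_finite_rho)
  have S: "axS - cz_star R \<in> sets rho"
    using sets.compl_sets[OF cz_star_sets[OF R]] by simp
  have fm: "(\<lambda>z. f (snd z)) \<in> borel_measurable (rho \<Otimes>\<^sub>M rho)"
    using measurable_compose[OF measurable_snd Linf_c_measurable[OF f]] .
  have im: "(\<lambda>z. indicat_real (axS - cz_star R) (snd z)) \<in> borel_measurable (rho \<Otimes>\<^sub>M rho)"
    using measurable_compose[OF measurable_snd borel_measurable_indicator[OF S]] .
  have "(\<lambda>z. indicat_real (axS - cz_star R) (snd z) *\<^sub>R (K (fst z) (snd z) * f (snd z))) \<in> borel_measurable (rho \<Otimes>\<^sub>M rho)"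
    by (intro borel_measurable_scaleR borel_measurable_times im fm K_measurable)
  then show ?thesis
    unfolding TI_def set_lebesgue_integral_def
    by (intro borel_measurable_lebesgue_integral) (simp add: split_beta')
qed

lemma Tstar_measurable:
  assumes f: "f \<in> Linf_c"
  shows "Tstar K f \<in> borel_measurable rho"
proof -
  \<comment> \<open>The index type is countable. Indices that are not admissible or miss
    \<open>x\<close> contribute 0, which cannot raise a supremum of extended nonnegative
    numbers.\<close>
  define g where "g i x = (case i of (j, k, q, q') \<Rightarrow>
     if adm_log_box j (of_rat q) (of_rat q') \<and> x \<in> log_box j k (of_rat q) (of_rat q')
     then ennreal (cmod (TI f (log_box j k (of_rat q) (of_rat q')) x)) else 0)" for i :: "int \<times> ('n \<Rightarrow> int) \<times> rat \<times> rat" and x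
  have "Tstar K f x = (SUP i. g i x)" for x
  proof (rule antisym)
    show "Tstar K f x \<le> (SUP i. g i x)"
    proof (rule Tstar_leI)
      fix R assume R: "R \<in> CZ" "x \<in> R"
      show "ennreal (cmod (TI f R x)) \<le> (SUP i. g i x)"
      proof (rule ennreal_le_epsilon)
        fix e :: real assume "0 < e"
        then obtain j k and q q' :: rat where *: "adm_log_box j (of_rat q) (of_rat q')" "x \<in> log_box j k (of_rat q) (of_rat q')"
          "cmod (TI f R x) \<le> cmod (TI f (log_box j k (of_rat q) (of_rat q')) x) + e"
          using TI_rational_approx[OF f R] by blast
        have "ennreal (cmod (TI f R x)) \<le> ennreal (cmod (TI f (log_box j k (of_rat q) (of_rat q')) x) + e)"
          using *(3) by (rule ennreal_leI)
        also have "\<dots> = g (j, k, q, q') x + ennreal e"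
          using * \<open>0 < e\<close> by (simp add: g_def)
        also have "\<dots> \<le> (SUP i. g i x) + ennreal e"
          by (intro add_right_mono SUP_upper) simp
        finally show "ennreal (cmod (TI f R x)) \<le> (SUP i. g i x) + ennreal e" .
      qed
    qed
    show "(SUP i. g i x) \<le> Tstar K f x"
    proof (rule SUP_least)
      fix i :: "int \<times> ('n \<Rightarrow> int) \<times> rat \<times> rat"
      obtain j k q q' where i: "i = (j, k, q, q')" by (metis prod_cases4)
      show "g i x \<le> Tstar K f x"
      proof (cases "adm_log_box j (of_rat q) (of_rat q') \<and> x \<in> log_box j k (of_rat q) (of_rat q')")
        case True
        then have "log_box j k (of_rat q) (of_rat q') \<in> CZ" using cz_with_log_box unfolding CZ_def by blast
        then show ?thesis using True unfolding i g_def by (simp add: TI_le_Tstar)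
      next
        case False
        then have "g i x = 0" unfolding i g_def prod.case by (rule if_not_P)
        then show ?thesis by simp
      qed
    qed
  qed
  then have "Tstar K f = (\<lambda>x. SUP i. g i x)" by (rule ext)
  moreover have "g i \<in> borel_measurable rho" for i
  proof -
    obtain j k q q' where i: "i = (j, k, q, q')" by (metis prod_cases4)
    show ?thesis
    proof (cases "adm_log_box j (of_rat q) (of_rat q')")
      case True
      then have C: "log_box j k (of_rat q) (of_rat q') \<in> CZ" using cz_with_log_box unfolding CZ_def by blast
      have "g i = (\<lambda>x. if x \<in> log_box j k (of_rat q) (of_rat q') then ennreal (cmod (TI f (log_box j k (of_rat q) (of_rat q')) x)) else 0)"
        unfolding i g_def using True by simp
      then show ?thesis using TI_measurable[OF f C] cz_sets[OF C] by simp
    next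
      case False
      then have "g i = (\<lambda>x. 0)" unfolding i g_def by simp
      then show ?thesis by simp
    qed
  qed
  ultimately show ?thesis
    by (simp only:) (rule borel_measurable_SUP, simp_all)
qed

end

section \<open>The good and the bad part of a function\<close>

text \<open>Either the right side is infinite or it forces absolute convergence, so the bound can be
  applied before convergence of the complex series has been established.\<close>

lemma ennreal_norm_suminf_le:
  fixes z :: "nat \<Rightarrow> complex" and u :: "nat \<Rightarrow> ennreal"
  assumes "\<And>i. ennreal (cmod (z i)) \<le> u i"
  shows "ennreal (cmod (\<Sum>i. z i)) \<le> (\<Sum>i. u i)"
proof (cases "(\<Sum>i. u i) = top")
  case True then show ?thesis by simp
next
  case False
  have le: "(\<Sum>i. ennreal (cmod (z i))) \<le> (\<Sum>i. u i)"
    using assms by (intro suminf_le) auto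
  then have nt: "(\<Sum>i. ennreal (cmod (z i))) \<noteq> top" using False by (metis top.extremum_unique)
  then have s: "summable (\<lambda>i. cmod (z i))"
    by (intro summable_suminf_not_top) auto
  have "ennreal (cmod (\<Sum>i. z i)) \<le> ennreal (\<Sum>i. cmod (z i))"
    by (intro ennreal_leI summable_norm s)
  also have "\<dots> = (\<Sum>i. ennreal (cmod (z i)))"
    using nt by (intro suminf_ennreal[symmetric]) auto
  finally show ?thesis using le by (rule order_trans)
qed

text \<open>A set of radius at least 1 that comes within \<open>D\<close> of the unit has a cube of
  side at least \<open>exp (- D)\<close>, so its measure bounds its radius. This confines the pieces
  of a decomposition to a bounded region.\<close>

lemma cz_radius_bound:
  fixes R :: "((real ^ 'n) \<times> real) set"
  assumes R: "cz_with R r" and z: "z \<in> R" "axd z axe \<le> D" and m: "emeasure rho R \<le> ennreal v"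
  shows "r \<le> max 1 (v * exp (real CARD('n) * D))"
proof (cases "r < 1")
  case False
  obtain j :: int and k :: "'n \<Rightarrow> int" and L a where *: "L = 2 powi j" "0 < L" "0 < a" "0 < r"
    and c: "r < 1 \<Longrightarrow> exp 2 * a * r \<le> L" "r < 1 \<Longrightarrow> L < exp 8 * a * r"
      "1 \<le> r \<Longrightarrow> a * exp (2 * r) \<le> L" "1 \<le> r \<Longrightarrow> L < a * exp (8 * r)"
    and Re: "R = {x::real^'n. \<forall>i. of_int (k i) * L \<le> x $ i \<and> x $ i < (of_int (k i) + 1) * L} \<times>
      {a * exp (- r)..<a * exp r}"
    using R by (rule cz_withE) blast
  have zS: "z \<in> axS" using cz_subset_axS[OF R] z(1) by (rule subsetD)
  have pos: "0 < snd z" using zS by (simp add: axS_def)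
  have "1 \<le> snd z * exp (axd axe z)" using snd_le_exp_axd[OF axe_in zS] by (simp add: axe_def)
  also have "\<dots> \<le> snd z * exp D" using z(2) pos by (simp add: axd_commute)
  finally have "exp (- D) \<le> snd z" by (simp add: exp_minus field_simps)
  also have "\<dots> \<le> a * exp r" using z(1) unfolding Re by auto
  also have "\<dots> \<le> a * exp (2 * r)" using * by simp
  also have "\<dots> \<le> L" using c(3) False by simp
  finally have "exp (- D) ^ CARD('n) \<le> L ^ CARD('n)" by (intro power_mono) auto
  then have "2 * r * exp (- D) ^ CARD('n) \<le> 2 * r * L ^ CARD('n)" using * by (intro mult_left_mono) auto
  moreover have "ennreal (2 * r * L ^ CARD('n)) \<le> ennreal v"
    using m unfolding Re emeasure_cell[OF *(2,3,4)] .
  then have "2 * r * L ^ CARD('n) \<le> v"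
    using * ennreal_le_iff2 by (metis mult_pos_pos not_le zero_less_numeral zero_less_power)
  ultimately have "2 * r * exp (- D) ^ CARD('n) \<le> v" by linarith
  then have "(2 * r * exp (- D) ^ CARD('n)) * exp (real CARD('n) * D) \<le> v * exp (real CARD('n) * D)"
    by (intro mult_right_mono) auto
  moreover have "exp (- D) ^ CARD('n) * exp (real CARD('n) * D) = 1"
    by (simp flip: exp_of_nat_mult exp_add)
  ultimately have "2 * r \<le> v * exp (real CARD('n) * D)" by (simp add: mult.assoc)
  then show ?thesis using * by (simp add: le_max_iff_disj)
qed simp

section \<open>Geometric constants shared by all decompositions\<close>

context cz_kernel
begin

definition diam_const :: real where
  "diam_const = (SOME C. 1 \<le> C \<and> (\<forall>(R :: ((real ^ 'n) \<times> real) set) r p q. cz_with R r \<longrightarrow> p \<in> R \<longrightarrow> q \<in> R \<longrightarrow> axd p q \<le> C * r))"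

lemma diam_const: "1 \<le> diam_const"
  "cz_with R r \<Longrightarrow> p \<in> R \<Longrightarrow> q \<in> R \<Longrightarrow> axd p q \<le> diam_const * r" for R :: "((real ^ 'n) \<times> real) set"
proof -
  have ex: "\<exists>C\<ge>1. \<forall>(R :: ((real ^ 'n) \<times> real) set) r p q. cz_with R r \<longrightarrow> p \<in> R \<longrightarrow> q \<in> R \<longrightarrow> axd p q \<le> C * r"
    by (rule cz_diam)
  have *: "1 \<le> diam_const \<and> (\<forall>(R :: ((real ^ 'n) \<times> real) set) r p q. cz_with R r \<longrightarrow> p \<in> R \<longrightarrow> q \<in> R \<longrightarrow> axd p q \<le> diam_const * r)"
    unfolding diam_const_def by (rule someI_ex[OF ex])
  show "1 \<le> diam_const" using * by (rule conjunct1)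
  show "cz_with R r \<Longrightarrow> p \<in> R \<Longrightarrow> q \<in> R \<Longrightarrow> axd p q \<le> diam_const * r" for R :: "((real ^ 'n) \<times> real) set"
    by (rule conjunct2[OF *, rule_format])
qed

text \<open>Two annuli occur below: of ratio \<open>(1 + diam_const) ^ 3\<close> for pieces crossing
  the boundary of a star, and of ratio \<open>2 * (1 + diam_const)\<^sup>2\<close> for pieces
  meeting a dyadic shell. The number chosen covers both.\<close>

definition shell_count :: nat where
  "shell_count = (SOME k. 2 * (1 + diam_const) ^ 3 \<le> 2 ^ k)"

lemma shell_count: "2 * (1 + diam_const) ^ 3 \<le> 2 ^ shell_count"
proof -
  obtain k :: nat where "2 * (1 + diam_const) ^ 3 < 2 ^ k" using real_arch_pow[of 2 "2 * (1 + diam_const) ^ 3"] by auto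
  then have "\<exists>k::nat. 2 * (1 + diam_const) ^ 3 \<le> 2 ^ k" using less_imp_le by blast
  then show ?thesis unfolding shell_count_def by (rule someI_ex)
qed

end

text \<open>The conclusions of \<open>cz_decomposition\<close> for \<open>cmod (f x)\<close> at
  height \<open>\<beta>\<close>, except the bound on the measure of the union. Empty
  \<open>A i\<close> stem from the padding of the enumeration.\<close>

locale cz_pieces = cz_kernel K for K :: "(real ^ 'n) \<times> real \<Rightarrow> (real ^ 'n) \<times> real \<Rightarrow> complex" +
  fixes f :: "(real ^ 'n) \<times> real \<Rightarrow> complex" and \<beta> :: real and A :: "nat \<Rightarrow> ((real ^ 'n) \<times> real) set"
  assumes f: "f \<in> Linf_c" and \<beta>: "0 < \<beta>" and disj: "disjoint_family A"
    and CZA: "\<And>i. A i \<noteq> {} \<Longrightarrow> A i \<in> CZ" and setsA: "\<And>i. A i \<in> sets rho"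
    and lower: "\<And>i. ennreal \<beta> * emeasure rho (A i) \<le> (\<integral>\<^sup>+x\<in>A i. ennreal (cmod (f x)) \<partial>rho)"
    and upper: "\<And>i. (\<integral>\<^sup>+x\<in>A i. ennreal (cmod (f x)) \<partial>rho) \<le> ennreal (2 ^ CARD('n) * \<beta>) * emeasure rho (A i)"
    and ae_le: "AE x in rho. x \<notin> (\<Union>i. A i) \<longrightarrow> ennreal (cmod (f x)) \<le> ennreal \<beta>"
begin

text \<open>\<open>piece_bound i x\<close> dominates the contribution of the \<open>i\<close>-th piece to the truncated integral of the bad part.
  Its weight contains \<open>2 * height\<close> besides \<open>cmod (bad y)\<close> so that a piece crossing the boundary of the
  truncation region, where no cancellation is available, is controlled as well, up to an integral
  of \<open>cmod (K x y)\<close> over the piece.\<close>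

definition "height = 2 ^ CARD('n) * \<beta>"
definition "Omega = (\<Union>i. A i)"
definition "piece_index y = (LEAST i. y \<in> A i)"
definition "good y = (if y \<in> Omega then cz_avg f (A (piece_index y)) else f y)"
definition "bad y = f y - good y"
definition "centre i = (SOME y. y \<in> A i)"
definition "wt y = cmod (bad y) + 2 * height"
definition "piece_bound i x = (\<integral>\<^sup>+y\<in>A i. ennreal (wt y * cmod (K x y - K x (centre i))) \<partial>rho)"
definition "Omega_star = (\<Union>i\<in>{i. A i \<noteq> {}}. cz_star (A i))"

section \<open>The good part\<close>

lemma height: "0 < height" "\<beta> \<le> height"
  using \<beta> by (simp_all add: height_def)

lemma piece_index_eq: "y \<in> A i \<Longrightarrow> piece_index y = i"
proof -
  assume y: "y \<in> A i"
  have "y \<in> A (piece_index y)" unfolding piece_index_def using y by (rule LeastI)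
  then show ?thesis using disj y unfolding disjoint_family_on_def by blast
qed

lemma Omega_sets: "Omega \<in> sets rho"
  unfolding Omega_def by (rule sets.countable_UN) (simp add: image_subset_iff setsA)

lemma in_axS: "y \<in> A i \<Longrightarrow> y \<in> axS"
  using sets.sets_into_space[OF setsA[of i]] by auto

lemma centre_in: "A i \<noteq> {} \<Longrightarrow> centre i \<in> A i"
  unfolding centre_def by (rule someI_ex) blast

lemma f_measurable: "f \<in> borel_measurable rho"
  by (rule Linf_c_measurable[OF f])

lemma piece_finite: "emeasure rho (A i) < \<infinity>"
  using cz_emeasure_finite[OF CZA[of i]] by (cases "A i = {}") auto

lemma piece_emeasure_eq: "emeasure rho (A i) = ennreal (measure rho (A i))"
  using piece_finite[of i] by (intro emeasure_eq_ennreal_measure) (simp add: less_top)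

lemma good_on: "y \<in> A i \<Longrightarrow> good y = cz_avg f (A i)"
  unfolding good_def Omega_def using piece_index_eq by auto

lemma bad_off: "y \<notin> Omega \<Longrightarrow> bad y = 0"
  by (simp add: bad_def good_def)

lemma f_integrable: "integrable rho f"
proof (rule integrableI_bounded[OF f_measurable])
  show "(\<integral>\<^sup>+x. ennreal (cmod (f x)) \<partial>rho) < \<infinity>"
    using Linf_c_powr_finite[OF f, of 1] by (simp add: powr_one_gt_zero_iff)
qed

lemma f_set_integrable: "set_integrable rho (A i) f"
  using f_integrable setsA unfolding set_integrable_def by (intro integrable_mult_indicator)

lemma avg_bound: "cmod (cz_avg f (A i)) \<le> height"
proof (cases "A i = {}")
  case True
  then show ?thesis using height by (simp add: cz_avg_def set_lebesgue_integral_def)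
next
  case False
  have "0 < emeasure rho (A i)" by (rule cz_emeasure_pos[OF CZA[OF False]])
  then have m0: "0 < measure rho (A i)" unfolding piece_emeasure_eq by simp
  have "ennreal (cmod (LINT x:A i|rho. f x)) \<le> (\<integral>\<^sup>+x. ennreal (norm (indicator (A i) x *\<^sub>R f x)) \<partial>rho)"
    unfolding set_lebesgue_integral_def using f_set_integrable[of i] unfolding set_integrable_def
    by (rule integral_norm_bound_ennreal)
  also have "\<dots> = (\<integral>\<^sup>+x\<in>A i. ennreal (cmod (f x)) \<partial>rho)"
    by (intro nn_integral_cong) (simp add: indicator_def)
  also have "\<dots> \<le> ennreal height * emeasure rho (A i)" using upper unfolding height_def .
  also have "\<dots> = ennreal (height * measure rho (A i))" using height unfolding piece_emeasure_eq by (simp add: ennreal_mult')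
  finally have "cmod (LINT x:A i|rho. f x) \<le> height * measure rho (A i)"
    using height m0 by (simp add: ennreal_le_iff)
  then have "cmod (LINT x:A i|rho. f x) / measure rho (A i) \<le> height" using m0 by (simp add: pos_divide_le_eq)
  then show ?thesis unfolding cz_avg_def by (simp add: norm_divide)
qed

lemma good_measurable: "good \<in> borel_measurable rho"
proof -
  have "(\<lambda>y. y \<in> A i) \<in> measurable rho (count_space UNIV)" for i
    using setsA[of i] by (rule pred_sets2[OF _ measurable_ident_sets[OF refl], simplified])
  then have "piece_index \<in> measurable rho (count_space UNIV)"
    unfolding piece_index_def by (rule measurable_Least)
  then have "(\<lambda>y. cz_avg f (A (piece_index y))) \<in> borel_measurable rho"
    by (rule measurable_compose) simp
  then show ?thesis unfolding good_def[abs_def] using f_measurable Omega_sets by simp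
qed

lemma good_bound: "AE x in rho. cmod (good x) \<le> height"
  using ae_le
proof eventually_elim
  case (elim x)
  show ?case
  proof (cases "x \<in> Omega")
    case True
    then show ?thesis using avg_bound[of "piece_index x"] by (simp add: good_def)
  next
    case False
    then have "cmod (f x) \<le> \<beta>" using elim \<beta> by (simp add: Omega_def ennreal_le_iff)
    then show ?thesis using False height by (simp add: good_def)
  qed
qed

text \<open>On every piece \<open>cmod (f x)\<close> has positive average, so the piece meets the
  support of \<open>f\<close>; its measure is at most the integral of \<open>cmod (f x)\<close>
  divided by \<open>\<beta>\<close>, which bounds its radius by \<open>cz_radius_bound\<close>.
  Averaging over the pieces therefore spreads the support only by a bounded distance.\<close>

lemma piece_near:
  obtains D where "\<And>i y. y \<in> A i \<Longrightarrow> axd y axe \<le> D"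
proof -
  obtain D where D: "AE x in rho. f x \<noteq> 0 \<longrightarrow> axd x axe \<le> D" using f by (rule Linf_c_support)
  define v where "v = enn2real (\<integral>\<^sup>+x. ennreal (cmod (f x)) \<partial>rho) / \<beta>"
  define r0 where "r0 = max 1 (v * exp (real CARD('n) * D))"
  have "axd y axe \<le> diam_const * r0 + D" if y: "y \<in> A i" for i y
  proof -
    have ne: "A i \<noteq> {}" using y by blast
    obtain r where r: "cz_with (A i) r" using CZA[OF ne] by (auto simp: CZ_def)
    have "0 < ennreal \<beta> * emeasure rho (A i)"
      using cz_emeasure_pos[OF CZA[OF ne]] \<beta> by (simp add: ennreal_zero_less_mult_iff)
    then have pos: "0 < (\<integral>\<^sup>+x\<in>A i. ennreal (cmod (f x)) \<partial>rho)" using lower[of i] by (rule less_le_trans)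
    have "\<exists>z\<in>A i. axd z axe \<le> D"
    proof (rule ccontr)
      assume nz: "\<not> ?thesis"
      have "AE x in rho. ennreal (cmod (f x)) * indicator (A i) x = 0"
        using D
      proof eventually_elim
        case (elim x)
        then show ?case using nz by (cases "x \<in> A i") auto
      qed
      then have "(\<integral>\<^sup>+x\<in>A i. ennreal (cmod (f x)) \<partial>rho) = 0"
        using f_measurable setsA[of i] by (subst nn_integral_0_iff_AE) auto
      then show False using pos by simp
    qed
    then obtain z where z: "z \<in> A i" "axd z axe \<le> D" by blast
    have "ennreal \<beta> * emeasure rho (A i) \<le> (\<integral>\<^sup>+x. ennreal (cmod (f x)) \<partial>rho)"
      by (rule order_trans[OF lower]) (auto intro!: nn_integral_mono simp: indicator_def)
    also have "\<dots> = ennreal (\<beta> * v)"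
      using Linf_c_powr_finite[OF f, of 1] \<beta> by (simp add: v_def)
    finally have "ennreal (\<beta> * measure rho (A i)) \<le> ennreal (\<beta> * v)"
      using \<beta> unfolding piece_emeasure_eq by (simp add: ennreal_mult')
    moreover have v0: "0 \<le> v" using \<beta> by (simp add: v_def)
    ultimately have "measure rho (A i) \<le> v" using \<beta> by (simp add: ennreal_le_iff)
    then have "emeasure rho (A i) \<le> ennreal v" unfolding piece_emeasure_eq by (rule ennreal_leI)
    then have "r \<le> r0" unfolding r0_def by (rule cz_radius_bound[OF r z])
    then have "diam_const * r \<le> diam_const * r0" using diam_const(1) by (intro mult_left_mono) auto
    moreover have "axd y z \<le> diam_const * r" by (rule diam_const(2)[OF r y z(1)])
    moreover have "axd y axe \<le> axd y z + axd z axe"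
      by (rule axd_triangle[OF in_axS[OF y] axe_in in_axS[OF z(1)]])
    ultimately show ?thesis using z(2) by linarith
  qed
  then show ?thesis by (rule that)
qed

lemma good_Linf_c: "good \<in> Linf_c"
proof -
  obtain D where D: "AE x in rho. f x \<noteq> 0 \<longrightarrow> axd x axe \<le> D" using f by (rule Linf_c_support)
  obtain D' where D': "\<And>i y. y \<in> A i \<Longrightarrow> axd y axe \<le> D'" by (rule piece_near) blast
  have "AE x in rho. good x \<noteq> 0 \<longrightarrow> axd x axe \<le> max D D'"
    using D
  proof eventually_elim
    case (elim x)
    show ?case
    proof (cases "x \<in> Omega")
      case True
      then obtain i where "x \<in> A i" unfolding Omega_def by blast
      then show ?thesis using D'[of x i] by (simp add: le_max_iff_disj)
    next
      case False
      then show ?thesis using elim by (auto simp: good_def)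
    qed
  qed
  then show ?thesis by (rule Linf_cI[OF good_measurable good_bound])
qed

section \<open>The bad part and its bound on a single piece\<close>

lemma bad_Linf_c: "bad \<in> Linf_c"
  unfolding bad_def[abs_def] by (rule Linf_c_diff[OF f good_Linf_c])

lemma bad_measurable: "bad \<in> borel_measurable rho"
  by (rule Linf_c_measurable[OF bad_Linf_c])

lemma bad_set_integrable: "set_integrable rho (A i) bad"
proof -
  have "integrable rho bad"
  proof (rule integrableI_bounded[OF bad_measurable])
    show "(\<integral>\<^sup>+x. ennreal (cmod (bad x)) \<partial>rho) < \<infinity>"
      using Linf_c_powr_finite[OF bad_Linf_c, of 1] by (simp add: powr_one_gt_zero_iff)
  qed
  then show ?thesis using setsA unfolding set_integrable_def by (intro integrable_mult_indicator)
qed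

lemma bad_mean_zero: "(LINT y:A i|rho. bad y) = 0"
proof (cases "A i = {}")
  case True then show ?thesis by (simp add: set_lebesgue_integral_def)
next
  case False
  have m0: "measure rho (A i) \<noteq> 0" using cz_emeasure_pos[OF CZA[OF False]] unfolding piece_emeasure_eq by simp
  have c: "set_integrable rho (A i) (\<lambda>y. cz_avg f (A i))"
    unfolding set_integrable_def using setsA piece_finite by (intro integrable_scaleR_left integrable_real_indicator) auto
  have "(LINT y:A i|rho. bad y) = (LINT y:A i|rho. f y - cz_avg f (A i))"
    using setsA by (intro set_lebesgue_integral_cong) (auto simp: bad_def good_on)
  also have "\<dots> = (LINT y:A i|rho. f y) - (LINT y:A i|rho. cz_avg f (A i))"
    by (rule set_integral_diff(2)[OF f_set_integrable c])
  also have "(LINT y:A i|rho. cz_avg f (A i)) = measure rho (A i) *\<^sub>R cz_avg f (A i)"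
    unfolding set_lebesgue_integral_def
    using setsA[of i] piece_finite[of i] sets.sets_into_space[OF setsA[of i]] by (simp add: Int_absorb2)
  also have "\<dots> = (LINT y:A i|rho. f y)" using m0 by (simp add: cz_avg_def)
  finally show ?thesis by simp
qed

lemma bad_abs_integral: "(\<integral>\<^sup>+y\<in>A i. ennreal (cmod (bad y)) \<partial>rho) \<le> ennreal (2 * height) * emeasure rho (A i)"
proof -
  have "(\<integral>\<^sup>+y\<in>A i. ennreal (cmod (bad y)) \<partial>rho) \<le>
      (\<integral>\<^sup>+y. ennreal (cmod (f y)) * indicator (A i) y + ennreal height * indicator (A i) y \<partial>rho)"
  proof (rule nn_integral_mono)
    fix y
    show "ennreal (cmod (bad y)) * indicator (A i) y \<le> ennreal (cmod (f y)) * indicator (A i) y + ennreal height * indicator (A i) y"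
    proof (cases "y \<in> A i")
      case True
      have "cmod (bad y) \<le> cmod (f y) + height"
        unfolding bad_def good_on[OF True] using norm_triangle_ineq4[of "f y" "cz_avg f (A i)"] avg_bound[of i] by linarith
      then have "ennreal (cmod (bad y)) \<le> ennreal (cmod (f y)) + ennreal height"
        using height by (simp add: ennreal_plus[symmetric] ennreal_leI del: ennreal_plus)
      then show ?thesis using True by simp
    qed simp
  qed
  also have "\<dots> = (\<integral>\<^sup>+y\<in>A i. ennreal (cmod (f y)) \<partial>rho) + ennreal height * emeasure rho (A i)"
    using f_measurable setsA[of i] by (subst nn_integral_add) (auto simp: nn_integral_cmult)
  also have "\<dots> \<le> ennreal height * emeasure rho (A i) + ennreal height * emeasure rho (A i)"
    using upper[of i] unfolding height_def by (intro add_right_mono)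
  also have "\<dots> = ennreal (2 * height) * emeasure rho (A i)"
    using height by (simp add: distrib_right[symmetric] ennreal_plus[symmetric] del: ennreal_plus)
  finally show ?thesis .
qed

lemma wt_integral: "(\<integral>\<^sup>+y\<in>A i. ennreal (wt y) \<partial>rho) \<le> ennreal (4 * height) * emeasure rho (A i)"
proof -
  have "(\<integral>\<^sup>+y\<in>A i. ennreal (wt y) \<partial>rho) = (\<integral>\<^sup>+y. ennreal (cmod (bad y)) * indicator (A i) y + ennreal (2 * height) * indicator (A i) y \<partial>rho)"
    using height by (intro nn_integral_cong) (simp add: wt_def indicator_def)
  also have "\<dots> = (\<integral>\<^sup>+y\<in>A i. ennreal (cmod (bad y)) \<partial>rho) + ennreal (2 * height) * emeasure rho (A i)"
    using bad_measurable setsA[of i] by (subst nn_integral_add) (auto simp: nn_integral_cmult)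
  also have "\<dots> \<le> ennreal (2 * height) * emeasure rho (A i) + ennreal (2 * height) * emeasure rho (A i)"
    by (intro add_right_mono bad_abs_integral)
  also have "\<dots> = ennreal (4 * height) * emeasure rho (A i)"
    using height by (simp add: distrib_right[symmetric] ennreal_plus[symmetric] del: ennreal_plus)
  finally show ?thesis .
qed

lemma wt_measurable: "wt \<in> borel_measurable rho"
  unfolding wt_def[abs_def] using bad_measurable by measurable

text \<open>The kernel is frozen at \<open>c\<close>, which leaves an oscillation term weighted by
  \<open>cmod (bad y)\<close>; the integral of \<open>cmod (bad y)\<close> is bounded by
  \<open>2 * height\<close> times the measure of the piece; then \<open>c\<close> is changed back to
  \<open>K x y\<close> against this constant weight. Both oscillation terms fit into
  \<open>piece_bound\<close>, and the remaining kernel integral no longer involves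
  \<open>bad\<close>, whose supremum is not controlled by the height.\<close>

lemma piece_abs:
  assumes x: "x \<in> axS" and ne: "A i \<noteq> {}"
  shows "(\<integral>\<^sup>+y\<in>A i. ennreal (cmod (K x y) * cmod (bad y)) \<partial>rho) \<le>
    piece_bound i x + ennreal (2 * height) * (\<integral>\<^sup>+y\<in>A i. ennreal (cmod (K x y)) \<partial>rho)"
proof -
  define c where "c = K x (centre i)"
  define d where "d y = cmod (K x y - c)" for y
  have Km: "K x \<in> borel_measurable rho" using K_section(1)[OF x] .
  have dm: "d \<in> borel_measurable rho" unfolding d_def[abs_def] using Km by measurable
  have "(\<integral>\<^sup>+y\<in>A i. ennreal (cmod (K x y) * cmod (bad y)) \<partial>rho) \<le>
      (\<integral>\<^sup>+y. ennreal (d y * cmod (bad y)) * indicator (A i) y + ennreal (cmod c) * (ennreal (cmod (bad y)) * indicator (A i) y) \<partial>rho)"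
  proof (rule nn_integral_mono)
    fix y
    have "cmod (K x y) * cmod (bad y) \<le> (d y + cmod c) * cmod (bad y)"
      unfolding d_def using norm_triangle_ineq2[of "K x y" c] by (intro mult_right_mono) auto
    then have "ennreal (cmod (K x y) * cmod (bad y)) \<le> ennreal (d y * cmod (bad y) + cmod c * cmod (bad y))"
      by (intro ennreal_leI) (simp add: distrib_right)
    also have "\<dots> = ennreal (d y * cmod (bad y)) + ennreal (cmod c) * ennreal (cmod (bad y))"
      by (simp add: ennreal_mult' d_def)
    finally show "ennreal (cmod (K x y) * cmod (bad y)) * indicator (A i) y \<le>
        ennreal (d y * cmod (bad y)) * indicator (A i) y + ennreal (cmod c) * (ennreal (cmod (bad y)) * indicator (A i) y)"
      by (simp add: indicator_def)
  qed
  also have "\<dots> = (\<integral>\<^sup>+y\<in>A i. ennreal (d y * cmod (bad y)) \<partial>rho) + ennreal (cmod c) * (\<integral>\<^sup>+y\<in>A i. ennreal (cmod (bad y)) \<partial>rho)"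
    using bad_measurable dm setsA[of i] by (subst nn_integral_add) (auto simp: nn_integral_cmult)
  also have "\<dots> \<le> (\<integral>\<^sup>+y\<in>A i. ennreal (d y * cmod (bad y)) \<partial>rho) + ennreal (cmod c) * (ennreal (2 * height) * emeasure rho (A i))"
    by (intro add_left_mono mult_left_mono bad_abs_integral) simp
  also have "ennreal (cmod c) * (ennreal (2 * height) * emeasure rho (A i)) = (\<integral>\<^sup>+y. ennreal (2 * height * cmod c) * indicator (A i) y \<partial>rho)"
    using setsA[of i] height by (simp add: nn_integral_cmult ennreal_mult' mult_ac)
  also have "\<dots> \<le> (\<integral>\<^sup>+y. ennreal (2 * height * d y) * indicator (A i) y + ennreal (2 * height) * (ennreal (cmod (K x y)) * indicator (A i) y) \<partial>rho)"
  proof (rule nn_integral_mono)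
    fix y
    have "cmod c \<le> d y + cmod (K x y)"
      unfolding d_def using norm_triangle_ineq2[of c "K x y"] by (simp add: norm_minus_commute)
    then have "2 * height * cmod c \<le> 2 * height * (d y + cmod (K x y))" using height by (intro mult_left_mono) auto
    then have "ennreal (2 * height * cmod c) \<le> ennreal (2 * height * d y + 2 * height * cmod (K x y))"
      by (intro ennreal_leI) (simp add: distrib_left)
    also have "\<dots> = ennreal (2 * height * d y) + ennreal (2 * height) * ennreal (cmod (K x y))"
      using height by (simp add: ennreal_mult' d_def)
    finally show "ennreal (2 * height * cmod c) * indicator (A i) y \<le>
        ennreal (2 * height * d y) * indicator (A i) y + ennreal (2 * height) * (ennreal (cmod (K x y)) * indicator (A i) y)"
      by (simp add: indicator_def)
  qed
  also have "\<dots> = (\<integral>\<^sup>+y\<in>A i. ennreal (2 * height * d y) \<partial>rho) + ennreal (2 * height) * (\<integral>\<^sup>+y\<in>A i. ennreal (cmod (K x y)) \<partial>rho)"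
    using dm Km setsA[of i] by (subst nn_integral_add) (auto simp: nn_integral_cmult)
  finally have le: "(\<integral>\<^sup>+y\<in>A i. ennreal (cmod (K x y) * cmod (bad y)) \<partial>rho) \<le>
      (\<integral>\<^sup>+y\<in>A i. ennreal (d y * cmod (bad y)) \<partial>rho) + ((\<integral>\<^sup>+y\<in>A i. ennreal (2 * height * d y) \<partial>rho) +
        ennreal (2 * height) * (\<integral>\<^sup>+y\<in>A i. ennreal (cmod (K x y)) \<partial>rho))"
    by (simp add: add_left_mono)
  have "(\<integral>\<^sup>+y\<in>A i. ennreal (d y * cmod (bad y)) \<partial>rho) + (\<integral>\<^sup>+y\<in>A i. ennreal (2 * height * d y) \<partial>rho) =
      (\<integral>\<^sup>+y. ennreal (d y * cmod (bad y)) * indicator (A i) y + ennreal (2 * height * d y) * indicator (A i) y \<partial>rho)"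
    using dm bad_measurable setsA[of i] by (subst nn_integral_add) auto
  also have "\<dots> = piece_bound i x"
    unfolding piece_bound_def
  proof (rule nn_integral_cong)
    fix y
    have "ennreal (d y * cmod (bad y)) + ennreal (2 * height * d y) = ennreal (wt y * cmod (K x y - K x (centre i)))"
      using height by (simp add: d_def c_def wt_def ennreal_plus[symmetric] algebra_simps del: ennreal_plus)
    then show "ennreal (d y * cmod (bad y)) * indicator (A i) y + ennreal (2 * height * d y) * indicator (A i) y =
        ennreal (wt y * cmod (K x y - K x (centre i))) * indicator (A i) y"
      by (simp add: indicator_def)
  qed
  finally have e: "(\<integral>\<^sup>+y\<in>A i. ennreal (d y * cmod (bad y)) \<partial>rho) + (\<integral>\<^sup>+y\<in>A i. ennreal (2 * height * d y) \<partial>rho) = piece_bound i x" .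
  show ?thesis using le unfolding add.assoc[symmetric] e .
qed

text \<open>The mean of \<open>bad\<close> over the piece vanishes, so \<open>K x (centre i)\<close>
  may be subtracted from the kernel.\<close>

lemma piece_cancel:
  assumes x: "x \<in> axS" and int: "set_integrable rho (A i) (\<lambda>y. K x y * bad y)"
  shows "ennreal (cmod (LINT y:A i|rho. K x y * bad y)) \<le> piece_bound i x"
proof -
  define c where "c = K x (centre i)"
  have ic: "set_integrable rho (A i) (\<lambda>y. c * bad y)"
    using bad_set_integrable by (rule set_integrable_mult_right)
  have "(LINT y:A i|rho. K x y * bad y) = (LINT y:A i|rho. K x y * bad y) - c * (LINT y:A i|rho. bad y)"
    by (simp add: bad_mean_zero)
  also have "\<dots> = (LINT y:A i|rho. K x y * bad y - c * bad y)"
    using int ic by (simp add: set_integral_diff)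
  finally have e: "(LINT y:A i|rho. K x y * bad y) = (LINT y:A i|rho. K x y * bad y - c * bad y)" .
  have "ennreal (cmod (LINT y:A i|rho. K x y * bad y - c * bad y)) \<le>
      (\<integral>\<^sup>+y. ennreal (norm (indicator (A i) y *\<^sub>R (K x y * bad y - c * bad y))) \<partial>rho)"
    unfolding set_lebesgue_integral_def
    by (rule integral_norm_bound_ennreal) (use set_integral_diff(1)[OF int ic] in \<open>simp add: set_integrable_def\<close>)
  also have "\<dots> \<le> piece_bound i x"
    unfolding piece_bound_def
  proof (rule nn_integral_mono)
    fix y
    have "cmod (K x y * bad y - c * bad y) = cmod (bad y) * cmod (K x y - c)"
      by (simp only: left_diff_distrib[symmetric] norm_mult mult.commute)
    also have "\<dots> \<le> wt y * cmod (K x y - K x (centre i))"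
      using height unfolding wt_def c_def by (intro mult_right_mono) auto
    finally show "ennreal (norm (indicator (A i) y *\<^sub>R (K x y * bad y - c * bad y))) \<le>
        ennreal (wt y * cmod (K x y - K x (centre i))) * indicator (A i) y"
      by (cases "y \<in> A i") (simp_all add: ennreal_leI)
  qed
  finally show ?thesis unfolding e .
qed

lemma piece_bound_measurable: "piece_bound i \<in> borel_measurable rho"
proof (cases "A i = {}")
  case True
  then have "piece_bound i = (\<lambda>x. 0)" by (simp add: piece_bound_def[abs_def])
  then show ?thesis by simp
next
  case False
  interpret sigma_finite_measure "rho :: ((real ^ 'n) \<times> real) measure" by (rule sigma_finite_rho)
  have cS: "centre i \<in> axS" by (rule in_axS[OF centre_in[OF False]])
  have 1: "(\<lambda>z. K (fst z) (centre i)) \<in> borel_measurable (rho \<Otimes>\<^sub>M rho)"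
    using measurable_compose[OF measurable_fst K_section(2)[OF cS]] .
  have 2: "(\<lambda>z. wt (snd z)) \<in> borel_measurable (rho \<Otimes>\<^sub>M rho)"
    using measurable_compose[OF measurable_snd wt_measurable] .
  have 3: "(\<lambda>z. indicator (A i) (snd z) :: ennreal) \<in> borel_measurable (rho \<Otimes>\<^sub>M rho)"
    using measurable_compose[OF measurable_snd borel_measurable_indicator[OF setsA]] .
  have "(\<lambda>z. ennreal (wt (snd z) * cmod (K (fst z) (snd z) - K (fst z) (centre i))) * indicator (A i) (snd z)) \<in> borel_measurable (rho \<Otimes>\<^sub>M rho)"
    using 1 2 3 K_measurable by measurable
  then show ?thesis
    unfolding piece_bound_def[abs_def] by (intro borel_measurable_nn_integral) (simp add: split_beta')
qed

text \<open>Tonelli's theorem puts the integration in \<open>x\<close> inside, where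
  \<open>y\<close> and \<open>centre i\<close> lie in the same admissible set and the regularity
  condition bounds the integral by \<open>N2\<close> for every \<open>y\<close>.\<close>

lemma piece_bound_integral:
  assumes ne: "A i \<noteq> {}"
  shows "(\<integral>\<^sup>+x\<in>axS - cz_star (A i). piece_bound i x \<partial>rho) \<le> ennreal (4 * height * N2) * emeasure rho (A i)"
proof -
  interpret pair_sigma_finite "rho :: ((real ^ 'n) \<times> real) measure" "rho :: ((real ^ 'n) \<times> real) measure"
    by (intro pair_sigma_finite.intro sigma_finite_rho)
  have cS: "centre i \<in> axS" by (rule in_axS[OF centre_in[OF ne]])
  have S: "axS - cz_star (A i) \<in> sets rho"
    using sets.compl_sets[OF cz_star_sets[OF CZA[OF ne]]] by simp
  define F where "F x y = ennreal (wt y) * indicator (A i) y *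
     (ennreal (cmod (K x y - K x (centre i))) * indicator (axS - cz_star (A i)) x)" for x y
  have 1: "(\<lambda>z. K (fst z) (centre i)) \<in> borel_measurable (rho \<Otimes>\<^sub>M rho)"
    using measurable_compose[OF measurable_fst K_section(2)[OF cS]] .
  have 2: "(\<lambda>z. wt (snd z)) \<in> borel_measurable (rho \<Otimes>\<^sub>M rho)"
    using measurable_compose[OF measurable_snd wt_measurable] .
  have 3: "(\<lambda>z. indicator (A i) (snd z) :: ennreal) \<in> borel_measurable (rho \<Otimes>\<^sub>M rho)"
    using measurable_compose[OF measurable_snd borel_measurable_indicator[OF setsA]] .
  have 4: "(\<lambda>z. indicator (axS - cz_star (A i)) (fst z) :: ennreal) \<in> borel_measurable (rho \<Otimes>\<^sub>M rho)"
    using measurable_compose[OF measurable_fst borel_measurable_indicator[OF S]] .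
  have Fm: "(\<lambda>z. F (fst z) (snd z)) \<in> borel_measurable (rho \<Otimes>\<^sub>M rho)"
    unfolding F_def using 1 2 3 4 K_measurable by measurable
  have "(\<integral>\<^sup>+x\<in>axS - cz_star (A i). piece_bound i x \<partial>rho) = (\<integral>\<^sup>+x. \<integral>\<^sup>+y. F x y \<partial>rho \<partial>rho)"
  proof (rule nn_integral_cong)
    fix x :: "(real ^ 'n) \<times> real" assume "x \<in> space rho"
    then have xS: "x \<in> axS" by simp
    have m: "(\<lambda>y. ennreal (wt y * cmod (K x y - K x (centre i))) * indicator (A i) y) \<in> borel_measurable rho"
      using K_section(1)[OF xS] wt_measurable setsA[of i] by measurable
    have "piece_bound i x * indicator (axS - cz_star (A i)) x =
        (\<integral>\<^sup>+y. ennreal (wt y * cmod (K x y - K x (centre i))) * indicator (A i) y * indicator (axS - cz_star (A i)) x \<partial>rho)"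
      unfolding piece_bound_def using m by (rule nn_integral_multc[symmetric])
    also have "\<dots> = (\<integral>\<^sup>+y. F x y \<partial>rho)"
      using height by (intro nn_integral_cong) (simp add: F_def ennreal_mult' wt_def mult_ac)
    finally show "piece_bound i x * indicator (axS - cz_star (A i)) x = (\<integral>\<^sup>+y. F x y \<partial>rho)" .
  qed
  also have "\<dots> = (\<integral>\<^sup>+y. \<integral>\<^sup>+x. F x y \<partial>rho \<partial>rho)"
    by (rule Fubini'[symmetric]) (use Fm in \<open>simp add: split_beta'\<close>)
  also have "\<dots> \<le> (\<integral>\<^sup>+y. ennreal (wt y) * indicator (A i) y * ennreal N2 \<partial>rho)"
  proof (rule nn_integral_mono)
    fix y :: "(real ^ 'n) \<times> real" assume "y \<in> space rho"
    then have yS: "y \<in> axS" by simp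
    have m: "(\<lambda>x. ennreal (cmod (K x y - K x (centre i))) * indicator (axS - cz_star (A i)) x) \<in> borel_measurable rho"
      using K_section(2)[OF yS] K_section(2)[OF cS] S by measurable
    have "(\<integral>\<^sup>+x. F x y \<partial>rho) = ennreal (wt y) * indicator (A i) y *
        (\<integral>\<^sup>+x\<in>axS - cz_star (A i). ennreal (cmod (K x y - K x (centre i))) \<partial>rho)"
      unfolding F_def using m by (rule nn_integral_cmult)
    also have "\<dots> \<le> ennreal (wt y) * indicator (A i) y * ennreal N2"
    proof (cases "y \<in> A i")
      case True
      show ?thesis by (intro mult_left_mono hormander_bound(2)[OF CZA[OF ne] True centre_in[OF ne]]) simp
    qed simp
    finally show "(\<integral>\<^sup>+x. F x y \<partial>rho) \<le> ennreal (wt y) * indicator (A i) y * ennreal N2" .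
  qed
  also have "\<dots> = (\<integral>\<^sup>+y\<in>A i. ennreal (wt y) \<partial>rho) * ennreal N2"
    using wt_measurable setsA[of i] by (intro nn_integral_multc) simp
  also have "\<dots> \<le> ennreal (4 * height) * emeasure rho (A i) * ennreal N2"
    by (intro mult_right_mono wt_integral) simp
  also have "\<dots> = ennreal (4 * height * N2) * emeasure rho (A i)"
    using height N2_nonneg by (simp add: ennreal_mult' mult_ac)
  finally show ?thesis .
qed

definition "total_bound x = (\<Sum>i. piece_bound i x)"

lemma Omega_star_sets: "Omega_star \<in> sets rho"
  unfolding Omega_star_def by (rule sets.countable_UN') (auto intro!: cz_star_sets CZA)

lemma total_bound_integral: "(\<integral>\<^sup>+x\<in>axS - Omega_star. total_bound x \<partial>rho) \<le> ennreal (4 * height * N2) * emeasure rho Omega"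
proof -
  have S: "axS - Omega_star \<in> sets rho" using sets.compl_sets[OF Omega_star_sets] by simp
  have "(\<integral>\<^sup>+x\<in>axS - Omega_star. total_bound x \<partial>rho) = (\<integral>\<^sup>+x. (\<Sum>i. piece_bound i x * indicator (axS - Omega_star) x) \<partial>rho)"
    unfolding total_bound_def by (intro nn_integral_cong) (simp add: ennreal_suminf_multc)
  also have "\<dots> = (\<Sum>i. \<integral>\<^sup>+x\<in>axS - Omega_star. piece_bound i x \<partial>rho)"
    using piece_bound_measurable S by (intro nn_integral_suminf) auto
  also have "\<dots> \<le> (\<Sum>i. ennreal (4 * height * N2) * emeasure rho (A i))"
  proof (intro suminf_le allI)
    fix i
    show "(\<integral>\<^sup>+x\<in>axS - Omega_star. piece_bound i x \<partial>rho) \<le> ennreal (4 * height * N2) * emeasure rho (A i)"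
    proof (cases "A i = {}")
      case True then show ?thesis by (simp add: piece_bound_def)
    next
      case False
      have "(\<integral>\<^sup>+x\<in>axS - Omega_star. piece_bound i x \<partial>rho) \<le> (\<integral>\<^sup>+x\<in>axS - cz_star (A i). piece_bound i x \<partial>rho)"
        using False by (intro nn_integral_mono) (auto simp: Omega_star_def indicator_def)
      also note piece_bound_integral[OF False]
      finally show ?thesis .
    qed
  qed auto
  also have "\<dots> = ennreal (4 * height * N2) * emeasure rho Omega"
    using setsA disj unfolding Omega_def by (subst ennreal_suminf_cmult) (subst suminf_emeasure, auto)
  finally show ?thesis .
qed

lemma Omega_star_emeasure: "emeasure rho Omega_star \<le> ennreal (2 * 3 ^ CARD('n)) * emeasure rho Omega"
proof -
  define B where "B i = (if A i = {} then {} else cz_star (A i))" for i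
  have B: "B i \<in> sets rho" for i unfolding B_def using cz_star_sets[OF CZA[of i]] by simp
  have "Omega_star = (\<Union>i. B i)" unfolding Omega_star_def B_def by auto
  then have "emeasure rho Omega_star \<le> (\<Sum>i. emeasure rho (B i))"
    using B by (simp only:) (rule emeasure_subadditive_countably, simp add: image_subset_iff)
  also have "\<dots> \<le> (\<Sum>i. ennreal (2 * 3 ^ CARD('n)) * emeasure rho (A i))"
    using cz_star_emeasure[OF CZA] by (intro suminf_le) (auto simp: B_def)
  also have "\<dots> = ennreal (2 * 3 ^ CARD('n)) * emeasure rho Omega"
    using setsA disj unfolding Omega_def by (subst ennreal_suminf_cmult) (subst suminf_emeasure, auto)
  finally show ?thesis .
qed

text \<open>A point outside the star of a piece is at distance at least the radius from all of it,
  while the diameter is at most \<open>diam_const\<close> times the radius. Distances from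
  \<open>x\<close> to two points of the piece thus differ at most by the factor
  \<open>1 + diam_const\<close>, and one near and one far point locate the whole piece.\<close>

lemma piece_location:
  assumes x: "x \<in> axS - cz_star (A i)" and y: "y \<in> A i"
    and y0: "y0 \<in> A i" "axd x y0 \<le> t" and y1: "y1 \<in> A i" "s \<le> axd x y1"
  shows "s / (1 + diam_const) \<le> axd x y" "axd x y \<le> (1 + diam_const) * t"
proof -
  have ne: "A i \<noteq> {}" using y by blast
  obtain r where r: "cz_with (A i) r" using CZA[OF ne] by (auto simp: CZ_def)
  have S: "y \<in> axS" "y0 \<in> axS" "y1 \<in> axS" "x \<in> axS" using in_axS y y0(1) y1(1) x by auto
  have far: "r \<le> axd x y" "r \<le> axd x y0"
    using cz_star_far[OF r y x] cz_star_far[OF r y0(1) x] by (simp_all add: axd_commute[of x])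
  have "axd x y1 \<le> axd x y + axd y y1" by (rule axd_triangle[OF S(4,3,1)])
  also have "axd y y1 \<le> diam_const * r" by (rule diam_const(2)[OF r y y1(1)])
  also have "diam_const * r \<le> diam_const * axd x y" using far(1) diam_const(1) by (intro mult_left_mono) auto
  finally have "s \<le> (1 + diam_const) * axd x y" using y1(2) by (simp add: algebra_simps)
  then show "s / (1 + diam_const) \<le> axd x y" using diam_const(1) by (simp add: pos_divide_le_eq mult.commute)
  have "axd x y \<le> axd x y0 + axd y0 y" by (rule axd_triangle[OF S(4,1,2)])
  also have "axd y0 y \<le> diam_const * r" by (rule diam_const(2)[OF r y0(1) y])
  also have "diam_const * r \<le> diam_const * axd x y0" using far(2) diam_const(1) by (intro mult_left_mono) auto
  also have "axd x y0 + diam_const * axd x y0 = (1 + diam_const) * axd x y0" by (simp add: algebra_simps)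
  also have "\<dots> \<le> (1 + diam_const) * t" using y0(2) diam_const(1) by (intro mult_left_mono) auto
  finally show "axd x y \<le> (1 + diam_const) * t" by simp
qed

text \<open>The selected pieces are disjoint and lie in one annulus, so the sum is a single integral
  over part of it.\<close>

lemma crossing_sum:
  assumes x: "x \<in> axS" and s: "0 < s" and t: "t \<le> 2 ^ shell_count * s"
    and J: "\<And>i y. i \<in> J \<Longrightarrow> y \<in> A i \<Longrightarrow> s \<le> axd x y \<and> axd x y \<le> t"
  shows "(\<Sum>i. if i \<in> J then (\<integral>\<^sup>+y\<in>A i. ennreal (cmod (K x y)) \<partial>rho) else 0) \<le> ennreal (real (shell_count + 1) * N1)"
proof -
  define B where "B i = (if i \<in> J then A i else {})" for i
  have B: "B i \<in> sets rho" for i using setsA by (simp add: B_def)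
  have dB: "disjoint_family B"
    using disj unfolding disjoint_family_on_def B_def by auto
  have Km: "(\<lambda>y. ennreal (cmod (K x y))) \<in> borel_measurable rho" using K_section(1)[OF x] by measurable
  have "(\<Sum>i. if i \<in> J then (\<integral>\<^sup>+y\<in>A i. ennreal (cmod (K x y)) \<partial>rho) else 0) = (\<Sum>i. \<integral>\<^sup>+y\<in>B i. ennreal (cmod (K x y)) \<partial>rho)"
    by (intro suminf_cong) (simp add: B_def)
  also have "\<dots> = (\<integral>\<^sup>+y\<in>(\<Union>i. B i). ennreal (cmod (K x y)) \<partial>rho)"
    by (rule nn_integral_UN_disjoint[OF Km dB B, symmetric])
  also have "\<dots> = (\<integral>\<^sup>+y\<in>(\<Union>i. B i). ennreal (cmod (K x y) * cmod (1 :: complex)) \<partial>rho)" by simp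
  also have "\<dots> \<le> ennreal (real (shell_count + 1) * N1 * 1)"
  proof (rule annulus_bound[OF x s t])
    fix y assume "y \<in> (\<Union>i. B i)"
    then obtain i where "i \<in> J" "y \<in> A i" unfolding B_def by (auto split: if_splits)
    then show "y \<in> axS \<and> s \<le> axd x y \<and> axd x y \<le> t" using J in_axS by blast
  qed auto
  finally show ?thesis by simp
qed

lemma crossing_total_bound:
  assumes "(\<Sum>i. if i \<in> J then (\<integral>\<^sup>+y\<in>A i. ennreal (cmod (K x y)) \<partial>rho) else 0) \<le> ennreal (real (shell_count + 1) * N1)"
  shows "(\<Sum>i. piece_bound i x + (if i \<in> J then ennreal (2 * height) * (\<integral>\<^sup>+y\<in>A i. ennreal (cmod (K x y)) \<partial>rho) else 0)) \<le>
     total_bound x + ennreal (2 * height * (real (shell_count + 1) * N1))"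
proof -
  have "(\<Sum>i. piece_bound i x + (if i \<in> J then ennreal (2 * height) * (\<integral>\<^sup>+y\<in>A i. ennreal (cmod (K x y)) \<partial>rho) else 0)) =
     (\<Sum>i. piece_bound i x + ennreal (2 * height) * (if i \<in> J then (\<integral>\<^sup>+y\<in>A i. ennreal (cmod (K x y)) \<partial>rho) else 0))"
    by (intro suminf_cong) simp
  also have "\<dots> = total_bound x + ennreal (2 * height) * (\<Sum>i. if i \<in> J then (\<integral>\<^sup>+y\<in>A i. ennreal (cmod (K x y)) \<partial>rho) else 0)"
    unfolding total_bound_def by (subst suminf_add[symmetric]) (auto simp: ennreal_suminf_cmult)
  also have "\<dots> \<le> total_bound x + ennreal (2 * height) * ennreal (real (shell_count + 1) * N1)"
    by (intro add_left_mono mult_left_mono assms) simp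
  also have "\<dots> = total_bound x + ennreal (2 * height * (real (shell_count + 1) * N1))"
    using height by (simp add: ennreal_mult'[symmetric])
  finally show ?thesis .
qed

text \<open>The pieces crossing the boundary of the truncation region all lie in one annulus of bounded ratio
  around \<open>x\<close>, so they contribute a multiple of \<open>N1\<close>.\<close>

lemma Tstar_bad:
  assumes x: "x \<in> axS - Omega_star"
  shows "Tstar K bad x \<le> total_bound x + ennreal (2 * height * (real (shell_count + 1) * N1))"
proof (rule Tstar_leI)
  fix R assume R: "R \<in> CZ" "x \<in> R"
  obtain r where r: "cz_with R r" using R(1) by (auto simp: CZ_def)
  have r0: "0 < r" using r by (rule cz_withE)
  have xS: "x \<in> axS" using x by simp
  have xi: "x \<in> axS - cz_star (A i)" if "A i \<noteq> {}" for i using x that unfolding Omega_star_def by auto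
  have C1: "0 < 1 + diam_const" using diam_const(1) by simp
  define W where "W = axS - cz_star R"
  have W: "W \<in> sets rho" using sets.compl_sets[OF cz_star_sets[OF R(1)]] by (simp add: W_def)
  \<comment> \<open>Pieces inside the star contribute nothing and pieces disjoint from it are
    integrated in full, with cancellation; only those cut by the boundary remain.\<close>
  define J where "J = {i. A i \<inter> cz_star R \<noteq> {} \<and> \<not> A i \<subseteq> cz_star R}"
  have int: "set_integrable rho W (\<lambda>y. K x y * bad y)"
    unfolding W_def by (rule TI_integrable[OF bad_Linf_c R])
  have AW: "A i \<inter> W \<in> sets rho" for i using setsA W by (rule sets.Int)
  have iU: "set_integrable rho (\<Union>i. A i \<inter> W) (\<lambda>y. K x y * bad y)"
    by (rule set_integrable_subset[OF int sets.countable_UN]) (use AW in \<open>auto simp: image_subset_iff\<close>)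
  have "TI bad R x = (LINT y:W|rho. K x y * bad y)" by (simp add: TI_def W_def)
  also have "\<dots> = (LINT y:(\<Union>i. A i \<inter> W)|rho. K x y * bad y)"
    unfolding set_lebesgue_integral_def
  proof (rule Bochner_Integration.integral_cong[OF refl])
    fix y
    show "indicator W y *\<^sub>R (K x y * bad y) = indicator (\<Union>i. A i \<inter> W) y *\<^sub>R (K x y * bad y)"
    proof (cases "y \<in> Omega")
      case True
      then show ?thesis unfolding Omega_def by (auto simp: indicator_def)
    next
      case False
      then show ?thesis by (simp add: bad_off)
    qed
  qed
  also have "\<dots> = (\<Sum>i. LINT y:A i \<inter> W|rho. K x y * bad y)"
    by (rule lebesgue_integral_countable_add[OF AW _ iU])
      (use disj in \<open>auto simp: disjoint_family_on_def\<close>)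
  finally have TIe: "TI bad R x = (\<Sum>i. LINT y:A i \<inter> W|rho. K x y * bad y)" .
  have "ennreal (cmod (\<Sum>i. LINT y:A i \<inter> W|rho. K x y * bad y)) \<le>
     (\<Sum>i. piece_bound i x + (if i \<in> J then ennreal (2 * height) * (\<integral>\<^sup>+y\<in>A i. ennreal (cmod (K x y)) \<partial>rho) else 0))"
  proof (rule ennreal_norm_suminf_le)
    fix i
    show "ennreal (cmod (LINT y:A i \<inter> W|rho. K x y * bad y)) \<le>
      piece_bound i x + (if i \<in> J then ennreal (2 * height) * (\<integral>\<^sup>+y\<in>A i. ennreal (cmod (K x y)) \<partial>rho) else 0)"
    proof (cases "A i \<subseteq> cz_star R")
      case True
      then have "A i \<inter> W = {}" unfolding W_def by auto
      then show ?thesis by (simp add: set_lebesgue_integral_def)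
    next
      case nsub: False
      then have ne: "A i \<noteq> {}" by auto
      show ?thesis
      proof (cases "A i \<inter> cz_star R = {}")
        case True
        then have e: "A i \<inter> W = A i" unfolding W_def using in_axS[of _ i] by auto
        have "set_integrable rho (A i) (\<lambda>y. K x y * bad y)"
          using set_integrable_subset[OF int AW[of i]] unfolding e by (metis e inf_le2)
        from piece_cancel[OF xS this] show ?thesis unfolding e by (rule add_increasing2[rotated]) simp
      next
        case False
        then have J: "i \<in> J" using nsub by (simp add: J_def)
        have "ennreal (cmod (LINT y:A i \<inter> W|rho. K x y * bad y)) \<le>
            (\<integral>\<^sup>+y. ennreal (norm (indicator (A i \<inter> W) y *\<^sub>R (K x y * bad y))) \<partial>rho)"
          unfolding set_lebesgue_integral_def
          by (rule integral_norm_bound_ennreal)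
            (use set_integrable_subset[OF int AW[of i]] in \<open>simp add: set_integrable_def\<close>)
        also have "\<dots> \<le> (\<integral>\<^sup>+y\<in>A i. ennreal (cmod (K x y) * cmod (bad y)) \<partial>rho)"
          by (intro nn_integral_mono) (simp add: indicator_def norm_mult)
        also note piece_abs[OF xS ne]
        finally show ?thesis using J by simp
      qed
    qed
  qed
  also have "\<dots> \<le> total_bound x + ennreal (2 * height * (real (shell_count + 1) * N1))"
  proof (rule crossing_total_bound, rule crossing_sum[OF xS, where s = "r / (1 + diam_const)" and t = "(1 + diam_const) * ((1 + diam_const) * r)"])
    show "0 < r / (1 + diam_const)" using r0 C1 by simp
    have "(1 + diam_const) ^ 3 \<le> 2 ^ shell_count" using shell_count C1 by (smt (verit) zero_less_power)
    then have "(1 + diam_const) ^ 3 * r \<le> 2 ^ shell_count * r" using r0 by (intro mult_right_mono) auto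
    then show "(1 + diam_const) * ((1 + diam_const) * r) \<le> 2 ^ shell_count * (r / (1 + diam_const))"
      using C1 by (simp add: pos_le_divide_eq power3_eq_cube mult_ac)
    fix i y assume i: "i \<in> J" and y: "y \<in> A i"
    have ne: "A i \<noteq> {}" using y by blast
    obtain y0 where y0: "y0 \<in> A i" "y0 \<in> cz_star R" using i unfolding J_def by blast
    obtain y1 where y1: "y1 \<in> A i" "y1 \<notin> cz_star R" using i unfolding J_def by blast
    have S: "y0 \<in> axS" "y1 \<in> axS" using in_axS y0(1) y1(1) by auto
    \<comment> \<open>A point of the piece outside the star is at distance at least \<open>r\<close>
      from \<open>x\<close>, one inside at distance at most \<open>(1 + diam_const) * r\<close>;
      \<open>piece_location\<close> turns the two into an annulus containing the piece.\<close>
    have d1: "r \<le> axd x y1" using cz_star_far[OF r R(2), of y1] S(2) y1(2) by simp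
    obtain z where z: "z \<in> R" "axd y0 z < r" using y0(2) mem_cz_star_iff[OF r S(1)] by blast
    have zS: "z \<in> axS" using cz_subset_axS[OF r] z(1) by (rule subsetD)
    have "axd x y0 \<le> axd x z + axd z y0" by (rule axd_triangle[OF xS S(1) zS])
    moreover have "axd x z \<le> diam_const * r" by (rule diam_const(2)[OF r R(2) z(1)])
    ultimately have d0: "axd x y0 \<le> (1 + diam_const) * r" using z(2) by (simp add: axd_commute[of z] algebra_simps)
    show "r / (1 + diam_const) \<le> axd x y \<and> axd x y \<le> (1 + diam_const) * ((1 + diam_const) * r)"
      using piece_location[OF xi[OF ne] y y0(1) d0 y1(1) d1] by simp
  qed
  finally show "ennreal (cmod (TI bad R x)) \<le> total_bound x + ennreal (2 * height * (real (shell_count + 1) * N1))"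
    unfolding TIe .
qed

text \<open>The same splitting for absolute values: the good part is covered by the size condition,
  and a piece that meets the shell lies in a slightly larger annulus. The bound does not depend on
  \<open>s\<close>, so it covers the shells in which \<open>Tstar_far\<close> finds the support of
  \<open>f\<close>.\<close>

lemma shell_f:
  assumes x: "x \<in> axS - Omega_star" and s: "0 < s"
  shows "(\<integral>\<^sup>+y\<in>{y \<in> axS. s < axd x y \<and> axd x y \<le> 2 * s}. ennreal (cmod (K x y) * cmod (f y)) \<partial>rho) \<le>
     total_bound x + ennreal (2 * height * (real (shell_count + 1) * N1) + 2 * N1 * height)"
proof -
  have xS: "x \<in> axS" using x by simp
  have xi: "x \<in> axS - cz_star (A i)" if "A i \<noteq> {}" for i using x that unfolding Omega_star_def by auto
  have C1: "0 < 1 + diam_const" using diam_const(1) by simp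
  define W where "W = {y \<in> space rho. s < axd x y \<and> axd x y \<le> 2 * s}"
  have W: "W \<in> sets rho" unfolding W_def using axd_measurable(2)[OF xS] by measurable
  define J where "J = {i. A i \<inter> W \<noteq> {}}"
  have Km: "K x \<in> borel_measurable rho" using K_section(1)[OF xS] .
  have gm: "good \<in> borel_measurable rho" by (rule good_measurable)
  have Kb: "(\<lambda>y. ennreal (cmod (K x y) * cmod (bad y)) * indicator W y) \<in> borel_measurable rho"
    using Km bad_measurable W by measurable
  have "(\<integral>\<^sup>+y\<in>W. ennreal (cmod (K x y) * cmod (f y)) \<partial>rho) \<le>
      (\<integral>\<^sup>+y. ennreal (cmod (K x y) * cmod (bad y)) * indicator W y + ennreal (cmod (K x y) * cmod (good y)) * indicator W y \<partial>rho)"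
  proof (rule nn_integral_mono)
    fix y
    have "cmod (f y) \<le> cmod (bad y) + cmod (good y)"
      using norm_triangle_ineq[of "bad y" "good y"] by (simp add: bad_def)
    then have "cmod (K x y) * cmod (f y) \<le> cmod (K x y) * (cmod (bad y) + cmod (good y))"
      by (intro mult_left_mono) auto
    then have "ennreal (cmod (K x y) * cmod (f y)) \<le> ennreal (cmod (K x y) * cmod (bad y) + cmod (K x y) * cmod (good y))"
      by (intro ennreal_leI) (simp add: distrib_left)
    also have "\<dots> = ennreal (cmod (K x y) * cmod (bad y)) + ennreal (cmod (K x y) * cmod (good y))" by simp
    finally show "ennreal (cmod (K x y) * cmod (f y)) * indicator W y \<le>
      ennreal (cmod (K x y) * cmod (bad y)) * indicator W y + ennreal (cmod (K x y) * cmod (good y)) * indicator W y"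
      by (simp add: indicator_def)
  qed
  also have "\<dots> = (\<integral>\<^sup>+y\<in>W. ennreal (cmod (K x y) * cmod (bad y)) \<partial>rho) + (\<integral>\<^sup>+y\<in>W. ennreal (cmod (K x y) * cmod (good y)) \<partial>rho)"
    using Km gm Kb W by (intro nn_integral_add) auto
  also have "(\<integral>\<^sup>+y\<in>W. ennreal (cmod (K x y) * cmod (good y)) \<partial>rho) \<le> ennreal (real (1 + 1) * N1 * height)"
    by (rule annulus_bound[OF xS s _ _ good_bound, of "2 * s" 1]) (use height in \<open>auto simp: W_def\<close>)
  also have "(\<integral>\<^sup>+y\<in>W. ennreal (cmod (K x y) * cmod (bad y)) \<partial>rho) \<le>
     (\<Sum>i. piece_bound i x + (if i \<in> J then ennreal (2 * height) * (\<integral>\<^sup>+y\<in>A i. ennreal (cmod (K x y)) \<partial>rho) else 0))"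
  proof -
    have m: "(\<lambda>y. ennreal (cmod (K x y) * cmod (bad y))) \<in> borel_measurable rho"
      using Km bad_measurable by measurable
    have AW: "A i \<inter> W \<in> sets rho" for i using setsA W by (rule sets.Int)
    have dAW: "disjoint_family (\<lambda>i. A i \<inter> W)"
      using disj unfolding disjoint_family_on_def by auto
    have "(\<integral>\<^sup>+y\<in>W. ennreal (cmod (K x y) * cmod (bad y)) \<partial>rho) = (\<integral>\<^sup>+y\<in>(\<Union>i. A i \<inter> W). ennreal (cmod (K x y) * cmod (bad y)) \<partial>rho)"
    proof (rule nn_integral_cong)
      fix y
      show "ennreal (cmod (K x y) * cmod (bad y)) * indicator W y = ennreal (cmod (K x y) * cmod (bad y)) * indicator (\<Union>i. A i \<inter> W) y"
      proof (cases "y \<in> Omega")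
        case True
        then show ?thesis unfolding Omega_def by (auto simp: indicator_def)
      next
        case False
        then show ?thesis by (simp add: bad_off)
      qed
    qed
    also have "\<dots> = (\<Sum>i. \<integral>\<^sup>+y\<in>A i \<inter> W. ennreal (cmod (K x y) * cmod (bad y)) \<partial>rho)"
      by (rule nn_integral_UN_disjoint[OF m dAW AW])
    also have "\<dots> \<le> (\<Sum>i. piece_bound i x + (if i \<in> J then ennreal (2 * height) * (\<integral>\<^sup>+y\<in>A i. ennreal (cmod (K x y)) \<partial>rho) else 0))"
    proof (intro suminf_le allI)
      fix i
      show "(\<integral>\<^sup>+y\<in>A i \<inter> W. ennreal (cmod (K x y) * cmod (bad y)) \<partial>rho) \<le>
        piece_bound i x + (if i \<in> J then ennreal (2 * height) * (\<integral>\<^sup>+y\<in>A i. ennreal (cmod (K x y)) \<partial>rho) else 0)"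
      proof (cases "i \<in> J")
        case True
        then have ne: "A i \<noteq> {}" unfolding J_def by auto
        have "(\<integral>\<^sup>+y\<in>A i \<inter> W. ennreal (cmod (K x y) * cmod (bad y)) \<partial>rho) \<le> (\<integral>\<^sup>+y\<in>A i. ennreal (cmod (K x y) * cmod (bad y)) \<partial>rho)"
          by (intro nn_integral_mono) (simp add: indicator_def)
        also note piece_abs[OF xS ne]
        finally show ?thesis using True by simp
      next
        case False
        then have "A i \<inter> W = {}" unfolding J_def by simp
        then show ?thesis by simp
      qed
    qed auto
    finally show ?thesis .
  qed
  also have "\<dots> \<le> total_bound x + ennreal (2 * height * (real (shell_count + 1) * N1))"
  proof (rule crossing_total_bound, rule crossing_sum[OF xS, where s = "s / (1 + diam_const)" and t = "(1 + diam_const) * (2 * s)"])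
    show "0 < s / (1 + diam_const)" using s C1 by simp
    have "(1 + diam_const) ^ 2 * 1 \<le> (1 + diam_const) ^ 2 * (1 + diam_const)" using diam_const(1) by (intro mult_left_mono) auto
    then have "2 * (1 + diam_const)\<^sup>2 \<le> 2 ^ shell_count" using shell_count by (simp add: power3_eq_cube power2_eq_square)
    then have "2 * (1 + diam_const)\<^sup>2 * s \<le> 2 ^ shell_count * s" using s by (intro mult_right_mono) auto
    moreover have "2 * (1 + diam_const)\<^sup>2 * s = (1 + diam_const) * (2 * s) * (1 + diam_const)" by (simp only: power2_eq_square mult_ac)
    ultimately have "(1 + diam_const) * (2 * s) * (1 + diam_const) \<le> 2 ^ shell_count * s" by simp
    then show "(1 + diam_const) * (2 * s) \<le> 2 ^ shell_count * (s / (1 + diam_const))"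
      using pos_le_divide_eq[OF C1] by (simp only: times_divide_eq_right)
    fix i y assume i: "i \<in> J" and y: "y \<in> A i"
    have ne: "A i \<noteq> {}" using y by blast
    obtain y0 where y0: "y0 \<in> A i" "y0 \<in> W" using i unfolding J_def by blast
    then have d: "axd x y0 \<le> 2 * s" "s \<le> axd x y0" unfolding W_def by auto
    show "s / (1 + diam_const) \<le> axd x y \<and> axd x y \<le> (1 + diam_const) * (2 * s)"
      using piece_location[OF xi[OF ne] y y0(1) d(1) y0(1) d(2)] by simp
  qed
  finally show ?thesis
    using height N1_nonneg unfolding W_def
    by (simp add: add.assoc ennreal_plus[symmetric] add_mono del: ennreal_plus)
qed

end

section \<open>Splitting a function at a prescribed level\<close>

context cz_kernel
begin

text \<open>The first summand pays for the stars of the pieces, the second for the set where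
  \<open>total_bound\<close> exceeds half the level; its 8 is 4 from
  \<open>total_bound_integral\<close> times 2 from Chebyshev's inequality.\<close>

definition Cb :: real where
  "Cb = 2 * 3 ^ CARD('n) + 8 * 2 ^ CARD('n) * N2"

lemma Cb_nonneg: "0 \<le> Cb"
  unfolding Cb_def using N2_nonneg by simp

text \<open>The terms that accompany \<open>total_bound\<close> are proportional to the height, that
  is to \<open>\<Gamma> * \<alpha>\<close>, so a small \<open>\<gamma>\<close> keeps them below half
  of \<open>\<alpha>\<close>. \<open>\<Gamma>\<close> stays free below \<open>\<gamma>\<close> so
  that the bound of \<open>g\<close> can later be adapted to the constant of
  \<open>OSC\<close>.\<close>

lemma good_bad_decomposition:
  obtains \<gamma> :: real where "0 < \<gamma>"
    "\<forall>f \<alpha> \<Gamma>. f \<in> Linf_c \<longrightarrow> 0 < \<alpha> \<longrightarrow> 0 < \<Gamma> \<longrightarrow> \<Gamma> \<le> \<gamma> \<longrightarrow> (\<exists>g E. g \<in> Linf_c \<and>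
      (AE x in rho. cmod (g x) \<le> 2 ^ CARD('n) * \<Gamma> * \<alpha>) \<and> E \<in> sets rho \<and>
      ennreal (\<Gamma> * \<alpha> / 2) * emeasure rho E \<le>
        ennreal Cb * (\<integral>\<^sup>+x. (if ennreal (\<Gamma> * \<alpha> / 2) < emod f x then emod f x else 0) \<partial>rho) \<and>
      (\<forall>x\<in>axS - E. Tstar K (\<lambda>y. f y - g y) x \<le> ennreal \<alpha> \<and>
        (\<forall>s>0. (\<integral>\<^sup>+y\<in>{y \<in> axS. s < axd x y \<and> axd x y \<le> 2 * s}. ennreal (cmod (K x y) * cmod (f y)) \<partial>rho) \<le> ennreal \<alpha>)))"
proof -
  \<comment> \<open>The coefficient of \<open>\<Gamma> * \<alpha>\<close> in the bound of
    \<open>shell_f\<close>, the larger of the two bounds to be controlled.\<close>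
  define q where "q = 2 * (2 ^ CARD('n)) * (real (shell_count + 1) * N1) + 2 * N1 * 2 ^ CARD('n)"
  have q: "0 \<le> q" unfolding q_def using N1_nonneg by simp
  define \<gamma> where "\<gamma> = min 1 (1 / (2 * (q + 1)))"
  have \<gamma>: "0 < \<gamma>" "\<gamma> \<le> 1" unfolding \<gamma>_def using q by auto
  have \<gamma>q: "q * \<Gamma> \<le> 1 / 2" if "0 < \<Gamma>" "\<Gamma> \<le> \<gamma>" for \<Gamma>
  proof -
    have "q * \<Gamma> \<le> (q + 1) * (1 / (2 * (q + 1)))"
      using that q unfolding \<gamma>_def by (intro mult_mono) auto
    also have "\<dots> = 1 / 2" using q by simp
    finally show ?thesis .
  qed
  show ?thesis
  proof (rule that[OF \<gamma>(1)], intro allI impI)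
    fix f :: "(real ^ 'n) \<times> real \<Rightarrow> complex" and \<alpha> \<Gamma> assume f: "f \<in> Linf_c" and \<alpha>: "(0::real) < \<alpha>" and \<Gamma>: "(0::real) < \<Gamma>" "\<Gamma> \<le> \<gamma>"
    define \<beta> where "\<beta> = \<Gamma> * \<alpha>"
    have \<beta>: "0 < \<beta>" using \<alpha> \<Gamma> by (simp add: \<beta>_def)
    have hm: "emod f \<in> borel_measurable rho" using Linf_c_measurable[OF f] by measurable
    have hf: "(\<integral>\<^sup>+x. emod f x \<partial>rho) < \<infinity>" using Linf_c_powr_finite[OF f, of 1] by simp
    obtain A :: "nat \<Rightarrow> ((real ^ 'n) \<times> real) set" where A: "disjoint_family A"
      "\<forall>i. A i \<noteq> {} \<longrightarrow> A i \<in> CZ"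
      "\<forall>i. A i \<in> sets rho"
      "\<forall>i. ennreal \<beta> * emeasure rho (A i) \<le> (\<integral>\<^sup>+x\<in>A i. emod f x \<partial>rho)"
      "\<forall>i. (\<integral>\<^sup>+x\<in>A i. emod f x \<partial>rho) \<le> ennreal (2 ^ CARD('n) * \<beta>) * emeasure rho (A i)"
      "AE x in rho. x \<notin> (\<Union>i. A i) \<longrightarrow> emod f x \<le> ennreal \<beta>"
      "ennreal (\<beta> / 2) * emeasure rho (\<Union>i. A i) \<le> (\<integral>\<^sup>+x. (if ennreal (\<beta> / 2) < emod f x then emod f x else 0) \<partial>rho)"
      using cz_decomposition[OF hm hf \<beta>] .
    interpret cz_pieces K f \<beta> A
      by unfold_locales (use f \<beta> A in auto)
    have height_eq: "height = 2 ^ CARD('n) * \<Gamma> * \<alpha>" by (simp only: height_def) (simp add: \<beta>_def)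
    define E2 where "E2 = {x \<in> space rho. x \<notin> Omega_star \<and> ennreal (\<alpha> / 2) < total_bound x}"
    have Pm: "total_bound \<in> borel_measurable rho"
      unfolding total_bound_def[abs_def] using piece_bound_measurable by measurable
    have E2: "E2 \<in> sets rho" unfolding E2_def using Pm Omega_star_sets by measurable
    have E2m: "emeasure rho E2 \<le> ennreal (8 * 2 ^ CARD('n) * N2) * emeasure rho Omega"
    proof -
      have "ennreal (\<alpha> / 2) * emeasure rho E2 = (\<integral>\<^sup>+x. ennreal (\<alpha> / 2) * indicator E2 x \<partial>rho)"
        using E2 by (simp add: nn_integral_cmult)
      also have "\<dots> \<le> (\<integral>\<^sup>+x\<in>axS - Omega_star. total_bound x \<partial>rho)"
        by (intro nn_integral_mono) (auto simp: E2_def indicator_def)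
      also have "\<dots> \<le> ennreal (4 * height * N2) * emeasure rho Omega" by (rule total_bound_integral)
      finally have "ennreal (2 / \<alpha>) * (ennreal (\<alpha> / 2) * emeasure rho E2) \<le> ennreal (2 / \<alpha>) * (ennreal (4 * height * N2) * emeasure rho Omega)"
        by (intro mult_left_mono) auto
      moreover have "ennreal (2 / \<alpha>) * ennreal (\<alpha> / 2) = 1" using \<alpha> by (simp add: ennreal_mult'[symmetric])
      moreover have "ennreal (2 / \<alpha>) * ennreal (4 * height * N2) = ennreal (8 * 2 ^ CARD('n) * N2 * \<Gamma>)"
        using \<alpha> by (simp add: ennreal_mult'[symmetric] height_eq mult_ac)
      ultimately have "emeasure rho E2 \<le> ennreal (8 * 2 ^ CARD('n) * N2 * \<Gamma>) * emeasure rho Omega"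
        by (simp add: mult.assoc[symmetric])
      also have "\<dots> \<le> ennreal (8 * 2 ^ CARD('n) * N2) * emeasure rho Omega"
        using \<Gamma> \<gamma>(2) N2_nonneg by (intro mult_right_mono ennreal_leI) (simp_all add: mult_left_le)
      finally show ?thesis .
    qed
    define E where "E = Omega_star \<union> E2"
    have E: "E \<in> sets rho" unfolding E_def using Omega_star_sets E2 by (rule sets.Un)
    have "emeasure rho E \<le> emeasure rho Omega_star + emeasure rho E2"
      unfolding E_def by (rule emeasure_subadditive[OF Omega_star_sets E2])
    also have "\<dots> \<le> ennreal (2 * 3 ^ CARD('n)) * emeasure rho Omega + ennreal (8 * 2 ^ CARD('n) * N2) * emeasure rho Omega"
      by (intro add_mono Omega_star_emeasure E2m)
    also have "\<dots> = ennreal Cb * emeasure rho Omega"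
      unfolding Cb_def using N2_nonneg by (simp add: distrib_right[symmetric] ennreal_plus[symmetric] del: ennreal_plus)
    finally have Em: "emeasure rho E \<le> ennreal Cb * emeasure rho Omega" .
    have "ennreal (\<beta> / 2) * emeasure rho E \<le> ennreal Cb * (ennreal (\<beta> / 2) * emeasure rho Omega)"
      using mult_left_mono[OF Em, of "ennreal (\<beta> / 2)"] by (simp add: mult_ac)
    also have "\<dots> \<le> ennreal Cb * (\<integral>\<^sup>+x. (if ennreal (\<beta> / 2) < emod f x then emod f x else 0) \<partial>rho)"
      using A(7) unfolding Omega_def by (intro mult_left_mono) simp_all
    finally have Em': "ennreal (\<beta> / 2) * emeasure rho E \<le> ennreal Cb * (\<integral>\<^sup>+x. (if ennreal (\<beta> / 2) < emod f x then emod f x else 0) \<partial>rho)" .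
    have half: "2 * height * (real (shell_count + 1) * N1) + 2 * N1 * height \<le> \<alpha> / 2"
    proof -
      have "2 * height * (real (shell_count + 1) * N1) + 2 * N1 * height = (q * \<Gamma>) * \<alpha>"
        unfolding height_eq q_def by (simp add: algebra_simps)
      also have "\<dots> \<le> 1 / 2 * \<alpha>" using \<gamma>q[OF \<Gamma>] \<alpha> by (intro mult_right_mono) auto
      finally show ?thesis by simp
    qed
    have add: "total_bound x + ennreal c \<le> ennreal \<alpha>" if x: "x \<in> axS - E" and c: "c \<le> \<alpha> / 2" for x c
    proof -
      have "total_bound x \<le> ennreal (\<alpha> / 2)" using x unfolding E_def E2_def by (auto simp: not_less)
      then have "total_bound x + ennreal c \<le> ennreal (\<alpha> / 2) + ennreal (\<alpha> / 2)"
        using c by (intro add_mono ennreal_leI)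
      also have "\<dots> = ennreal \<alpha>" using \<alpha> by (simp add: ennreal_plus[symmetric] del: ennreal_plus)
      finally show ?thesis .
    qed
    have pt: "Tstar K (\<lambda>y. f y - good y) x \<le> ennreal \<alpha> \<and>
        (\<forall>s>0. (\<integral>\<^sup>+y\<in>{y \<in> axS. s < axd x y \<and> axd x y \<le> 2 * s}. ennreal (cmod (K x y) * cmod (f y)) \<partial>rho) \<le> ennreal \<alpha>)"
      if x: "x \<in> axS - E" for x
    proof (intro conjI allI impI)
      have xO: "x \<in> axS - Omega_star" using x unfolding E_def by auto
      have "0 \<le> 2 * N1 * height" using height(1) N1_nonneg by simp
      then have "2 * height * (real (shell_count + 1) * N1) \<le> \<alpha> / 2" using half by linarith
      from order_trans[OF Tstar_bad[OF xO] add[OF x this]]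
      show "Tstar K (\<lambda>y. f y - good y) x \<le> ennreal \<alpha>" unfolding bad_def[abs_def] .
      fix s :: real assume "0 < s"
      from order_trans[OF shell_f[OF xO this] add[OF x half]]
      show "(\<integral>\<^sup>+y\<in>{y \<in> axS. s < axd x y \<and> axd x y \<le> 2 * s}. ennreal (cmod (K x y) * cmod (f y)) \<partial>rho) \<le> ennreal \<alpha>" .
    qed
    show "\<exists>g E. g \<in> Linf_c \<and>
      (AE x in rho. cmod (g x) \<le> 2 ^ CARD('n) * \<Gamma> * \<alpha>) \<and> E \<in> sets rho \<and>
      ennreal (\<Gamma> * \<alpha> / 2) * emeasure rho E \<le>
        ennreal Cb * (\<integral>\<^sup>+x. (if ennreal (\<Gamma> * \<alpha> / 2) < emod f x then emod f x else 0) \<partial>rho) \<and>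
      (\<forall>x\<in>axS - E. Tstar K (\<lambda>y. f y - g y) x \<le> ennreal \<alpha> \<and>
        (\<forall>s>0. (\<integral>\<^sup>+y\<in>{y \<in> axS. s < axd x y \<and> axd x y \<le> 2 * s}. ennreal (cmod (K x y) * cmod (f y)) \<partial>rho) \<le> ennreal \<alpha>))"
      using good_Linf_c good_bound E Em' pt unfolding height_eq \<beta>_def[symmetric]
      by (intro exI[of _ good] exI[of _ E] conjI ballI) simp_all
  qed
qed

text \<open>If \<open>x\<close> is at distance \<open>d > 2 * D\<close> from the unit, the support
  of \<open>f\<close> lies between the distances \<open>d / 2\<close> and \<open>2 * d\<close> from
  \<open>x\<close>, hence in two consecutive dyadic shells, and every truncation is bounded by the
  two shell integrals.\<close>

lemma Tstar_far:
  assumes f: "f \<in> Linf_c"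
  obtains B where "B \<in> sets rho" "emeasure rho B < \<infinity>"
    "\<forall>x a. x \<in> axS - B \<longrightarrow> (\<forall>s>0. (\<integral>\<^sup>+y\<in>{y \<in> axS. s < axd x y \<and> axd x y \<le> 2 * s}. ennreal (cmod (K x y) * cmod (f y)) \<partial>rho) \<le> a)
      \<longrightarrow> Tstar K f x \<le> 2 * a"
proof -
  obtain D0 where D0: "AE x in rho. f x \<noteq> 0 \<longrightarrow> axd x axe \<le> D0" using f by (rule Linf_c_support)
  define D where "D = max 1 D0"
  have D: "0 < D" "AE x in rho. f x \<noteq> 0 \<longrightarrow> axd x axe \<le> D"
    using D0 unfolding D_def by (auto elim!: eventually_mono)
  define B where "B = {x \<in> space (rho :: ((real ^ 'n) \<times> real) measure). axd x axe \<le> 2 * D}"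
  have B: "B \<in> sets rho" unfolding B_def using axd_measurable(1)[OF axe_in] by measurable
  have "emeasure rho B < \<infinity>"
  proof -
    obtain C :: "((real ^ 'n) \<times> real) set" where C: "compact C" "C \<subseteq> axS" "{p \<in> axS. axd p axe \<le> 2 * D} \<subseteq> C"
      using axd_ball_compact by blast
    have "emeasure rho B \<le> emeasure rho C"
      using C B unfolding B_def by (intro emeasure_mono borel_sets_rho borel_compact) auto
    then show ?thesis using emeasure_rho_compact[OF C(1,2)] by (rule le_less_trans)
  qed
  moreover have "Tstar K f x \<le> 2 * a" if x: "x \<in> axS - B" and
    a: "\<forall>s>0. (\<integral>\<^sup>+y\<in>{y \<in> axS. s < axd x y \<and> axd x y \<le> 2 * s}. ennreal (cmod (K x y) * cmod (f y)) \<partial>rho) \<le> a" for x a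
  proof (rule Tstar_leI)
    fix R assume R: "R \<in> CZ" "x \<in> R"
    have xS: "x \<in> axS" using x by simp
    define d where "d = axd x axe"
    have d: "2 * D < d" using x unfolding B_def d_def by auto
    define S where "S s = {y \<in> axS. s < axd x y \<and> axd x y \<le> 2 * s}" for s
    have Sm: "S s \<in> sets rho" for s
    proof -
      have "S s = {y \<in> space rho. s < axd x y \<and> axd x y \<le> 2 * s}" by (simp add: S_def)
      also have "\<dots> \<in> sets rho" using axd_measurable(2)[OF xS] by measurable
      finally show ?thesis .
    qed
    have Kf: "(\<lambda>y. ennreal (cmod (K x y) * cmod (f y))) \<in> borel_measurable rho"
      using K_section(1)[OF xS] Linf_c_measurable[OF f] by measurable
    have "ennreal (cmod (TI f R x)) \<le> (\<integral>\<^sup>+y. ennreal (norm (indicator (axS - cz_star R) y *\<^sub>R (K x y * f y))) \<partial>rho)"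
      unfolding TI_def set_lebesgue_integral_def
      by (rule integral_norm_bound_ennreal) (use TI_integrable[OF f R] in \<open>simp add: set_integrable_def\<close>)
    also have "\<dots> \<le> (\<integral>\<^sup>+y. ennreal (cmod (K x y) * cmod (f y)) * indicator (S (d / 2)) y + ennreal (cmod (K x y) * cmod (f y)) * indicator (S d) y \<partial>rho)"
    proof (rule nn_integral_mono_AE)
      show "AE y in rho. ennreal (norm (indicator (axS - cz_star R) y *\<^sub>R (K x y * f y))) \<le>
          ennreal (cmod (K x y) * cmod (f y)) * indicator (S (d / 2)) y + ennreal (cmod (K x y) * cmod (f y)) * indicator (S d) y"
        using D(2) AE_space
      proof eventually_elim
        case (elim y)
        then have yS: "y \<in> axS" by simp
        show ?case
        proof (cases "f y = 0")
          case False
          then have dy: "axd y axe \<le> D" using elim by simp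
          have "d \<le> axd x y + axd y axe" unfolding d_def by (rule axd_triangle[OF xS axe_in yS])
          moreover have "axd x y \<le> d + axd axe y" unfolding d_def by (rule axd_triangle[OF xS yS axe_in])
          ultimately have "d / 2 < axd x y" "axd x y \<le> 2 * d" using dy d by (simp_all add: axd_commute[of axe])
          then have "y \<in> S (d / 2) \<or> y \<in> S d" using yS unfolding S_def by auto
          moreover have "norm (indicator (axS - cz_star R) y *\<^sub>R (K x y * f y)) \<le> cmod (K x y) * cmod (f y)"
            by (simp add: indicator_def norm_mult)
          then have "ennreal (norm (indicator (axS - cz_star R) y *\<^sub>R (K x y * f y))) \<le> ennreal (cmod (K x y) * cmod (f y))"
            by (rule ennreal_leI)
          ultimately show ?thesis by (auto simp: indicator_def add_increasing add_increasing2)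
        qed simp
      qed
    qed
    also have "\<dots> = (\<integral>\<^sup>+y\<in>S (d / 2). ennreal (cmod (K x y) * cmod (f y)) \<partial>rho) + (\<integral>\<^sup>+y\<in>S d. ennreal (cmod (K x y) * cmod (f y)) \<partial>rho)"
      using Kf Sm by (intro nn_integral_add) auto
    also have "\<dots> \<le> a + a"
    proof (intro add_mono)
      have "0 < d" "0 < d / 2" using d D(1) by simp_all
      then show "(\<integral>\<^sup>+y\<in>S (d / 2). ennreal (cmod (K x y) * cmod (f y)) \<partial>rho) \<le> a"
        "(\<integral>\<^sup>+y\<in>S d. ennreal (cmod (K x y) * cmod (f y)) \<partial>rho) \<le> a"
        unfolding S_def using a by blast+
    qed
    finally show "ennreal (cmod (TI f R x)) \<le> 2 * a" by (simp add: mult_2)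
  qed
  ultimately show ?thesis using B by (intro that[of B]) simp_all
qed

end

section \<open>Local oscillation and the good-lambda inequality\<close>

lemma nn_integral_powr:
  fixes q t :: real
  assumes q: "0 < q" and t: "0 \<le> t"
  shows "(\<integral>\<^sup>+\<alpha>. ennreal (q * \<alpha> powr (q - 1)) * indicator {0<..<t} \<alpha> \<partial>lborel) = ennreal (t powr q)"
proof -
  have "((\<lambda>x. x powr (q - 1)) has_integral (t powr (q - 1 + 1) / (q - 1 + 1))) {0..t}"
    by (rule has_integral_powr_from_0) (use q t in auto)
  then have "((\<lambda>x. q * x powr (q - 1)) has_integral (q * (t powr q / q))) {0..t}"
    by (intro has_integral_mult_right) simp
  then have *: "((\<lambda>x. q * x powr (q - 1)) has_integral (t powr q)) {0..t}" using q by simp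
  have "(\<integral>\<^sup>+\<alpha>. ennreal (q * \<alpha> powr (q - 1)) * indicator {0<..<t} \<alpha> \<partial>lborel) =
      (\<integral>\<^sup>+\<alpha>. ennreal (indicator {0..t} \<alpha> * (q * \<alpha> powr (q - 1))) \<partial>lborel)"
    using AE_lborel_singleton[of t] AE_lborel_singleton[of 0]
    by (intro nn_integral_cong_AE) (auto simp: indicator_def elim!: eventually_rev_mp)
  also have "\<dots> = ennreal (t powr q)"
    by (rule nn_integral_has_integral_lebesgue[OF _ *]) (use q in auto)
  finally show ?thesis .
qed

context cz_kernel
begin

text \<open>If \<open>Tstar K g\<close> is at most \<open>\<beta>\<close> on a non-negligible part of an admissible set, then it exceeds \<open>\<beta>\<close> by
  a multiple of the bound of \<open>g\<close> only on a small part of it. The whole equivalence passes through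
  this property.\<close>

definition OSC :: bool where
  "OSC \<longleftrightarrow> (\<forall>\<epsilon>>0. \<exists>\<Lambda>\<ge>0. \<forall>g M R \<beta>. g \<in> Linf_c \<longrightarrow> 0 < M \<longrightarrow> (AE x in rho. cmod (g x) \<le> M) \<longrightarrow> R \<in> CZ \<longrightarrow> 0 \<le> \<beta> \<longrightarrow>
     ennreal \<epsilon> * emeasure rho R < emeasure rho {x \<in> R. Tstar K g x \<le> ennreal \<beta>} \<longrightarrow>
     emeasure rho {x \<in> R. ennreal (\<beta> + \<Lambda> * M) < Tstar K g x} \<le> ennreal \<epsilon> * emeasure rho R)"

definition lev where "lev f a = emeasure rho {x \<in> axS. ennreal a < Tstar K f x}"

definition tail :: "((real ^ 'n) \<times> real \<Rightarrow> complex) \<Rightarrow> real \<Rightarrow> ennreal" where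
  "tail f c = (\<integral>\<^sup>+x. (if ennreal c < emod f x then emod f x else 0) \<partial>rho)"

lemma level_sets [measurable]:
  assumes "f \<in> Linf_c"
  shows "{x \<in> axS. a < Tstar K f x} \<in> sets rho" "{x \<in> axS. Tstar K f x \<le> a} \<in> sets rho"
    and "R \<in> sets rho \<Longrightarrow> {x \<in> R. a < Tstar K f x} \<in> sets rho"
    and "R \<in> sets rho \<Longrightarrow> {x \<in> R. Tstar K f x \<le> a} \<in> sets rho"
proof -
  have T: "Tstar K f \<in> borel_measurable rho" by (rule Tstar_measurable[OF assms])
  have "{x \<in> space rho. a < Tstar K f x} \<in> sets rho" "{x \<in> space rho. Tstar K f x \<le> a} \<in> sets rho"
    using T by measurable
  then show *: "{x \<in> axS. a < Tstar K f x} \<in> sets rho" "{x \<in> axS. Tstar K f x \<le> a} \<in> sets rho" by simp_all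
  show "{x \<in> R. a < Tstar K f x} \<in> sets rho" if R: "R \<in> sets rho"
  proof -
    have "{x \<in> R. a < Tstar K f x} = R \<inter> {x \<in> axS. a < Tstar K f x}"
      using sets.sets_into_space[OF R] by auto
    then show ?thesis using sets.Int[OF R *(1)] by simp
  qed
  show "{x \<in> R. Tstar K f x \<le> a} \<in> sets rho" if R: "R \<in> sets rho"
  proof -
    have "{x \<in> R. Tstar K f x \<le> a} = R \<inter> {x \<in> axS. Tstar K f x \<le> a}"
      using sets.sets_into_space[OF R] by auto
    then show ?thesis using sets.Int[OF R *(2)] by simp
  qed
qed

lemma ennreal_cancel_le:
  assumes "0 < a" "ennreal a * x \<le> y" shows "x \<le> ennreal (1 / a) * y"
proof -
  have "ennreal (1 / a) * (ennreal a * x) \<le> ennreal (1 / a) * y" using assms(2) by (intro mult_left_mono) auto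
  moreover have "ennreal (1 / a) * ennreal a = 1" using assms(1) by (simp add: ennreal_mult'[symmetric])
  ultimately show ?thesis by (simp add: mult.assoc[symmetric])
qed

text \<open>At most half of a piece of the decomposition belongs to the level set \<open>U\<close>.
  Either the exceptional set \<open>E\<close> fills a quarter of the piece, which is then charged to
  \<open>E\<close>, or at least a quarter remains where \<open>Tstar K g\<close> is at most
  \<open>2 * \<alpha>\<close>, and \<open>OSC\<close> applies to \<open>g\<close>.\<close>

lemma good_lambda:
  assumes "OSC" and \<delta>: "0 < \<delta>"
  obtains c C where "0 < c" "0 \<le> C"
    "\<forall>f \<alpha>. f \<in> Linf_c \<longrightarrow> 0 < \<alpha> \<longrightarrow> lev f (4 * \<alpha>) \<le> ennreal \<delta> * lev f \<alpha> + ennreal (C / \<alpha>) * tail f (c * \<alpha>)"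
proof -
  define \<kappa> :: real where "\<kappa> = 2 ^ CARD('n)"
  have \<kappa>: "1 \<le> \<kappa>" by (simp add: \<kappa>_def)
  \<comment> \<open>Times the factor \<open>\<kappa>\<close> of the decomposition this is 1/2, so
    the level set fills at most half of a piece; from below it fills at least the fraction
    \<open>\<eta>\<close>.\<close>
  define \<eta> where "\<eta> = 1 / (2 * \<kappa>)"
  have \<eta>: "0 < \<eta>" "\<kappa> * \<eta> = 1 / 2" "\<eta> < 1" using \<kappa> by (auto simp: \<eta>_def field_simps)
  \<comment> \<open>1/8 stays below the quarter of a piece on which \<open>Tstar K g\<close> is
    known to be small; \<open>\<delta> * \<eta>\<close> leaves \<open>\<delta>\<close> when the
    measure of the pieces is bounded by \<open>1 / \<eta>\<close> times that of the level
    set.\<close>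
  define \<epsilon> where "\<epsilon> = min (1 / 8) (\<delta> * \<eta>)"
  have \<epsilon>: "0 < \<epsilon>" "\<epsilon> \<le> 1 / 8" "\<epsilon> \<le> \<delta> * \<eta>" using \<delta> \<eta> by (auto simp: \<epsilon>_def)
  obtain \<Lambda> where \<Lambda>: "0 \<le> \<Lambda>" and osc: "\<And>g M R \<beta>. g \<in> Linf_c \<Longrightarrow> 0 < M \<Longrightarrow> (AE x in rho. cmod (g x) \<le> M) \<Longrightarrow> R \<in> CZ \<Longrightarrow> 0 \<le> \<beta> \<Longrightarrow>
     ennreal \<epsilon> * emeasure rho R < emeasure rho {x \<in> R. Tstar K g x \<le> ennreal \<beta>} \<Longrightarrow>
     emeasure rho {x \<in> R. ennreal (\<beta> + \<Lambda> * M) < Tstar K g x} \<le> ennreal \<epsilon> * emeasure rho R"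
    using assms(1) \<epsilon>(1) unfolding OSC_def by blast
  obtain \<gamma> :: real where \<gamma>: "0 < \<gamma>" and dec:
    "\<forall>f \<alpha> \<Gamma>. f \<in> Linf_c \<longrightarrow> 0 < \<alpha> \<longrightarrow> 0 < \<Gamma> \<longrightarrow> \<Gamma> \<le> \<gamma> \<longrightarrow> (\<exists>g E. g \<in> Linf_c \<and>
      (AE x in rho. cmod (g x) \<le> 2 ^ CARD('n) * \<Gamma> * \<alpha>) \<and> E \<in> sets rho \<and>
      ennreal (\<Gamma> * \<alpha> / 2) * emeasure rho E \<le>
        ennreal Cb * (\<integral>\<^sup>+x. (if ennreal (\<Gamma> * \<alpha> / 2) < emod f x then emod f x else 0) \<partial>rho) \<and>
      (\<forall>x\<in>axS - E. Tstar K (\<lambda>y. f y - g y) x \<le> ennreal \<alpha> \<and>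
        (\<forall>s>0. (\<integral>\<^sup>+y\<in>{y \<in> axS. s < axd x y \<and> axd x y \<le> 2 * s}. ennreal (cmod (K x y) * cmod (f y)) \<partial>rho) \<le> ennreal \<alpha>)))"
    by (rule good_bad_decomposition)
  \<comment> \<open>Makes the bound \<open>M\<close> of the good part so small that
    \<open>\<Lambda> * M \<le> \<alpha>\<close>.\<close>
  define \<Gamma> where "\<Gamma> = min \<gamma> (1 / (\<kappa> * (\<Lambda> + 1)))"
  have \<Gamma>: "0 < \<Gamma>" "\<Gamma> \<le> \<gamma>" using \<gamma> \<kappa> \<Lambda> by (auto simp: \<Gamma>_def)
  have \<Lambda>\<Gamma>: "\<Lambda> * (\<kappa> * \<Gamma>) \<le> 1"
  proof -
    have "\<Lambda> * (\<kappa> * \<Gamma>) \<le> (\<Lambda> + 1) * (\<kappa> * (1 / (\<kappa> * (\<Lambda> + 1))))"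
      using \<Lambda> \<kappa> \<Gamma> by (intro mult_mono) (auto simp: \<Gamma>_def)
    also have "\<dots> = 1" using \<Lambda> \<kappa> by simp
    finally show ?thesis .
  qed
  \<comment> \<open>\<open>E\<close> is counted five times, four in the pieces and once directly;
    dividing by \<open>\<Gamma> * \<alpha> / 2\<close> supplies another 2.\<close>
  define C where "C = 10 * Cb / \<Gamma>"
  have C: "0 \<le> C" using Cb_nonneg \<Gamma> by (simp add: C_def)
  have main: "lev f (4 * \<alpha>) \<le> ennreal \<delta> * lev f \<alpha> + ennreal (C / \<alpha>) * tail f (\<Gamma> / 2 * \<alpha>)"
    if f: "f \<in> Linf_c" and \<alpha>: "0 < \<alpha>" for f \<alpha>
  proof (cases "lev f \<alpha> = \<infinity>")
    case True
    then show ?thesis using \<delta> by (simp add: ennreal_mult_top)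
  next
    case fin: False
    obtain g E where g: "g \<in> Linf_c" "AE x in rho. cmod (g x) \<le> 2 ^ CARD('n) * \<Gamma> * \<alpha>" and E: "E \<in> sets rho"
      and Em: "ennreal (\<Gamma> * \<alpha> / 2) * emeasure rho E \<le> ennreal Cb * (\<integral>\<^sup>+x. (if ennreal (\<Gamma> * \<alpha> / 2) < emod f x then emod f x else 0) \<partial>rho)"
      and pt: "\<forall>x\<in>axS - E. Tstar K (\<lambda>y. f y - g y) x \<le> ennreal \<alpha> \<and>
        (\<forall>s>0. (\<integral>\<^sup>+y\<in>{y \<in> axS. s < axd x y \<and> axd x y \<le> 2 * s}. ennreal (cmod (K x y) * cmod (f y)) \<partial>rho) \<le> ennreal \<alpha>)"
      using dec[rule_format, OF f \<alpha> \<Gamma>] by blast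
    define M where "M = \<kappa> * \<Gamma> * \<alpha>"
    have M: "0 < M" "AE x in rho. cmod (g x) \<le> M" using \<kappa> \<Gamma> \<alpha> g(2) by (auto simp: M_def \<kappa>_def)
    have \<Lambda>M: "\<Lambda> * M \<le> \<alpha>"
      using mult_right_mono[OF \<Lambda>\<Gamma>, of \<alpha>] \<alpha> by (simp add: M_def mult_ac)
    define U where "U = {x \<in> axS. ennreal \<alpha> < Tstar K f x}"
    define V where "V = {x \<in> axS. ennreal (4 * \<alpha>) < Tstar K f x}"
    have UV: "U \<in> sets rho" "V \<in> sets rho" unfolding U_def V_def by (rule level_sets(1)[OF f])+
    have VU: "V \<subseteq> U"
    proof
      fix x assume "x \<in> V"
      then have x: "x \<in> axS" "ennreal (4 * \<alpha>) < Tstar K f x" by (auto simp: V_def)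
      have "ennreal \<alpha> \<le> ennreal (4 * \<alpha>)" using \<alpha> by (intro ennreal_leI) simp
      then show "x \<in> U" using x unfolding U_def by (auto intro: le_less_trans)
    qed
    have hm: "(\<lambda>x. indicator U x :: ennreal) \<in> borel_measurable rho" using UV by simp
    have hf: "(\<integral>\<^sup>+x. indicator U x \<partial>rho) < \<infinity>" using UV fin by (simp add: lev_def U_def less_top)
    obtain A :: "nat \<Rightarrow> ((real ^ 'n) \<times> real) set" where A: "disjoint_family A"
      "\<forall>i. A i \<noteq> {} \<longrightarrow> A i \<in> CZ"
      "\<forall>i. A i \<in> sets rho"
      "\<forall>i. ennreal \<eta> * emeasure rho (A i) \<le> (\<integral>\<^sup>+x\<in>A i. indicator U x \<partial>rho)"
      "\<forall>i. (\<integral>\<^sup>+x\<in>A i. indicator U x \<partial>rho) \<le> ennreal (2 ^ CARD('n) * \<eta>) * emeasure rho (A i)"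
      "AE x in rho. x \<notin> (\<Union>i. A i) \<longrightarrow> indicator U x \<le> ennreal \<eta>"
      "ennreal (\<eta> / 2) * emeasure rho (\<Union>i. A i) \<le> (\<integral>\<^sup>+x. (if ennreal (\<eta> / 2) < indicator U x then indicator U x else 0) \<partial>rho)"
      using cz_decomposition[OF hm hf \<eta>(1)] .
    have As: "A i \<in> sets rho" for i using A(3) by simp
    have AU: "(\<integral>\<^sup>+x\<in>A i. indicator U x \<partial>rho) = emeasure rho (A i \<inter> U)" for i
    proof -
      have "(\<integral>\<^sup>+x\<in>A i. indicator U x \<partial>rho) = (\<integral>\<^sup>+x. indicator (A i \<inter> U) x \<partial>rho)"
        by (intro nn_integral_cong) (auto simp: indicator_def)
      then show ?thesis using As UV(1) by simp
    qed
    have piece: "emeasure rho (A i \<inter> (V - E)) \<le> ennreal \<epsilon> * emeasure rho (A i) + 4 * emeasure rho (A i \<inter> E)" for i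
    proof (cases "emeasure rho (A i) \<le> 4 * emeasure rho (A i \<inter> E)")
      case True
      have "emeasure rho (A i \<inter> (V - E)) \<le> emeasure rho (A i)" using As by (intro emeasure_mono) auto
      also note True
      finally show ?thesis by (rule order_trans) simp
    next
      case False
      then have ne: "A i \<noteq> {}" by auto
      have CZi: "A i \<in> CZ" using A(2) ne by simp
      define a where "a = measure rho (A i)"
      have em: "emeasure rho B = ennreal (measure rho B)" if "B \<subseteq> A i" "B \<in> sets rho" for B
      proof -
        have "emeasure rho B \<le> emeasure rho (A i)" using that As by (intro emeasure_mono)
        also have "\<dots> < \<infinity>" by (rule cz_emeasure_finite[OF CZi])
        finally show ?thesis by (intro emeasure_eq_ennreal_measure) simp
      qed
      have a: "emeasure rho (A i) = ennreal a" unfolding a_def by (rule em[OF subset_refl As])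
      have a0: "0 < a" using cz_emeasure_pos[OF CZi] unfolding a by simp
      have sE: "A i \<inter> E \<in> sets rho" "A i \<inter> U \<in> sets rho" using As E UV(1) by auto
      define e u where "e = measure rho (A i \<inter> E)" and "u = measure rho (A i \<inter> U)"
      have e: "emeasure rho (A i \<inter> E) = ennreal e" unfolding e_def by (rule em[OF _ sE(1)]) auto
      have u: "emeasure rho (A i \<inter> U) = ennreal u" unfolding u_def by (rule em[OF _ sE(2)]) auto
      have eu0: "0 \<le> e" "0 \<le> u" by (simp_all add: e_def u_def)
      have e4: "4 * e < a"
      proof -
        have "4 * ennreal e < ennreal a" using False unfolding a e by simp
        also have "4 * ennreal e = ennreal (4 * e)" using eu0 by (simp add: ennreal_mult')
        finally show ?thesis by (metis ennreal_less_iff eu0(1) mult_nonneg_nonneg zero_le_numeral)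
      qed
      have u2: "u \<le> a / 2"
      proof -
        have "ennreal u \<le> ennreal (\<kappa> * \<eta>) * ennreal a" using A(5) unfolding AU \<kappa>_def[symmetric] u[symmetric] a[symmetric] by simp
        also have "\<dots> = ennreal (1 / 2 * a)" unfolding \<eta>(2) by (rule ennreal_mult'[symmetric]) simp
        also have "\<dots> = ennreal (a / 2)" by simp
        finally show ?thesis using a0 by (simp add: ennreal_le_iff)
      qed
      define G where "G = {x \<in> A i. Tstar K g x \<le> ennreal (2 * \<alpha>)}"
      have Gs: "G \<in> sets rho" unfolding G_def by (rule level_sets(4)[OF g(1) As])
      have inS: "x \<in> axS" if "x \<in> A i" for x using sets.sets_into_space[OF As[of i]] that by auto
      have cover: "A i \<subseteq> (A i \<inter> E) \<union> (A i \<inter> U) \<union> G"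
      proof
        fix x assume x: "x \<in> A i"
        show "x \<in> (A i \<inter> E) \<union> (A i \<inter> U) \<union> G"
        proof (cases "x \<in> E \<or> x \<in> U")
          case False
          have "Tstar K g x \<le> Tstar K f x + Tstar K (\<lambda>y. f y - g y) x" by (rule Tstar_triangle'[OF f g(1)])
          also have "\<dots> \<le> ennreal \<alpha> + ennreal \<alpha>"
            using False pt inS[OF x] unfolding U_def by (intro add_mono) (auto simp: not_less)
          also have "\<dots> = ennreal (2 * \<alpha>)" using \<alpha> by (simp add: ennreal_plus[symmetric] del: ennreal_plus)
          finally have "x \<in> G" using x unfolding G_def by simp
          then show ?thesis by simp
        qed (use x in auto)
      qed
      have "emeasure rho (A i) \<le> emeasure rho ((A i \<inter> E) \<union> (A i \<inter> U) \<union> G)"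
        using cover sE Gs by (intro emeasure_mono) auto
      also have "\<dots> \<le> emeasure rho ((A i \<inter> E) \<union> (A i \<inter> U)) + emeasure rho G"
        using sE Gs by (intro emeasure_subadditive) auto
      also have "\<dots> \<le> (emeasure rho (A i \<inter> E) + emeasure rho (A i \<inter> U)) + emeasure rho G"
        using sE by (intro add_right_mono emeasure_subadditive) auto
      finally have sum: "ennreal a \<le> ennreal e + ennreal u + emeasure rho G" unfolding a e u .
      have Gm: "emeasure rho G = ennreal (measure rho G)" by (rule em[OF _ Gs]) (auto simp: G_def)
      have "ennreal a \<le> ennreal (e + u + measure rho G)"
        using sum eu0 unfolding Gm by (simp add: ennreal_plus[symmetric] del: ennreal_plus)
      moreover have "0 \<le> e + u + measure rho G" using eu0 by simp
      ultimately have "a \<le> e + u + measure rho G" by (subst (asm) ennreal_le_iff)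
      moreover have "\<epsilon> * a \<le> 1 / 8 * a" using \<epsilon>(2) a0 by (intro mult_right_mono) auto
      ultimately have "\<epsilon> * a < measure rho G" using e4 u2 a0 by linarith
      then have "ennreal \<epsilon> * emeasure rho (A i) < emeasure rho G"
        unfolding a Gm using a0 \<epsilon>(1) by (simp add: ennreal_mult'[symmetric] ennreal_less_iff)
      then have "emeasure rho {x \<in> A i. ennreal (2 * \<alpha> + \<Lambda> * M) < Tstar K g x} \<le> ennreal \<epsilon> * emeasure rho (A i)"
        unfolding G_def using \<alpha> by (intro osc[OF g(1) M CZi]) auto
      \<comment> \<open>The level \<open>4 * \<alpha>\<close> is made up of
        \<open>2 * \<alpha>\<close> for \<open>Tstar K g\<close> on \<open>G\<close>, one
        \<open>\<alpha>\<close> for the excess allowed by \<open>OSC\<close>, and one for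
        \<open>Tstar\<close> of the bad part.\<close>
      moreover have "A i \<inter> (V - E) \<subseteq> {x \<in> A i. ennreal (2 * \<alpha> + \<Lambda> * M) < Tstar K g x}"
      proof
        fix x assume x: "x \<in> A i \<inter> (V - E)"
        have "ennreal (2 * \<alpha> + \<Lambda> * M) < Tstar K g x"
        proof (rule ccontr)
          assume "\<not> ?thesis"
          then have "Tstar K g x \<le> ennreal (2 * \<alpha> + \<Lambda> * M)" by simp
          also have "\<dots> \<le> ennreal (3 * \<alpha>)" using \<Lambda>M by (intro ennreal_leI) simp
          finally have "Tstar K g x \<le> ennreal (3 * \<alpha>)" .
          moreover have "Tstar K (\<lambda>y. f y - g y) x \<le> ennreal \<alpha>" using pt x inS by auto
          ultimately have "Tstar K g x + Tstar K (\<lambda>y. f y - g y) x \<le> ennreal (3 * \<alpha>) + ennreal \<alpha>" by (rule add_mono)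
          also have "\<dots> = ennreal (4 * \<alpha>)" using \<alpha> by (simp add: ennreal_plus[symmetric] del: ennreal_plus)
          finally have "Tstar K f x \<le> ennreal (4 * \<alpha>)" using Tstar_triangle[OF f g(1), of x] by (rule order_trans[rotated])
          then show False using x unfolding V_def by (auto simp: not_less[symmetric])
        qed
        then show "x \<in> {x \<in> A i. ennreal (2 * \<alpha> + \<Lambda> * M) < Tstar K g x}" using x by simp
      qed
      then have "emeasure rho (A i \<inter> (V - E)) \<le> emeasure rho {x \<in> A i. ennreal (2 * \<alpha> + \<Lambda> * M) < Tstar K g x}"
        by (intro emeasure_mono level_sets(3)[OF g(1) As])
      ultimately have "emeasure rho (A i \<inter> (V - E)) \<le> ennreal \<epsilon> * emeasure rho (A i)" by (rule order_trans[rotated])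
      then show ?thesis by (rule add_increasing2[rotated]) simp
    qed
    have VE: "V - E \<in> sets rho" using UV(2) E by (rule sets.Diff)
    have UA: "(\<Union>i. A i) \<in> sets rho" by (rule sets.countable_UN) (simp add: image_subset_iff As)
    have Vi: "A i \<inter> (V - E) \<in> sets rho" "A i \<inter> E \<in> sets rho" "A i \<inter> U \<in> sets rho" for i
      using sets.Int[OF As VE] sets.Int[OF As E] sets.Int[OF As UV(1)] by auto
    have sumle: "(\<Sum>i. emeasure rho (A i \<inter> B)) \<le> emeasure rho B" if B: "B \<in> sets rho" for B
    proof -
      have "(\<Sum>i. emeasure rho (A i \<inter> B)) = emeasure rho (\<Union>i. A i \<inter> B)"
        using As B A(1) by (intro suminf_emeasure) (auto simp: disjoint_family_on_def)
      also have "\<dots> \<le> emeasure rho B" using B by (intro emeasure_mono) auto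
      finally show ?thesis .
    qed
    have "emeasure rho (V - E) \<le> emeasure rho (\<Union>i. A i \<inter> (V - E))"
    proof (rule emeasure_mono_AE)
      show "(\<Union>i. A i \<inter> (V - E)) \<in> sets rho"
        by (rule sets.countable_UN) (simp add: image_subset_iff Vi)
      show "AE x in rho. x \<in> V - E \<longrightarrow> x \<in> (\<Union>i. A i \<inter> (V - E))"
        using A(6)
      proof eventually_elim
        case (elim x)
        show ?case
        proof
          assume x: "x \<in> V - E"
          then have "x \<in> U" using VU by auto
          \<comment> \<open>The indicator is 1 on \<open>U\<close>, above \<open>\<eta>\<close>, so
            the pieces cover \<open>U\<close> up to a null set.\<close>
          then have "\<not> indicator U x \<le> ennreal \<eta>" using \<eta>(3) by (simp add: indicator_def not_le)
          then have "x \<in> (\<Union>i. A i)" using elim by blast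
          then show "x \<in> (\<Union>i. A i \<inter> (V - E))" using x by blast
        qed
      qed
    qed
    also have "\<dots> = (\<Sum>i. emeasure rho (A i \<inter> (V - E)))"
      using Vi(1) A(1) by (intro suminf_emeasure[symmetric]) (auto simp: disjoint_family_on_def)
    also have "\<dots> \<le> (\<Sum>i. ennreal \<epsilon> * emeasure rho (A i) + 4 * emeasure rho (A i \<inter> E))"
      using piece by (intro suminf_le) auto
    also have "\<dots> = ennreal \<epsilon> * (\<Sum>i. emeasure rho (A i)) + 4 * (\<Sum>i. emeasure rho (A i \<inter> E))"
      by (subst suminf_add[symmetric]) (auto simp: ennreal_suminf_cmult)
    also have "\<dots> \<le> ennreal \<delta> * emeasure rho U + 4 * emeasure rho E"
    proof (intro add_mono mult_left_mono sumle E)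
      have "ennreal \<epsilon> * (\<Sum>i. emeasure rho (A i)) \<le> ennreal \<delta> * (ennreal \<eta> * (\<Sum>i. emeasure rho (A i)))"
        using \<epsilon>(3) \<delta> \<eta>(1) by (simp add: mult.assoc[symmetric] ennreal_mult'[symmetric] mult_right_mono ennreal_leI)
      also have "ennreal \<eta> * (\<Sum>i. emeasure rho (A i)) = (\<Sum>i. ennreal \<eta> * emeasure rho (A i))"
        by (simp add: ennreal_suminf_cmult)
      also have "\<dots> \<le> (\<Sum>i. emeasure rho (A i \<inter> U))"
        using A(4) unfolding AU by (intro suminf_le) auto
      also have "\<dots> \<le> emeasure rho U" by (rule sumle[OF UV(1)])
      finally show "ennreal \<epsilon> * (\<Sum>i. emeasure rho (A i)) \<le> ennreal \<delta> * emeasure rho U"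
        by (simp add: mult_left_mono)
    qed simp
    finally have 1: "emeasure rho (V - E) \<le> ennreal \<delta> * emeasure rho U + 4 * emeasure rho E" .
    have "emeasure rho V \<le> emeasure rho (V - E) + emeasure rho E"
    proof -
      have "emeasure rho V \<le> emeasure rho ((V - E) \<union> E)" by (intro emeasure_mono sets.Un VE E) auto
      also have "\<dots> \<le> emeasure rho (V - E) + emeasure rho E" by (rule emeasure_subadditive[OF VE E])
      finally show ?thesis .
    qed
    also have "\<dots> \<le> (ennreal \<delta> * emeasure rho U + 4 * emeasure rho E) + emeasure rho E"
      by (intro add_right_mono 1)
    also have "\<dots> = ennreal \<delta> * emeasure rho U + 5 * emeasure rho E"
    proof -
      have "(4::ennreal) * emeasure rho E + emeasure rho E = (4 + 1) * emeasure rho E"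
        by (simp only: distrib_right mult_1)
      then show ?thesis by (simp add: add.assoc)
    qed
    also have "5 * emeasure rho E \<le> ennreal (C / \<alpha>) * tail f (\<Gamma> / 2 * \<alpha>)"
    proof -
      have pos: "0 < \<Gamma> * \<alpha> / 2" using \<Gamma> \<alpha> by simp
      have "emeasure rho E \<le> ennreal (1 / (\<Gamma> * \<alpha> / 2)) * (ennreal Cb * tail f (\<Gamma> / 2 * \<alpha>))"
        using ennreal_cancel_le[OF pos Em] unfolding tail_def by simp
      then have "5 * emeasure rho E \<le> 5 * (ennreal (1 / (\<Gamma> * \<alpha> / 2)) * (ennreal Cb * tail f (\<Gamma> / 2 * \<alpha>)))"
        by (intro mult_left_mono) auto
      also have "\<dots> = (ennreal 5 * (ennreal (1 / (\<Gamma> * \<alpha> / 2)) * ennreal Cb)) * tail f (\<Gamma> / 2 * \<alpha>)"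
        by (simp add: mult.assoc)
      also have "ennreal 5 * (ennreal (1 / (\<Gamma> * \<alpha> / 2)) * ennreal Cb) = ennreal (C / \<alpha>)"
        using \<Gamma> \<alpha> Cb_nonneg unfolding C_def
        by (subst ennreal_mult'[symmetric], simp, subst ennreal_mult'[symmetric], simp, intro arg_cong[where f = ennreal]) (simp add: field_simps)
      finally show ?thesis .
    qed
    finally show ?thesis unfolding lev_def U_def V_def by (simp add: add_left_mono)
  qed
  show ?thesis
    by (rule that[of "\<Gamma> / 2" C]) (use \<Gamma> C main in auto)
qed

text \<open>The a priori finiteness needed to absorb terms in the iteration of the good-lambda inequality.\<close>

lemma lev_finite:
  assumes f: "f \<in> Linf_c"
  obtains v C where "0 \<le> v" "0 \<le> C" "\<forall>\<alpha>>0. lev f \<alpha> \<le> ennreal (v + C / \<alpha>)"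
proof -
  obtain \<gamma> :: real where \<gamma>: "0 < \<gamma>" and dec:
    "\<forall>f \<alpha> \<Gamma>. f \<in> Linf_c \<longrightarrow> 0 < \<alpha> \<longrightarrow> 0 < \<Gamma> \<longrightarrow> \<Gamma> \<le> \<gamma> \<longrightarrow> (\<exists>g E. g \<in> Linf_c \<and>
      (AE x in rho. cmod (g x) \<le> 2 ^ CARD('n) * \<Gamma> * \<alpha>) \<and> E \<in> sets rho \<and>
      ennreal (\<Gamma> * \<alpha> / 2) * emeasure rho E \<le>
        ennreal Cb * (\<integral>\<^sup>+x. (if ennreal (\<Gamma> * \<alpha> / 2) < emod f x then emod f x else 0) \<partial>rho) \<and>
      (\<forall>x\<in>axS - E. Tstar K (\<lambda>y. f y - g y) x \<le> ennreal \<alpha> \<and>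
        (\<forall>s>0. (\<integral>\<^sup>+y\<in>{y \<in> axS. s < axd x y \<and> axd x y \<le> 2 * s}. ennreal (cmod (K x y) * cmod (f y)) \<partial>rho) \<le> ennreal \<alpha>)))"
    by (rule good_bad_decomposition)
  obtain B where B: "B \<in> sets rho" "emeasure rho B < \<infinity>" and far:
    "\<forall>x a. x \<in> axS - B \<longrightarrow> (\<forall>s>0. (\<integral>\<^sup>+y\<in>{y \<in> axS. s < axd x y \<and> axd x y \<le> 2 * s}. ennreal (cmod (K x y) * cmod (f y)) \<partial>rho) \<le> a)
      \<longrightarrow> Tstar K f x \<le> 2 * a"
    using f by (rule Tstar_far)
  define n1 where "n1 = enn2real (\<integral>\<^sup>+x. emod f x \<partial>rho)"
  have n1: "(\<integral>\<^sup>+x. emod f x \<partial>rho) = ennreal n1" "0 \<le> n1"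
    using Linf_c_powr_finite[OF f, of 1] by (simp_all add: n1_def)
  define v where "v = measure rho B"
  define C where "C = 4 / \<gamma> * Cb * n1"
  have v: "emeasure rho B = ennreal v" "0 \<le> v"
    using B(2) unfolding v_def by (auto intro!: emeasure_eq_ennreal_measure)
  have C: "0 \<le> C" using \<gamma> Cb_nonneg n1 by (simp add: C_def)
  have "lev f \<alpha> \<le> ennreal (v + C / \<alpha>)" if \<alpha>: "0 < \<alpha>" for \<alpha>
  proof -
    have \<alpha>2: "0 < \<alpha> / 2" using \<alpha> by simp
    obtain g E where E: "E \<in> sets rho"
      and Em: "ennreal (\<gamma> * (\<alpha> / 2) / 2) * emeasure rho E \<le> ennreal Cb * (\<integral>\<^sup>+x. (if ennreal (\<gamma> * (\<alpha> / 2) / 2) < emod f x then emod f x else 0) \<partial>rho)"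
      and pt: "\<forall>x\<in>axS - E. Tstar K (\<lambda>y. f y - g y) x \<le> ennreal (\<alpha> / 2) \<and>
        (\<forall>s>0. (\<integral>\<^sup>+y\<in>{y \<in> axS. s < axd x y \<and> axd x y \<le> 2 * s}. ennreal (cmod (K x y) * cmod (f y)) \<partial>rho) \<le> ennreal (\<alpha> / 2))"
      using dec[rule_format, OF f \<alpha>2 \<gamma> order_refl] by blast
    have sub: "{x \<in> axS. ennreal \<alpha> < Tstar K f x} \<subseteq> B \<union> E"
    proof
      fix x assume x: "x \<in> {x \<in> axS. ennreal \<alpha> < Tstar K f x}"
      show "x \<in> B \<union> E"
      proof (rule ccontr)
        assume n: "x \<notin> B \<union> E"
        then have "x \<in> axS - B" "x \<in> axS - E" using x by auto
        then have "Tstar K f x \<le> 2 * ennreal (\<alpha> / 2)" using far pt by blast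
        also have "2 * ennreal (\<alpha> / 2) = ennreal (2 * (\<alpha> / 2))" using \<alpha> by (subst ennreal_mult') auto
        finally show False using x by (simp add: not_less[symmetric])
      qed
    qed
    have "lev f \<alpha> \<le> emeasure rho (B \<union> E)"
      unfolding lev_def using sub B(1) E by (intro emeasure_mono) auto
    also have "\<dots> \<le> emeasure rho B + emeasure rho E" by (rule emeasure_subadditive[OF B(1) E])
    also have "emeasure rho E \<le> ennreal (1 / (\<gamma> * (\<alpha> / 2) / 2)) * (ennreal Cb * (\<integral>\<^sup>+x. (if ennreal (\<gamma> * (\<alpha> / 2) / 2) < emod f x then emod f x else 0) \<partial>rho))"
      by (rule ennreal_cancel_le[OF _ Em]) (use \<gamma> \<alpha> in simp)
    also have "\<dots> \<le> ennreal (1 / (\<gamma> * (\<alpha> / 2) / 2)) * (ennreal Cb * ennreal n1)"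
      unfolding n1(1)[symmetric] by (intro mult_left_mono nn_integral_mono) auto
    also have "\<dots> = ennreal (C / \<alpha>)"
      using \<gamma> \<alpha> Cb_nonneg n1 unfolding C_def by (simp add: ennreal_mult'[symmetric] field_simps)
    finally show ?thesis using v C \<alpha> by (simp add: ennreal_plus)
  qed
  then show ?thesis using v C by (intro that[of v C]) auto
qed

text \<open>With \<open>\<delta> = 1 / 8\<close> the quantity \<open>a * lev f a\<close> is halved,
  up to an additive constant, in passing from \<open>a\<close> to \<open>4 * a\<close>. The
  iteration starts at \<open>\<alpha> / 4 ^ k\<close>, where \<open>lev_finite\<close> bounds it
  independently of \<open>k\<close>; letting \<open>k\<close> tend to infinity removes the starting
  value.\<close>

lemma weak_type_of_OSC:
  assumes OSC
  obtains C where "0 \<le> C" "\<forall>f \<alpha>. f \<in> Linf_c \<longrightarrow> 0 < \<alpha> \<longrightarrow> ennreal \<alpha> * lev f \<alpha> \<le> ennreal C * (\<integral>\<^sup>+x. emod f x \<partial>rho)"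
proof -
  obtain c C where c: "0 < c" and C: "0 \<le> C" and gl:
    "\<forall>f \<alpha>. f \<in> Linf_c \<longrightarrow> 0 < \<alpha> \<longrightarrow> lev f (4 * \<alpha>) \<le> ennreal (1 / 8) * lev f \<alpha> + ennreal (C / \<alpha>) * tail f (c * \<alpha>)"
    using good_lambda[OF assms, of "1 / 8"] by auto
  have "ennreal \<alpha> * lev f \<alpha> \<le> ennreal (8 * C) * (\<integral>\<^sup>+x. emod f x \<partial>rho)" if f: "f \<in> Linf_c" and \<alpha>: "0 < \<alpha>" for f \<alpha>
  proof -
    define n1 where "n1 = enn2real (\<integral>\<^sup>+x. emod f x \<partial>rho)"
    have n1: "(\<integral>\<^sup>+x. emod f x \<partial>rho) = ennreal n1" "0 \<le> n1"
      using Linf_c_powr_finite[OF f, of 1] by (simp_all add: n1_def)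
    obtain v C' where v: "0 \<le> v" "0 \<le> C'" "\<forall>\<alpha>>0. lev f \<alpha> \<le> ennreal (v + C' / \<alpha>)"
      using f by (rule lev_finite)
    define l where "l a = enn2real (lev f a)" for a
    have l: "lev f a = ennreal (l a)" "0 \<le> l a" "l a \<le> v + C' / a" if "0 < a" for a
    proof -
      have le: "lev f a \<le> ennreal (v + C' / a)" using v(3) that by simp
      then have "lev f a < top" by (rule le_less_trans) simp
      then show e: "lev f a = ennreal (l a)" by (simp add: l_def)
      show "0 \<le> l a" by (simp add: l_def)
      have "0 \<le> v + C' / a" using v that by simp
      then show "l a \<le> v + C' / a" using le unfolding e by (simp add: ennreal_le_iff)
    qed
    have step: "4 * a * l (4 * a) \<le> a * l a / 2 + 4 * C * n1" if a: "0 < a" for a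
    proof -
      have "tail f (c * a) \<le> ennreal n1"
        unfolding tail_def n1(1)[symmetric] by (intro nn_integral_mono) auto
      then have "lev f (4 * a) \<le> ennreal (1 / 8) * lev f a + ennreal (C / a) * ennreal n1"
        using gl[rule_format, OF f a] by (intro order_trans[OF gl[rule_format, OF f a]] add_left_mono mult_left_mono) auto
      also have "\<dots> = ennreal (1 / 8 * l a + C / a * n1)"
        using l[OF a] C n1 a by (simp add: ennreal_mult'[symmetric] ennreal_plus[symmetric] del: ennreal_plus)
      finally have "ennreal (l (4 * a)) \<le> ennreal (1 / 8 * l a + C / a * n1)"
        using l(1)[of "4 * a"] a by simp
      moreover have "0 \<le> 1 / 8 * l a + C / a * n1" using l(2)[OF a] C n1(2) a by simp
      ultimately have "l (4 * a) \<le> 1 / 8 * l a + C / a * n1" by (subst (asm) ennreal_le_iff)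
      then have "4 * a * l (4 * a) \<le> 4 * a * (1 / 8 * l a + C / a * n1)"
        using a by (intro mult_left_mono) auto
      also have "\<dots> = a * l a / 2 + 4 * C * n1" using a by (simp add: field_simps)
      finally show ?thesis .
    qed
    have iter: "\<forall>a>0. (4 ^ k * a) * l (4 ^ k * a) \<le> a * l a / 2 ^ k + 8 * C * n1" for k
    proof (induction k)
      case 0 then show ?case using C n1 by simp
    next
      case (Suc k)
      show ?case
      proof (intro allI impI)
        fix a :: real assume a: "0 < a"
        have "(4 ^ Suc k * a) * l (4 ^ Suc k * a) = 4 * (4 ^ k * a) * l (4 * (4 ^ k * a))" by (simp add: mult_ac)
        also have "\<dots> \<le> (4 ^ k * a) * l (4 ^ k * a) / 2 + 4 * C * n1" using a by (intro step) simp
        also have "\<dots> \<le> (a * l a / 2 ^ k + 8 * C * n1) / 2 + 4 * C * n1" using Suc.IH a by (simp add: divide_right_mono)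
        also have "\<dots> = a * l a / 2 ^ Suc k + 8 * C * n1" by (simp add: field_simps)
        finally show "(4 ^ Suc k * a) * l (4 ^ Suc k * a) \<le> a * l a / 2 ^ Suc k + 8 * C * n1" .
      qed
    qed
    have "\<alpha> * l \<alpha> \<le> (v * \<alpha> + C') * (1 / 2) ^ k + 8 * C * n1" for k
    proof -
      define a where "a = \<alpha> / 4 ^ k"
      have a: "0 < a" "4 ^ k * a = \<alpha>" "a \<le> \<alpha>" using \<alpha> by (auto simp: a_def divide_le_eq mult_le_cancel_left1)
      have "\<alpha> * l \<alpha> \<le> a * l a / 2 ^ k + 8 * C * n1" using iter[of k] a by metis
      also have "a * l a \<le> a * (v + C' / a)" using l(3)[OF a(1)] a by (intro mult_left_mono) auto
      also have "\<dots> = v * a + C'" using a by (simp add: field_simps)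
      also have "\<dots> \<le> v * \<alpha> + C'" using a v by (simp add: mult_left_mono)
      finally show ?thesis by (simp add: divide_right_mono power_divide)
    qed
    moreover have "(\<lambda>k. (v * \<alpha> + C') * (1 / 2) ^ k + 8 * C * n1) \<longlonglongrightarrow> (v * \<alpha> + C') * 0 + 8 * C * n1"
      by (rule tendsto_add[OF tendsto_mult[OF tendsto_const LIMSEQ_realpow_zero] tendsto_const]) auto
    ultimately have "\<alpha> * l \<alpha> \<le> (v * \<alpha> + C') * 0 + 8 * C * n1"
      by (intro LIMSEQ_le_const) auto
    then have "\<alpha> * l \<alpha> \<le> 8 * C * n1" by simp
    then have "ennreal (\<alpha> * l \<alpha>) \<le> ennreal (8 * C * n1)" by (rule ennreal_leI)
    then show ?thesis using \<alpha> C n1 l[OF \<alpha>] by (simp add: ennreal_mult')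
  qed
  then show ?thesis using C by (intro that[of "8 * C"]) auto
qed

end

section \<open>Powers of extended nonnegative numbers and absorption\<close>

lemma epow_ennreal: "0 \<le> t \<Longrightarrow> epow (ennreal t) p = ennreal (t powr p)"
  by (simp add: epow_def)

lemma epow_top: "epow top p = top"
  by (simp add: epow_def)

lemma epow_one: "epow t 1 = t"
  by (simp add: epow_def less_top)

lemma epow_measurable [measurable]:
  assumes "g \<in> borel_measurable M" shows "(\<lambda>x. epow (g x) p) \<in> borel_measurable M"
  unfolding epow_def using assms by measurable

lemma ennreal_inverse_mult: "0 < a \<Longrightarrow> ennreal (1 / a) * ennreal a = 1"
  by (simp add: ennreal_mult'[symmetric])

lemma absorb_half:
  fixes x d :: ennreal
  assumes "x < top" "x \<le> ennreal (1 / 2) * x + d"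
  shows "x \<le> 2 * d"
proof (cases d)
  case (real r)
  obtain a where a: "x = ennreal a" "0 \<le> a" using assms(1) by (cases x) auto
  have "ennreal (1 / 2) * ennreal a + ennreal r = ennreal (1 / 2 * a + r)"
    using a real by (subst ennreal_mult''[symmetric]) (simp_all only: ennreal_plus mult_nonneg_nonneg zero_le_divide_1_iff zero_le_numeral)
  then have "ennreal a \<le> ennreal (1 / 2 * a + r)"
    using assms(2) a(1) real(2) by (simp only:)
  then have "a \<le> 1 / 2 * a + r" using a real by (subst (asm) ennreal_le_iff) auto
  then have "ennreal a \<le> ennreal (2 * r)" by (intro ennreal_leI) simp
  then show ?thesis using a real by (simp add: ennreal_mult')
next
  case top then show ?thesis by (simp add: ennreal_mult_top)
qed

context cz_kernel
begin

text \<open>The layer-cake integrals truncated at level \<open>N\<close> satisfy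
  \<open>F (4 * N) \<le> F N / 2 + D\<close> by the good-lambda inequality; being finite by
  \<open>lev_finite\<close>, they can be absorbed before \<open>N\<close> tends to infinity. The
  tail term is integrated first in the level, which yields \<open>cmod (f x) powr p\<close> up to a
  constant because \<open>p > 1\<close>.\<close>

lemma nn_integral_Lp_of_OSC:
  assumes OSC and p: "1 < p"
  obtains C where "0 \<le> C"
    "\<forall>f. f \<in> Linf_c \<longrightarrow> (\<integral>\<^sup>+x. epow (Tstar K f x) p \<partial>rho) \<le> ennreal C * (\<integral>\<^sup>+x. ennreal (cmod (f x) powr p) \<partial>rho)"
proof -
  \<comment> \<open>Substituting \<open>4 * \<alpha>\<close> for the level multiplies the integral
    by \<open>4 powr p\<close>; half of the inverse leaves the factor 1/2.\<close>
  have \<delta>0: "0 < 4 powr (- p) / 2" by simp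
  obtain c C where c: "0 < c" and C: "0 \<le> C" and gl:
    "\<forall>f \<alpha>. f \<in> Linf_c \<longrightarrow> 0 < \<alpha> \<longrightarrow> lev f (4 * \<alpha>) \<le> ennreal (4 powr (- p) / 2) * lev f \<alpha> + ennreal (C / \<alpha>) * tail f (c * \<alpha>)"
    by (rule good_lambda[OF assms(1) \<delta>0])
  define C' where "C' = 2 * (4 powr p * C * (p / (p - 1) * c powr (1 - p)))"
  have C': "0 \<le> C'" using C p by (simp add: C'_def)
  have "(\<integral>\<^sup>+x. epow (Tstar K f x) p \<partial>rho) \<le> ennreal C' * (\<integral>\<^sup>+x. ennreal (cmod (f x) powr p) \<partial>rho)"
    if f: "f \<in> Linf_c" for f
  proof -
    interpret LR: pair_sigma_finite "lborel :: real measure" "rho :: ((real ^ 'n) \<times> real) measure"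
      by (intro pair_sigma_finite.intro sigma_finite_rho sigma_finite_lborel)

    have fm: "f \<in> borel_measurable rho" by (rule Linf_c_measurable[OF f])
    have Tm: "Tstar K f \<in> borel_measurable rho" by (rule Tstar_measurable[OF f])
    have Tm2: "(\<lambda>z. Tstar K f (snd z)) \<in> borel_measurable (lborel \<Otimes>\<^sub>M rho)"
      using measurable_compose[OF measurable_snd Tm] .
    have fm2: "(\<lambda>z. emod f (snd z)) \<in> borel_measurable (lborel \<Otimes>\<^sub>M rho)"
      using measurable_compose[OF measurable_snd fm] by measurable
    have a2: "(\<lambda>z. fst z :: real) \<in> borel_measurable (lborel \<Otimes>\<^sub>M (rho :: ((real ^ 'n) \<times> real) measure))"
      using measurable_compose[OF measurable_fst, of "\<lambda>x. x" lborel borel rho] by simp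
    define L where "L \<alpha> x = (if ennreal \<alpha> < Tstar K f x then 1 else 0 :: ennreal)" for \<alpha> x
    have Lm: "(\<lambda>z. L (fst z) (snd z)) \<in> borel_measurable (lborel \<Otimes>\<^sub>M rho)"
      unfolding L_def using Tm2 a2 by measurable
    have Lx: "L \<alpha> \<in> borel_measurable rho" for \<alpha>
      unfolding L_def[abs_def] using Tm by measurable
    have lev_L: "lev f \<alpha> = (\<integral>\<^sup>+x. L \<alpha> x \<partial>rho)" for \<alpha>
    proof -
      have "(\<integral>\<^sup>+x. L \<alpha> x \<partial>rho) = (\<integral>\<^sup>+x. indicator {x \<in> axS. ennreal \<alpha> < Tstar K f x} x \<partial>rho)"
        by (intro nn_integral_cong) (simp add: L_def indicator_def)
      then show ?thesis using level_sets(1)[OF f] by (simp add: lev_def)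
    qed
    have levm: "lev f \<in> borel_measurable lborel"
      unfolding lev_L[abs_def] by (rule LR.M2.borel_measurable_nn_integral) (use Lm in \<open>simp add: split_beta'\<close>)
    define H where "H \<alpha> x = (if ennreal (c * \<alpha>) < emod f x then emod f x else 0)" for \<alpha> x
    have Hm: "(\<lambda>z. H (fst z) (snd z)) \<in> borel_measurable (lborel \<Otimes>\<^sub>M rho)"
      unfolding H_def using fm2 a2 by measurable
    have Hx: "H \<alpha> \<in> borel_measurable rho" for \<alpha>
      unfolding H_def[abs_def] using fm by measurable
    have tail_H: "tail f (c * \<alpha>) = (\<integral>\<^sup>+x. H \<alpha> x \<partial>rho)" for \<alpha>
      by (simp add: tail_def H_def)
    have tailm: "(\<lambda>\<alpha>. tail f (c * \<alpha>)) \<in> borel_measurable lborel"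
      unfolding tail_H by (rule LR.M2.borel_measurable_nn_integral) (use Hm in \<open>simp add: split_beta'\<close>)
    define w where "w N \<alpha> = ennreal (p * \<alpha> powr (p - 1)) * indicator {0<..<N} \<alpha>" for N \<alpha> :: real
    have wm: "w N \<in> borel_measurable lborel" for N
      unfolding w_def[abs_def] by measurable
    define F where "F N = (\<integral>\<^sup>+\<alpha>. w N \<alpha> * lev f \<alpha> \<partial>lborel)" for N
    define \<phi> where "\<phi> N x = (\<integral>\<^sup>+\<alpha>. w N \<alpha> * L \<alpha> x \<partial>lborel)" for N x
    have F\<phi>: "F N = (\<integral>\<^sup>+x. \<phi> N x \<partial>rho)" for N
    proof -
      have wf: "(\<lambda>z. w N (fst z)) \<in> borel_measurable (lborel \<Otimes>\<^sub>M (rho :: ((real ^ 'n) \<times> real) measure))"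
        using measurable_compose[OF measurable_fst wm] .
      have "F N = (\<integral>\<^sup>+\<alpha>. \<integral>\<^sup>+x. w N \<alpha> * L \<alpha> x \<partial>rho \<partial>lborel)"
        unfolding F_def lev_L using Lx by (simp add: nn_integral_cmult)
      also have "\<dots> = (\<integral>\<^sup>+x. \<phi> N x \<partial>rho)"
        unfolding \<phi>_def by (rule LR.Fubini'[symmetric]) (use wf Lm in \<open>simp add: split_beta'\<close>)
      finally show ?thesis .
    qed
    define G where "G = (\<integral>\<^sup>+\<alpha>. ennreal (p * \<alpha> powr (p - 2)) * indicator {0<..} \<alpha> * tail f (c * \<alpha>) \<partial>lborel)"
    have Ge: "G = ennreal (p / (p - 1) * c powr (1 - p)) * (\<integral>\<^sup>+x. ennreal (cmod (f x) powr p) \<partial>rho)"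
    proof -
      let ?v = "\<lambda>\<alpha>::real. ennreal (p * \<alpha> powr (p - 2)) * indicator {0<..} \<alpha>"
      have vm: "?v \<in> borel_measurable lborel" by measurable
      have vf: "(\<lambda>z. ?v (fst z)) \<in> borel_measurable (lborel \<Otimes>\<^sub>M (rho :: ((real ^ 'n) \<times> real) measure))"
        using measurable_compose[OF measurable_fst vm] .
      have "G = (\<integral>\<^sup>+\<alpha>. \<integral>\<^sup>+x. ?v \<alpha> * H \<alpha> x \<partial>rho \<partial>lborel)"
        unfolding G_def tail_H using Hx by (simp add: nn_integral_cmult)
      also have "\<dots> = (\<integral>\<^sup>+x. \<integral>\<^sup>+\<alpha>. ?v \<alpha> * H \<alpha> x \<partial>lborel \<partial>rho)"
        by (rule LR.Fubini'[symmetric]) (use vf Hm in \<open>simp add: split_beta'\<close>)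
      also have "\<dots> = (\<integral>\<^sup>+x. ennreal (p / (p - 1) * c powr (1 - p)) * ennreal (cmod (f x) powr p) \<partial>rho)"
      proof (rule nn_integral_cong)
        fix x
        define t where "t = cmod (f x)"
        have t: "0 \<le> t" by (simp add: t_def)
        have "(\<integral>\<^sup>+\<alpha>. ?v \<alpha> * H \<alpha> x \<partial>lborel) =
            (\<integral>\<^sup>+\<alpha>. ennreal (p / (p - 1) * t) * (ennreal ((p - 1) * \<alpha> powr ((p - 1) - 1)) * indicator {0<..<t / c} \<alpha>) \<partial>lborel)"
        proof (rule nn_integral_cong)
          fix \<alpha> :: real
          show "?v \<alpha> * H \<alpha> x = ennreal (p / (p - 1) * t) * (ennreal ((p - 1) * \<alpha> powr ((p - 1) - 1)) * indicator {0<..<t / c} \<alpha>)"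
          proof (cases "0 < \<alpha>")
            case True
            have iff: "ennreal (c * \<alpha>) < ennreal t \<longleftrightarrow> \<alpha> < t / c"
              using c True by (simp add: ennreal_less_iff pos_less_divide_eq mult.commute)
            have eq: "p * \<alpha> powr (p - 2) * t = p / (p - 1) * t * ((p - 1) * \<alpha> powr (p - 2))" using p by simp
            have "ennreal (p * \<alpha> powr (p - 2)) * ennreal t = ennreal (p * \<alpha> powr (p - 2) * t)"
              using t by (rule ennreal_mult''[symmetric])
            also have "\<dots> = ennreal (p / (p - 1) * t) * ennreal ((p - 1) * \<alpha> powr (p - 2))"
              unfolding eq by (rule ennreal_mult'') (use p in simp)
            finally have "ennreal (p * \<alpha> powr (p - 2)) * ennreal t = ennreal (p / (p - 1) * t) * ennreal ((p - 1) * \<alpha> powr (p - 2))" .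
            then show ?thesis using True iff by (simp add: H_def t_def[symmetric] indicator_def)
          next
            case False
            then show ?thesis by simp
          qed
        qed
        also have "\<dots> = ennreal (p / (p - 1) * t) * ennreal ((t / c) powr (p - 1))"
          by (subst nn_integral_cmult) (use nn_integral_powr[of "p - 1" "t / c"] p t c in auto)
        also have "\<dots> = ennreal (p / (p - 1) * c powr (1 - p)) * ennreal (t powr p)"
        proof -
          have e1: "t powr p = t * t powr (p - 1)"
            using t p by (cases "t = 0") (auto simp: powr_mult_base)
          have e2: "(t / c) powr (p - 1) = t powr (p - 1) * c powr (1 - p)"
          proof -
            have A: "(t / c) powr (p - 1) = t powr (p - 1) / c powr (p - 1)"
              by (rule powr_divide)
            have B: "c powr (1 - p) = 1 / c powr (p - 1)" using powr_minus_divide[of c "p - 1"] by simp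
            show ?thesis unfolding A B by simp
          qed
          have e3: "p / (p - 1) * t * (t / c) powr (p - 1) = p / (p - 1) * c powr (1 - p) * t powr p"
            unfolding e1 e2 by (simp only: mult_ac)
          have "ennreal (p / (p - 1) * t) * ennreal ((t / c) powr (p - 1)) = ennreal (p / (p - 1) * t * (t / c) powr (p - 1))"
            by (rule ennreal_mult''[symmetric]) simp
          also have "\<dots> = ennreal (p / (p - 1) * c powr (1 - p)) * ennreal (t powr p)"
            unfolding e3 by (rule ennreal_mult'') simp
          finally show ?thesis .
        qed
        finally show "(\<integral>\<^sup>+\<alpha>. ?v \<alpha> * H \<alpha> x \<partial>lborel) = ennreal (p / (p - 1) * c powr (1 - p)) * ennreal (cmod (f x) powr p)"
          by (simp add: t_def)
      qed
      also have "\<dots> = ennreal (p / (p - 1) * c powr (1 - p)) * (\<integral>\<^sup>+x. ennreal (cmod (f x) powr p) \<partial>rho)"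
        using fm by (intro nn_integral_cmult) measurable
      finally show ?thesis .
    qed
    \<comment> \<open>The a priori bound \<open>v + C1 / \<alpha>\<close> is integrable against
      \<open>\<alpha> powr (p - 1)\<close> near 0 because \<open>p > 1\<close>; the cut-off at
      \<open>N\<close> deals with large levels.\<close>
    have Ffin: "F N < top" if N: "0 < N" for N
    proof -
      obtain v C1 where v: "0 \<le> v" "0 \<le> C1" "\<forall>\<alpha>>0. lev f \<alpha> \<le> ennreal (v + C1 / \<alpha>)"
        using f by (rule lev_finite)
      have "F N \<le> (\<integral>\<^sup>+\<alpha>. ennreal v * w N \<alpha> + ennreal (C1 * p / (p - 1)) * (ennreal ((p - 1) * \<alpha> powr ((p - 1) - 1)) * indicator {0<..<N} \<alpha>) \<partial>lborel)"
        unfolding F_def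
      proof (rule nn_integral_mono)
        fix \<alpha> :: real
        show "w N \<alpha> * lev f \<alpha> \<le> ennreal v * w N \<alpha> + ennreal (C1 * p / (p - 1)) * (ennreal ((p - 1) * \<alpha> powr ((p - 1) - 1)) * indicator {0<..<N} \<alpha>)"
        proof (cases "\<alpha> \<in> {0<..<N}")
          case True
          then have \<alpha>: "0 < \<alpha>" by simp
          have "\<alpha> powr (p - 1) / \<alpha> = \<alpha> powr (p - 2)"
            using \<alpha> powr_diff[of \<alpha> "p - 1" 1] by simp
          then have e: "p * \<alpha> powr (p - 1) * (v + C1 / \<alpha>) = v * (p * \<alpha> powr (p - 1)) + C1 * p / (p - 1) * ((p - 1) * \<alpha> powr (p - 2))"
          proof -
            have "p * \<alpha> powr (p - 1) * (v + C1 / \<alpha>) = v * (p * \<alpha> powr (p - 1)) + C1 * p * (\<alpha> powr (p - 1) / \<alpha>)"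
              by (simp add: distrib_left)
            moreover have "C1 * p / (p - 1) * ((p - 1) * \<alpha> powr (p - 2)) = C1 * p * \<alpha> powr (p - 2)" using p by simp
            ultimately show ?thesis using \<open>\<alpha> powr (p - 1) / \<alpha> = \<alpha> powr (p - 2)\<close> by (simp only:)
          qed
          have "w N \<alpha> * lev f \<alpha> \<le> ennreal (p * \<alpha> powr (p - 1)) * ennreal (v + C1 / \<alpha>)"
            using v(3) \<alpha> True unfolding w_def by (intro mult_mono) auto
          also have "\<dots> = ennreal (v * (p * \<alpha> powr (p - 1)) + C1 * p / (p - 1) * ((p - 1) * \<alpha> powr (p - 2)))"
            using e v \<alpha> by (subst ennreal_mult''[symmetric]) auto
          also have "\<dots> = ennreal v * ennreal (p * \<alpha> powr (p - 1)) + ennreal (C1 * p / (p - 1)) * ennreal ((p - 1) * \<alpha> powr (p - 2))"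
            using v p by (subst ennreal_plus) (auto simp: ennreal_mult'[symmetric])
          finally show ?thesis using True by (simp add: w_def)
        qed (simp add: w_def)
      qed
      also have "\<dots> = ennreal v * ennreal (N powr p) + ennreal (C1 * p / (p - 1)) * ennreal (N powr (p - 1))"
        using nn_integral_powr[of p N] nn_integral_powr[of "p - 1" N] p N wm[of N] unfolding w_def[abs_def]
        by (subst nn_integral_add) (auto simp: nn_integral_cmult)
      also have "\<dots> < top" by (simp add: ennreal_mult_less_top)
      finally show ?thesis .
    qed
    have Fmono: "F N \<le> F N'" if "N \<le> N'" for N N'
      unfolding F_def w_def using that by (intro nn_integral_mono mult_right_mono) (auto simp: indicator_def)
    have Fstep: "F (4 * N) \<le> ennreal (1 / 2) * F N + ennreal (4 powr p * C) * G" if N: "0 < N" for N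
    proof -
      have F4: "F (4 * N) = ennreal \<bar>4\<bar> * (\<integral>\<^sup>+\<alpha>. w (4 * N) (0 + 4 * \<alpha>) * lev f (0 + 4 * \<alpha>) \<partial>lborel)"
        unfolding F_def using wm[of "4 * N"] levm by (intro nn_integral_real_affine) auto
      have "(\<integral>\<^sup>+\<alpha>. w (4 * N) (0 + 4 * \<alpha>) * lev f (0 + 4 * \<alpha>) \<partial>lborel) \<le>
         (\<integral>\<^sup>+\<alpha>. ennreal (4 powr (- 1) / 2) * (w N \<alpha> * lev f \<alpha>) +
           ennreal (4 powr (p - 1) * C) * (ennreal (p * \<alpha> powr (p - 2)) * indicator {0<..} \<alpha> * tail f (c * \<alpha>)) \<partial>lborel)"
      proof (rule nn_integral_mono)
        fix \<alpha> :: real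
        show "w (4 * N) (0 + 4 * \<alpha>) * lev f (0 + 4 * \<alpha>) \<le> ennreal (4 powr (- 1) / 2) * (w N \<alpha> * lev f \<alpha>) +
           ennreal (4 powr (p - 1) * C) * (ennreal (p * \<alpha> powr (p - 2)) * indicator {0<..} \<alpha> * tail f (c * \<alpha>))"
        proof (cases "\<alpha> \<in> {0<..<N}")
          case True
          then have \<alpha>: "0 < \<alpha>" by simp
          define W where "W = p * \<alpha> powr (p - 1)"
          have W: "0 \<le> W" using p by (simp add: W_def)
          have w4: "w (4 * N) (4 * \<alpha>) = ennreal (4 powr (p - 1) * W)"
            using True \<alpha> by (simp add: w_def W_def powr_mult mult_ac)
          have "w (4 * N) (4 * \<alpha>) * lev f (4 * \<alpha>) \<le> ennreal (4 powr (p - 1) * W) *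
              (ennreal (4 powr (- p) / 2) * lev f \<alpha> + ennreal (C / \<alpha>) * tail f (c * \<alpha>))"
            unfolding w4 using gl f \<alpha> by (intro mult_left_mono) auto
          also have "\<dots> = (ennreal (4 powr (p - 1) * W) * ennreal (4 powr (- p) / 2)) * lev f \<alpha> +
              (ennreal (4 powr (p - 1) * W) * ennreal (C / \<alpha>)) * tail f (c * \<alpha>)"
            by (simp only: distrib_left mult.assoc)
          finally have le: "w (4 * N) (4 * \<alpha>) * lev f (4 * \<alpha>) \<le>
              (ennreal (4 powr (p - 1) * W) * ennreal (4 powr (- p) / 2)) * lev f \<alpha> +
              (ennreal (4 powr (p - 1) * W) * ennreal (C / \<alpha>)) * tail f (c * \<alpha>)" .
          have E1: "ennreal (4 powr (p - 1) * W) * ennreal (4 powr (- p) / 2) = ennreal (4 powr (- 1) / 2) * ennreal W"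
          proof -
            have "4 powr (p - 1) * 4 powr (- p) = (4::real) powr (- 1)" by (simp only: powr_add[symmetric]) simp
            then have "(4 powr (p - 1) * 4 powr (- p)) * (W / 2) = (4::real) powr (- 1) * (W / 2)" by (simp only:)
            then have "4 powr (p - 1) * W * (4 powr (- p) / 2) = 4 powr (- 1) / 2 * W"
              by (simp only: times_divide_eq_left times_divide_eq_right mult_ac)
            then show ?thesis using W by (subst (1 2) ennreal_mult''[symmetric]) auto
          qed
          have E2: "ennreal (4 powr (p - 1) * W) * ennreal (C / \<alpha>) = ennreal (4 powr (p - 1) * C) * ennreal (p * \<alpha> powr (p - 2))"
          proof -
            have "\<alpha> powr (p - 1) / \<alpha> = \<alpha> powr (p - 2)"
              using \<alpha> powr_diff[of \<alpha> "p - 1" 1] by simp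
            moreover have "4 powr (p - 1) * W * (C / \<alpha>) = 4 powr (p - 1) * C * (p * (\<alpha> powr (p - 1) / \<alpha>))"
              unfolding W_def by simp
            ultimately have "4 powr (p - 1) * W * (C / \<alpha>) = 4 powr (p - 1) * C * (p * \<alpha> powr (p - 2))"
              by (simp only:)
            then show ?thesis using C p \<alpha> by (subst (1 2) ennreal_mult''[symmetric]) auto
          qed
          show ?thesis using le unfolding E1 E2 using True by (simp add: w_def W_def mult.assoc)
        next
          case False
          then have "w (4 * N) (0 + 4 * \<alpha>) = 0" by (auto simp: w_def indicator_def)
          then show ?thesis by simp
        qed
      qed
      also have "\<dots> = ennreal (4 powr (- 1) / 2) * F N + ennreal (4 powr (p - 1) * C) * G"
        unfolding F_def G_def using wm[of N] levm tailm
        by (subst nn_integral_add) (auto simp: nn_integral_cmult)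
      finally have "F (4 * N) \<le> ennreal \<bar>4\<bar> * (ennreal (4 powr (- 1) / 2) * F N + ennreal (4 powr (p - 1) * C) * G)"
        unfolding F4 by (rule mult_left_mono) simp
      also have "\<dots> = (ennreal 4 * ennreal (4 powr (- 1) / 2)) * F N + (ennreal 4 * ennreal (4 powr (p - 1) * C)) * G"
        by (simp only: distrib_left mult.assoc abs_numeral)
      also have "ennreal 4 * ennreal (4 powr (- 1) / 2) = ennreal (1 / 2)"
        by (subst ennreal_mult''[symmetric]) (auto simp: powr_minus_divide)
      also have "ennreal 4 * ennreal (4 powr (p - 1) * C) = ennreal (4 powr p * C)"
      proof -
        have "4 * (4 powr (p - 1) * C) = 4 powr p * C" using powr_mult_base[of 4 "p - 1"] by simp
        then show ?thesis using C by (subst ennreal_mult''[symmetric]) auto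
      qed
      finally show ?thesis .
    qed
    define D where "D = ennreal (4 powr p * C) * G"
    have bound: "F N \<le> 2 * D" if N: "0 < N" for N
    proof -
      have "F (4 * N) \<le> ennreal (1 / 2) * F N + D" using Fstep[OF N] by (simp add: D_def)
      also have "\<dots> \<le> ennreal (1 / 2) * F (4 * N) + D"
        using N by (intro add_right_mono mult_left_mono Fmono) auto
      finally have "F (4 * N) \<le> 2 * D" using Ffin[of "4 * N"] N by (intro absorb_half) auto
      moreover have "F N \<le> F (4 * N)" by (rule Fmono) (use N in simp)
      ultimately show ?thesis by (rule order_trans[rotated])
    qed
    have \<phi>m: "\<phi> N \<in> borel_measurable rho" for N
    proof -
      have sw: "(\<lambda>z. L (snd z) (fst z)) \<in> borel_measurable (rho \<Otimes>\<^sub>M lborel)"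
        using measurable_compose[OF measurable_pair_swap' Lm] by (simp add: split_beta')
      have wf: "(\<lambda>z. w N (snd z)) \<in> borel_measurable ((rho :: ((real ^ 'n) \<times> real) measure) \<Otimes>\<^sub>M lborel)"
        using measurable_compose[OF measurable_snd wm] .
      show ?thesis
        unfolding \<phi>_def[abs_def] by (rule lborel.borel_measurable_nn_integral) (use sw wf in \<open>simp add: split_beta'\<close>)
    qed
    have inc: "incseq (\<lambda>n x. \<phi> (real n) x)"
    proof (rule incseq_SucI, rule le_funI)
      fix n x
      show "\<phi> (real n) x \<le> \<phi> (real (Suc n)) x"
        unfolding \<phi>_def w_def by (intro nn_integral_mono mult_right_mono mult_left_mono) (auto simp: indicator_def)
    qed
    \<comment> \<open>At a finite value the truncated integral is exact once the cut-off exceeds it;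
      at an infinite value it is \<open>real n powr p\<close>, which is unbounded in
      \<open>n\<close>.\<close>
    have pw: "epow (Tstar K f x) p \<le> (SUP n. \<phi> (real n) x)" for x
    proof (cases "Tstar K f x")
      case (real t)
      obtain n :: nat where n: "t < real n" using reals_Archimedean2 by blast
      have "\<phi> (real n) x = (\<integral>\<^sup>+\<alpha>. ennreal (p * \<alpha> powr (p - 1)) * indicator {0<..<t} \<alpha> \<partial>lborel)"
        unfolding \<phi>_def
      proof (rule nn_integral_cong)
        fix \<alpha> :: real
        show "w (real n) \<alpha> * L \<alpha> x = ennreal (p * \<alpha> powr (p - 1)) * indicator {0<..<t} \<alpha>"
          using n real by (cases "0 < \<alpha>") (auto simp: w_def L_def indicator_def ennreal_less_iff)
      qed
      also have "\<dots> = ennreal (t powr p)" using p real by (intro nn_integral_powr) auto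
      also have "\<dots> = epow (Tstar K f x) p" using real by (simp add: epow_ennreal)
      finally have "epow (Tstar K f x) p = \<phi> (real n) x" ..
      then show ?thesis by (simp only:) (rule SUP_upper, simp)
    next
      case top
      have "of_nat n \<le> (SUP n. \<phi> (real n) x)" for n
      proof -
        have "\<phi> (real n) x = (\<integral>\<^sup>+\<alpha>. ennreal (p * \<alpha> powr (p - 1)) * indicator {0<..<real n} \<alpha> \<partial>lborel)"
          unfolding \<phi>_def using top by (intro nn_integral_cong) (simp add: w_def L_def)
        also have "\<dots> = ennreal (real n powr p)" using p by (intro nn_integral_powr) auto
        finally have e: "\<phi> (real n) x = ennreal (real n powr p)" .
        have "real n \<le> real n powr p"
        proof (cases "n = 0")
          case False
          then have "real n powr 1 \<le> real n powr p" using p by (intro powr_mono) auto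
          then show ?thesis using False by simp
        qed simp
        then have "of_nat n \<le> \<phi> (real n) x" unfolding e by (simp add: ennreal_of_nat_eq_real_of_nat ennreal_leI)
        also have "\<dots> \<le> (SUP n. \<phi> (real n) x)" by (rule SUP_upper) simp
        finally show ?thesis .
      qed
      then have "(SUP n. of_nat n :: ennreal) \<le> (SUP n. \<phi> (real n) x)" by (rule SUP_least)
      then have "(SUP n. \<phi> (real n) x) = top" unfolding ennreal_SUP_of_nat_eq_top by (rule top_le)
      then show ?thesis by (simp only: top_greatest)
    qed
    have "(\<integral>\<^sup>+x. epow (Tstar K f x) p \<partial>rho) \<le> (\<integral>\<^sup>+x. (SUP n. \<phi> (real n) x) \<partial>rho)"
      using pw by (intro nn_integral_mono)
    also have "\<dots> = (SUP n. \<integral>\<^sup>+x. \<phi> (real n) x \<partial>rho)"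
      using inc \<phi>m by (intro nn_integral_monotone_convergence_SUP)
    also have "\<dots> = (SUP n. F (real n))" by (simp add: F\<phi>)
    also have "\<dots> \<le> 2 * D"
    proof (rule SUP_least)
      fix n :: nat
      have "F (real n) \<le> F (real n + 1)" by (rule Fmono) simp
      also have "\<dots> \<le> 2 * D" by (rule bound) simp
      finally show "F (real n) \<le> 2 * D" .
    qed
    also have "\<dots> = ennreal C' * (\<integral>\<^sup>+x. ennreal (cmod (f x) powr p) \<partial>rho)"
    proof -
      have "ennreal C' = ennreal 2 * ennreal (4 powr p * C * (p / (p - 1) * c powr (1 - p)))"
        unfolding C'_def by (rule ennreal_mult') simp
      also have "ennreal (4 powr p * C * (p / (p - 1) * c powr (1 - p))) = ennreal (4 powr p * C) * ennreal (p / (p - 1) * c powr (1 - p))"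
        by (rule ennreal_mult') (use C in simp)
      finally show ?thesis unfolding D_def Ge by (simp only: mult.assoc ennreal_numeral)
    qed
    finally show ?thesis .
  qed
  then show ?thesis using C' by (intro that[of C']) auto
qed

text \<open>\<open>R\<close> contains a point \<open>x0\<close> where \<open>Tstar\<close> is at
  most \<open>\<beta>\<close> for \<open>g\<close> and small for the part of \<open>g\<close> in the
  star. The part outside the star is then controlled at \<open>x0\<close> and, by
  \<open>Tstar_oscillation\<close>, on all of \<open>R\<close>; adding the inner part back costs
  only a set of small measure.\<close>

lemma OSC_of_weak:
  assumes q: "1 \<le> q" and C: "0 \<le> C"
    and weak: "\<And>f \<alpha>. f \<in> Linf_c \<Longrightarrow> 0 < \<alpha> \<Longrightarrow>
      ennreal (\<alpha> powr q) * lev f \<alpha> \<le> ennreal C * (\<integral>\<^sup>+x. ennreal (cmod (f x) powr q) \<partial>rho)"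
  shows OSC
proof -
  define \<kappa> :: real where "\<kappa> = 2 * 3 ^ CARD('n)"
  have \<kappa>: "0 < \<kappa>" by (simp add: \<kappa>_def)
  obtain Co where Co: "0 \<le> Co" and osc: "\<forall>f M R x x'. f \<in> Linf_c \<longrightarrow> 0 \<le> M \<longrightarrow> (AE y in rho. cmod (f y) \<le> M) \<longrightarrow> R \<in> CZ \<longrightarrow>
     (AE y in rho. y \<in> cz_star R \<longrightarrow> f y = 0) \<longrightarrow> x \<in> R \<longrightarrow> x' \<in> R \<longrightarrow>
     Tstar K f x \<le> Tstar K f x' + ennreal (Co * M)"
    using Tstar_oscillation by blast
  show ?thesis
    unfolding OSC_def
  proof (intro allI impI)
    fix \<epsilon> :: real assume \<epsilon>: "0 < \<epsilon>"
    \<comment> \<open>Makes the weak estimate for \<open>g1\<close>, which is supported in a set of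
      measure at most \<open>\<kappa>\<close> times that of \<open>R\<close>, yield the proportion
      \<open>\<epsilon>\<close>; with \<open>1 \<le> l\<close> and \<open>1 \<le> q\<close>,
      \<open>l \<le> l powr q\<close>.\<close>
    define l where "l = max 1 (C * \<kappa> / \<epsilon>)"
    have l: "1 \<le> l" "C * \<kappa> / \<epsilon> \<le> l" by (auto simp: l_def)
    have lq: "C * \<kappa> \<le> \<epsilon> * l powr q"
    proof -
      have "C * \<kappa> \<le> \<epsilon> * l" using l(2) \<epsilon> by (simp add: pos_divide_le_eq mult.commute)
      also have "l \<le> l powr q" using powr_mono[of 1 q l] q l(1) by simp
      finally show ?thesis using \<epsilon> by simp
    qed
    show "\<exists>\<Lambda>\<ge>0. \<forall>g M R \<beta>. g \<in> Linf_c \<longrightarrow> 0 < M \<longrightarrow> (AE x in rho. cmod (g x) \<le> M) \<longrightarrow> R \<in> CZ \<longrightarrow> 0 \<le> \<beta> \<longrightarrow>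
     ennreal \<epsilon> * emeasure rho R < emeasure rho {x \<in> R. Tstar K g x \<le> ennreal \<beta>} \<longrightarrow>
     emeasure rho {x \<in> R. ennreal (\<beta> + \<Lambda> * M) < Tstar K g x} \<le> ennreal \<epsilon> * emeasure rho R"
    \<comment> \<open>One \<open>l\<close> for passing from \<open>g\<close> to \<open>g2\<close> at
      \<open>x0\<close>, one for returning from \<open>g2\<close> to \<open>g\<close> at
      \<open>x\<close>, and \<open>Co\<close> for the oscillation of \<open>g2\<close>.\<close>
    proof (intro exI[of _ "2 * l + Co"] conjI allI impI)
      show "0 \<le> 2 * l + Co" using l Co by simp
      fix g :: "(real ^ 'n) \<times> real \<Rightarrow> complex" and M R and \<beta> :: real
      assume g: "g \<in> Linf_c" and M: "0 < M" and gM: "AE x in rho. cmod (g x) \<le> M" and R: "R \<in> CZ" and \<beta>: "0 \<le> \<beta>"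
        and big: "ennreal \<epsilon> * emeasure rho R < emeasure rho {x \<in> R. Tstar K g x \<le> ennreal \<beta>}"
      define g1 where "g1 y = (if y \<in> cz_star R then g y else 0)" for y
      define g2 where "g2 y = g y - g1 y" for y
      have sR: "cz_star R \<in> sets rho" by (rule cz_star_sets[OF R])
      have g1: "g1 \<in> Linf_c" unfolding g1_def[abs_def] by (rule Linf_c_restrict[OF g sR])
      have g2: "g2 \<in> Linf_c" unfolding g2_def[abs_def] by (rule Linf_c_diff[OF g g1])
      have g12: "(\<lambda>y. g y - g2 y) = g1" by (simp add: g2_def fun_eq_iff)
      have g2M: "AE x in rho. cmod (g2 x) \<le> M"
        using gM by eventually_elim (use M in \<open>simp add: g2_def g1_def\<close>)
      have lM: "0 < l * M" using l M by simp
      have small: "emeasure rho {x \<in> axS. ennreal (l * M) < Tstar K g1 x} \<le> ennreal \<epsilon> * emeasure rho R"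
      proof -
        have "(\<integral>\<^sup>+x. ennreal (cmod (g1 x) powr q) \<partial>rho) \<le> (\<integral>\<^sup>+x. ennreal (M powr q) * indicator (cz_star R) x \<partial>rho)"
        proof (rule nn_integral_mono_AE)
          show "AE x in rho. ennreal (cmod (g1 x) powr q) \<le> ennreal (M powr q) * indicator (cz_star R) x"
            using gM
          proof eventually_elim
            case (elim x)
            then show ?case using q by (auto simp: g1_def intro!: ennreal_leI powr_mono2)
          qed
        qed
        also have "\<dots> = ennreal (M powr q) * emeasure rho (cz_star R)" using sR by (simp add: nn_integral_cmult)
        also have "\<dots> \<le> ennreal (M powr q) * (ennreal \<kappa> * emeasure rho R)"
          unfolding \<kappa>_def by (intro mult_left_mono cz_star_emeasure[OF R]) simp
        finally have "ennreal ((l * M) powr q) * lev g1 (l * M) \<le> ennreal C * (ennreal (M powr q) * (ennreal \<kappa> * emeasure rho R))"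
          using weak[OF g1 lM] by (meson mult_left_mono order_trans zero_le)
        also have "\<dots> = ennreal (C * \<kappa> * M powr q) * emeasure rho R"
          using C \<kappa> by (simp add: ennreal_mult' ennreal_mult'' mult_ac)
        also have "\<dots> \<le> ennreal (\<epsilon> * l powr q * M powr q) * emeasure rho R"
          using lq by (intro mult_right_mono ennreal_leI) auto
        also have "\<dots> = ennreal ((l * M) powr q) * (ennreal \<epsilon> * emeasure rho R)"
          using l M \<epsilon> by (simp add: powr_mult ennreal_mult' ennreal_mult'' mult_ac)
        finally have "ennreal ((l * M) powr q) * lev g1 (l * M) \<le> ennreal ((l * M) powr q) * (ennreal \<epsilon> * emeasure rho R)" .
        moreover have a0: "0 < (l * M) powr q"
        proof -
          have "l * M \<noteq> 0" using lM by linarith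
          then show ?thesis by (simp only: powr_gt_zero simp_thms)
        qed
        ultimately have "lev g1 (l * M) \<le> ennreal (1 / (l * M) powr q) * (ennreal ((l * M) powr q) * (ennreal \<epsilon> * emeasure rho R))"
          by (intro ennreal_cancel_le)
        also have "\<dots> = (ennreal (1 / (l * M) powr q) * ennreal ((l * M) powr q)) * (ennreal \<epsilon> * emeasure rho R)"
          by (simp only: mult.assoc)
        also have "ennreal (1 / (l * M) powr q) * ennreal ((l * M) powr q) = 1"
          by (rule ennreal_inverse_mult[OF a0])
        finally show ?thesis unfolding lev_def by simp
      qed
      have Rs: "R \<in> sets rho" by (rule cz_sets[OF R])
      have inS: "x \<in> axS" if "x \<in> R" for x using sets.sets_into_space[OF Rs] that by auto
      have "\<exists>x0\<in>R. Tstar K g x0 \<le> ennreal \<beta> \<and> Tstar K g1 x0 \<le> ennreal (l * M)"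
      proof (rule ccontr)
        assume n: "\<not> ?thesis"
        have "{x \<in> R. Tstar K g x \<le> ennreal \<beta>} \<subseteq> {x \<in> axS. ennreal (l * M) < Tstar K g1 x}"
          using n inS by (auto simp: not_le)
        then have "emeasure rho {x \<in> R. Tstar K g x \<le> ennreal \<beta>} \<le> emeasure rho {x \<in> axS. ennreal (l * M) < Tstar K g1 x}"
          by (rule emeasure_mono) (rule level_sets(1)[OF g1])
        then show False using small big by simp
      qed
      then obtain x0 where x0: "x0 \<in> R" "Tstar K g x0 \<le> ennreal \<beta>" "Tstar K g1 x0 \<le> ennreal (l * M)" by blast
      have b2: "Tstar K g2 x \<le> ennreal (\<beta> + l * M + Co * M)" if x: "x \<in> R" for x
      proof -
        have "Tstar K g2 x \<le> Tstar K g2 x0 + ennreal (Co * M)"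
          by (rule osc[rule_format, OF g2 _ g2M R _ x x0(1)]) (use M in \<open>auto simp: g2_def g1_def\<close>)
        also have "\<dots> \<le> (Tstar K g x0 + Tstar K g1 x0) + ennreal (Co * M)"
          using Tstar_triangle'[OF g g2, of x0] unfolding g12 by (rule add_right_mono)
        also have "\<dots> \<le> (ennreal \<beta> + ennreal (l * M)) + ennreal (Co * M)"
          by (intro add_right_mono add_mono x0)
        also have "\<dots> = ennreal (\<beta> + l * M + Co * M)"
          using \<beta> lM M Co by (simp add: ennreal_plus[symmetric] del: ennreal_plus)
        finally show ?thesis .
      qed
      have "{x \<in> R. ennreal (\<beta> + (2 * l + Co) * M) < Tstar K g x} \<subseteq> {x \<in> axS. ennreal (l * M) < Tstar K g1 x}"
      proof
        fix x assume x: "x \<in> {x \<in> R. ennreal (\<beta> + (2 * l + Co) * M) < Tstar K g x}"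
        have "ennreal (l * M) < Tstar K g1 x"
        proof (rule ccontr)
          assume "\<not> ?thesis"
          then have le: "Tstar K g1 x \<le> ennreal (l * M)" by simp
          have "Tstar K g x \<le> Tstar K g2 x + Tstar K g1 x"
            using Tstar_triangle[OF g g2, of x] unfolding g12 .
          also have "\<dots> \<le> ennreal (\<beta> + l * M + Co * M) + ennreal (l * M)"
            using x by (intro add_mono b2 le) simp
          also have "\<dots> = ennreal (\<beta> + (2 * l + Co) * M)"
            using \<beta> lM M Co by (simp add: ennreal_plus[symmetric] algebra_simps del: ennreal_plus)
          finally show False using x by (simp add: not_less[symmetric])
        qed
        then show "x \<in> {x \<in> axS. ennreal (l * M) < Tstar K g1 x}" using x inS by simp
      qed
      then have "emeasure rho {x \<in> R. ennreal (\<beta> + (2 * l + Co) * M) < Tstar K g x} \<le> emeasure rho {x \<in> axS. ennreal (l * M) < Tstar K g1 x}"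
        by (rule emeasure_mono) (rule level_sets(1)[OF g1])
      then show "emeasure rho {x \<in> R. ennreal (\<beta> + (2 * l + Co) * M) < Tstar K g x} \<le> ennreal \<epsilon> * emeasure rho R"
        using small by (rule order_trans)
    qed
  qed
qed

section \<open>The equivalences\<close>

text \<open>Off a set of proportion \<open>\<epsilon>\<close> the function differs from its mean on
  \<open>R\<close> by at most \<open>l * M\<close>. A set of larger proportion where it is at most
  \<open>\<beta>\<close> contains such a point, and two such points have values within
  \<open>2 * l * M\<close> of each other.\<close>

lemma OSC_of_BMO:
  assumes "bounded_Linf_c_BMO (Tstar K)"
  shows OSC
proof -
  obtain C where C: "0 \<le> C" and bnd: "\<forall>f\<in>Linf_c.
     (AE x in rho. Tstar K f x < \<infinity>) \<and>
     (\<lambda>x. complex_of_real (enn2real (Tstar K f x))) \<in> BMO \<and>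
     BMO_norm (\<lambda>x. complex_of_real (enn2real (Tstar K f x))) \<le> ennreal C * Linf_norm (emod f)"
    using assms unfolding bounded_Linf_c_BMO_def by blast
  show ?thesis
    unfolding OSC_def
  proof (intro allI impI)
    fix \<epsilon> :: real assume \<epsilon>: "0 < \<epsilon>"
    \<comment> \<open>The summand 1 keeps \<open>l\<close> positive when \<open>C = 0\<close>, as
      division by \<open>l * M\<close> requires.\<close>
    define l where "l = (C + 1) / \<epsilon>"
    have l: "0 < l" using C \<epsilon> by (simp add: l_def)
    show "\<exists>\<Lambda>\<ge>0. \<forall>g M R \<beta>. g \<in> Linf_c \<longrightarrow> 0 < M \<longrightarrow> (AE x in rho. cmod (g x) \<le> M) \<longrightarrow> R \<in> CZ \<longrightarrow> 0 \<le> \<beta> \<longrightarrow>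
     ennreal \<epsilon> * emeasure rho R < emeasure rho {x \<in> R. Tstar K g x \<le> ennreal \<beta>} \<longrightarrow>
     emeasure rho {x \<in> R. ennreal (\<beta> + \<Lambda> * M) < Tstar K g x} \<le> ennreal \<epsilon> * emeasure rho R"
    proof (intro exI[of _ "2 * l"] conjI allI impI)
      show "0 \<le> 2 * l" using l by simp
      fix g :: "(real ^ 'n) \<times> real \<Rightarrow> complex" and M R and \<beta> :: real
      assume g: "g \<in> Linf_c" and M: "0 < M" and gM: "AE x in rho. cmod (g x) \<le> M" and R: "R \<in> CZ" and \<beta>: "0 \<le> \<beta>"
        and big: "ennreal \<epsilon> * emeasure rho R < emeasure rho {x \<in> R. Tstar K g x \<le> ennreal \<beta>}"
      define F where "F x = complex_of_real (enn2real (Tstar K g x))" for x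
      have Tm: "Tstar K g \<in> borel_measurable rho" by (rule Tstar_measurable[OF g])
      have Fm: "F \<in> borel_measurable rho" unfolding F_def[abs_def] using Tm by measurable
      have Rs: "R \<in> sets rho" by (rule cz_sets[OF R])
      have inS: "x \<in> axS" if "x \<in> R" for x using sets.sets_into_space[OF Rs] that by auto
      define m where "m = cz_avg F R"
      have aefin: "AE x in rho. Tstar K g x < \<infinity>" using bnd g by blast
      have e0: "emeasure rho R \<noteq> 0" "emeasure rho R \<noteq> top"
        using cz_emeasure_pos[OF R] cz_emeasure_finite[OF R] by auto
      have "(\<integral>\<^sup>+x\<in>R. ennreal (cmod (F x - m)) \<partial>rho) / emeasure rho R \<le> BMO_norm F"
        unfolding BMO_norm_def m_def by (rule SUP_upper[OF R])
      also have "\<dots> \<le> ennreal C * Linf_norm (emod g)" using bnd g unfolding F_def[abs_def] by blast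
      also have "\<dots> \<le> ennreal C * ennreal M"
        by (intro mult_left_mono Linf_norm_le[OF Linf_c_measurable[OF g] gM]) simp
      finally have "(\<integral>\<^sup>+x\<in>R. ennreal (cmod (F x - m)) \<partial>rho) / emeasure rho R * emeasure rho R \<le> ennreal C * ennreal M * emeasure rho R"
        by (rule mult_right_mono) simp
      then have int: "(\<integral>\<^sup>+x\<in>R. ennreal (cmod (F x - m)) \<partial>rho) \<le> ennreal C * ennreal M * emeasure rho R"
        using e0 by (simp add: ennreal_divide_times ennreal_divide_self less_top)
      \<comment> \<open>\<open>enn2real\<close> sends an infinite value to 0, so the points of this
        null set are set aside before \<open>F\<close> is compared with
        \<open>Tstar\<close>.\<close>
      define N where "N = {x \<in> space rho. Tstar K g x = \<infinity>}"
      define D where "D = {x \<in> space rho. x \<in> R \<and> l * M < cmod (F x - m)}"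
      have Ns: "N \<in> sets rho" unfolding N_def using Tm by measurable
      have Ds: "D \<in> sets rho" unfolding D_def using Fm Rs by measurable
      have Neq: "N = {x \<in> space rho. \<not> Tstar K g x < \<infinity>}" using less_top[where 'a = ennreal] by (auto simp: N_def simp del: not_less)
      have N0: "emeasure rho N = 0"
        by (rule AE_iff_measurable[THEN iffD1, OF Ns Neq[symmetric] aefin])
      have lM: "0 < l * M" using l M by simp
      have Dm: "emeasure rho D \<le> ennreal \<epsilon> * emeasure rho R"
      proof -
        have "ennreal (l * M) * emeasure rho D = (\<integral>\<^sup>+x. ennreal (l * M) * indicator D x \<partial>rho)"
          using Ds by (simp add: nn_integral_cmult)
        also have "\<dots> \<le> (\<integral>\<^sup>+x\<in>R. ennreal (cmod (F x - m)) \<partial>rho)"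
          by (intro nn_integral_mono) (auto simp: D_def indicator_def intro!: ennreal_leI)
        also note int
        also have "ennreal C * ennreal M * emeasure rho R \<le> ennreal (l * M) * (ennreal \<epsilon> * emeasure rho R)"
        proof -
          have "C * M \<le> l * M * \<epsilon>" using C M \<epsilon> by (simp add: l_def mult_right_mono)
          then have "ennreal (C * M) \<le> ennreal (l * M * \<epsilon>)" by (rule ennreal_leI)
          then have "ennreal C * ennreal M \<le> ennreal (l * M) * ennreal \<epsilon>"
            using M \<epsilon> by (subst (1 2) ennreal_mult''[symmetric]) auto
          then show ?thesis by (simp only: mult.assoc[symmetric]) (rule mult_right_mono, simp_all)
        qed
        finally have "emeasure rho D \<le> ennreal (1 / (l * M)) * (ennreal (l * M) * (ennreal \<epsilon> * emeasure rho R))"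
          by (rule ennreal_cancel_le[OF lM])
        also have "\<dots> = (ennreal (1 / (l * M)) * ennreal (l * M)) * (ennreal \<epsilon> * emeasure rho R)"
          by (simp only: mult.assoc)
        also have "\<dots> = ennreal \<epsilon> * emeasure rho R" unfolding ennreal_inverse_mult[OF lM] by simp
        finally show ?thesis .
      qed
      have "\<exists>x0\<in>R. Tstar K g x0 \<le> ennreal \<beta> \<and> cmod (F x0 - m) \<le> l * M"
      proof (rule ccontr)
        assume n: "\<not> ?thesis"
        have "{x \<in> R. Tstar K g x \<le> ennreal \<beta>} \<subseteq> D"
          using n inS unfolding D_def by (auto simp: not_le)
        then have "emeasure rho {x \<in> R. Tstar K g x \<le> ennreal \<beta>} \<le> emeasure rho D" by (rule emeasure_mono[OF _ Ds])
        then show False using Dm big by simp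
      qed
      then obtain x0 where x0: "x0 \<in> R" "Tstar K g x0 \<le> ennreal \<beta>" "cmod (F x0 - m) \<le> l * M" by blast
      have "{x \<in> R. ennreal (\<beta> + 2 * l * M) < Tstar K g x} \<subseteq> D \<union> N"
      proof
        fix x assume "x \<in> {x \<in> R. ennreal (\<beta> + 2 * l * M) < Tstar K g x}"
        then have x: "x \<in> R" "ennreal (\<beta> + 2 * l * M) < Tstar K g x" by auto
        show "x \<in> D \<union> N"
        proof (rule ccontr)
          assume nx: "x \<notin> D \<union> N"
          then have fx: "Tstar K g x = ennreal (enn2real (Tstar K g x))"
            using inS[OF x(1)] by (simp add: N_def less_top)
          have dx: "cmod (F x - m) \<le> l * M" using nx x(1) inS[OF x(1)] by (simp add: D_def)
          have "cmod (F x - F x0) \<le> 2 * (l * M)"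
            using norm_triangle_ineq4[of "F x - m" "F x0 - m"] dx x0(3) by simp
          then have "\<bar>enn2real (Tstar K g x) - enn2real (Tstar K g x0)\<bar> \<le> 2 * (l * M)"
            unfolding F_def by (simp only: of_real_diff[symmetric] norm_of_real)
          moreover have "enn2real (Tstar K g x0) \<le> \<beta>"
            using enn2real_mono[OF x0(2)] \<beta> by simp
          ultimately have "enn2real (Tstar K g x) \<le> \<beta> + 2 * l * M" by linarith
          then have "Tstar K g x \<le> ennreal (\<beta> + 2 * l * M)" by (subst fx) (rule ennreal_leI)
          then show False using x(2) by simp
        qed
      qed
      then have "emeasure rho {x \<in> R. ennreal (\<beta> + 2 * l * M) < Tstar K g x} \<le> emeasure rho (D \<union> N)"
        by (rule emeasure_mono) (rule sets.Un[OF Ds Ns])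
      also have "\<dots> \<le> emeasure rho D + emeasure rho N" by (rule emeasure_subadditive[OF Ds Ns])
      also have "\<dots> \<le> ennreal \<epsilon> * emeasure rho R" using Dm N0 by simp
      finally show "emeasure rho {x \<in> R. ennreal (\<beta> + 2 * l * M) < Tstar K g x} \<le> ennreal \<epsilon> * emeasure rho R" .
    qed
  qed
qed

section \<open>Norm inequalities, integrals of powers and level sets\<close>

lemma bounded_Lp_nn_integral:
  assumes p: "0 < p" and bnd: "bounded_Lp p (Tstar K)"
  obtains C where "0 \<le> C"
    "\<forall>f. f \<in> Linf_c \<longrightarrow> (\<integral>\<^sup>+x. epow (Tstar K f x) p \<partial>rho) \<le> ennreal C * (\<integral>\<^sup>+x. ennreal (cmod (f x) powr p) \<partial>rho)"
proof -
  obtain C where C: "0 \<le> C" and b: "\<forall>f\<in>Linf_c. Tstar K f \<in> borel_measurable rho \<and> Lp_norm p (Tstar K f) \<le> ennreal C * Lp_norm p (emod f)"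
    using bnd unfolding bounded_Lp_def by blast
  have "(\<integral>\<^sup>+x. epow (Tstar K f x) p \<partial>rho) \<le> ennreal (C powr p) * (\<integral>\<^sup>+x. ennreal (cmod (f x) powr p) \<partial>rho)"
    if f: "f \<in> Linf_c" for f
  proof -
    define X where "X = (\<integral>\<^sup>+x. epow (Tstar K f x) p \<partial>rho)"
    define y where "y = enn2real (\<integral>\<^sup>+x. ennreal (cmod (f x) powr p) \<partial>rho)"
    have y: "(\<integral>\<^sup>+x. ennreal (cmod (f x) powr p) \<partial>rho) = ennreal y" "0 \<le> y"
      using Linf_c_powr_finite[OF f p] by (simp_all add: y_def)
    have "Lp_norm p (emod f) = epow (ennreal y) (1 / p)"
      unfolding Lp_norm_def y(1)[symmetric] by (simp add: epow_ennreal)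
    also have "\<dots> = ennreal (y powr (1 / p))" using y by (simp add: epow_ennreal)
    finally have "epow X (1 / p) \<le> ennreal C * ennreal (y powr (1 / p))"
      using b f unfolding X_def Lp_norm_def by fastforce
    also have "\<dots> = ennreal (C * y powr (1 / p))" by (rule ennreal_mult''[symmetric]) simp
    finally have le: "epow X (1 / p) \<le> ennreal (C * y powr (1 / p))" .
    show ?thesis
    proof (cases X)
      case top
      then show ?thesis using le by (simp add: epow_top top_unique)
    next
      case (real x)
      then have "x powr (1 / p) \<le> C * y powr (1 / p)"
        using le C by (simp add: epow_ennreal ennreal_le_iff)
      then have "(x powr (1 / p)) powr p \<le> (C * y powr (1 / p)) powr p"
        using p by (intro powr_mono2) auto
      then have "x \<le> C powr p * y"
        using p real y C by (simp add: powr_powr powr_mult)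
      then have "ennreal x \<le> ennreal (C powr p * y)" by (rule ennreal_leI)
      also have "\<dots> = ennreal (C powr p) * ennreal y" by (rule ennreal_mult') simp
      finally show ?thesis using real y unfolding X_def by simp
    qed
  qed
  then show ?thesis by (intro that[of "C powr p"]) auto
qed

lemma bounded_Lp_of_nn_integral:
  assumes p: "0 < p" and C: "0 \<le> C"
    and le: "\<forall>f. f \<in> Linf_c \<longrightarrow> (\<integral>\<^sup>+x. epow (Tstar K f x) p \<partial>rho) \<le> ennreal C * (\<integral>\<^sup>+x. ennreal (cmod (f x) powr p) \<partial>rho)"
  shows "bounded_Lp p (Tstar K)"
  unfolding bounded_Lp_def
proof (intro exI[of _ "C powr (1 / p)"] conjI ballI)
  show "0 \<le> C powr (1 / p)" by simp
  fix f :: "(real ^ 'n) \<times> real \<Rightarrow> complex" assume f: "f \<in> Linf_c"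
  show "Tstar K f \<in> borel_measurable rho" by (rule Tstar_measurable[OF f])
  define y where "y = enn2real (\<integral>\<^sup>+x. ennreal (cmod (f x) powr p) \<partial>rho)"
  have y: "(\<integral>\<^sup>+x. ennreal (cmod (f x) powr p) \<partial>rho) = ennreal y" "0 \<le> y"
    using Linf_c_powr_finite[OF f p] by (simp_all add: y_def)
  have "Lp_norm p (emod f) = epow (ennreal y) (1 / p)"
    unfolding Lp_norm_def y(1)[symmetric] by (simp add: epow_ennreal)
  also have "\<dots> = ennreal (y powr (1 / p))" using y by (simp add: epow_ennreal)
  finally have yn: "Lp_norm p (emod f) = ennreal (y powr (1 / p))" .
  have X: "(\<integral>\<^sup>+x. epow (Tstar K f x) p \<partial>rho) \<le> ennreal (C * y)"
    using le[rule_format, OF f] C y by (simp add: ennreal_mult')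
  obtain x where x: "(\<integral>\<^sup>+x. epow (Tstar K f x) p \<partial>rho) = ennreal x" "0 \<le> x"
    using X by (cases "\<integral>\<^sup>+x. epow (Tstar K f x) p \<partial>rho") (auto simp: top_unique)
  have "x \<le> C * y" using X C y unfolding x(1) by (simp add: ennreal_le_iff)
  then have "x powr (1 / p) \<le> (C * y) powr (1 / p)" using x p by (intro powr_mono2) auto
  then have "ennreal (x powr (1 / p)) \<le> ennreal (C powr (1 / p) * y powr (1 / p))"
    using C y by (intro ennreal_leI) (simp add: powr_mult)
  also have "\<dots> = ennreal (C powr (1 / p)) * ennreal (y powr (1 / p))" by (rule ennreal_mult') simp
  finally have "ennreal (x powr (1 / p)) \<le> ennreal (C powr (1 / p)) * Lp_norm p (emod f)" unfolding yn .
  moreover have "Lp_norm p (Tstar K f) = ennreal (x powr (1 / p))"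
    unfolding Lp_norm_def x(1) by (rule epow_ennreal[OF x(2)])
  ultimately show "Lp_norm p (Tstar K f) \<le> ennreal (C powr (1 / p)) * Lp_norm p (emod f)" by simp
qed

lemma chebyshev_epow:
  assumes f: "f \<in> Linf_c" and p: "0 < p" and \<alpha>: "0 < \<alpha>"
  shows "ennreal (\<alpha> powr p) * lev f \<alpha> \<le> (\<integral>\<^sup>+x. epow (Tstar K f x) p \<partial>rho)"
proof -
  have "ennreal (\<alpha> powr p) * lev f \<alpha> = (\<integral>\<^sup>+x. ennreal (\<alpha> powr p) * indicator {x \<in> axS. ennreal \<alpha> < Tstar K f x} x \<partial>rho)"
    using level_sets(1)[OF f] by (simp add: lev_def nn_integral_cmult)
  also have "\<dots> \<le> (\<integral>\<^sup>+x. epow (Tstar K f x) p \<partial>rho)"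
  proof (rule nn_integral_mono)
    fix x
    show "ennreal (\<alpha> powr p) * indicator {x \<in> axS. ennreal \<alpha> < Tstar K f x} x \<le> epow (Tstar K f x) p"
    proof (cases "ennreal \<alpha> < Tstar K f x")
      case True
      have "ennreal (\<alpha> powr p) \<le> epow (Tstar K f x) p"
      proof (cases "Tstar K f x")
        case (real t)
        then have "\<alpha> \<le> t" using True \<alpha> by (simp add: ennreal_less_iff)
        then show ?thesis using real \<alpha> p by (simp add: epow_ennreal ennreal_leI powr_mono2)
      qed (simp add: epow_top)
      then show ?thesis by (simp add: indicator_def)
    qed simp
  qed
  finally show ?thesis .
qed

lemma OSC_of_Lp:
  assumes p: "1 < p" and bnd: "bounded_Lp p (Tstar K)"
  shows OSC
proof -
  have p0: "0 < p" using p by simp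
  obtain C where C: "0 \<le> C" and le:
    "\<forall>f. f \<in> Linf_c \<longrightarrow> (\<integral>\<^sup>+x. epow (Tstar K f x) p \<partial>rho) \<le> ennreal C * (\<integral>\<^sup>+x. ennreal (cmod (f x) powr p) \<partial>rho)"
    by (rule bounded_Lp_nn_integral[OF p0 bnd])
  show ?thesis
  proof (rule OSC_of_weak[OF less_imp_le[OF p] C])
    fix f :: "(real ^ 'n) \<times> real \<Rightarrow> complex" and \<alpha> assume f: "f \<in> Linf_c" and \<alpha>: "(0::real) < \<alpha>"
    show "ennreal (\<alpha> powr p) * lev f \<alpha> \<le> ennreal C * (\<integral>\<^sup>+x. ennreal (cmod (f x) powr p) \<partial>rho)"
      by (rule order_trans[OF chebyshev_epow[OF f p0 \<alpha>] le[rule_format, OF f]])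
  qed
qed

lemma Lp_norm_one: "Lp_norm 1 (emod f) = (\<integral>\<^sup>+x. emod f x \<partial>rho)"
  by (simp add: Lp_norm_def epow_one)

lemma OSC_of_weak_L1:
  assumes "bounded_L1_weak_L1 (Tstar K)"
  shows OSC
proof -
  obtain C where C: "0 \<le> C" and b: "\<forall>f\<in>Linf_c. Tstar K f \<in> borel_measurable rho \<and> weak_Lp_norm 1 (Tstar K f) \<le> ennreal C * Lp_norm 1 (emod f)"
    using assms unfolding bounded_L1_weak_L1_def by blast
  show ?thesis
  proof (rule OSC_of_weak[OF order_refl C])
    fix f :: "(real ^ 'n) \<times> real \<Rightarrow> complex" and \<alpha> assume f: "f \<in> Linf_c" and \<alpha>: "(0::real) < \<alpha>"
    have "ennreal \<alpha> * lev f \<alpha> \<le> weak_Lp_norm 1 (Tstar K f)"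
      unfolding weak_Lp_norm_def lev_def using \<alpha> by (intro SUP_upper2[of \<alpha>]) (auto simp: epow_one)
    also have "\<dots> \<le> ennreal C * (\<integral>\<^sup>+x. emod f x \<partial>rho)" using b f unfolding Lp_norm_one by blast
    finally show "ennreal (\<alpha> powr 1) * lev f \<alpha> \<le> ennreal C * (\<integral>\<^sup>+x. ennreal (cmod (f x) powr 1) \<partial>rho)"
      using \<alpha> by simp
  qed
qed

lemma weak_L1_of_OSC:
  assumes OSC shows "bounded_L1_weak_L1 (Tstar K)"
proof -
  obtain C where C: "0 \<le> C" and w: "\<forall>f \<alpha>. f \<in> Linf_c \<longrightarrow> 0 < \<alpha> \<longrightarrow> ennreal \<alpha> * lev f \<alpha> \<le> ennreal C * (\<integral>\<^sup>+x. emod f x \<partial>rho)"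
    by (rule weak_type_of_OSC[OF assms])
  show ?thesis
    unfolding bounded_L1_weak_L1_def
  proof (intro exI[of _ C] conjI ballI C)
    fix f :: "(real ^ 'n) \<times> real \<Rightarrow> complex" assume f: "f \<in> Linf_c"
    show "Tstar K f \<in> borel_measurable rho" by (rule Tstar_measurable[OF f])
    show "weak_Lp_norm 1 (Tstar K f) \<le> ennreal C * Lp_norm 1 (emod f)"
      unfolding weak_Lp_norm_def Lp_norm_one
    proof (rule SUP_least)
      fix \<alpha> :: real assume "\<alpha> \<in> {0<..}"
      then show "ennreal \<alpha> * epow (emeasure rho {x \<in> axS. ennreal \<alpha> < Tstar K f x}) (1 / 1) \<le> ennreal C * (\<integral>\<^sup>+x. emod f x \<partial>rho)"
        using w[rule_format, OF f, of \<alpha>] by (simp add: lev_def epow_one)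
    qed
  qed
qed

lemma Lp_of_OSC:
  assumes OSC "1 < p" shows "bounded_Lp p (Tstar K)"
proof -
  obtain C where "0 \<le> C"
    "\<forall>f. f \<in> Linf_c \<longrightarrow> (\<integral>\<^sup>+x. epow (Tstar K f x) p \<partial>rho) \<le> ennreal C * (\<integral>\<^sup>+x. ennreal (cmod (f x) powr p) \<partial>rho)"
    by (rule nn_integral_Lp_of_OSC[OF assms])
  then show ?thesis using assms(2) by (intro bounded_Lp_of_nn_integral) auto
qed

end

text \<open>The average is itself within \<open>d\<close> of \<open>c\<close>, so replacing
  \<open>c\<close> by it at most doubles the mean deviation. This lets the value of a maximal
  function at one point serve as the constant.\<close>

lemma mean_oscillation_le:
  fixes F :: "(real ^ 'n) \<times> real \<Rightarrow> complex"
  assumes R: "R \<in> CZ" and F: "set_integrable rho R F" and d: "0 \<le> d"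
    and le: "(\<integral>\<^sup>+x\<in>R. ennreal (cmod (F x - c)) \<partial>rho) \<le> ennreal d * emeasure rho R"
  shows "(\<integral>\<^sup>+x\<in>R. ennreal (cmod (F x - cz_avg F R)) \<partial>rho) / emeasure rho R \<le> ennreal (2 * d)"
proof -
  have Rs: "R \<in> sets rho" by (rule cz_sets[OF R])
  define v where "v = measure rho R"
  have v: "emeasure rho R = ennreal v"
    using cz_emeasure_finite[OF R] unfolding v_def by (intro emeasure_eq_ennreal_measure) (simp add: less_top)
  have v0: "0 < v" using cz_emeasure_pos[OF R] unfolding v by simp
  have ic: "set_integrable rho R (\<lambda>x. c)"
    unfolding set_integrable_def using Rs cz_emeasure_finite[OF R] by (intro integrable_scaleR_left integrable_real_indicator) auto
  have cR: "(LINT x:R|rho. c) = v *\<^sub>R c"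
    unfolding set_lebesgue_integral_def v_def
    using Rs cz_emeasure_finite[OF R] sets.sets_into_space[OF Rs] by (simp add: Int_absorb2)
  have "cz_avg F R - c = (1 / v) *\<^sub>R (LINT x:R|rho. F x - c)"
    unfolding set_integral_diff(2)[OF F ic] cR cz_avg_def v_def[symmetric] using v0 by (simp add: scaleR_diff_right)
  then have n: "cmod (cz_avg F R - c) = cmod (LINT x:R|rho. F x - c) / v" using v0 by simp
  have "ennreal (cmod (LINT x:R|rho. F x - c)) \<le> (\<integral>\<^sup>+x. ennreal (norm (indicator R x *\<^sub>R (F x - c))) \<partial>rho)"
    unfolding set_lebesgue_integral_def
    by (rule integral_norm_bound_ennreal) (use set_integral_diff(1)[OF F ic] in \<open>simp add: set_integrable_def\<close>)
  also have "\<dots> = (\<integral>\<^sup>+x\<in>R. ennreal (cmod (F x - c)) \<partial>rho)"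
    by (intro nn_integral_cong) (simp add: indicator_def)
  also have "\<dots> \<le> ennreal (d * v)" using le d unfolding v by (simp add: ennreal_mult')
  finally have "cmod (LINT x:R|rho. F x - c) \<le> d * v" using d v0 by (simp add: ennreal_le_iff)
  then have a: "cmod (cz_avg F R - c) \<le> d" unfolding n using v0 by (simp add: pos_divide_le_eq)
  have Fm: "(\<lambda>x. ennreal (cmod (F x - c)) * indicator R x) \<in> borel_measurable rho"
  proof -
    have "(\<lambda>x. indicator R x *\<^sub>R (F x - c)) \<in> borel_measurable rho"
      using set_integral_diff(1)[OF F ic] unfolding set_integrable_def by (rule borel_measurable_integrable)
    then have "(\<lambda>x. ennreal (cmod (indicator R x *\<^sub>R (F x - c)))) \<in> borel_measurable rho" by measurable
    moreover have "(\<lambda>x. ennreal (cmod (indicator R x *\<^sub>R (F x - c)))) = (\<lambda>x. ennreal (cmod (F x - c)) * indicator R x)"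
      by (rule ext) (simp add: indicator_def)
    ultimately show ?thesis by (simp only:)
  qed
  have "(\<integral>\<^sup>+x\<in>R. ennreal (cmod (F x - cz_avg F R)) \<partial>rho) \<le>
      (\<integral>\<^sup>+x. ennreal (cmod (F x - c)) * indicator R x + ennreal d * indicator R x \<partial>rho)"
  proof (rule nn_integral_mono)
    fix x
    have "cmod (F x - cz_avg F R) \<le> cmod (F x - c) + d"
      using norm_triangle_ineq4[of "F x - c" "cz_avg F R - c"] a by simp
    then have "ennreal (cmod (F x - cz_avg F R)) \<le> ennreal (cmod (F x - c)) + ennreal d"
      using d by (simp add: ennreal_plus[symmetric] ennreal_leI del: ennreal_plus)
    then show "ennreal (cmod (F x - cz_avg F R)) * indicator R x \<le> ennreal (cmod (F x - c)) * indicator R x + ennreal d * indicator R x"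
      by (simp add: indicator_def)
  qed
  also have "\<dots> = (\<integral>\<^sup>+x\<in>R. ennreal (cmod (F x - c)) \<partial>rho) + ennreal d * emeasure rho R"
    using Fm Rs by (subst nn_integral_add) (auto simp: nn_integral_cmult)
  also have "\<dots> \<le> ennreal d * emeasure rho R + ennreal d * emeasure rho R" by (intro add_right_mono le)
  also have "\<dots> = ennreal (2 * d * v)"
    using d v0 unfolding v by (simp add: ennreal_mult'[symmetric] ennreal_plus[symmetric] del: ennreal_plus)
  finally have "(\<integral>\<^sup>+x\<in>R. ennreal (cmod (F x - cz_avg F R)) \<partial>rho) \<le> ennreal (2 * d * v)" .
  then have "(\<integral>\<^sup>+x\<in>R. ennreal (cmod (F x - cz_avg F R)) \<partial>rho) / emeasure rho R \<le> ennreal (2 * d * v) / ennreal v"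
    unfolding v by (rule divide_right_mono_ennreal)
  also have "\<dots> = ennreal (2 * d)" using d v0 by (simp add: divide_ennreal)
  finally show ?thesis .
qed

context cz_kernel
begin

lemma BMO_of_L2:
  assumes bnd: "bounded_Lp 2 (Tstar K)"
  shows "bounded_Linf_c_BMO (Tstar K)"
proof -
  have p2: "0 < (2::real)" by simp
  obtain C where C: "0 \<le> C" and le:
    "\<forall>f. f \<in> Linf_c \<longrightarrow> (\<integral>\<^sup>+x. epow (Tstar K f x) 2 \<partial>rho) \<le> ennreal C * (\<integral>\<^sup>+x. ennreal (cmod (f x) powr 2) \<partial>rho)"
    by (rule bounded_Lp_nn_integral[OF p2 bnd])
  obtain Co where Co: "0 \<le> Co" and osc: "\<forall>f M R x x'. f \<in> Linf_c \<longrightarrow> 0 \<le> M \<longrightarrow> (AE y in rho. cmod (f y) \<le> M) \<longrightarrow> R \<in> CZ \<longrightarrow>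
     (AE y in rho. y \<in> cz_star R \<longrightarrow> f y = 0) \<longrightarrow> x \<in> R \<longrightarrow> x' \<in> R \<longrightarrow>
     Tstar K f x \<le> Tstar K f x' + ennreal (Co * M)"
    using Tstar_oscillation by blast
  define \<kappa> :: real where "\<kappa> = 2 * 3 ^ CARD('n)"
  have \<kappa>: "0 < \<kappa>" by (simp add: \<kappa>_def)
  \<comment> \<open>\<open>1 + C * \<kappa>\<close> comes from the part of \<open>f\<close> in the
    star via \<open>le_epow\<close>, \<open>Co\<close> from the oscillation of the part
    outside.\<close>
  define B where "B = 1 + C * \<kappa> + Co"
  have B: "0 \<le> B" using C \<kappa> Co by (simp add: B_def)
  have Tm: "Tstar K f \<in> borel_measurable rho" if "f \<in> Linf_c" for f by (rule Tstar_measurable[OF that])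
  have L2: "(\<integral>\<^sup>+x. epow (Tstar K f x) 2 \<partial>rho) < \<infinity>" if f: "f \<in> Linf_c" for f
    by (rule le_less_trans[OF le[rule_format, OF f]]) (use Linf_c_powr_finite[OF f p2] in \<open>simp add: ennreal_mult_less_top\<close>)
  have aefin: "AE x in rho. Tstar K f x < \<infinity>" if f: "f \<in> Linf_c" for f
  proof -
    have "AE x in rho. epow (Tstar K f x) 2 \<noteq> \<infinity>"
      using L2[OF f] epow_measurable[OF Tm[OF f]] by (intro nn_integral_PInf_AE) auto
    then show ?thesis
    proof eventually_elim
      case (elim x)
      then show ?case by (cases "Tstar K f x") (simp_all add: epow_top)
    qed
  qed
  \<comment> \<open>Takes the place of the Cauchy-Schwarz inequality: integrated over
    \<open>R\<close>, the first term gives \<open>M\<close> times the measure and the second is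
    covered by the estimate on squares.\<close>
  have le_epow: "t \<le> ennreal M + ennreal (1 / M) * epow t 2" if M: "0 < M" for t M
  proof (cases t)
    case (real r)
    have "r * M \<le> M * M + r * r" using sum_squares_bound[of r M] zero_le_power2[of r] zero_le_power2[of M]
      unfolding power2_eq_square by linarith
    then have "r \<le> M + 1 / M * r\<^sup>2" using M by (simp add: field_simps power2_eq_square)
    then have "ennreal r \<le> ennreal (M + 1 / M * r\<^sup>2)" by (rule ennreal_leI)
    also have "\<dots> = ennreal M + ennreal (1 / M) * ennreal (r\<^sup>2)"
      using M by (subst ennreal_plus) (auto simp: ennreal_mult'[symmetric])
    finally show ?thesis using real by (simp add: epow_ennreal)
  next
    case top
    then show ?thesis using M by (simp add: epow_top ennreal_mult_top)
  qed
  define F where "F f x = complex_of_real (enn2real (Tstar K f x))" for f x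
  have Fm: "F f \<in> borel_measurable rho" if f: "f \<in> Linf_c" for f
    unfolding F_def[abs_def] using Tm[OF f] by measurable
  have Fint: "set_integrable rho S (F f)" if f: "f \<in> Linf_c" and S: "S \<in> sets rho" "emeasure rho S < \<infinity>" for f S
    unfolding set_integrable_def
  proof (rule integrableI_bounded)
    show "(\<lambda>x. indicator S x *\<^sub>R F f x) \<in> borel_measurable rho" using Fm[OF f] S(1) by measurable
    have "(\<integral>\<^sup>+x. ennreal (norm (indicator S x *\<^sub>R F f x)) \<partial>rho) \<le> (\<integral>\<^sup>+x. ennreal 1 * indicator S x + ennreal (1 / 1) * epow (Tstar K f x) 2 \<partial>rho)"
    proof (rule nn_integral_mono)
      fix x
      have "ennreal (norm (F f x)) \<le> Tstar K f x"
        unfolding F_def by (cases "Tstar K f x") auto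
      also have "\<dots> \<le> ennreal 1 + ennreal (1 / 1) * epow (Tstar K f x) 2" by (rule le_epow) simp
      finally have "ennreal (norm (F f x)) \<le> ennreal 1 + ennreal (1 / 1) * epow (Tstar K f x) 2" .
      then show "ennreal (norm (indicator S x *\<^sub>R F f x)) \<le> ennreal 1 * indicator S x + ennreal (1 / 1) * epow (Tstar K f x) 2"
        by (cases "x \<in> S") simp_all
    qed
    also have "\<dots> = emeasure rho S + (\<integral>\<^sup>+x. epow (Tstar K f x) 2 \<partial>rho)"
      using S(1) epow_measurable[OF Tm[OF f]] by (subst nn_integral_add) auto
    also have "\<dots> < \<infinity>" using S(2) L2[OF f] by simp
    finally show "(\<integral>\<^sup>+x. ennreal (norm (indicator S x *\<^sub>R F f x)) \<partial>rho) < \<infinity>" .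
  qed
  have main: "BMO_norm (F f) \<le> ennreal (2 * (B * M))"
    if f: "f \<in> Linf_c" and M: "0 < M" and fM: "AE x in rho. cmod (f x) \<le> M" for f M
    unfolding BMO_norm_def
  proof (rule SUP_least)
    fix R :: "((real ^ 'n) \<times> real) set" assume R: "R \<in> CZ"
    have Rs: "R \<in> sets rho" by (rule cz_sets[OF R])
    define g1 where "g1 y = (if y \<in> cz_star R then f y else 0)" for y
    define g2 where "g2 y = f y - g1 y" for y
    have sR: "cz_star R \<in> sets rho" by (rule cz_star_sets[OF R])
    have g1: "g1 \<in> Linf_c" unfolding g1_def[abs_def] by (rule Linf_c_restrict[OF f sR])
    have g2: "g2 \<in> Linf_c" unfolding g2_def[abs_def] by (rule Linf_c_diff[OF f g1])
    have g12: "(\<lambda>y. f y - g2 y) = g1" by (simp add: g2_def fun_eq_iff)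
    have g2M: "AE x in rho. cmod (g2 x) \<le> M"
      using fM by eventually_elim (use M in \<open>simp add: g2_def g1_def\<close>)
    \<comment> \<open>\<open>Tstar K g2\<close> is finite almost everywhere and \<open>R\<close> has
      positive measure; the value at such a point is the constant with which \<open>F f\<close> is
      compared.\<close>
    have "\<exists>x0\<in>R. Tstar K g2 x0 < \<infinity>"
    proof (rule ccontr)
      assume n: "\<not> ?thesis"
      have "AE x in rho. x \<notin> R" using aefin[OF g2] by eventually_elim (use n in blast)
      moreover have "{x \<in> space rho. \<not> x \<notin> R} = R" using sets.sets_into_space[OF Rs] by auto
      ultimately have "emeasure rho R = 0" using AE_iff_measurable[OF Rs, of "\<lambda>x. x \<notin> R"] by simp
      then show False using cz_emeasure_pos[OF R] by simp
    qed
    then obtain x0 where x0: "x0 \<in> R" "Tstar K g2 x0 < \<infinity>" by blast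
    define t where "t = enn2real (Tstar K g2 x0)"
    have t: "Tstar K g2 x0 = ennreal t" "0 \<le> t" using x0(2) by (simp_all add: t_def)
    have oscR: "Tstar K g2 x \<le> Tstar K g2 x' + ennreal (Co * M)" if "x \<in> R" "x' \<in> R" for x x'
      by (rule osc[rule_format, OF g2 _ g2M R _ that]) (use M in \<open>auto simp: g2_def g1_def\<close>)
    have CoM: "0 \<le> Co * M" using Co M by simp
    have "(\<integral>\<^sup>+x\<in>R. ennreal (cmod (F f x - complex_of_real t)) \<partial>rho) \<le>
        (\<integral>\<^sup>+x. Tstar K g1 x * indicator R x + ennreal (Co * M) * indicator R x \<partial>rho)"
    proof (rule nn_integral_mono_AE)
      show "AE x in rho. ennreal (cmod (F f x - complex_of_real t)) * indicator R x \<le> Tstar K g1 x * indicator R x + ennreal (Co * M) * indicator R x"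
        using aefin[OF f]
      proof eventually_elim
        case (elim x)
        show ?case
        proof (cases "x \<in> R")
          case True
          define a where "a = enn2real (Tstar K f x)"
          have a: "Tstar K f x = ennreal a" "0 \<le> a" using elim by (simp_all add: a_def)
          have "ennreal \<bar>a - t\<bar> \<le> Tstar K g1 x + ennreal (Co * M)"
          proof (cases "Tstar K g1 x")
            case (real b)
            have "ennreal a \<le> Tstar K g2 x + Tstar K g1 x"
              using Tstar_triangle[OF f g2, of x] unfolding g12 a .
            also have "\<dots> \<le> (ennreal t + ennreal (Co * M)) + ennreal b"
              using oscR[OF True x0(1)] unfolding t real by (rule add_right_mono)
            also have "\<dots> = ennreal (t + Co * M + b)" using t CoM real by (simp add: ennreal_plus[symmetric] del: ennreal_plus)
            finally have 1: "a \<le> t + Co * M + b" using t CoM real by (subst (asm) ennreal_le_iff) auto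
            have "ennreal t \<le> Tstar K g2 x + ennreal (Co * M)"
              using oscR[OF x0(1) True] unfolding t .
            also have "\<dots> \<le> (ennreal a + ennreal b) + ennreal (Co * M)"
              using Tstar_triangle'[OF f g2, of x] unfolding g12 a real by (rule add_right_mono)
            also have "\<dots> = ennreal (a + b + Co * M)" using a CoM real by (simp add: ennreal_plus[symmetric] del: ennreal_plus)
            finally have 2: "t \<le> a + b + Co * M" using a CoM real by (subst (asm) ennreal_le_iff) auto
            have "\<bar>a - t\<bar> \<le> b + Co * M" using 1 2 by linarith
            then have "ennreal \<bar>a - t\<bar> \<le> ennreal (b + Co * M)" by (rule ennreal_leI)
            then show ?thesis using real CoM by simp
          qed simp
          moreover have "cmod (F f x - complex_of_real t) = \<bar>a - t\<bar>"
            unfolding F_def a_def by (simp only: of_real_diff[symmetric] norm_of_real)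
          ultimately show ?thesis using True by simp
        qed simp
      qed
    qed
    also have "\<dots> = (\<integral>\<^sup>+x\<in>R. Tstar K g1 x \<partial>rho) + ennreal (Co * M) * emeasure rho R"
      using Tm[OF g1] Rs by (subst nn_integral_add) (auto simp: nn_integral_cmult)
    finally have 1: "(\<integral>\<^sup>+x\<in>R. ennreal (cmod (F f x - complex_of_real t)) \<partial>rho) \<le>
        (\<integral>\<^sup>+x\<in>R. Tstar K g1 x \<partial>rho) + ennreal (Co * M) * emeasure rho R" .
    have "(\<integral>\<^sup>+x\<in>R. Tstar K g1 x \<partial>rho) \<le> (\<integral>\<^sup>+x. ennreal M * indicator R x + ennreal (1 / M) * epow (Tstar K g1 x) 2 \<partial>rho)"
    proof (rule nn_integral_mono)
      fix x
      show "Tstar K g1 x * indicator R x \<le> ennreal M * indicator R x + ennreal (1 / M) * epow (Tstar K g1 x) 2"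
        using le_epow[OF M, of "Tstar K g1 x"] by (simp add: indicator_def)
    qed
    also have "\<dots> = ennreal M * emeasure rho R + ennreal (1 / M) * (\<integral>\<^sup>+x. epow (Tstar K g1 x) 2 \<partial>rho)"
      using Rs epow_measurable[OF Tm[OF g1]] by (subst nn_integral_add) (auto simp: nn_integral_cmult)
    finally have 2: "(\<integral>\<^sup>+x\<in>R. Tstar K g1 x \<partial>rho) \<le> ennreal M * emeasure rho R + ennreal (1 / M) * (\<integral>\<^sup>+x. epow (Tstar K g1 x) 2 \<partial>rho)" .
    have "(\<integral>\<^sup>+x. ennreal (cmod (g1 x) powr 2) \<partial>rho) \<le> (\<integral>\<^sup>+x. ennreal (M\<^sup>2) * indicator (cz_star R) x \<partial>rho)"
    proof (rule nn_integral_mono_AE)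
      show "AE x in rho. ennreal (cmod (g1 x) powr 2) \<le> ennreal (M\<^sup>2) * indicator (cz_star R) x"
        using fM
      proof eventually_elim
        case (elim x)
        then show ?case by (auto simp: g1_def intro!: ennreal_leI power_mono)
      qed
    qed
    also have "\<dots> = ennreal (M\<^sup>2) * emeasure rho (cz_star R)" using sR by (simp add: nn_integral_cmult)
    also have "\<dots> \<le> ennreal (M\<^sup>2) * (ennreal \<kappa> * emeasure rho R)"
      unfolding \<kappa>_def by (intro mult_left_mono cz_star_emeasure[OF R]) simp
    finally have g1i: "(\<integral>\<^sup>+x. ennreal (cmod (g1 x) powr 2) \<partial>rho) \<le> ennreal (M\<^sup>2) * (ennreal \<kappa> * emeasure rho R)" .
    have "ennreal (1 / M) * (\<integral>\<^sup>+x. epow (Tstar K g1 x) 2 \<partial>rho) \<le> ennreal (1 / M) * (ennreal C * (ennreal (M\<^sup>2) * (ennreal \<kappa> * emeasure rho R)))"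
      by (intro mult_left_mono order_trans[OF le[rule_format, OF g1]] g1i) simp_all
    also have "\<dots> = ennreal (1 / M * (C * (M\<^sup>2 * \<kappa>))) * emeasure rho R"
    proof -
      have "ennreal (1 / M * (C * (M\<^sup>2 * \<kappa>))) = ennreal (1 / M) * (ennreal C * (ennreal (M\<^sup>2) * ennreal \<kappa>))"
        using M C by (simp only: ennreal_mult' divide_nonneg_nonneg zero_le_one less_imp_le zero_le_power2)
      then show ?thesis by (simp only: mult.assoc)
    qed
    also have "1 / M * (C * (M\<^sup>2 * \<kappa>)) = C * \<kappa> * M" using M by (simp add: power2_eq_square)
    finally have 3: "ennreal (1 / M) * (\<integral>\<^sup>+x. epow (Tstar K g1 x) 2 \<partial>rho) \<le> ennreal (C * \<kappa> * M) * emeasure rho R" .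
    have "(\<integral>\<^sup>+x\<in>R. ennreal (cmod (F f x - complex_of_real t)) \<partial>rho) \<le>
        (ennreal M * emeasure rho R + ennreal (C * \<kappa> * M) * emeasure rho R) + ennreal (Co * M) * emeasure rho R"
      by (rule order_trans[OF 1 add_right_mono[OF order_trans[OF 2 add_left_mono[OF 3]]]])
    also have "\<dots> = ennreal (B * M) * emeasure rho R"
    proof -
      have "ennreal (B * M) = ennreal M + ennreal (C * \<kappa> * M) + ennreal (Co * M)"
        using M C \<kappa> CoM unfolding B_def by (simp add: ennreal_plus[symmetric] algebra_simps del: ennreal_plus)
      then show ?thesis by (simp only: distrib_right)
    qed
    finally have "(\<integral>\<^sup>+x\<in>R. ennreal (cmod (F f x - complex_of_real t)) \<partial>rho) \<le> ennreal (B * M) * emeasure rho R" .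
    then show "(\<integral>\<^sup>+x\<in>R. ennreal (cmod (F f x - cz_avg (F f) R)) \<partial>rho) / emeasure rho R \<le> ennreal (2 * (B * M))"
      by (rule mean_oscillation_le[OF R Fint[OF f Rs cz_emeasure_finite[OF R]], rotated]) (use B M in simp)
  qed
  show ?thesis
    unfolding bounded_Linf_c_BMO_def
  proof (intro exI[of _ "2 * B"] conjI ballI)
    show "0 \<le> 2 * B" using B by simp
    fix f :: "(real ^ 'n) \<times> real \<Rightarrow> complex" assume f: "f \<in> Linf_c"
    show "AE x in rho. Tstar K f x < \<infinity>" by (rule aefin[OF f])
    define M0 where "M0 = enn2real (Linf_norm (emod f))"
    have M0: "0 \<le> M0" "AE x in rho. cmod (f x) \<le> M0" unfolding M0_def by (simp, rule Linf_c_norm_le[OF f])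
    have nM: "Linf_norm (emod f) = ennreal M0" using f by (simp add: M0_def Linf_c_def)
    have "BMO_norm (F f) \<le> ennreal (2 * B * M0)"
    proof (rule ennreal_le_epsilon)
      fix e :: real assume e: "0 < e"
      \<comment> \<open>\<open>main\<close> divides by its bound and needs it positive, whereas the
        essential supremum may be 0; the small increment covers this case and is removed in the
        limit.\<close>
      define M where "M = M0 + e / (2 * (B + 1))"
      have M: "0 < M" "M0 \<le> M" using M0 e B by (auto simp: M_def add_nonneg_pos)
      have "AE x in rho. cmod (f x) \<le> M" using M0(2) by eventually_elim (use M in simp)
      from main[OF f M(1) this] have "BMO_norm (F f) \<le> ennreal (2 * (B * M))" .
      also have "\<dots> \<le> ennreal (2 * B * M0 + e)"
      proof (rule ennreal_leI)
        have "B * e / (B + 1) \<le> e" using B e by (simp add: field_simps)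
        then show "2 * (B * M) \<le> 2 * B * M0 + e" using B unfolding M_def by (simp add: field_simps)
      qed
      also have "\<dots> = ennreal (2 * B * M0) + ennreal e" using B M0 e by simp
      finally show "BMO_norm (F f) \<le> ennreal (2 * B * M0) + ennreal e" .
    qed
    then have bm: "BMO_norm (F f) \<le> ennreal (2 * B) * Linf_norm (emod f)"
      unfolding nM using B M0 by (simp add: ennreal_mult')
    then show "BMO_norm (\<lambda>x. complex_of_real (enn2real (Tstar K f x))) \<le> ennreal (2 * B) * Linf_norm (emod f)"
      unfolding F_def[abs_def] .
    have "BMO_norm (F f) < \<infinity>" by (rule le_less_trans[OF bm]) (simp add: nM ennreal_mult_less_top)
    moreover have "F f \<in> L1_loc"
      unfolding L1_loc_def
    proof (intro CollectI allI impI)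
      fix S :: "((real ^ 'n) \<times> real) set" assume S: "compact S \<and> S \<subseteq> axS"
      then show "set_integrable rho S (F f)"
        using emeasure_rho_compact by (intro Fint[OF f] borel_sets_rho borel_compact) auto
    qed
    ultimately show "(\<lambda>x. complex_of_real (enn2real (Tstar K f x))) \<in> BMO"
      unfolding BMO_def F_def[abs_def] by simp
  qed
qed

lemma boundedness_equivalences:
  "(bounded_Linf_c_BMO (Tstar K) \<longleftrightarrow> (\<forall>p>1. bounded_Lp p (Tstar K))) \<and>
    ((\<forall>p>1. bounded_Lp p (Tstar K)) \<longleftrightarrow> (\<exists>p>1. bounded_Lp p (Tstar K))) \<and>
    ((\<exists>p>1. bounded_Lp p (Tstar K)) \<longleftrightarrow> bounded_L1_weak_L1 (Tstar K))"
proof -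
  have ex: "\<exists>p>1. bounded_Lp p (Tstar K)" if "\<forall>p>1. bounded_Lp p (Tstar K)"
    using that by (intro exI[of _ 2]) simp
  have "OSC \<Longrightarrow> \<forall>p>1. bounded_Lp p (Tstar K)" using Lp_of_OSC by blast
  moreover have "\<exists>p>1. bounded_Lp p (Tstar K) \<Longrightarrow> OSC" using OSC_of_Lp by blast
  moreover have "\<forall>p>1. bounded_Lp p (Tstar K) \<Longrightarrow> bounded_Linf_c_BMO (Tstar K)" by (rule BMO_of_L2) simp
  ultimately show ?thesis using ex OSC_of_BMO OSC_of_weak_L1 weak_L1_of_OSC by metis
qed

end

text \<open>Local integrability gives no information on the diagonal, so the kernel is set to \<open>0\<close> there; this
  does not affect the maximal operator, because \<open>x\<close> never belongs to the region of integration.\<close>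

lemma offdiagonal_measurable:
  fixes K :: "(real ^ 'n) \<times> real \<Rightarrow> (real ^ 'n) \<times> real \<Rightarrow> complex"
  assumes "loc_integrable_kernel K"
  shows "(\<lambda>z. if fst z \<noteq> snd z then K (fst z) (snd z) else 0) \<in> borel_measurable (rho \<Otimes>\<^sub>M rho)"
proof -
  define D :: "(((real ^ 'n) \<times> real) \<times> ((real ^ 'n) \<times> real)) set" where "D = axS \<times> axS - {(x, x) |x. x \<in> axS}"
  have De: "D = (axS \<times> axS) \<inter> {z. fst z \<noteq> snd z}" unfolding D_def by auto
  have "open {z :: ((real ^ 'n) \<times> real) \<times> ((real ^ 'n) \<times> real). fst z \<noteq> snd z}"
    by (intro open_Collect_neq continuous_intros)
  then have "open D" unfolding De by (intro open_Int open_Times open_axS)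
  \<comment> \<open>An exhaustion of the complement of the diagonal by compact sets; off the
    diagonal the kernel is the pointwise limit of its restrictions to them, which are
    integrable.\<close>
  then obtain C where C: "\<And>n. compact (C n)" "\<And>n. C n \<subseteq> D" "\<And>n. C n \<subseteq> interior (C (Suc n))" "\<Union>(range C) = D"
    by (metis open_Union_compact_subsets)
  have mono: "C n \<subseteq> C m" if "n \<le> m" for n m
    using that by (induction rule: dec_induct) (use C(3) interior_subset in blast)+
  define G where "G n z = indicator (C n) z *\<^sub>R K (fst z) (snd z)" for n z
  have "G n \<in> borel_measurable (rho \<Otimes>\<^sub>M rho)" for n
  proof -
    have "set_integrable (rho \<Otimes>\<^sub>M rho) (C n) (\<lambda>(x, y). K x y)"
      using assms C(1)[of n] C(2)[of n] unfolding loc_integrable_kernel_def D_def by blast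
    then show ?thesis
      unfolding set_integrable_def G_def[abs_def] by (simp add: split_beta' borel_measurable_integrable)
  qed
  then show ?thesis
  proof (rule borel_measurable_LIMSEQ_metric)
    fix z :: "((real ^ 'n) \<times> real) \<times> ((real ^ 'n) \<times> real)" assume "z \<in> space (rho \<Otimes>\<^sub>M rho)"
    then have z: "z \<in> axS \<times> axS" by (simp add: space_pair_measure)
    show "(\<lambda>n. G n z) \<longlonglongrightarrow> (if fst z \<noteq> snd z then K (fst z) (snd z) else 0)"
    proof (cases "fst z = snd z")
      case True
      then have "z \<notin> D" unfolding De by simp
      then have "z \<notin> C n" for n using C(2)[of n] by blast
      then have "G n z = 0" for n by (simp add: G_def)
      then show ?thesis using True by simp
    next
      case False
      then have "z \<in> \<Union>(range C)" unfolding C(4) De using z by simp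
      then obtain N where N: "z \<in> C N" by blast
      have "eventually (\<lambda>n. G n z = K (fst z) (snd z)) sequentially"
        using eventually_ge_at_top[of N]
      proof eventually_elim
        case (elim n)
        then have "z \<in> C n" using mono N by blast
        then show ?case by (simp add: G_def)
      qed
      then show ?thesis using False by (simp add: tendsto_eventually)
    qed
  qed
qed

theorem theorem4p1:
  fixes K :: "(real ^ 'n) \<times> real \<Rightarrow> (real ^ 'n) \<times> real \<Rightarrow> complex"
  assumes "loc_integrable_kernel K"
    and "nu1 K < \<infinity>"
    and "nu2 K < \<infinity>"
  shows "(bounded_Linf_c_BMO (Tstar K) \<longleftrightarrow> (\<forall>p>1. bounded_Lp p (Tstar K))) \<and>
    ((\<forall>p>1. bounded_Lp p (Tstar K)) \<longleftrightarrow> (\<exists>p>1. bounded_Lp p (Tstar K))) \<and>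
    ((\<exists>p>1. bounded_Lp p (Tstar K)) \<longleftrightarrow> bounded_L1_weak_L1 (Tstar K))"
proof -
  define K' where "K' x y = (if x \<noteq> y then K x y else 0)" for x y
  have eq: "K' x y = K x y" if "x \<noteq> y" for x y using that by (simp add: K'_def)
  have out: "x \<noteq> y" if "R \<in> CZ" "x \<in> R" "y \<in> axS - cz_star R" for x y and R :: "((real ^ 'n) \<times> real) set"
    using that cz_subset_cz_star by (auto simp: CZ_def)
  have n1: "nu1 K' = nu1 K"
    unfolding nu1_def
  proof (intro SUP_cong refl nn_integral_cong)
    fix y x :: "(real ^ 'n) \<times> real" and r :: real assume y: "y \<in> axS" "r \<in> {0<..}"
    show "ennreal (cmod (K' x y) + cmod (K' y x)) * indicator {x \<in> axS. r < axd x y \<and> axd x y \<le> 2 * r} x =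
      ennreal (cmod (K x y) + cmod (K y x)) * indicator {x \<in> axS. r < axd x y \<and> axd x y \<le> 2 * r} x"
    proof (cases "x = y")
      case True
      then have "\<not> r < axd x y" using axd_self[OF y(1)] y(2) by simp
      then show ?thesis by simp
    next
      case False
      then show ?thesis using eq[of x y] eq[of y x] by simp
    qed
  qed
  have n2: "nu2 K' = nu2 K"
    unfolding nu2_def
  proof (intro SUP_cong refl nn_integral_cong)
    fix R and y y' x :: "(real ^ 'n) \<times> real" assume R: "R \<in> CZ" "y \<in> R" "y' \<in> R"
    show "ennreal (cmod (K' x y - K' x y') + cmod (K' y x - K' y' x)) * indicator (axS - cz_star R) x =
      ennreal (cmod (K x y - K x y') + cmod (K y x - K y' x)) * indicator (axS - cz_star R) x"
    proof (cases "x \<in> axS - cz_star R")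
      case True
      then have "y \<noteq> x" "y' \<noteq> x" using out[OF R(1)] R by blast+
      then show ?thesis using eq by simp
    qed simp
  qed
  have T: "Tstar K' f x = Tstar K f x" for f x
    unfolding Tstar_def
  proof (intro SUP_cong refl arg_cong[where f = "\<lambda>z. ennreal (cmod z)"])
    fix R assume R: "R \<in> {R \<in> CZ. x \<in> R}"
    show "(LINT y:axS - cz_star R|rho. K' x y * f y) = (LINT y:axS - cz_star R|rho. K x y * f y)"
      unfolding set_lebesgue_integral_def
    proof (rule Bochner_Integration.integral_cong[OF refl])
      fix y
      show "indicator (axS - cz_star R) y *\<^sub>R (K' x y * f y) = indicator (axS - cz_star R) y *\<^sub>R (K x y * f y)"
      proof (cases "y \<in> axS - cz_star R")
        case True
        then have "x \<noteq> y" using out R by blast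
        then show ?thesis using eq by simp
      qed simp
    qed
  qed
  have "cz_kernel K'"
  proof
    show "(\<lambda>z. K' (fst z) (snd z)) \<in> borel_measurable (rho \<Otimes>\<^sub>M rho)"
      unfolding K'_def by (rule offdiagonal_measurable[OF assms(1)])
    show "nu1 K' < \<infinity>" "nu2 K' < \<infinity>" using assms(2,3) n1 n2 by simp_all
  qed
  moreover have "Tstar K' = Tstar K" using T by (intro ext)
  ultimately show ?thesis using cz_kernel.boundedness_equivalences[of K'] by simp
qed

end
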